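(* Let $\mathcal G=\mathcal G(G,A,\alpha)$. The bicategory $\mathsf{Bun}_{\mathcal G}^{\mathrm{pre}}$ admits a calculus of right fractions with respect to the class $\mathcal W$ of 1-morphisms of the form $(f,h,\eta)$ where $f$ is an essential equivalence. (The localized bicategory $\mathsf{Bun}_{\mathcal G}^{\mathrm{pre}}[\mathcal W^{-1}]$ is denoted $\mathsf{Bun}_{\mathcal G}$.)
   Context: **2-groups.** $G$ is a discrete group, $A$ a discrete abelian group (multiplicative, trivial $G$-action), $\alpha\colon G^3\to A$ a normalized 3-cocycle: $\alpha(g_2,g_3,g_4)\alpha(g_1,g_2g_3,g_4)\alpha(g_1,g_2,g_3)=\alpha(g_1g_2,g_3,g_4)\alpha(g_1,g_2,g_3g_4)$ and $\alpha=1_A$ if some argument is $1_G$. $\mathcal G(G,A,\alpha)$ is the 2-group (monoidal groupoid) with object set $G$, $\mathrm{Aut}(g)=A$, no morphisms between distinct objects, tensor product given by multiplication in $G$ and $A$, associator $\alpha(g_1,g_2,g_3)\colon(g_1g_2)g_3\to g_1(g_2g_3)$ and identity unitors. **Lie groupoids.** A Lie groupoid $X=\{X_1\rightrightarrows X_0\}$ is a groupoid internal to smooth manifolds with source $s$ and target $t$ submersions; $X_n$ is the manifold of $n$ composable morphisms; $(\phi,\psi)\in X_2$ means $s(\phi)=t(\psi)$, with composite $\phi\circ\psi$. A smooth functor $f\colon X\to Y$ is an essential equivalence if $Y_1\times_{s,Y_0,f_0}X_0\to Y_0$ (induced by $t$) is a surjective submersion and $X_1$ is the pullback of $s\times t\colon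 Y_1\to Y_0\times Y_0$ along $f_0\times f_0$. **$\mathsf{Bun}^{\mathrm{pre}}_{\mathcal G}(X)$** is the bicategory (equivalent to smooth pseudofunctors $X\to\mathrm{pt}/\!/\mathcal G$) with: objects, pairs of locally constant maps $\rho\colon X_1\to G$, $\gamma\colon X_2\to A$ with $\rho(\phi\circ\psi)=\rho(\phi)\rho(\psi)$, $\frac{\gamma(\psi,\xi)\gamma(\phi,\psi\circ\xi)}{\gamma(\phi\circ\psi,\xi)\gamma(\phi,\psi)}=\alpha(\rho(\phi),\rho(\psi),\rho(\xi))$ on $X_3$, $\gamma=1_A$ if one argument is an identity; 1-morphisms $(\rho_1,\gamma_1)\to(\rho_2,\gamma_2)$, pairs of locally constant maps $h\colon X_0\to G$, $\eta\colon X_1\to A$ with $\rho_2(\phi)h(x)=h(x')\rho_1(\phi)$ for $\phi\colon x\to x'$ and, for $x\xrightarrow{\psi}x'\xrightarrow{\phi}x''$, $$\frac{\eta(\phi)\eta(\psi)}{\eta(\phi\circ\psi)}=\frac{\gamma_1(\phi,\psi)}{\gamma_2(\phi,\psi)}\frac{\alpha(\rho_2(\phi),h(x'),\rho_1(\psi))}{\alpha(\rho_2(\phi),\rho_2(\psi),h(x))\,\alpha(h(x''),\rho_1(\phi),\rho_1(\psi))};$$ 2-morphisms $(h,\eta_1)\to(h,\eta_2)$ (none if the maps $h$ differ), locally constant $\omega\colon X_0\to A$ with $\omega(x)/\omega(x')=\eta_1(\phi)/\eta_2(\phi)$. The composite $(h_2,\eta_2)\circ(h_1,\eta_1)$ of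 $(\rho_1,\gamma_1)\to(\rho_2,\gamma_2)\to(\rho_3,\gamma_3)$ is $h_2h_1$ with $\phi\mapsto\eta_2(\phi)\eta_1(\phi)\frac{\alpha(h_2(x'),\rho_2(\phi),h_1(x))}{\alpha(\rho_3(\phi),h_2(x),h_1(x))\alpha(h_2(x'),h_1(x'),\rho_1(\phi))}$; 2-morphisms compose by pointwise multiplication; associativity constraints are $\alpha(h_3(x),h_2(x),h_1(x))$. For a smooth functor $f\colon X\to Y$, $f^*$ is precomposition. For a smooth natural transformation $\tau\colon f_1\Rightarrow f_2$ and $(\rho,\gamma)\in\mathsf{Bun}^{\mathrm{pre}}_{\mathcal G}(Y)$, $\widetilde\tau_{(\rho,\gamma)}\colon f_1^*(\rho,\gamma)\to f_2^*(\rho,\gamma)$ is the 1-morphism $x\mapsto\rho(\tau(x))$, $(\phi\colon x\to y)\mapsto\frac{\gamma(\tau(y),f_1(\phi))}{\gamma(f_2(\phi),\tau(x))}$. **The bicategory $\mathsf{Bun}^{\mathrm{pre}}_{\mathcal G}$.** Objects $(\rho,\gamma)_X$: a Lie groupoid $X$ and $(\rho,\gamma)\in\mathsf{Bun}^{\mathrm{pre}}_{\mathcal G}(X)$. 1-morphisms $(f,h,\eta)\colon(\rho_1,\gamma_1)_X\to(\rho_2,\gamma_2)_Y$: a smooth functor $f\colon X\to Y$ and a 1-morphism $(h,\eta)\colon(\rho_1,\gamma_1)\to f^*(\rho_2,\gamma_2)$ in $\mathsf{Bun}^{\mathrm{pre}}_{\mathcal G}(X)$; composition $(f_2,h_2,\eta_2)\circ(f_1,h_1,\eta_1)=(f_2\circ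 f_1,\,f_1^*(h_2,\eta_2)\circ(h_1,\eta_1))$. 2-morphisms $(f_1,h_1,\eta_1)\to(f_2,h_2,\eta_2)$: pairs $(\tau,\omega)$ with $\tau\colon f_1\Rightarrow f_2$ a smooth natural transformation and $\omega$ a 2-morphism $\widetilde\tau_{(\rho_2,\gamma_2)}\circ(h_1,\eta_1)\to(h_2,\eta_2)$ in $\mathsf{Bun}^{\mathrm{pre}}_{\mathcal G}(X)$. Vertical composition: $(\tau_2,\omega_2)\circ(\tau,\omega)=(\tau_2\circ\tau,\omega')$ with $\omega'(x)=\omega_2(x)\omega(x)\,\alpha(\rho_2(\tau_2(x)),\rho_2(\tau(x)),h_1(x))\,\gamma_2(\tau_2(x),\tau(x))$. Horizontal composition of $(\tau,\omega)\colon(f_1,h_1,\eta_1)\to(f_2,h_2,\eta_2)$ with $(\tau_2,\omega_2)\colon(f_3,h_3,\eta_3)\to(f_4,h_4,\eta_4)$, the latter between 1-morphisms $(\rho_2,\gamma_2)_Y\to(\rho_3,\gamma_3)_Z$: $(\tau_2\star\tau,\omega_2\star\omega)$ with $$\begin{aligned}\omega_2\star\omega(x)=\;&\omega_2(f_1(x))\,\omega(x)\,\eta_4(\tau(x))\,\gamma_3(f_4(\tau(x)),\tau_2(f_1(x)))\\&\cdot\frac{\alpha(\rho_3(f_4(\tau(x))),\rho_3(\tau_2(f_1(x))),h_3(f_1(x))h_1(x))\,\alpha(h_4(f_2(x)),\rho_2(\tau(x)),h_1(x))}{\alpha(\rho_3(\tau_2(f_1(x))),h_3(f_1(x)),h_1(x))\,\alpha(\rho_3(f_4(\tau(x))),h_4(f_1(x)),h_1(x))}.\end{aligned}$$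 **Calculus of right fractions (Pronk).** A bicategory $\mathsf B$ admits a calculus of right fractions with respect to a class $\mathcal W$ of 1-morphisms if: (BF1) every equivalence is in $\mathcal W$; (BF2) $\mathcal W$ is closed under composition; (BF3) for every $w\colon x\to z$ in $\mathcal W$ and $f\colon y\to z$ there are $v\colon u\to y$ in $\mathcal W$, $g\colon u\to x$ and a 2-isomorphism $w\circ g\cong f\circ v$; (BF4) for every $w\colon y\to z$ in $\mathcal W$, $f,g\colon x\to y$ and 2-morphism $\theta\colon w\circ f\Rightarrow w\circ g$ there are $v\colon u\to x$ in $\mathcal W$ and $\beta\colon f\circ v\Rightarrow g\circ v$ with $\theta\star v=w\star\beta$ (modulo associators), with $\beta$ invertible if $\theta$ is; and if $(v',\beta')$ is another such pair, there are 1-morphisms $p,p'$ and a 2-isomorphism $\epsilon\colon v\circ p\Rightarrow v'\circ p'$ with $v\circ p,v'\circ p'\in\mathcal W$ and $(g\star\epsilon)(\beta\star p)=(\beta'\star p')(f\star\epsilon)$; (BF5) a 1-morphism 2-isomorphic to one in $\mathcal W$ is in $\mathcal W$. *)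

theory Defs
  imports "HOL-Analysis.Analysis"
begin

section \<open>Smooth manifolds\<close>

text \<open>
  The coordinate space of dimension \<open>n\<close> is the topological space \<open>Euclidean_space n\<close>, whose points
  are the functions \<open>nat \<Rightarrow> real\<close> that vanish from \<open>n\<close> on, so that dimensions are natural numbers
  rather than types.
\<close>

definition pderiv_at :: "((nat \<Rightarrow> real) \<Rightarrow> real) \<Rightarrow> nat \<Rightarrow> (nat \<Rightarrow> real) \<Rightarrow> real" where
  "pderiv_at F i x = deriv (\<lambda>t. F (x(i := t))) (x i)"

primrec Ck_on :: "nat \<Rightarrow> nat \<Rightarrow> (nat \<Rightarrow> real) set \<Rightarrow> ((nat \<Rightarrow> real) \<Rightarrow> real) \<Rightarrow> bool" where
  "Ck_on 0 n S F \<longleftrightarrow> continuous_on S F"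
| "Ck_on (Suc k) n S F \<longleftrightarrow> continuous_on S F \<and>
     (\<forall>i<n. (\<forall>x\<in>S. (\<lambda>t. F (x(i := t))) differentiable at (x i)) \<and> Ck_on k n S (pderiv_at F i))"

text \<open>\<open>S\<close> is meant to be an open subset of \<open>Euclidean_space n\<close>.\<close>

definition smooth_coords ::
    "nat \<Rightarrow> nat \<Rightarrow> (nat \<Rightarrow> real) set \<Rightarrow> ((nat \<Rightarrow> real) \<Rightarrow> (nat \<Rightarrow> real)) \<Rightarrow> bool" where
  "smooth_coords n m S F \<longleftrightarrow> (\<forall>j<m. \<forall>k. Ck_on k n S (\<lambda>x. F x j))"

type_synonym 'p chart = "'p set \<times> ('p \<Rightarrow> nat \<Rightarrow> real)"

text \<open>The points of a manifold form a subset of the type \<open>'p\<close>, namely the \<open>topspace\<close> of \<open>mtop\<close>.\<close>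

record 'p mfd =
  mtop :: "'p topology"
  mdim :: nat
  charts :: "'p chart set"

abbreviation points :: "'p mfd \<Rightarrow> 'p set" where
  "points M \<equiv> topspace (mtop M)"

definition is_chart :: "'p topology \<Rightarrow> nat \<Rightarrow> 'p chart \<Rightarrow> bool" where
  "is_chart X n = (\<lambda>(U, \<phi>). openin X U \<and> openin (Euclidean_space n) (\<phi> ` U) \<and>
     homeomorphic_map (subtopology X U) (subtopology (Euclidean_space n) (\<phi> ` U)) \<phi>)"

definition manifold :: "'p mfd \<Rightarrow> bool" where
  "manifold M \<longleftrightarrow> Hausdorff_space (mtop M) \<and> second_countable (mtop M) \<and>
     (\<forall>c\<in>charts M. is_chart (mtop M) (mdim M) c) \<and>
     (\<Union>(U, \<phi>)\<in>charts M. U) = points M \<and>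
     (\<forall>(U, \<phi>)\<in>charts M. \<forall>(V, \<psi>)\<in>charts M.
        smooth_coords (mdim M) (mdim M) (\<phi> ` (U \<inter> V)) (\<psi> \<circ> inv_into U \<phi>))"

definition smooth_map :: "'a mfd \<Rightarrow> 'b mfd \<Rightarrow> ('a \<Rightarrow> 'b) \<Rightarrow> bool" where
  "smooth_map M N f \<longleftrightarrow> continuous_map (mtop M) (mtop N) f \<and>
     (\<forall>(U, \<phi>)\<in>charts M. \<forall>(V, \<psi>)\<in>charts N.
        smooth_coords (mdim M) (mdim N) (\<phi> ` {x\<in>U. f x \<in> V}) (\<psi> \<circ> f \<circ> inv_into U \<phi>))"

text \<open>A submersion is a smooth map whose differential, in charts the Jacobian matrix, is
  surjective at every point.\<close>

definition submersion :: "'a mfd \<Rightarrow> 'b mfd \<Rightarrow> ('a \<Rightarrow> 'b) \<Rightarrow> bool" where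
  "submersion M N f \<longleftrightarrow> smooth_map M N f \<and>
     (\<forall>(U, \<phi>)\<in>charts M. \<forall>(V, \<psi>)\<in>charts N. \<forall>x\<in>U. f x \<in> V \<longrightarrow>
        (\<forall>v :: nat \<Rightarrow> real. \<exists>u :: nat \<Rightarrow> real. \<forall>j<mdim N.
           v j = (\<Sum>i<mdim M. pderiv_at (\<lambda>z. (\<psi> \<circ> f \<circ> inv_into U \<phi>) z j) i (\<phi> x) * u i)))"

definition surjective_submersion :: "'a mfd \<Rightarrow> 'b mfd \<Rightarrow> ('a \<Rightarrow> 'b) \<Rightarrow> bool" where
  "surjective_submersion M N f \<longleftrightarrow> submersion M N f \<and> f ` points M = points N"

definition prod_mfd :: "'a mfd \<Rightarrow> 'b mfd \<Rightarrow> ('a \<times> 'b) mfd" where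
  "prod_mfd M N = \<lparr>mtop = prod_topology (mtop M) (mtop N), mdim = mdim M + mdim N,
     charts = {(U \<times> V, \<lambda>(x, y) i. if i < mdim M then \<phi> x i else \<psi> y (i - mdim M)) | U \<phi> V \<psi>.
       (U, \<phi>) \<in> charts M \<and> (V, \<psi>) \<in> charts N}\<rparr>"

text \<open>
  \<open>is_pullback M N f g P p q\<close>: the manifold \<open>P\<close> with \<open>p : P \<rightarrow> M\<close> and \<open>q : P \<rightarrow> N\<close> is a pullback, in
  the category of smooth manifolds, of \<open>f\<close> on \<open>M\<close> and \<open>g\<close> on \<open>N\<close>. The test manifolds \<open>T\<close> range over
  those with points in the type \<open>'a\<close>; if \<open>'a\<close> has at least the cardinality of the continuum, then this is
  every smooth manifold up to diffeomorphism. Maps between manifolds are made unique as HOL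
  functions by requiring the value \<open>undefined\<close> off the domain (\<open>extensional\<close>), here and below.
\<close>

definition is_pullback ::
    "'a mfd \<Rightarrow> 'b mfd \<Rightarrow> ('a \<Rightarrow> 'c) \<Rightarrow> ('b \<Rightarrow> 'c) \<Rightarrow> 'd mfd \<Rightarrow> ('d \<Rightarrow> 'a) \<Rightarrow> ('d \<Rightarrow> 'b) \<Rightarrow> bool" where
  "is_pullback M N f g P p q \<longleftrightarrow>
     manifold P \<and> smooth_map P M p \<and> smooth_map P N q \<and> (\<forall>z\<in>points P. f (p z) = g (q z)) \<and>
     (\<forall>(T :: 'a mfd) a b.
        manifold T \<and> smooth_map T M a \<and> smooth_map T N b \<and> (\<forall>z\<in>points T. f (a z) = g (b z)) \<longrightarrow>
        (\<exists>!u. u \<in> extensional (points T) \<and> smooth_map T P u \<and>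
              (\<forall>z\<in>points T. p (u z) = a z \<and> q (u z) = b z)))"

text \<open>The fibre product on its usual set of points; this determines the smooth structure.\<close>

definition is_fibre_product ::
    "'a mfd \<Rightarrow> 'b mfd \<Rightarrow> ('a \<Rightarrow> 'c) \<Rightarrow> ('b \<Rightarrow> 'c) \<Rightarrow> ('a \<times> 'b) mfd \<Rightarrow> bool" where
  "is_fibre_product M N f g P \<longleftrightarrow>
     points P = {(x, y). x \<in> points M \<and> y \<in> points N \<and> f x = g y} \<and>
     is_pullback M N f g P fst snd"

abbreviation locally_constant :: "'p topology \<Rightarrow> ('p \<Rightarrow> 'b) \<Rightarrow> bool" where
  "locally_constant X f \<equiv> continuous_map X (discrete_topology UNIV) f"


section \<open>Lie groupoids\<close>

record 'p groupoid_data =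
  Ob :: "'p mfd"
  Ar :: "'p mfd"
  sr :: "'p \<Rightarrow> 'p"
  tg :: "'p \<Rightarrow> 'p"
  un :: "'p \<Rightarrow> 'p"
  iv :: "'p \<Rightarrow> 'p"
  mu :: "'p \<Rightarrow> 'p \<Rightarrow> 'p"

abbreviation X0 :: "'p groupoid_data \<Rightarrow> 'p set" where "X0 X \<equiv> points (Ob X)"
abbreviation X1 :: "'p groupoid_data \<Rightarrow> 'p set" where "X1 X \<equiv> points (Ar X)"

text \<open>\<open>(\<phi>, \<psi>) \<in> X2 X\<close> means that \<open>\<phi>\<close> can be composed after \<open>\<psi>\<close>, and \<open>mu X \<phi> \<psi>\<close> is \<open>\<phi> \<circ> \<psi>\<close>.\<close>

definition X2 :: "'p groupoid_data \<Rightarrow> ('p \<times> 'p) set" where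
  "X2 X = {(\<phi>, \<psi>). \<phi> \<in> X1 X \<and> \<psi> \<in> X1 X \<and> sr X \<phi> = tg X \<psi>}"

text \<open>As source and target are submersions, the manifold of composable pairs is an embedded
  submanifold of the product, so it carries the subspace topology.\<close>

definition X2_top :: "'p groupoid_data \<Rightarrow> ('p \<times> 'p) topology" where
  "X2_top X = subtopology (prod_topology (mtop (Ar X)) (mtop (Ar X))) (X2 X)"

definition lie_groupoid :: "'p groupoid_data \<Rightarrow> bool" where
  "lie_groupoid X \<longleftrightarrow>
     manifold (Ob X) \<and> manifold (Ar X) \<and>
     submersion (Ar X) (Ob X) (sr X) \<and> submersion (Ar X) (Ob X) (tg X) \<and>
     smooth_map (Ob X) (Ar X) (un X) \<and> smooth_map (Ar X) (Ar X) (iv X) \<and>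
     (\<exists>P. is_fibre_product (Ar X) (Ar X) (sr X) (tg X) P \<and>
          smooth_map P (Ar X) (\<lambda>(\<phi>, \<psi>). mu X \<phi> \<psi>)) \<and>
     (\<forall>x\<in>X0 X. sr X (un X x) = x \<and> tg X (un X x) = x) \<and>
     (\<forall>(\<phi>, \<psi>)\<in>X2 X. sr X (mu X \<phi> \<psi>) = sr X \<psi> \<and> tg X (mu X \<phi> \<psi>) = tg X \<phi>) \<and>
     (\<forall>\<phi> \<psi> \<xi>. (\<phi>, \<psi>) \<in> X2 X \<and> (\<psi>, \<xi>) \<in> X2 X \<longrightarrow>
        mu X (mu X \<phi> \<psi>) \<xi> = mu X \<phi> (mu X \<psi> \<xi>)) \<and>
     (\<forall>\<phi>\<in>X1 X. mu X \<phi> (un X (sr X \<phi>)) = \<phi> \<and> mu X (un X (tg X \<phi>)) \<phi> = \<phi>) \<and>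
     (\<forall>\<phi>\<in>X1 X. sr X (iv X \<phi>) = tg X \<phi> \<and> tg X (iv X \<phi>) = sr X \<phi> \<and>
        mu X (iv X \<phi>) \<phi> = un X (sr X \<phi>) \<and> mu X \<phi> (iv X \<phi>) = un X (tg X \<phi>))"

text \<open>A functor is the pair of its maps on objects and on arrows.\<close>

type_synonym 'p functor_data = "('p \<Rightarrow> 'p) \<times> ('p \<Rightarrow> 'p)"

definition smooth_functor ::
    "'p groupoid_data \<Rightarrow> 'p groupoid_data \<Rightarrow> 'p functor_data \<Rightarrow> bool" where
  "smooth_functor X Y = (\<lambda>(f0, f1).
     f0 \<in> extensional (X0 X) \<and> f1 \<in> extensional (X1 X) \<and>
     smooth_map (Ob X) (Ob Y) f0 \<and> smooth_map (Ar X) (Ar Y) f1 \<and>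
     (\<forall>\<phi>\<in>X1 X. sr Y (f1 \<phi>) = f0 (sr X \<phi>) \<and> tg Y (f1 \<phi>) = f0 (tg X \<phi>)) \<and>
     (\<forall>x\<in>X0 X. f1 (un X x) = un Y (f0 x)) \<and>
     (\<forall>(\<phi>, \<psi>)\<in>X2 X. f1 (mu X \<phi> \<psi>) = mu Y (f1 \<phi>) (f1 \<psi>)))"

definition id_functor :: "'p groupoid_data \<Rightarrow> 'p functor_data" where
  "id_functor X = (\<lambda>x\<in>X0 X. x, \<lambda>\<phi>\<in>X1 X. \<phi>)"

definition comp_functor ::
    "'p groupoid_data \<Rightarrow> 'p functor_data \<Rightarrow> 'p functor_data \<Rightarrow> 'p functor_data" where
  "comp_functor X g f = (\<lambda>x\<in>X0 X. fst g (fst f x), \<lambda>\<phi>\<in>X1 X. snd g (snd f \<phi>))"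

definition smooth_nat_trans ::
    "'p groupoid_data \<Rightarrow> 'p groupoid_data \<Rightarrow> 'p functor_data \<Rightarrow> 'p functor_data \<Rightarrow> ('p \<Rightarrow> 'p) \<Rightarrow> bool"
  where
  "smooth_nat_trans X Y f g \<tau> \<longleftrightarrow>
     \<tau> \<in> extensional (X0 X) \<and> smooth_map (Ob X) (Ar Y) \<tau> \<and>
     (\<forall>x\<in>X0 X. sr Y (\<tau> x) = fst f x \<and> tg Y (\<tau> x) = fst g x) \<and>
     (\<forall>\<phi>\<in>X1 X. mu Y (\<tau> (tg X \<phi>)) (snd f \<phi>) = mu Y (snd g \<phi>) (\<tau> (sr X \<phi>)))"

definition essential_equivalence ::
    "'p groupoid_data \<Rightarrow> 'p groupoid_data \<Rightarrow> 'p functor_data \<Rightarrow> bool" where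
  "essential_equivalence X Y f \<longleftrightarrow> smooth_functor X Y f \<and>
     (\<exists>P. is_fibre_product (Ar Y) (Ob X) (sr Y) (fst f) P \<and>
          surjective_submersion P (Ob Y) (\<lambda>(\<phi>, x). tg Y \<phi>)) \<and>
     is_pullback (Ar Y) (prod_mfd (Ob X) (Ob X))
       (\<lambda>\<phi>. (sr Y \<phi>, tg Y \<phi>)) (map_prod (fst f) (fst f))
       (Ar X) (snd f) (\<lambda>\<phi>. (sr X \<phi>, tg X \<phi>))"


section \<open>Bundles over a fixed Lie groupoid\<close>

text \<open>
  The (not necessarily commutative) group \<open>G\<close> and the abelian group \<open>A\<close> are the types \<open>'g::group_add\<close>
  and \<open>'a::ab_group_add\<close>, both written additively. The 2-group \<open>\<G>(G, A, \<alpha>)\<close> enters only through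
  \<open>G\<close>, \<open>A\<close> and the associator \<open>\<alpha>\<close>.
\<close>

definition normalized_3cocycle :: "('g::group_add \<Rightarrow> 'g \<Rightarrow> 'g \<Rightarrow> 'a::ab_group_add) \<Rightarrow> bool" where
  "normalized_3cocycle \<alpha> \<longleftrightarrow>
     (\<forall>g1 g2 g3 g4. \<alpha> g2 g3 g4 + \<alpha> g1 (g2 + g3) g4 + \<alpha> g1 g2 g3
        = \<alpha> (g1 + g2) g3 g4 + \<alpha> g1 g2 (g3 + g4)) \<and>
     (\<forall>g h. \<alpha> 0 g h = 0 \<and> \<alpha> g 0 h = 0 \<and> \<alpha> g h 0 = 0)"

type_synonym ('p, 'g, 'a) bun = "('p \<Rightarrow> 'g) \<times> ('p \<times> 'p \<Rightarrow> 'a)"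
type_synonym ('p, 'g, 'a) bun_mor = "('p \<Rightarrow> 'g) \<times> ('p \<Rightarrow> 'a)"

definition bun_ob ::
    "('g::group_add \<Rightarrow> 'g \<Rightarrow> 'g \<Rightarrow> 'a::ab_group_add) \<Rightarrow> 'p groupoid_data \<Rightarrow> ('p, 'g, 'a) bun \<Rightarrow> bool"
  where
  "bun_ob \<alpha> X = (\<lambda>(\<rho>, \<gamma>).
     \<rho> \<in> extensional (X1 X) \<and> \<gamma> \<in> extensional (X2 X) \<and>
     locally_constant (mtop (Ar X)) \<rho> \<and> locally_constant (X2_top X) \<gamma> \<and>
     (\<forall>(\<phi>, \<psi>)\<in>X2 X. \<rho> (mu X \<phi> \<psi>) = \<rho> \<phi> + \<rho> \<psi>) \<and>
     (\<forall>\<phi> \<psi> \<xi>. (\<phi>, \<psi>) \<in> X2 X \<and> (\<psi>, \<xi>) \<in> X2 X \<longrightarrow>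
        \<gamma> (\<psi>, \<xi>) + \<gamma> (\<phi>, mu X \<psi> \<xi>) - \<gamma> (mu X \<phi> \<psi>, \<xi>) - \<gamma> (\<phi>, \<psi>) = \<alpha> (\<rho> \<phi>) (\<rho> \<psi>) (\<rho> \<xi>)) \<and>
     (\<forall>\<phi>\<in>X1 X. \<gamma> (un X (tg X \<phi>), \<phi>) = 0 \<and> \<gamma> (\<phi>, un X (sr X \<phi>)) = 0))"

definition bun_1mor ::
    "('g::group_add \<Rightarrow> 'g \<Rightarrow> 'g \<Rightarrow> 'a::ab_group_add) \<Rightarrow> 'p groupoid_data \<Rightarrow>
     ('p, 'g, 'a) bun \<Rightarrow> ('p, 'g, 'a) bun \<Rightarrow> ('p, 'g, 'a) bun_mor \<Rightarrow> bool" where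
  "bun_1mor \<alpha> X = (\<lambda>(\<rho>\<^sub>1, \<gamma>\<^sub>1) (\<rho>\<^sub>2, \<gamma>\<^sub>2) (h, \<eta>).
     h \<in> extensional (X0 X) \<and> \<eta> \<in> extensional (X1 X) \<and>
     locally_constant (mtop (Ob X)) h \<and> locally_constant (mtop (Ar X)) \<eta> \<and>
     (\<forall>\<phi>\<in>X1 X. \<rho>\<^sub>2 \<phi> + h (sr X \<phi>) = h (tg X \<phi>) + \<rho>\<^sub>1 \<phi>) \<and>
     (\<forall>(\<phi>, \<psi>)\<in>X2 X.
        \<eta> \<phi> + \<eta> \<psi> - \<eta> (mu X \<phi> \<psi>)
        = \<gamma>\<^sub>1 (\<phi>, \<psi>) - \<gamma>\<^sub>2 (\<phi>, \<psi>) + \<alpha> (\<rho>\<^sub>2 \<phi>) (h (tg X \<psi>)) (\<rho>\<^sub>1 \<psi>)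
          - \<alpha> (\<rho>\<^sub>2 \<phi>) (\<rho>\<^sub>2 \<psi>) (h (sr X \<psi>)) - \<alpha> (h (tg X \<phi>)) (\<rho>\<^sub>1 \<phi>) (\<rho>\<^sub>1 \<psi>)))"

definition bun_2mor ::
    "'p groupoid_data \<Rightarrow> ('p, 'g, 'a::ab_group_add) bun_mor \<Rightarrow> ('p, 'g, 'a) bun_mor \<Rightarrow> ('p \<Rightarrow> 'a) \<Rightarrow> bool"
  where
  "bun_2mor X = (\<lambda>(h\<^sub>1, \<eta>\<^sub>1) (h\<^sub>2, \<eta>\<^sub>2) \<omega>. h\<^sub>1 = h\<^sub>2 \<and>
     \<omega> \<in> extensional (X0 X) \<and> locally_constant (mtop (Ob X)) \<omega> \<and>
     (\<forall>\<phi>\<in>X1 X. \<omega> (sr X \<phi>) - \<omega> (tg X \<phi>) = \<eta>\<^sub>1 \<phi> - \<eta>\<^sub>2 \<phi>))"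

definition bun_comp ::
    "('g::group_add \<Rightarrow> 'g \<Rightarrow> 'g \<Rightarrow> 'a::ab_group_add) \<Rightarrow> 'p groupoid_data \<Rightarrow>
     ('p, 'g, 'a) bun \<Rightarrow> ('p, 'g, 'a) bun \<Rightarrow> ('p, 'g, 'a) bun \<Rightarrow>
     ('p, 'g, 'a) bun_mor \<Rightarrow> ('p, 'g, 'a) bun_mor \<Rightarrow> ('p, 'g, 'a) bun_mor" where
  "bun_comp \<alpha> X = (\<lambda>(\<rho>\<^sub>1, \<gamma>\<^sub>1) (\<rho>\<^sub>2, \<gamma>\<^sub>2) (\<rho>\<^sub>3, \<gamma>\<^sub>3) (h\<^sub>2, \<eta>\<^sub>2) (h\<^sub>1, \<eta>\<^sub>1).
     (\<lambda>x\<in>X0 X. h\<^sub>2 x + h\<^sub>1 x,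
      \<lambda>\<phi>\<in>X1 X. \<eta>\<^sub>2 \<phi> + \<eta>\<^sub>1 \<phi> + \<alpha> (h\<^sub>2 (tg X \<phi>)) (\<rho>\<^sub>2 \<phi>) (h\<^sub>1 (sr X \<phi>))
        - \<alpha> (\<rho>\<^sub>3 \<phi>) (h\<^sub>2 (sr X \<phi>)) (h\<^sub>1 (sr X \<phi>)) - \<alpha> (h\<^sub>2 (tg X \<phi>)) (h\<^sub>1 (tg X \<phi>)) (\<rho>\<^sub>1 \<phi>)))"

text \<open>Pullback along a functor \<open>f\<close> with source \<open>X\<close>, on objects and on 1-morphisms.\<close>

definition pull_ob :: "'p groupoid_data \<Rightarrow> 'p functor_data \<Rightarrow> ('p, 'g, 'a) bun \<Rightarrow> ('p, 'g, 'a) bun" where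
  "pull_ob X f = (\<lambda>(\<rho>, \<gamma>).
     (\<lambda>\<phi>\<in>X1 X. \<rho> (snd f \<phi>), \<lambda>c\<in>X2 X. \<gamma> (snd f (fst c), snd f (snd c))))"

definition pull_mor ::
    "'p groupoid_data \<Rightarrow> 'p functor_data \<Rightarrow> ('p, 'g, 'a) bun_mor \<Rightarrow> ('p, 'g, 'a) bun_mor" where
  "pull_mor X f = (\<lambda>(h, \<eta>). (\<lambda>x\<in>X0 X. h (fst f x), \<lambda>\<phi>\<in>X1 X. \<eta> (snd f \<phi>)))"

definition tau_tilde ::
    "'p groupoid_data \<Rightarrow> 'p functor_data \<Rightarrow> 'p functor_data \<Rightarrow> ('p \<Rightarrow> 'p) \<Rightarrow>
     ('p, 'g, 'a::ab_group_add) bun \<Rightarrow> ('p, 'g, 'a) bun_mor" where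
  "tau_tilde X f g \<tau> = (\<lambda>(\<rho>, \<gamma>).
     (\<lambda>x\<in>X0 X. \<rho> (\<tau> x),
      \<lambda>\<phi>\<in>X1 X. \<gamma> (\<tau> (tg X \<phi>), snd f \<phi>) - \<gamma> (snd g \<phi>, \<tau> (sr X \<phi>))))"


section \<open>Bicategories and the calculus of right fractions\<close>

text \<open>
  Every cell carries its boundary. Composition \<open>G \<odot> F\<close> of 1-cells, vertical composition \<open>\<Theta> \<cdot> \<Xi>\<close> and
  horizontal composition \<open>\<Theta> \<star> \<Xi>\<close> are written in the order of functions, and the constraint 2-cells
  are \<open>assoc H G F : (H \<odot> G) \<odot> F \<Rightarrow> H \<odot> (G \<odot> F)\<close>, \<open>lunit F : id \<odot> F \<Rightarrow> F\<close> and
  \<open>runit F : F \<odot> id \<Rightarrow> F\<close>.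
\<close>

record ('o, 'c, 'd) bicat =
  cells0 :: "'o set"
  cells1 :: "'c set"
  cells2 :: "'d set"
  dom1 :: "'c \<Rightarrow> 'o"
  cod1 :: "'c \<Rightarrow> 'o"
  dom2 :: "'d \<Rightarrow> 'c"
  cod2 :: "'d \<Rightarrow> 'c"
  id1 :: "'o \<Rightarrow> 'c"
  id2 :: "'c \<Rightarrow> 'd"
  comp1 :: "'c \<Rightarrow> 'c \<Rightarrow> 'c" (infixl "\<odot>\<index>" 75)
  vcomp :: "'d \<Rightarrow> 'd \<Rightarrow> 'd" (infixl "\<cdot>\<index>" 65)
  hcomp :: "'d \<Rightarrow> 'd \<Rightarrow> 'd" (infixl "\<star>\<index>" 70)
  assoc :: "'c \<Rightarrow> 'c \<Rightarrow> 'c \<Rightarrow> 'd"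
  lunit :: "'c \<Rightarrow> 'd"
  runit :: "'c \<Rightarrow> 'd"

definition is_1cell :: "('o, 'c, 'd) bicat \<Rightarrow> 'c \<Rightarrow> 'o \<Rightarrow> 'o \<Rightarrow> bool" where
  "is_1cell B F a b \<longleftrightarrow> F \<in> cells1 B \<and> dom1 B F = a \<and> cod1 B F = b"

definition is_2cell :: "('o, 'c, 'd) bicat \<Rightarrow> 'd \<Rightarrow> 'c \<Rightarrow> 'c \<Rightarrow> bool" where
  "is_2cell B \<Theta> F G \<longleftrightarrow> \<Theta> \<in> cells2 B \<and> dom2 B \<Theta> = F \<and> cod2 B \<Theta> = G"

definition inverse_2cells :: "('o, 'c, 'd) bicat \<Rightarrow> 'd \<Rightarrow> 'd \<Rightarrow> bool" where
  "inverse_2cells B \<Theta> \<Xi> \<longleftrightarrow>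
     is_2cell B \<Xi> (cod2 B \<Theta>) (dom2 B \<Theta>) \<and>
     vcomp B \<Xi> \<Theta> = id2 B (dom2 B \<Theta>) \<and> vcomp B \<Theta> \<Xi> = id2 B (cod2 B \<Theta>)"

definition iso_2cell :: "('o, 'c, 'd) bicat \<Rightarrow> 'd \<Rightarrow> 'c \<Rightarrow> 'c \<Rightarrow> bool" where
  "iso_2cell B \<Theta> F G \<longleftrightarrow> is_2cell B \<Theta> F G \<and> (\<exists>\<Xi>. inverse_2cells B \<Theta> \<Xi>)"

definition inv_2cell :: "('o, 'c, 'd) bicat \<Rightarrow> 'd \<Rightarrow> 'd" where
  "inv_2cell B \<Theta> = (THE \<Xi>. inverse_2cells B \<Theta> \<Xi>)"

definition isomorphic_1cells :: "('o, 'c, 'd) bicat \<Rightarrow> 'c \<Rightarrow> 'c \<Rightarrow> bool" where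
  "isomorphic_1cells B F G \<longleftrightarrow> (\<exists>\<Theta>. iso_2cell B \<Theta> F G)"

definition equivalence_1cell :: "('o, 'c, 'd) bicat \<Rightarrow> 'c \<Rightarrow> bool" where
  "equivalence_1cell B F \<longleftrightarrow> F \<in> cells1 B \<and>
     (\<exists>G. is_1cell B G (cod1 B F) (dom1 B F) \<and>
          isomorphic_1cells B (comp1 B G F) (id1 B (dom1 B F)) \<and>
          isomorphic_1cells B (comp1 B F G) (id1 B (cod1 B F)))"

locale bicategory =
  fixes B :: "('o, 'c, 'd) bicat" (structure)
  assumes boundary_1cell: "F \<in> cells1 B \<Longrightarrow> dom1 B F \<in> cells0 B \<and> cod1 B F \<in> cells0 B"
    and boundary_2cell: "is_2cell B \<Theta> F G \<Longrightarrow>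
      F \<in> cells1 B \<and> G \<in> cells1 B \<and> dom1 B F = dom1 B G \<and> cod1 B F = cod1 B G"
    and id1_cell: "a \<in> cells0 B \<Longrightarrow> is_1cell B (id1 B a) a a"
    and comp1_cell: "\<lbrakk>is_1cell B F a b; is_1cell B G b c\<rbrakk> \<Longrightarrow> is_1cell B (G \<odot> F) a c"
    and id2_cell: "F \<in> cells1 B \<Longrightarrow> is_2cell B (id2 B F) F F"
    and vcomp_cell: "\<lbrakk>is_2cell B \<Xi> F G; is_2cell B \<Theta> G H\<rbrakk> \<Longrightarrow> is_2cell B (\<Theta> \<cdot> \<Xi>) F H"
    and vcomp_id: "is_2cell B \<Theta> F G \<Longrightarrow> \<Theta> \<cdot> id2 B F = \<Theta> \<and> id2 B G \<cdot> \<Theta> = \<Theta>"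
    and vcomp_assoc: "\<lbrakk>is_2cell B \<Xi> F G; is_2cell B \<Theta> G H; is_2cell B \<Omega> H K\<rbrakk> \<Longrightarrow>
      (\<Omega> \<cdot> \<Theta>) \<cdot> \<Xi> = \<Omega> \<cdot> (\<Theta> \<cdot> \<Xi>)"
    and hcomp_cell: "\<lbrakk>is_2cell B \<Xi> F F'; is_2cell B \<Theta> G G'; cod1 B F = dom1 B G\<rbrakk> \<Longrightarrow>
      is_2cell B (\<Theta> \<star> \<Xi>) (G \<odot> F) (G' \<odot> F')"
    and hcomp_id: "\<lbrakk>is_1cell B F a b; is_1cell B G b c\<rbrakk> \<Longrightarrow> id2 B G \<star> id2 B F = id2 B (G \<odot> F)"
    and interchange: "\<lbrakk>is_2cell B \<Xi> F F'; is_2cell B \<Xi>' F' F''; is_2cell B \<Theta> G G';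
      is_2cell B \<Theta>' G' G''; cod1 B F = dom1 B G\<rbrakk> \<Longrightarrow>
      (\<Theta>' \<cdot> \<Theta>) \<star> (\<Xi>' \<cdot> \<Xi>) = (\<Theta>' \<star> \<Xi>') \<cdot> (\<Theta> \<star> \<Xi>)"
    and assoc_cell: "\<lbrakk>is_1cell B F a b; is_1cell B G b c; is_1cell B H c d\<rbrakk> \<Longrightarrow>
      iso_2cell B (assoc B H G F) ((H \<odot> G) \<odot> F) (H \<odot> (G \<odot> F))"
    and assoc_natural: "\<lbrakk>is_2cell B \<Xi> F F'; is_2cell B \<Theta> G G'; is_2cell B \<Omega> H H';
      cod1 B F = dom1 B G; cod1 B G = dom1 B H\<rbrakk> \<Longrightarrow>
      assoc B H' G' F' \<cdot> ((\<Omega> \<star> \<Theta>) \<star> \<Xi>) = (\<Omega> \<star> (\<Theta> \<star> \<Xi>)) \<cdot> assoc B H G F"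
    and lunit_cell: "is_1cell B F a b \<Longrightarrow> iso_2cell B (lunit B F) (id1 B b \<odot> F) F"
    and lunit_natural: "\<lbrakk>is_2cell B \<Theta> F G; cod1 B F = b\<rbrakk> \<Longrightarrow>
      lunit B G \<cdot> (id2 B (id1 B b) \<star> \<Theta>) = \<Theta> \<cdot> lunit B F"
    and runit_cell: "is_1cell B F a b \<Longrightarrow> iso_2cell B (runit B F) (F \<odot> id1 B a) F"
    and runit_natural: "\<lbrakk>is_2cell B \<Theta> F G; dom1 B F = a\<rbrakk> \<Longrightarrow>
      runit B G \<cdot> (\<Theta> \<star> id2 B (id1 B a)) = \<Theta> \<cdot> runit B F"
    and triangle: "\<lbrakk>is_1cell B F a b; is_1cell B G b c\<rbrakk> \<Longrightarrow>
      (id2 B G \<star> lunit B F) \<cdot> assoc B G (id1 B b) F = runit B G \<star> id2 B F"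
    and pentagon: "\<lbrakk>is_1cell B F a b; is_1cell B G b c; is_1cell B H c d; is_1cell B K d e\<rbrakk> \<Longrightarrow>
      assoc B K H (G \<odot> F) \<cdot> assoc B (K \<odot> H) G F
      = (id2 B K \<star> assoc B H G F) \<cdot> (assoc B K (H \<odot> G) F \<cdot> (assoc B K H G \<star> id2 B F))"

text \<open>
  A pair \<open>(v, \<beta>)\<close> as in (BF4) for \<open>\<Theta> : w \<odot> f \<Rightarrow> w \<odot> g\<close>, and the comparison of two such pairs.
  Whiskering is horizontal composition with an identity 2-cell, and the equations
  \<open>\<Theta> \<star> v = w \<star> \<beta>\<close> and \<open>(g \<star> \<epsilon>) (\<beta> \<star> p) = (\<beta>' \<star> p') (f \<star> \<epsilon>)\<close> are filled in with associators.
\<close>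

definition BF4_lift ::
    "('o, 'c, 'd) bicat \<Rightarrow> 'c set \<Rightarrow> 'c \<Rightarrow> 'c \<Rightarrow> 'c \<Rightarrow> 'd \<Rightarrow> 'c \<Rightarrow> 'd \<Rightarrow> bool" where
  "BF4_lift B W w f g \<Theta> v \<beta> \<longleftrightarrow>
     v \<in> W \<and> is_1cell B v (dom1 B v) (dom1 B f) \<and>
     is_2cell B \<beta> (f \<odot>\<^bsub>B\<^esub> v) (g \<odot>\<^bsub>B\<^esub> v) \<and>
     assoc B w g v \<cdot>\<^bsub>B\<^esub> (\<Theta> \<star>\<^bsub>B\<^esub> id2 B v) = (id2 B w \<star>\<^bsub>B\<^esub> \<beta>) \<cdot>\<^bsub>B\<^esub> assoc B w f v \<and>
     (iso_2cell B \<Theta> (w \<odot>\<^bsub>B\<^esub> f) (w \<odot>\<^bsub>B\<^esub> g) \<longrightarrow> iso_2cell B \<beta> (f \<odot>\<^bsub>B\<^esub> v) (g \<odot>\<^bsub>B\<^esub> v))"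

definition BF4_comparison ::
    "('o, 'c, 'd) bicat \<Rightarrow> 'c set \<Rightarrow> 'c \<Rightarrow> 'c \<Rightarrow> 'c \<Rightarrow> 'd \<Rightarrow> 'c \<Rightarrow> 'd \<Rightarrow> bool" where
  "BF4_comparison B W f g v \<beta> v' \<beta>' \<longleftrightarrow> (\<exists>s p p' \<epsilon>.
     is_1cell B p s (dom1 B v) \<and> is_1cell B p' s (dom1 B v') \<and>
     v \<odot>\<^bsub>B\<^esub> p \<in> W \<and> v' \<odot>\<^bsub>B\<^esub> p' \<in> W \<and>
     iso_2cell B \<epsilon> (v \<odot>\<^bsub>B\<^esub> p) (v' \<odot>\<^bsub>B\<^esub> p') \<and>
     (id2 B g \<star>\<^bsub>B\<^esub> \<epsilon>) \<cdot>\<^bsub>B\<^esub> (assoc B g v p \<cdot>\<^bsub>B\<^esub> (\<beta> \<star>\<^bsub>B\<^esub> id2 B p))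
     = assoc B g v' p' \<cdot>\<^bsub>B\<^esub> ((\<beta>' \<star>\<^bsub>B\<^esub> id2 B p') \<cdot>\<^bsub>B\<^esub>
         (inv_2cell B (assoc B f v' p') \<cdot>\<^bsub>B\<^esub> ((id2 B f \<star>\<^bsub>B\<^esub> \<epsilon>) \<cdot>\<^bsub>B\<^esub> assoc B f v p))))"

locale right_fractions = bicategory B
  for B :: "('o, 'c, 'd) bicat" (structure) +
  fixes W :: "'c set"
  assumes W_1cells: "W \<subseteq> cells1 B"
    and BF1: "equivalence_1cell B F \<Longrightarrow> F \<in> W"
    and BF2: "\<lbrakk>F \<in> W; G \<in> W; cod1 B F = dom1 B G\<rbrakk> \<Longrightarrow> G \<odot> F \<in> W"
    and BF3: "\<lbrakk>w \<in> W; is_1cell B w x z; is_1cell B f y z\<rbrakk> \<Longrightarrow>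
      \<exists>u v g. v \<in> W \<and> is_1cell B v u y \<and> is_1cell B g u x \<and> isomorphic_1cells B (w \<odot> g) (f \<odot> v)"
    and BF4_exists: "\<lbrakk>w \<in> W; is_1cell B w y z; is_1cell B f x y; is_1cell B g x y;
      is_2cell B \<Theta> (w \<odot> f) (w \<odot> g)\<rbrakk> \<Longrightarrow> \<exists>v \<beta>. BF4_lift B W w f g \<Theta> v \<beta>"
    and BF4_unique: "\<lbrakk>w \<in> W; is_1cell B w y z; is_1cell B f x y; is_1cell B g x y;
      is_2cell B \<Theta> (w \<odot> f) (w \<odot> g); BF4_lift B W w f g \<Theta> v \<beta>; BF4_lift B W w f g \<Theta> v' \<beta>'\<rbrakk> \<Longrightarrow>
      BF4_comparison B W f g v \<beta> v' \<beta>'"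
    and BF5: "\<lbrakk>G \<in> W; isomorphic_1cells B F G\<rbrakk> \<Longrightarrow> F \<in> W"


section \<open>The bicategory of bundles over varying Lie groupoids\<close>

record ('p, 'g, 'a) obj =
  base :: "'p groupoid_data"
  bun_of :: "('p, 'g, 'a) bun"

abbreviation rho :: "('p, 'g, 'a) obj \<Rightarrow> 'p \<Rightarrow> 'g" where "rho a \<equiv> fst (bun_of a)"
abbreviation gam :: "('p, 'g, 'a) obj \<Rightarrow> 'p \<times> 'p \<Rightarrow> 'a" where "gam a \<equiv> snd (bun_of a)"

record ('p, 'g, 'a) mor =
  sob :: "('p, 'g, 'a) obj"
  tob :: "('p, 'g, 'a) obj"
  fn :: "'p functor_data"
  bmor :: "('p, 'g, 'a) bun_mor"

abbreviation f_ob :: "('p, 'g, 'a) mor \<Rightarrow> 'p \<Rightarrow> 'p" where "f_ob F \<equiv> fst (fn F)"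
abbreviation f_ar :: "('p, 'g, 'a) mor \<Rightarrow> 'p \<Rightarrow> 'p" where "f_ar F \<equiv> snd (fn F)"
abbreviation hh :: "('p, 'g, 'a) mor \<Rightarrow> 'p \<Rightarrow> 'g" where "hh F \<equiv> fst (bmor F)"
abbreviation eta :: "('p, 'g, 'a) mor \<Rightarrow> 'p \<Rightarrow> 'a" where "eta F \<equiv> snd (bmor F)"

record ('p, 'g, 'a) cell =
  smor :: "('p, 'g, 'a) mor"
  tmor :: "('p, 'g, 'a) mor"
  tau :: "'p \<Rightarrow> 'p"
  omega :: "'p \<Rightarrow> 'a"

context
  fixes \<alpha> :: "'g::group_add \<Rightarrow> 'g \<Rightarrow> 'g \<Rightarrow> 'a::ab_group_add"
begin

definition Bun_cells0 :: "('p, 'g, 'a) obj set" where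
  "Bun_cells0 = {a. lie_groupoid (base a) \<and> bun_ob \<alpha> (base a) (bun_of a)}"

definition Bun_cells1 :: "('p, 'g, 'a) mor set" where
  "Bun_cells1 = {F. sob F \<in> Bun_cells0 \<and> tob F \<in> Bun_cells0 \<and>
     smooth_functor (base (sob F)) (base (tob F)) (fn F) \<and>
     bun_1mor \<alpha> (base (sob F)) (bun_of (sob F))
       (pull_ob (base (sob F)) (fn F) (bun_of (tob F))) (bmor F)}"

definition Bun_cells2 :: "('p, 'g, 'a) cell set" where
  "Bun_cells2 = {\<Theta>. smor \<Theta> \<in> Bun_cells1 \<and> tmor \<Theta> \<in> Bun_cells1 \<and>
     sob (smor \<Theta>) = sob (tmor \<Theta>) \<and> tob (smor \<Theta>) = tob (tmor \<Theta>) \<and>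
     (let X = base (sob (smor \<Theta>)); Y = base (tob (smor \<Theta>)); b = bun_of (tob (smor \<Theta>));
          f\<^sub>1 = fn (smor \<Theta>); f\<^sub>2 = fn (tmor \<Theta>)
      in smooth_nat_trans X Y f\<^sub>1 f\<^sub>2 (tau \<Theta>) \<and>
         bun_2mor X
           (bun_comp \<alpha> X (bun_of (sob (smor \<Theta>))) (pull_ob X f\<^sub>1 b) (pull_ob X f\<^sub>2 b)
              (tau_tilde X f\<^sub>1 f\<^sub>2 (tau \<Theta>) b) (bmor (smor \<Theta>)))
           (bmor (tmor \<Theta>)) (omega \<Theta>))}"

definition Bun_id1 :: "('p, 'g, 'a) obj \<Rightarrow> ('p, 'g, 'a) mor" where
  "Bun_id1 a = \<lparr>sob = a, tob = a, fn = id_functor (base a),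
     bmor = (\<lambda>x\<in>X0 (base a). 0, \<lambda>\<phi>\<in>X1 (base a). 0)\<rparr>"

definition Bun_comp1 :: "('p, 'g, 'a) mor \<Rightarrow> ('p, 'g, 'a) mor \<Rightarrow> ('p, 'g, 'a) mor" where
  "Bun_comp1 F\<^sub>2 F\<^sub>1 = (let X = base (sob F\<^sub>1); f = comp_functor X (fn F\<^sub>2) (fn F\<^sub>1) in
     \<lparr>sob = sob F\<^sub>1, tob = tob F\<^sub>2, fn = f,
      bmor = bun_comp \<alpha> X (bun_of (sob F\<^sub>1))
        (pull_ob X (fn F\<^sub>1) (bun_of (tob F\<^sub>1))) (pull_ob X f (bun_of (tob F\<^sub>2)))
        (pull_mor X (fn F\<^sub>1) (bmor F\<^sub>2)) (bmor F\<^sub>1)\<rparr>)"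

definition Bun_id2 :: "('p, 'g, 'a) mor \<Rightarrow> ('p, 'g, 'a) cell" where
  "Bun_id2 F = \<lparr>smor = F, tmor = F,
     tau = (\<lambda>x\<in>X0 (base (sob F)). un (base (tob F)) (f_ob F x)),
     omega = (\<lambda>x\<in>X0 (base (sob F)). 0)\<rparr>"

definition Bun_vcomp :: "('p, 'g, 'a) cell \<Rightarrow> ('p, 'g, 'a) cell \<Rightarrow> ('p, 'g, 'a) cell" where
  "Bun_vcomp \<Theta>\<^sub>2 \<Theta> = (let F = smor \<Theta>; X = base (sob F); Y = tob F in
     \<lparr>smor = F, tmor = tmor \<Theta>\<^sub>2,
      tau = (\<lambda>x\<in>X0 X. mu (base Y) (tau \<Theta>\<^sub>2 x) (tau \<Theta> x)),
      omega = (\<lambda>x\<in>X0 X. omega \<Theta>\<^sub>2 x + omega \<Theta> x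
        + \<alpha> (rho Y (tau \<Theta>\<^sub>2 x)) (rho Y (tau \<Theta> x)) (hh F x) + gam Y (tau \<Theta>\<^sub>2 x, tau \<Theta> x))\<rparr>)"

definition Bun_hcomp :: "('p, 'g, 'a) cell \<Rightarrow> ('p, 'g, 'a) cell \<Rightarrow> ('p, 'g, 'a) cell" where
  "Bun_hcomp \<Theta>\<^sub>2 \<Theta> = (let F\<^sub>1 = smor \<Theta>; F\<^sub>2 = tmor \<Theta>; F\<^sub>3 = smor \<Theta>\<^sub>2; F\<^sub>4 = tmor \<Theta>\<^sub>2;
       X = base (sob F\<^sub>1); Y = tob F\<^sub>1; Z = tob F\<^sub>3 in
     \<lparr>smor = Bun_comp1 F\<^sub>3 F\<^sub>1, tmor = Bun_comp1 F\<^sub>4 F\<^sub>2,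
      tau = (\<lambda>x\<in>X0 X. mu (base Z) (f_ar F\<^sub>4 (tau \<Theta> x)) (tau \<Theta>\<^sub>2 (f_ob F\<^sub>1 x))),
      omega = (\<lambda>x\<in>X0 X. let y\<^sub>1 = f_ob F\<^sub>1 x; y\<^sub>2 = f_ob F\<^sub>2 x; t = f_ar F\<^sub>4 (tau \<Theta> x); t\<^sub>2 = tau \<Theta>\<^sub>2 y\<^sub>1 in
        omega \<Theta>\<^sub>2 y\<^sub>1 + omega \<Theta> x + eta F\<^sub>4 (tau \<Theta> x) + gam Z (t, t\<^sub>2)
        + \<alpha> (rho Z t) (rho Z t\<^sub>2) (hh F\<^sub>3 y\<^sub>1 + hh F\<^sub>1 x)
        + \<alpha> (hh F\<^sub>4 y\<^sub>2) (rho Y (tau \<Theta> x)) (hh F\<^sub>1 x)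
        - \<alpha> (rho Z t\<^sub>2) (hh F\<^sub>3 y\<^sub>1) (hh F\<^sub>1 x)
        - \<alpha> (rho Z t) (hh F\<^sub>4 y\<^sub>1) (hh F\<^sub>1 x))\<rparr>)"

definition Bun_assoc ::
    "('p, 'g, 'a) mor \<Rightarrow> ('p, 'g, 'a) mor \<Rightarrow> ('p, 'g, 'a) mor \<Rightarrow> ('p, 'g, 'a) cell" where
  "Bun_assoc F\<^sub>3 F\<^sub>2 F\<^sub>1 = (let H = Bun_comp1 (Bun_comp1 F\<^sub>3 F\<^sub>2) F\<^sub>1; X = base (sob F\<^sub>1) in
     \<lparr>smor = H, tmor = Bun_comp1 F\<^sub>3 (Bun_comp1 F\<^sub>2 F\<^sub>1),
      tau = (\<lambda>x\<in>X0 X. un (base (tob F\<^sub>3)) (f_ob H x)),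
      omega = (\<lambda>x\<in>X0 X. \<alpha> (hh F\<^sub>3 (f_ob F\<^sub>2 (f_ob F\<^sub>1 x))) (hh F\<^sub>2 (f_ob F\<^sub>1 x)) (hh F\<^sub>1 x))\<rparr>)"

text \<open>As \<open>\<alpha>\<close> is normalized, composition with identities is strict and the unit constraints are
  identity 2-cells.\<close>

definition Bun_pre ::
    "(('p, 'g, 'a) obj, ('p, 'g, 'a) mor, ('p, 'g, 'a) cell) bicat" where
  "Bun_pre = \<lparr>cells0 = Bun_cells0, cells1 = Bun_cells1, cells2 = Bun_cells2,
     dom1 = sob, cod1 = tob, dom2 = smor, cod2 = tmor, id1 = Bun_id1, id2 = Bun_id2,
     comp1 = Bun_comp1, vcomp = Bun_vcomp, hcomp = Bun_hcomp, assoc = Bun_assoc,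
     lunit = Bun_id2, runit = Bun_id2\<rparr>"

definition ess_equiv_class :: "('p, 'g, 'a) mor set" where
  "ess_equiv_class =
     {F \<in> Bun_cells1. essential_equivalence (base (sob F)) (base (tob F)) (fn F)}"

end

end

theory Submission
 imports Defs
begin

text \<open>
  A functor is an essential equivalence iff arrows into the codomain lift locally along smooth
  sections, every object is hit up to isomorphism, and families of arrows lift uniquely; this
  reformulation makes closure under composition, isomorphism and quasi-inverses a matter of
  composing lifts. For (BF3) the groupoid \<open>Y\<close> is pulled back along the surjective submersion
  \<open>(Z\<^sub>1 \<times> X\<^sub>0) \<times> Y\<^sub>0 \<rightarrow> Y\<^sub>0\<close>, and the bundle data are transported, with \<open>\<omega> = 0\<close>, along the tautological
  natural transformation. (BF4) follows from \<open>w \<star> _\<close> being fully faithful on 2-cells for \<open>w\<close> in \<open>\<W>\<close>.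

  All identities for \<open>\<alpha>\<close>, \<open>\<gamma>\<close>, \<open>\<eta>\<close> and \<open>\<omega>\<close> are certified linearly: a diagram is labelled by potentials of
  its vertices, arrows are differences of potentials, and the identity is a signed sum of instances of
  the cocycle conditions on subchains of the diagram.
\<close>

text \<open>A submersion is defined by a rank condition and an essential equivalence by a universal
  property, while every construction needs maps. Submersions are therefore traded for smooth local
  sections through each point, which takes a straightening theorem and so an inverse function
  theorem; essential equivalences are traded for lifts.

  Objects and arrows of all groupoids live in one type, so the triples that form the groupoid of
  (BF3) must be coded in it; the coding rests on the assumed injection of the reals. Only the
  functor to \<open>Y\<close> is built by hand there: the one to \<open>X\<close> comes from full
  faithfulness of \<open>w\<close>.

  In (BF4) a 2-cell lifts without refining its domain, so an identity serves as \<open>v\<close>.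
  Comparing two lifts is harder: (BF3), applied to \<open>v\<close> and \<open>v'\<close>, gives a
  common domain, and faithfulness reduces the equation to its whiskering with \<open>w\<close>,
  where both sides become the horizontal composite of \<open>\<Theta>\<close> with the comparison
  cell. Cocycle conditions of composites are stated as equivalences, since composing uses one
  direction and inverting, dividing or lifting the other.\<close>

abbreviation "smooth \<equiv> smooth_map"
abbreviation "cmp \<equiv> Bun_comp1"
abbreviation "hcmp \<equiv> Bun_hcomp"
abbreviation "vcmp \<equiv> Bun_vcomp"
abbreviation "asc \<equiv> Bun_assoc"

section \<open>Differential calculus on coordinate spaces\<close>

abbreviation Espace :: "nat => (nat => real) set" where
 "Espace n \<equiv> {x. \<forall>i\<ge>n. x i = 0}"

abbreviation Eopen :: "nat => (nat => real) set => bool" where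
 "Eopen n S \<equiv> openin (Euclidean_space n) S"

lemma Euclidean_space_top_of_set: "Euclidean_space n = top_of_set (Espace n)"
 by (simp add: Euclidean_space_def euclidean_product_topology)

lemma tendsto_coordinatewise:
 fixes q :: "'b => nat => real"
 assumes "\<And>i. ((%t. q t i) \<longlongrightarrow> p i) F"
 shows "(q \<longlongrightarrow> p) F"
proof -
 have "limitin (product_topology (%i. euclidean) UNIV) q p F"
  unfolding limitin_componentwise using assms by auto
 then show ?thesis
  by (simp add: euclidean_product_topology)
qed

lemma tendsto_Espace:
 fixes q :: "'b => nat => real"
 assumes "\<And>i. i < n ==> ((%t. q t i) \<longlongrightarrow> p i) F"
  and "\<forall>\<^sub>F t in F. q t : Espace n" and "p : Espace n"
 shows "(q \<longlongrightarrow> p) F"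
proof (rule tendsto_coordinatewise)
 fix i
 show "((%t. q t i) \<longlongrightarrow> p i) F"
 proof (cases "i < n")
  case False
  then have "\<forall>\<^sub>F t in F. q t i = p i"
   using assms(2,3) by (auto elim!: eventually_mono)
  then show ?thesis by (rule tendsto_eventually)
 qed (use assms in auto)
qed

lemma Eopen_subset: "Eopen n S ==> S <= Espace n"
 using openin_subset[of "Euclidean_space n" S] by (simp add: topspace_Euclidean_space)

text \<open>From coordinate \<open>n\<close> on, all points of \<open>Espace n\<close> vanish, so a
  box in the first \<open>n\<close> coordinates is already the trace of a basic open set of the
  product topology.\<close>

lemma EopenI:
 assumes "S <= Espace n"
  and "\<And>x. x : S ==> \<exists>e>0. \<forall>y\<in>Espace n. (\<forall>i<n. \<bar>y i - x i\<bar> < e) --> y : S"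
 shows "Eopen n S"
proof (rule openin_subopen[THEN iffD2], rule ballI)
 fix x assume x: "x : S"
 then obtain e where e: "e > 0" "\<forall>y\<in>Espace n. (\<forall>i<n. \<bar>y i - x i\<bar> < e) --> y : S"
  using assms(2) by blast
 define T where "T = {f::nat => real. \<forall>i\<in>{..<n}. f i : ball (x i) e}"
 have "open T"
  unfolding T_def by (rule product_topology_basis'[where x = "%i. i"]) auto
 moreover have "Espace n \<inter> T <= S"
  using e(2) by (auto simp: T_def dist_real_def abs_minus_commute)
 moreover have "x : T" using e(1) by (auto simp: T_def)
 ultimately show "\<exists>T. openin (Euclidean_space n) T & x : T & T <= S"
  using x assms(1) by (intro exI[of _ "Espace n \<inter> T"])
   (auto simp: Euclidean_space_top_of_set openin_open)
qed

lemma Eopen_box: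
 assumes "Eopen n S" "x : S"
 obtains e where "e > 0" "\<And>y. y : Espace n ==> (\<forall>i<n. \<bar>y i - x i\<bar> < e) ==> y : S"
proof -
 obtain T where T: "open T" "S = Espace n \<inter> T"
  using assms(1) by (auto simp: Euclidean_space_top_of_set openin_open)
 have "openin (product_topology (%i. euclidean) UNIV) T"
  using T by (simp add: euclidean_product_topology)
 from product_topology_open_contains_basis[OF this] assms(2) T
 obtain X where X: "x : Pi\<^sub>E UNIV X" "\<And>i. open (X i)" "Pi\<^sub>E UNIV X <= T"
  by (metis IntD2 open_openin)
 have "\<exists>e>0. ball (x i) e <= X i" for i
  using X(1,2) by (auto simp: open_contains_ball PiE_iff)
 then obtain e where e: "\<And>i. e i > 0" "\<And>i. ball (x i) (e i) <= X i" by metis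
 \<comment> \<open>The bounds \<open>e i\<close> for \<open>i >= n\<close> can be ignored, as
   \<open>y\<close> and \<open>x\<close> agree there. Inserting 1 keeps the minimum defined and
   positive for \<open>n = 0\<close>.\<close>
 define d where "d = Min (insert 1 (e ` {..<n}))"
 have d: "d > 0" "\<And>i. i < n ==> d \<le> e i"
  by (auto simp: d_def e)
 have xn: "x : Espace n" using assms(2) T by auto
 have "y : S" if y: "y : Espace n" "\<forall>i<n. \<bar>y i - x i\<bar> < d" for y
 proof -
  have "y i : X i" for i
  proof (cases "i < n")
   case True
   then have "y i : ball (x i) (e i)"
    using y(2) d(2) by (force simp: dist_real_def)
   then show ?thesis using e(2)[of i] by blast
  next
   case False
   then have "y i = x i" using y(1) xn by auto
   then show ?thesis using X(1) by auto
  qed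
  then show ?thesis using X(3) T y(1) by (auto simp: PiE_iff)
 qed
 with d(1) show thesis using that by blast
qed

lemma Espace_upd: "x : Espace n ==> i < n ==> x(i := t) : Espace n"
 by auto

lemma Eopen_line_eventually:
 assumes "Eopen n S" "x : S" "i < n"
 shows "\<forall>\<^sub>F t in nhds (x i). x(i := t) : S"
proof -
 obtain e where e: "e > 0" "\<And>y. y : Espace n ==> (\<forall>i<n. \<bar>y i - x i\<bar> < e) ==> y : S"
  using Eopen_box[OF assms(1,2)] by blast
 show ?thesis
  unfolding eventually_nhds_metric
 proof (intro exI[of _ e] conjI e(1) allI impI)
  fix t assume "dist t (x i) < e"
  then have "\<forall>j<n. \<bar>(x(i := t)) j - x j\<bar> < e"
   using e(1) by (simp add: dist_real_def)
  moreover have "x(i := t) : Espace n"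
   using Eopen_subset[OF assms(1)] assms(2,3) by auto
  ultimately show "x(i := t) : S" using e(2) by blast
 qed
qed

text \<open>\<open>pderiv_at\<close> is built on \<open>deriv\<close>, which has some value even
  where no derivative exists. The relational form carries existence along, and the rules of calculus
  are proved for it.\<close>

definition has_pd :: "((nat => real) => real) => nat => (nat => real) => real => bool" where
 "has_pd F i x d \<longleftrightarrow> ((%t. F (x(i := t))) has_real_derivative d) (at (x i))"

lemma has_pd_pderiv_at: "has_pd F i x d ==> pderiv_at F i x = d"
 by (simp add: has_pd_def pderiv_at_def DERIV_imp_deriv)

lemma has_pd_imp_differentiable: "has_pd F i x d ==> (%t. F (x(i := t))) differentiable at (x i)"
 by (auto simp: has_pd_def real_differentiable_def)

lemma has_pd_add: "has_pd F i x d ==> has_pd G i x e ==> has_pd (%x. F x + G x) i x (d + e)"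
 unfolding has_pd_def by (rule DERIV_add)

lemma has_pd_mult: "has_pd F i x d ==> has_pd G i x e ==> has_pd (%x. F x * G x) i x (d * G x + e * F x)"
 unfolding has_pd_def by (drule (1) DERIV_mult) (simp only: fun_upd_triv)

lemma has_pd_inverse:
 "has_pd F i x d ==> F x ~= 0 ==> has_pd (%x. inverse (F x)) i x (- (inverse (F x) * d * inverse (F x)))"
 unfolding has_pd_def by (drule DERIV_inverse', simp, simp only: fun_upd_triv)

lemma has_pd_cong:
 assumes "Eopen n S" "x : S" "i < n" "\<And>x. x : S ==> F x = G x" "has_pd F i x d"
 shows "has_pd G i x d"
proof -
 have ev: "\<forall>\<^sub>F t in nhds (x i). F (x(i := t)) = G (x(i := t))"
  using Eopen_line_eventually[OF assms(1-3)] by eventually_elim (rule assms(4))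
 then show ?thesis
  using assms(5) DERIV_cong_ev[OF refl ev refl] unfolding has_pd_def by blast
qed

section \<open>Functions of class C^k\<close>

lemma Ck_on_imp_continuous: "Ck_on k n S F ==> continuous_on S F"
 by (cases k) auto

lemma Ck_on_Suc_pd:
 assumes "Ck_on (Suc k) n S F" "x : S" "i < n" shows "has_pd F i x (pderiv_at F i x)"
 using assms by (auto simp: has_pd_def pderiv_at_def DERIV_deriv_iff_real_differentiable)

text \<open>Near a point of an open \<open>S\<close>, each coordinate line stays in
  \<open>S\<close>, so the partial derivatives there see only the restriction to \<open>S\<close>.
  This matters because coordinate expressions with \<open>inv_into\<close> have arbitrary values
  elsewhere.\<close>

lemma Ck_on_cong_imp:
 assumes "Eopen n S"
 shows "(\<And>x. x : S ==> F x = G x) ==> Ck_on k n S F ==> Ck_on k n S G"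
proof (induction k arbitrary: F G)
 case 0
 then show ?case by (metis Ck_on.simps(1) continuous_on_cong)
next
 case (Suc k)
 have pd: "has_pd G i x (pderiv_at F i x)" if "x : S" "i < n" for x i
  using has_pd_cong[OF assms that] Suc.prems Ck_on_Suc_pd[OF Suc.prems(2) that] by blast
 have "Ck_on k n S (pderiv_at G i)" if i: "i < n" for i
  proof (rule Suc.IH)
  show "pderiv_at F i x = pderiv_at G i x" if "x : S" for x
   using has_pd_pderiv_at[OF pd[OF that i]] by simp
  show "Ck_on k n S (pderiv_at F i)" using Suc.prems(2) i by simp
 qed
 moreover have "continuous_on S G"
  using Suc.prems continuous_on_cong by (metis Ck_on_imp_continuous)
 ultimately show ?case
  using has_pd_imp_differentiable[OF pd] by simp
qed

text \<open>The derivatives may be given by any expression \<open>G i\<close>; congruence moves the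
  regularity of \<open>G i\<close> over to \<open>pderiv_at F i\<close>, so the rules below never
  compute with \<open>pderiv_at\<close> of a compound function.\<close>

lemma Ck_on_SucI:
 assumes "Eopen n S" "continuous_on S F"
  and pd: "\<And>x i. x : S ==> i < n ==> has_pd F i x (G i x)"
  and G: "\<And>i. i < n ==> Ck_on k n S (G i)"
 shows "Ck_on (Suc k) n S F"
proof -
 have "Ck_on k n S (pderiv_at F i)" if i: "i < n" for i
 proof (rule Ck_on_cong_imp[OF assms(1) _ G[OF i]])
  show "G i x = pderiv_at F i x" if "x : S" for x
   using has_pd_pderiv_at[OF pd[OF that i]] by simp
 qed
 then show ?thesis using assms(2) has_pd_imp_differentiable[OF pd] by simp
qed

lemma Ck_on_SucD: "Ck_on (Suc k) n S F ==> i < n ==> Ck_on k n S (pderiv_at F i)"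
 by simp

lemma Ck_on_Suc_imp: "Ck_on (Suc k) n S F ==> Ck_on k n S F"
 by (induction k arbitrary: F) auto

lemma Ck_on_mono: "Ck_on k n S F ==> T <= S ==> Ck_on k n T F"
 by (induction k arbitrary: F) (auto intro: continuous_on_subset)

lemma Ck_on_const: "Ck_on k n S (%x. c)"
proof (induction k arbitrary: c)
 case (Suc k)
 have "pderiv_at (%x. c) i = (%x. 0)" for i by (simp add: pderiv_at_def fun_eq_iff)
 then show ?case using Suc by simp
qed simp

lemma has_pd_coord: "has_pd (%x. x j) i x (if i = j then 1 else 0)"
 by (cases "i = j") (simp_all add: has_pd_def)

lemma Ck_on_coord: "Ck_on k n S (%x. x j)"
proof (cases k)
 case 0
 then show ?thesis using continuous_on_subset[OF continuous_on_product_coordinates] by auto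
next
 case (Suc l)
 have *: "pderiv_at (%x. x j) i = (%x. if i = j then 1 else 0)" for i
  by (rule ext, rule has_pd_pderiv_at, rule has_pd_coord)
 have "(%t. (x(i := t)) j) differentiable at (x i)" for x :: "nat => real" and i
  by (rule has_pd_imp_differentiable, rule has_pd_coord)
 then show ?thesis
  using Suc continuous_on_subset[OF continuous_on_product_coordinates] by (auto simp: * Ck_on_const)
qed

lemma Ck_on_add:
 assumes "Eopen n S"
 shows "Ck_on k n S F ==> Ck_on k n S G ==> Ck_on k n S (%x. F x + G x)"
proof (induction k arbitrary: F G)
 case (Suc k)
 show ?case
 proof (rule Ck_on_SucI[OF assms])
  show "continuous_on S (%x. F x + G x)"
   using Suc.prems[THEN Ck_on_imp_continuous] by (rule continuous_on_add)
  show "has_pd (%x. F x + G x) i x (pderiv_at F i x + pderiv_at G i x)" if "x : S" "i < n" for x i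
   using Suc.prems[THEN Ck_on_Suc_pd, OF that] by (rule has_pd_add)
  show "Ck_on k n S (%x. pderiv_at F i x + pderiv_at G i x)" if "i < n" for i
   using Suc.prems[THEN Ck_on_SucD, OF that] by (rule Suc.IH)
 qed
qed (auto intro: continuous_on_add)

lemma Ck_on_mult:
 assumes "Eopen n S"
 shows "Ck_on k n S F ==> Ck_on k n S G ==> Ck_on k n S (%x. F x * G x)"
proof (induction k arbitrary: F G)
 case (Suc k)
 show ?case
 proof (rule Ck_on_SucI[OF assms])
  show "continuous_on S (%x. F x * G x)"
   using Suc.prems[THEN Ck_on_imp_continuous] by (rule continuous_on_mult)
  show "has_pd (%x. F x * G x) i x (pderiv_at F i x * G x + pderiv_at G i x * F x)"
   if "x : S" "i < n" for x i
   using Suc.prems[THEN Ck_on_Suc_pd, OF that] by (rule has_pd_mult)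
  show "Ck_on k n S (%x. pderiv_at F i x * G x + pderiv_at G i x * F x)" if i: "i < n" for i
   by (rule Ck_on_add[OF assms]; rule Suc.IH; rule Suc.prems[THEN Ck_on_SucD, OF i] Suc.prems[THEN Ck_on_Suc_imp])
 qed
qed (auto intro: continuous_on_mult)

lemma Ck_on_sum:
 assumes "Eopen n S" "finite I" "\<And>i. i : I ==> Ck_on k n S (F i)"
 shows "Ck_on k n S (%x. \<Sum>i\<in>I. F i x)"
 using assms(2,3) by (induction I rule: finite_induct) (auto simp: Ck_on_const Ck_on_add[OF assms(1)])

lemma Ck_on_uminus:
 assumes "Eopen n S" "Ck_on k n S F" shows "Ck_on k n S (%x. - F x)"
 using Ck_on_mult[OF assms(1) Ck_on_const[of k n S "-1"] assms(2)] by simp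

lemma Ck_on_inverse:
 assumes "Eopen n S" and nz: "\<And>x. x : S ==> F x ~= 0"
 shows "Ck_on k n S F ==> Ck_on k n S (%x. inverse (F x))"
proof (induction k)
 case 0
 then show ?case using nz by (simp add: continuous_on_inverse)
next
 case (Suc k)
 note IH = Suc.IH[OF Ck_on_Suc_imp[OF Suc.prems]]
 show ?case
 proof (rule Ck_on_SucI[OF assms(1)])
  show "continuous_on S (%x. inverse (F x))"
   using Ck_on_imp_continuous[OF Suc.prems] nz by (simp add: continuous_on_inverse)
  show "has_pd (%x. inverse (F x)) i x (- (inverse (F x) * pderiv_at F i x * inverse (F x)))"
   if "x : S" "i < n" for x i
   using Ck_on_Suc_pd[OF Suc.prems that] nz[OF that(1)] by (rule has_pd_inverse)
  show "Ck_on k n S (%x. - (inverse (F x) * pderiv_at F i x * inverse (F x)))" if "i < n" for i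
   by (rule Ck_on_uminus Ck_on_mult assms(1) IH Ck_on_SucD[OF Suc.prems that])+
 qed
qed

text \<open>An open \<open>T\<close> inside \<open>S\<close> around \<open>x\<close> yields the same
  filter \<open>at x within\<close> as \<open>S\<close> does, so continuity within \<open>T\<close>
  is continuity within \<open>S\<close>.\<close>

lemma continuous_on_Eopen_local:
 assumes "Eopen n S" "\<And>x. x : S ==> \<exists>T. Eopen n T & x : T & T <= S & continuous_on T F"
 shows "continuous_on S F"
 unfolding continuous_on_eq_continuous_within
proof
 fix x assume "x : S"
 then obtain T where T: "Eopen n T" "x : T" "T <= S" "continuous_on T F" using assms(2) by blast
 obtain U where U: "open U" "T = Espace n \<inter> U"
  using T(1) by (auto simp: Euclidean_space_top_of_set openin_open)
 have "S \<inter> U - {x} = T \<inter> U - {x}"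
  using U T(3) Eopen_subset[OF assms(1)] by blast
 then have "at x within S = at x within T"
  using at_within_nhd[of x U S T] U T(2) by blast
 then show "continuous (at x within S) F"
  using T(2,4) by (simp add: continuous_on_eq_continuous_within)
qed

lemma Ck_on_local:
 assumes S: "Eopen n S"
 shows "(\<And>x. x : S ==> \<exists>T. Eopen n T & x : T & T <= S & Ck_on k n T F) ==> Ck_on k n S F"
proof (induction k arbitrary: F)
 case 0
 show ?case
  unfolding Ck_on.simps(1) by (rule continuous_on_Eopen_local[OF S 0[unfolded Ck_on.simps(1)]])
next
 case (Suc k)
 have ex: "\<exists>T. Eopen n T & x : T & T <= S & P T"
  if "x : S" "\<And>T. Ck_on (Suc k) n T F ==> P T" for x P
  using Suc.prems[OF that(1)] that(2) by metis
 show ?case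
 proof (rule Ck_on_SucI[OF S])
  show "continuous_on S F"
   by (rule continuous_on_Eopen_local[OF S]) (rule ex, assumption, rule Ck_on_imp_continuous)
  show "Ck_on k n S (pderiv_at F i)" if "i < n" for i
   by (rule Suc.IH) (rule ex, assumption, rule Ck_on_SucD[OF _ that])
  fix x i assume x: "x : S" "i < n"
  from Suc.prems[OF x(1)] obtain T where "x : T" "Ck_on (Suc k) n T F" by (elim exE conjE)
  then show "has_pd F i x (pderiv_at F i x)" using x(2) by (intro Ck_on_Suc_pd)
 qed
qed

subsection \<open>The chain rule\<close>

text \<open>The endpoints come in either order or coincide: below they are a coordinate of a base
  point and the same coordinate of a moving point nearby, whose order is unknown.\<close>

lemma mvt_closed_segment:
 fixes f :: "real => real"
 assumes "\<And>s. s : closed_segment a b ==> (f has_real_derivative f' s) (at s)"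
 shows "\<exists>xi\<in>closed_segment a b. f b - f a = f' xi * (b - a)"
proof (cases a b rule: linorder_cases)
 case less
 have "\<exists>z. a < z & z < b & f b - f a = (b - a) * f' z"
  using assms by (intro MVT2 less) (auto simp: closed_segment_eq_real_ivl)
 then show ?thesis using less by (auto simp: closed_segment_eq_real_ivl mult.commute)
next
 case greater
 have "\<exists>z. b < z & z < a & f a - f b = (a - b) * f' z"
  using assms by (intro MVT2 greater) (auto simp: closed_segment_eq_real_ivl)
 then obtain z where "b < z" "z < a" "f a - f b = (a - b) * f' z" by blast
 then show ?thesis using greater
  by (intro bexI[of _ z]) (auto simp: closed_segment_eq_real_ivl algebra_simps)
qed auto

text \<open>Replacing the coordinates of the curve one at a time reduces the chain rule to the mean value
  theorem along coordinate lines.\<close>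

lemma chain_rule_curve:
 fixes c :: "real => nat => real"
 assumes S: "Eopen n S" and pd: "\<And>x i. x : S ==> i < n ==> has_pd F i x (D i x)"
  and contD: "\<And>i. i < n ==> continuous_on S (D i)"
  and c0: "c t0 : S" and cE: "\<forall>\<^sub>F t in nhds t0. c t : Espace n"
  and c': "\<And>i. i < n ==> ((%t. c t i) has_real_derivative c' i) (at t0)"
 shows "((%t. F (c t)) has_real_derivative (\<Sum>i<n. D i (c t0) * c' i)) (at t0)"
proof -
 define p where "p = c t0"
 define P where "P k t = (%i. if i < k then c t i else p i)" for k t
 have pS: "p : S" and pE: "p : Espace n" using c0 Eopen_subset[OF S] by (auto simp: p_def)
 have P0: "P k t0 = p" for k by (auto simp: P_def p_def)
 have cc: "((%t. c t i) \<longlongrightarrow> p i) (at t0)" if "i < n" for i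
  using DERIV_isCont[OF c'[OF that]] by (simp add: isCont_def p_def)
 have PE: "P k t : Espace n" if "k \<le> n" for k t
  using pE that by (auto simp: P_def)
 have Pt: "((%t. (P k t)(k := x t)) \<longlongrightarrow> p) (at t0)" if "k < n" "(x \<longlongrightarrow> p k) (at t0)" for k x
 proof (rule tendsto_Espace)
  show "((%t. ((P k t)(k := x t)) i) \<longlongrightarrow> p i) (at t0)" if "i < n" for i
   using \<open>(x \<longlongrightarrow> p k) (at t0)\<close> cc[OF that] by (cases "i = k"; cases "i < k") (auto simp: P_def)
  show "\<forall>\<^sub>F t in at t0. (P k t)(k := x t) : Espace n"
   using PE[of k] \<open>k < n\<close> by (intro always_eventually) auto
 qed (rule pE)
 have "k \<le> n ==> ((%t. F (P k t)) has_real_derivative (\<Sum>i<k. D i p * c' i)) (at t0)" for k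
 proof (induction k)
  case 0
  have "P 0 t = p" for t by (simp add: P_def)
  then show ?case by simp
 next
  case (Suc k)
  then have k: "k < n" by simp
  have Pk: "P k t = (P k t)(k := p k)" for t by (auto simp: P_def)
  have PSuc: "P (Suc k) t = (P k t)(k := c t k)" for t by (auto simp: P_def less_Suc_eq)
  \<comment> \<open>The mean value theorem needs the whole segment between two consecutive stages
    inside \<open>S\<close>. All its points lie in a box around \<open>p\<close> as soon as
    \<open>c t\<close> does.\<close>
  have inS: "\<forall>\<^sub>F t in at t0. \<forall>s\<in>closed_segment (p k) (c t k). (P k t)(k := s) : S"
  proof -
   obtain e where e: "e > 0" "\<And>y. y : Espace n ==> (\<forall>i<n. \<bar>y i - p i\<bar> < e) ==> y : S"
    using Eopen_box[OF S pS] by blast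
   have "\<forall>\<^sub>F t in at t0. \<forall>i\<in>{..<n}. dist (c t i) (p i) < e"
    using cc e(1) by (intro eventually_ball_finite) (auto simp: tendsto_iff)
   then show ?thesis
   proof eventually_elim
    case (elim t)
    show ?case
    proof
     fix s assume s: "s : closed_segment (p k) (c t k)"
     have "\<bar>s - p k\<bar> \<le> \<bar>c t k - p k\<bar>"
      using s by (auto simp: closed_segment_eq_real_ivl split: if_splits)
     then have "\<forall>i<n. \<bar>((P k t)(k := s)) i - p i\<bar> < e"
      using elim k e(1) by (force simp: P_def dist_real_def)
     moreover have "(P k t)(k := s) : Espace n" using PE[of k t] k by auto
     ultimately show "(P k t)(k := s) : S" using e(2) by blast
    qed
   qed
  qed
  \<comment> \<open>Chosen for every \<open>t\<close> at once: the mean value points have to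
    converge to \<open>p k\<close> as \<open>t\<close> tends to \<open>t0\<close>, which holds
    because they lie between \<open>p k\<close> and \<open>c t k\<close>.\<close>
  define xi where "xi t = (SOME s. s : closed_segment (p k) (c t k) \<and>
   F (P (Suc k) t) - F (P k t) = D k ((P k t)(k := s)) * (c t k - p k))" for t
  have xi: "\<forall>\<^sub>F t in at t0. xi t : closed_segment (p k) (c t k) \<and>
   F (P (Suc k) t) - F (P k t) = D k ((P k t)(k := xi t)) * (c t k - p k)"
   using inS
  proof eventually_elim
   case (elim t)
   have "\<exists>s\<in>closed_segment (p k) (c t k). F ((P k t)(k := c t k)) - F ((P k t)(k := p k))
     = D k ((P k t)(k := s)) * (c t k - p k)"
   proof (rule mvt_closed_segment)
    fix s assume "s : closed_segment (p k) (c t k)"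
    from pd[OF elim[rule_format, OF this] k]
    show "((%s. F ((P k t)(k := s))) has_real_derivative D k ((P k t)(k := s))) (at s)"
     by (simp add: has_pd_def)
   qed
   then have "\<exists>s. s : closed_segment (p k) (c t k) \<and>
     F (P (Suc k) t) - F (P k t) = D k ((P k t)(k := s)) * (c t k - p k)"
    unfolding Bex_def PSuc Pk[of t, symmetric] .
   then show ?case unfolding xi_def by (rule someI_ex)
  qed
  have "(xi \<longlongrightarrow> p k) (at t0)"
  proof (rule Lim_transform_bound[THEN LIM_zero_cancel])
   show "((%t. c t k - p k) \<longlongrightarrow> 0) (at t0)" using cc[OF k] by (rule LIM_zero)
   show "\<forall>\<^sub>F t in at t0. norm (xi t - p k) \<le> norm (c t k - p k)"
    using xi by eventually_elim (auto simp: closed_segment_eq_real_ivl split: if_splits)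
  qed
  then have lim: "((%t. (P k t)(k := xi t)) \<longlongrightarrow> p) (at t0)" by (rule Pt[OF k])
  have DE: "((%t. D k ((P k t)(k := xi t))) \<longlongrightarrow> D k p) (at t0)"
  proof (rule continuous_on_tendsto_compose[OF contD[OF k] lim pS])
   show "\<forall>\<^sub>F t in at t0. (P k t)(k := xi t) : S"
    using xi inS by eventually_elim blast
  qed
  have "((%t. F (P (Suc k) t) - F (P k t)) has_real_derivative D k p * c' k) (at t0)"
   unfolding has_field_derivative_iff
  proof (rule Lim_transform_eventually)
   show "((%t. D k ((P k t)(k := xi t)) * ((c t k - c t0 k) / (t - t0))) \<longlongrightarrow> D k p * c' k) (at t0)"
    using c'[OF k] by (intro tendsto_mult DE) (simp add: has_field_derivative_iff)
   show "\<forall>\<^sub>F t in at t0. D k ((P k t)(k := xi t)) * ((c t k - c t0 k) / (t - t0)) =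
     (F (P (Suc k) t) - F (P k t) - (F (P (Suc k) t0) - F (P k t0))) / (t - t0)"
    using xi by eventually_elim (simp add: P0 p_def)
  qed
  from DERIV_add[OF this Suc.IH] Suc.prems show ?case by (simp add: add.commute)
 qed
 from this[of n] have "((%t. F (P n t)) has_real_derivative (\<Sum>i<n. D i p * c' i)) (at t0)" by simp
 \<comment> \<open>From coordinate \<open>n\<close> on, the last stage \<open>P n t\<close> still
   shows \<open>p\<close>; it agrees with \<open>c t\<close> because both vanish there, the latter
   by \<open>cE\<close>.\<close>
 moreover have ev: "\<forall>\<^sub>F t in nhds t0. F (P n t) = F (c t)"
  using cE
 proof eventually_elim
  case (elim t)
  then have "P n t = c t" using pE by (auto simp: P_def fun_eq_iff)
  then show ?case by simp
 qed
 ultimately show ?thesis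
  using DERIV_cong_ev[OF refl ev refl] unfolding p_def by blast
qed

lemma continuous_on_Espace_map:
 assumes "\<And>j. j < n ==> continuous_on S (%x. H x j)" "\<And>x. x : S ==> H x : Espace n"
 shows "continuous_on S H"
proof (rule continuous_on_coordinatewise_then_product)
 fix i
 show "continuous_on S (%x. H x i)"
 proof (cases "i < n")
  case False
  then have "continuous_on S (%x. H x i) \<longleftrightarrow> continuous_on S (%x. 0::real)"
   using assms(2) by (intro continuous_on_cong) auto
  then show ?thesis by simp
 qed (use assms in auto)
qed

lemma chain_rule_pd:
 assumes S: "Eopen n S" and T: "Eopen l T" and HT: "\<And>x. x : T ==> H x : S"
  and F: "Ck_on 1 n S F" and x: "x : T" "i < l"
  and H: "\<And>j. j < n ==> has_pd (%x. H x j) i x (H' j)"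
 shows "has_pd (%x. F (H x)) i x (\<Sum>j<n. pderiv_at F j (H x) * H' j)"
proof -
 have 1: "\<forall>\<^sub>F t in nhds (x i). H (x(i := t)) : Espace n"
  using Eopen_line_eventually[OF T x] by eventually_elim (use HT Eopen_subset[OF S] in blast)
 have "((%t. F (H (x(i := t)))) has_real_derivative
   (\<Sum>j<n. pderiv_at F j (H (x(i := x i))) * H' j)) (at (x i))"
  using H[unfolded has_pd_def] F Ck_on_Suc_pd[of 0 n S F] HT x 1
  by (intro chain_rule_curve[OF S, where c = "%t. H (x(i := t))"]) auto
 then show ?thesis by (simp add: has_pd_def)
qed

text \<open>Induction on \<open>k\<close> with \<open>F\<close> varying: the chain rule writes a
  partial derivative of the composite as a sum of products, in which the derivatives of
  \<open>F\<close>, one order lower, are again composed with \<open>H\<close>.\<close>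

lemma Ck_on_compose:
 assumes S: "Eopen n S" and T: "Eopen l T" and HT: "\<And>x. x : T ==> H x : S"
 shows "Ck_on k n S F ==> (\<And>j. j < n ==> Ck_on k l T (%x. H x j)) ==> Ck_on k l T (%x. F (H x))"
proof (induction k arbitrary: F)
 have HE: "H x : Espace n" if "x : T" for x
  using HT[OF that] Eopen_subset[OF S] by (rule subsetD[rotated])
 have comp: "continuous_on T (%x. F (H x))" if "continuous_on S F" "continuous_on T H" for F :: "(nat => real) => real"
  by (rule continuous_on_compose2[OF that]) (rule image_subsetI, rule HT)
 {
 case 0
 have "continuous_on T H"
  by (rule continuous_on_Espace_map[OF _ HE]) (use 0 in simp_all)
 then show ?case using 0(1) comp by simp
 next
 case (Suc k)
 have C: "Ck_on k l T (%x. H x j)" if "j < n" for j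
  using Suc.prems(2)[OF that] by (rule Ck_on_Suc_imp)
 have cH: "continuous_on T H"
  by (rule continuous_on_Espace_map[OF _ HE]) (rule Ck_on_imp_continuous[OF C])
 have F1: "Ck_on 1 n S F" using Suc.prems(1) by (auto intro: Ck_on_imp_continuous)
 show ?case
 proof (rule Ck_on_SucI[OF T])
  show "continuous_on T (%x. F (H x))"
   by (rule comp[OF Ck_on_imp_continuous[OF Suc.prems(1)] cH])
  let ?G = "%i x. \<Sum>j<n. pderiv_at F j (H x) * pderiv_at (%x. H x j) i x"
  show "has_pd (%x. F (H x)) i x (?G i x)" if "x : T" "i < l" for x i
   by (rule chain_rule_pd[OF S T HT F1 that], assumption, rule Ck_on_Suc_pd[OF Suc.prems(2) that])
  show "Ck_on k l T (?G i)" if i: "i < l" for i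
  proof (rule Ck_on_sum[OF T])
   fix j assume "j : {..<n}"
   then have j: "j < n" by simp
   show "Ck_on k l T (%x. pderiv_at F j (H x) * pderiv_at (%x. H x j) i x)"
   proof (rule Ck_on_mult[OF T])
    show "Ck_on k l T (%x. pderiv_at F j (H x))"
     by (rule Suc.IH[OF Ck_on_SucD[OF Suc.prems(1) j] C])
    show "Ck_on k l T (pderiv_at (%x. H x j) i)"
     by (rule Ck_on_SucD[OF Suc.prems(2)[OF j] i])
   qed
  qed simp
 qed
 }
qed

lemma Eopen_preimage:
 assumes "Eopen n S" "continuous_on S f" "open U" shows "Eopen n {x\<in>S. f x : U}"
proof -
 have "openin (top_of_set S) {x\<in>S. f x : U}"
  using continuous_openin_preimage_gen[OF assms(2,3)] by (simp add: vimage_def Int_def)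
 then show ?thesis
  using assms(1) by (simp add: Euclidean_space_top_of_set openin_trans)
qed

section \<open>Smooth real functions\<close>

definition smooth_fun :: "nat => (nat => real) set => ((nat => real) => real) => bool" where
 "smooth_fun n S F \<longleftrightarrow> (\<forall>k. Ck_on k n S F)"

lemma smooth_funD: "smooth_fun n S F ==> Ck_on k n S F"
 by (simp add: smooth_fun_def)

lemma smooth_fun_continuous: "smooth_fun n S F ==> continuous_on S F"
 by (rule Ck_on_imp_continuous, rule smooth_funD)

lemma smooth_fun_coord: "smooth_fun n S (%x. x j)"
 by (simp add: smooth_fun_def Ck_on_coord)

lemma smooth_fun_const: "smooth_fun n S (%x. c)"
 by (simp add: smooth_fun_def Ck_on_const)

lemma smooth_fun_cong:
 assumes "Eopen n S" "\<And>x. x : S ==> F x = G x" "smooth_fun n S F" shows "smooth_fun n S G"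
 unfolding smooth_fun_def
 by (rule allI, rule Ck_on_cong_imp[OF assms(1,2) smooth_funD[OF assms(3)]])

lemma smooth_fun_mono: "smooth_fun n S F ==> T <= S ==> smooth_fun n T F"
 unfolding smooth_fun_def by (intro allI, rule Ck_on_mono) auto

lemma smooth_fun_compose:
 assumes "Eopen n S" "Eopen l T" "\<And>x. x : T ==> H x : S" "smooth_fun n S F"
  and "\<And>j. j < n ==> smooth_fun l T (%x. H x j)"
 shows "smooth_fun l T (%x. F (H x))"
 unfolding smooth_fun_def
 by (rule allI, rule Ck_on_compose[OF assms(1-3) smooth_funD[OF assms(4)] smooth_funD[OF assms(5)]])

lemma smooth_fun_has_pd:
 "smooth_fun n S F ==> x : S ==> i < n ==> has_pd F i x (pderiv_at F i x)"
 by (rule Ck_on_Suc_pd, rule smooth_funD)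

lemma smooth_fun_pderiv: "smooth_fun n S F ==> i < n ==> smooth_fun n S (pderiv_at F i)"
 unfolding smooth_fun_def by (intro allI, rule Ck_on_SucD) auto

subsection \<open>The inverse function theorem\<close>

text \<open>The inverse function theorem for maps that change a single coordinate, in which case it
  follows from the intermediate value theorem.\<close>

locale coordinate_replacement =
 fixes n i :: nat and e si :: real and p :: "nat => real" and G :: "(nat => real) => real"
  and B :: "(nat => real) set"
 assumes i: "i < n" and e: "e > 0" and p: "p : Espace n"
  and B_def: "B = {y\<in>Espace n. \<forall>j<n. \<bar>y j - p j\<bar> < e}"
  and G: "smooth_fun n B G" and pos: "\<And>y. y : B ==> si * pderiv_at G i y > 0"
begin

text \<open>\<open>W\<close> is the image of \<open>B\<close> under \<open>x(i := G x)\<close>, and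
  \<open>g z\<close> is the coordinate that this map has overwritten, so \<open>z(i := g z)\<close>
  is the inverse.\<close>

definition W :: "(nat => real) set" where
 "W = {z. \<exists>t. z(i := t) : B & G (z(i := t)) = z i}"

definition g :: "(nat => real) => real" where
 "g z = (SOME t. z(i := t) : B & G (z(i := t)) = z i)"

text \<open>The bound on coordinate \<open>i\<close> is dropped: at a point of \<open>W\<close> that
  coordinate holds a value of \<open>G\<close>, which need not be close to
  \<open>p i\<close>.\<close>

definition N :: "(nat => real) set" where
 "N = {z\<in>Espace n. \<forall>j<n. j ~= i --> \<bar>z j - p j\<bar> < e}"

lemma finite_margin:
 assumes "\<And>j. j : J ==> \<bar>z j - p j\<bar> < e" "finite J"
 shows "\<exists>d>0. \<forall>y. (\<forall>j\<in>J. \<bar>y j - z j\<bar> < d) --> (\<forall>j\<in>J. \<bar>y j - p j\<bar> < e)"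
proof (cases "J = {}")
 case False
 define d where "d = Min ((%j. e - \<bar>z j - p j\<bar>) ` J)"
 have "d > 0" using assms False by (auto simp: d_def)
 moreover have d: "d \<le> e - \<bar>z j - p j\<bar>" if "j : J" for j
  using assms(2) that by (simp add: d_def)
 moreover have "\<bar>y j - p j\<bar> < e" if "\<forall>j\<in>J. \<bar>y j - z j\<bar> < d" "j : J" for y j
  using that(1)[rule_format, OF that(2)] d[OF that(2)] by linarith
 ultimately show ?thesis by blast
qed (auto intro: exI[of _ 1])

lemma Eopen_box_set:
 assumes "J <= {..<n}" shows "Eopen n {z\<in>Espace n. \<forall>j\<in>J. \<bar>z j - p j\<bar> < e}"
proof (rule EopenI)
 fix z assume "z : {z\<in>Espace n. \<forall>j\<in>J. \<bar>z j - p j\<bar> < e}"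
 then obtain d where d: "d > 0" "\<And>y. \<forall>j\<in>J. \<bar>y j - z j\<bar> < d ==> \<forall>j\<in>J. \<bar>y j - p j\<bar> < e"
  using finite_margin[of J z] finite_subset[OF assms] by auto
 have "y : {z\<in>Espace n. \<forall>j\<in>J. \<bar>z j - p j\<bar> < e}"
  if "y : Espace n" "\<forall>j<n. \<bar>y j - z j\<bar> < d" for y
 proof -
  have "\<forall>j\<in>J. \<bar>y j - p j\<bar> < e" using that(2) assms by (intro d(2)) auto
  then show ?thesis using that(1) by simp
 qed
 then show "\<exists>d>0. \<forall>y\<in>Espace n. (\<forall>j<n. \<bar>y j - z j\<bar> < d) --> y : {z\<in>Espace n. \<forall>j\<in>J. \<bar>z j - p j\<bar> < e}"
  using d(1) by blast
qed auto

lemma Eopen_B: "Eopen n B"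
 using Eopen_box_set[of "{..<n}"] by (simp add: B_def Ball_def)

lemma Eopen_N: "Eopen n N"
proof -
 have "N = {z\<in>Espace n. \<forall>j\<in>{..<n}-{i}. \<bar>z j - p j\<bar> < e}" by (auto simp: N_def)
 then show ?thesis using Eopen_box_set[of "{..<n}-{i}"] by auto
qed

lemma upd_in_B: "z : N ==> \<bar>t - p i\<bar> < e ==> z(i := t) : B"
 using i by (auto simp: N_def B_def)

lemma upd_in_B_D: "z(i := t) : B ==> z : Espace n ==> z : N & \<bar>t - p i\<bar> < e"
 using i by (auto simp: N_def B_def split: if_splits)

lemma upd_in_B_Espace: "z(i := t) : B ==> z : Espace n"
 using i by (auto simp: B_def split: if_splits)

text \<open>Multiplying by \<open>si\<close>, which has the sign of the partial derivative, makes
  \<open>G\<close> increasing along the lines in direction \<open>i\<close>, so both signs are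
  handled at once.\<close>

lemma strict_mono_line:
 assumes "y(i := a) : B" "y(i := b) : B" "a < b"
 shows "si * G (y(i := a)) < si * G (y(i := b))"
proof -
 have yN: "y : N" "\<bar>a - p i\<bar> < e" "\<bar>b - p i\<bar> < e"
  using assms upd_in_B_D upd_in_B_Espace by blast+
 have "((%s. G (y(i := s))) has_real_derivative pderiv_at G i (y(i := s))) (at s)"
  if "s : closed_segment a b" for s
 proof -
  have "y(i := s) : B"
   using that assms(3) yN by (intro upd_in_B) (auto simp: closed_segment_eq_real_ivl)
  from smooth_fun_has_pd[OF G this i] show ?thesis by (simp add: has_pd_def)
 qed
 from mvt_closed_segment[OF this] obtain s where s: "s : closed_segment a b"
  "G (y(i := b)) - G (y(i := a)) = pderiv_at G i (y(i := s)) * (b - a)" by blast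
 have "y(i := s) : B"
  using s assms(3) yN by (intro upd_in_B) (auto simp: closed_segment_eq_real_ivl)
 then have "si * pderiv_at G i (y(i := s)) * (b - a) > 0"
  using pos assms(3) by simp
 moreover have "si * G (y(i := b)) - si * G (y(i := a)) = si * pderiv_at G i (y(i := s)) * (b - a)"
  by (simp only: right_diff_distrib[symmetric] s(2) mult.assoc)
 ultimately show ?thesis by linarith
qed

lemma line_inj:
 assumes "y(i := a) : B" "y(i := b) : B" "G (y(i := a)) = G (y(i := b))" shows "a = b"
 using strict_mono_line[OF assms(1,2)] strict_mono_line[OF assms(2,1)] assms(3)
 by (cases a b rule: linorder_cases) auto

lemma g_spec: "z : W ==> z(i := g z) : B & G (z(i := g z)) = z i"
 unfolding W_def g_def mem_Collect_eq by (rule someI_ex)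

lemma g_eqI: "z(i := t) : B ==> G (z(i := t)) = z i ==> z : W & g z = t"
proof
 assume *: "z(i := t) : B" "G (z(i := t)) = z i"
 then show W: "z : W" by (auto simp: W_def)
 show "g z = t" using line_inj[OF conjunct1[OF g_spec[OF W]] *(1)] g_spec[OF W] * by simp
qed

lemma continuous_upd:
 assumes "T <= Espace n" "continuous_on T f" shows "continuous_on T (%z. z(i := f z))"
proof (rule continuous_on_coordinatewise_then_product)
 fix j
 show "continuous_on T (%z. (z(i := f z)) j)"
  using assms continuous_on_subset[OF continuous_on_product_coordinates, of T j]
  by (cases "j = i") auto
qed

text \<open>On the line through \<open>z0\<close>, the value \<open>z0 i\<close> lies strictly
  between those of \<open>G\<close> at the ends of a short interval around \<open>g z0\<close>.
  These strict inequalities are open conditions on \<open>z\<close>, and where they hold the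
  intermediate value theorem solves the equation inside the interval. This gives openness of
  \<open>W\<close> and continuity of \<open>g\<close> together.\<close>

lemma neighbourhood:
 assumes z0: "z0 : W" and d: "d > 0"
 shows "\<exists>V. Eopen n V & z0 : V & V <= W & (\<forall>z\<in>V. \<bar>g z - g z0\<bar> < d)"
proof -
 let ?t = "g z0"
 have t: "z0(i := ?t) : B" "G (z0(i := ?t)) = z0 i" using g_spec[OF z0] by auto
 have zN: "z0 : N" "\<bar>?t - p i\<bar> < e" using upd_in_B_D[OF t(1) upd_in_B_Espace[OF t(1)]] by auto
 \<comment> \<open>Half of the smaller margin, so that the closed interval around \<open>?t\<close>
   stays strictly inside both the tolerance \<open>d\<close> and the box.\<close>
 define c where "c = min d (e - \<bar>?t - p i\<bar>) / 2"
 have "0 < min d r / 2 & min d r / 2 < d & min d r / 2 < r" if "r > 0" for r :: real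
  using d that by (auto simp: min_def)
 from this[of "e - \<bar>?t - p i\<bar>"] zN(2)
 have c: "c > 0" "c < d" "c < e - \<bar>?t - p i\<bar>" by (simp_all only: c_def diff_gt_0_iff_gt)
 define a b where "a = ?t - c" and "b = ?t + c"
 have ab: "a < ?t" "?t < b" "\<bar>a - p i\<bar> < e" "\<bar>b - p i\<bar> < e" using c by (auto simp: a_def b_def)
 have aB: "z(i := s) : B" if "z : N" "s : {a..b}" for z s
  using upd_in_B[OF that(1)] ab that(2) by auto
 have cont: "continuous_on N (%z. si * G (z(i := s)) - si * z i)" if "s : {a..b}" for s
  using Eopen_subset[OF Eopen_N] aB that continuous_on_subset[OF continuous_on_product_coordinates, of N i]
  by (intro continuous_intros continuous_on_compose2[OF smooth_fun_continuous[OF G]] continuous_upd) auto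
 define V where "V = {z\<in>N. si * G (z(i := a)) - si * z i : {..<0}} \<inter> {z\<in>N. si * G (z(i := b)) - si * z i : {0<..}}"
 have "Eopen n V"
  unfolding V_def using ab by (intro openin_Int Eopen_preimage Eopen_N cont) auto
 moreover have "z0 : V"
  using strict_mono_line[OF aB[OF zN(1)] aB[OF zN(1)], of a ?t] strict_mono_line[OF aB[OF zN(1)] aB[OF zN(1)], of ?t b]
   zN ab t by (auto simp: V_def)
 moreover have "z : W & \<bar>g z - ?t\<bar> < d" if "z : V" for z
 proof -
  have zN: "z : N" and lt: "si * G (z(i := a)) < si * z i" "si * z i < si * G (z(i := b))"
   using that by (auto simp: V_def)
  have line: "continuous_on {a..b} (%s. z(i := s))"
  proof (rule continuous_on_coordinatewise_then_product)
   show "continuous_on {a..b} (%s. (z(i := s)) l)" for l by (cases "l = i") simp_all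
  qed
  have "continuous_on {a..b} (%s. G (z(i := s)))"
   by (rule continuous_on_compose2[OF smooth_fun_continuous[OF G] line]) (use aB[OF zN] in blast)
  then have "continuous_on {a..b} (%s. si * G (z(i := s)))" by (rule continuous_on_mult_left)
  from IVT'[OF less_imp_le[OF lt(1)] less_imp_le[OF lt(2)] _ this]
  obtain s where s: "a \<le> s" "s \<le> b" "si * G (z(i := s)) = si * z i" using ab by auto
  have sB: "z(i := s) : B" using aB[OF zN] s by auto
  moreover have "si ~= 0" using pos[OF sB] by auto
  ultimately have "z : W & g z = s" using s(3) by (intro g_eqI) auto
  moreover have "\<bar>s - ?t\<bar> < d" using s(1,2) c by (auto simp: a_def b_def)
  ultimately show ?thesis by auto
 qed
 ultimately show ?thesis by (intro exI[of _ V]) auto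
qed

lemma Eopen_W: "Eopen n W"
proof (rule openin_subopen[THEN iffD2], rule ballI)
 fix z assume "z : W"
 from neighbourhood[OF this zero_less_one] show "\<exists>T. Eopen n T & z : T & T <= W" by blast
qed

lemma continuous_g: "continuous_on W g"
 unfolding continuous_on_def
proof (intro ballI tendstoI)
 fix z d :: "_" assume z: "z : W" "(0::real) < d"
 from neighbourhood[OF this] obtain V where V: "Eopen n V" "z : V" "V <= W" "\<forall>y\<in>V. \<bar>g y - g z\<bar> < d" by blast
 obtain T where T: "open T" "V = Espace n \<inter> T"
  using V(1) by (auto simp: Euclidean_space_top_of_set openin_open)
 have "W <= Espace n" by (rule Eopen_subset[OF Eopen_W])
 then show "\<forall>\<^sub>F y in at z within W. dist (g y) (g z) < d"
  unfolding eventually_at_topological using T V(2,4)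
  by (intro exI[of _ T]) (auto simp: dist_real_def)
qed

text \<open>Implicit differentiation of \<open>G (z(i := g z)) = z i\<close> along coordinate
  \<open>j\<close>, at \<open>y = z(i := g z)\<close>: the right side moves only for
  \<open>j = i\<close>, and for other \<open>j\<close> the argument of \<open>G\<close> moves both
  directly and through \<open>g\<close>.\<close>

definition g' :: "nat => (nat => real) => real" where
 "g' j y = (if j = i then 1 else - pderiv_at G j y) * inverse (pderiv_at G i y)"

lemma has_pd_g:
 assumes z: "z : W" and j: "j < n" shows "has_pd g j z (g' j (z(i := g z)))"
proof -
 let ?t0 = "z j" and ?y = "z(i := g z)" and ?D = "pderiv_at G i"
 define h where "h t = g (z(j := t))" for t
 \<comment> \<open>The defect in the equation when coordinate \<open>j\<close> moves to
   \<open>t\<close> but the old solution \<open>g z\<close> is kept. Its derivative is known because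
   \<open>g\<close> does not move in it, and the mean value theorem in direction \<open>i\<close>
   expresses it by the increment of \<open>g\<close>.\<close>
 define k where "k t = (z(j := t)) i - G ((z(j := t))(i := g z))" for t
 have y: "?y : B" "G ?y = z i" using g_spec[OF z] by auto
 have h0: "h ?t0 = g z" by (simp add: h_def)
 have inW: "\<forall>\<^sub>F t in at ?t0. z(j := t) : W"
  using Eopen_line_eventually[OF Eopen_W z j] by (simp add: eventually_nhds_conv_at)
 have hcont: "(h \<longlongrightarrow> g z) (at ?t0)"
  unfolding h_def
 proof (rule continuous_on_tendsto_compose[OF continuous_g _ z inW])
  show "((%t. z(j := t)) \<longlongrightarrow> z) (at ?t0)"
  proof (rule tendsto_coordinatewise)
   show "((%t. (z(j := t)) l) \<longlongrightarrow> z l) (at ?t0)" for l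
    by (cases "l = j") (auto intro: tendsto_ident_at)
  qed
 qed
 have k0: "k ?t0 = 0" using y by (simp add: k_def)
 have k': "(k has_real_derivative (if j = i then 1 else - pderiv_at G j ?y)) (at ?t0)"
 proof (cases "j = i")
  case True
  have "k t = t - G ?y" for t by (simp add: k_def True)
  then have "k = (%t. t - G ?y)" by (rule ext)
  then show ?thesis using True by (auto intro!: derivative_eq_intros)
 next
  case False
  have "k t = z i - G (?y(j := t))" for t
   using False by (simp add: k_def fun_upd_twist)
  then have k: "k = (%t. z i - G (?y(j := t)))" by (rule ext)
  have "((%t. G (?y(j := t))) has_real_derivative pderiv_at G j ?y) (at ?t0)"
   using smooth_fun_has_pd[OF G y(1) j] False by (simp add: has_pd_def)
  from DERIV_diff[OF DERIV_const this] show ?thesis using False by (simp add: k)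
 qed
 define xi where "xi t = (SOME s. s : closed_segment (g z) (h t) \<and>
   k t = ?D ((z(j := t))(i := s)) * (h t - g z))" for t
 have zline: "\<forall>\<^sub>F t in at ?t0. (z(j := t))(i := g z) : B"
 proof -
  have zN: "z : N" "\<bar>g z - p i\<bar> < e" using upd_in_B_D[OF y(1) upd_in_B_Espace[OF y(1)]] by auto
  have "\<forall>\<^sub>F t in at ?t0. z(j := t) : N"
   using Eopen_line_eventually[OF Eopen_N zN(1) j] by (simp add: eventually_nhds_conv_at)
  then show ?thesis by eventually_elim (rule upd_in_B[OF _ zN(2)])
 qed
 have xi: "\<forall>\<^sub>F t in at ?t0. xi t : closed_segment (g z) (h t) & (z(j := t))(i := xi t) : B \<and>
   k t = ?D ((z(j := t))(i := xi t)) * (h t - g z)"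
  using inW zline
 proof eventually_elim
  case (elim t)
  let ?z = "z(j := t)"
  have ht: "?z(i := h t) : B" "G (?z(i := h t)) = ?z i"
   using g_spec[OF elim(1)] by (auto simp: h_def)
  have zN: "?z : N" "\<bar>h t - p i\<bar> < e" "\<bar>g z - p i\<bar> < e"
   using upd_in_B_D[OF ht(1) upd_in_B_Espace[OF ht(1)]] upd_in_B_D[OF elim(2) upd_in_B_Espace[OF ht(1)]]
   by auto
  have seg: "?z(i := s) : B" if "s : closed_segment (g z) (h t)" for s
   using that zN by (intro upd_in_B) (auto simp: closed_segment_eq_real_ivl split: if_splits)
  have "((%s. G (?z(i := s))) has_real_derivative ?D (?z(i := s))) (at s)"
   if "s : closed_segment (g z) (h t)" for s
   using smooth_fun_has_pd[OF G seg[OF that] i] by (simp add: has_pd_def)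
  from mvt_closed_segment[OF this]
  obtain s where s: "s : closed_segment (g z) (h t)"
   "G (?z(i := h t)) - G (?z(i := g z)) = ?D (?z(i := s)) * (h t - g z)" by blast
  then have "\<exists>s. s : closed_segment (g z) (h t) & k t = ?D (?z(i := s)) * (h t - g z)"
   by (intro exI[of _ s]) (simp add: k_def ht(2))
  then have "xi t : closed_segment (g z) (h t) & k t = ?D (?z(i := xi t)) * (h t - g z)"
   unfolding xi_def by (rule someI_ex)
  then show ?case using seg by blast
 qed
 have "(xi \<longlongrightarrow> g z) (at ?t0)"
 proof (rule Lim_transform_bound[THEN LIM_zero_cancel])
  show "((%t. h t - g z) \<longlongrightarrow> 0) (at ?t0)" using hcont by (rule LIM_zero)
  show "\<forall>\<^sub>F t in at ?t0. norm (xi t - g z) \<le> norm (h t - g z)"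
   using xi by eventually_elim (auto simp: closed_segment_eq_real_ivl split: if_splits)
 qed
 then have "((%t. (z(j := t))(i := xi t)) \<longlongrightarrow> ?y) (at ?t0)"
 proof (intro tendsto_coordinatewise)
  show "((%t. ((z(j := t))(i := xi t)) l) \<longlongrightarrow> ?y l) (at ?t0)" if "(xi \<longlongrightarrow> g z) (at ?t0)" for l
   using that by (cases "l = i"; cases "l = j") (auto intro: tendsto_ident_at)
 qed
 then have Dlim: "((%t. ?D ((z(j := t))(i := xi t))) \<longlongrightarrow> ?D ?y) (at ?t0)"
  using xi by (intro continuous_on_tendsto_compose[OF smooth_fun_continuous[OF smooth_fun_pderiv[OF G i]] _ y(1)])
   (auto elim!: eventually_mono)
 have nz: "?D x ~= 0" if "x : B" for x using pos[OF that] by auto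
 have "(h has_real_derivative (if j = i then 1 else - pderiv_at G j ?y) * inverse (?D ?y)) (at ?t0)"
  unfolding has_field_derivative_iff
 proof (rule Lim_transform_eventually)
  show "((%t. (k t - k ?t0) / (t - ?t0) * inverse (?D ((z(j := t))(i := xi t)))) \<longlongrightarrow>
    (if j = i then 1 else - pderiv_at G j ?y) * inverse (?D ?y)) (at ?t0)"
   by (intro tendsto_mult tendsto_inverse Dlim nz[OF y(1)] k'[unfolded has_field_derivative_iff])
  show "\<forall>\<^sub>F t in at ?t0. (k t - k ?t0) / (t - ?t0) * inverse (?D ((z(j := t))(i := xi t)))
    = (h t - h ?t0) / (t - ?t0)"
   using xi
  proof eventually_elim
   case (elim t)
   have "(D * a - 0) / b * inverse D = a / b" if "D ~= 0" for D a b :: real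
    using that by (simp add: field_simps)
   from this[OF nz] elim show ?case unfolding k0 h0 by metis
  qed
 qed
 then show ?thesis by (simp add: has_pd_def h_def[abs_def] g'_def)
qed

lemma smooth_upd_g:
 assumes "Ck_on k n W g" "Ck_on k n B F" shows "Ck_on k n W (%z. F (z(i := g z)))"
proof (rule Ck_on_compose[OF Eopen_B Eopen_W _ assms(2)])
 show "z(i := g z) : B" if "z : W" for z using g_spec[OF that] by simp
 show "Ck_on k n W (%z. (z(i := g z)) j)" for j
  using assms(1) by (cases "j = i") (simp_all add: Ck_on_coord)
qed

text \<open>Bootstrapping: the partial derivatives of \<open>g\<close> are smooth functions composed
  with the inverse map, which is as often differentiable as \<open>g\<close> itself, so each order
  yields the next.\<close>

lemma smooth_g: "smooth_fun n W g"
 unfolding smooth_fun_def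
proof
 fix k
 show "Ck_on k n W g"
 proof (induction k)
  case 0
  show ?case using continuous_g by simp
 next
  case (Suc k)
  show ?case
  proof (rule Ck_on_SucI[OF Eopen_W continuous_g has_pd_g])
   fix j assume j: "j < n"
   have "Ck_on k n B (g' j)"
    unfolding g'_def
   proof (rule Ck_on_mult[OF Eopen_B])
    show "Ck_on k n B (%y. inverse (pderiv_at G i y))"
    proof (rule Ck_on_inverse[OF Eopen_B])
     show "pderiv_at G i y ~= 0" if "y : B" for y using pos[OF that] by auto
     show "Ck_on k n B (pderiv_at G i)" by (rule smooth_funD[OF smooth_fun_pderiv[OF G i]])
    qed
    show "Ck_on k n B (%y. if j = i then 1 else - pderiv_at G j y)"
     using Ck_on_uminus[OF Eopen_B smooth_funD[OF smooth_fun_pderiv[OF G j]], of k]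
     by (cases "j = i") (simp_all add: Ck_on_const)
   qed
   with Suc.IH show "Ck_on k n W (%z. g' j (z(i := g z)))" by (rule smooth_upd_g)
  qed
 qed
qed

end

lemma coordinate_replacement_exists:
 assumes S: "Eopen n S" and G: "smooth_fun n S G" and p: "p : S" and i: "i < n"
  and nz: "pderiv_at G i p ~= 0"
 obtains B W g where "Eopen n B" "p : B" "B <= S" "Eopen n W" "smooth_fun n W g"
  "\<And>x. x : B ==> x(i := G x) : W & g (x(i := G x)) = x i"
  "\<And>z. z : W ==> z(i := g z) : B & G (z(i := g z)) = z i"
proof -
 \<comment> \<open>The derivative at \<open>p\<close> serves as its own sign: the product below is a
   nonzero square at \<open>p\<close>, and by continuity it stays positive on a box.\<close>
 define si where "si = pderiv_at G i p"
 have "continuous_on S (%x. si * pderiv_at G i x)"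
  using smooth_fun_continuous[OF smooth_fun_pderiv[OF G i]] by (intro continuous_intros)
 then have open': "Eopen n {x\<in>S. si * pderiv_at G i x : {0<..}}" by (rule Eopen_preimage[OF S]) simp
 have p': "p : {x\<in>S. si * pderiv_at G i x : {0<..}}"
  using p nz by (auto simp: si_def zero_less_mult_iff)
 obtain e where e: "e > 0"
  "\<And>y. y : Espace n ==> (\<forall>j<n. \<bar>y j - p j\<bar> < e) ==> y : {x\<in>S. si * pderiv_at G i x : {0<..}}"
  using Eopen_box[OF open' p'] by blast
 define B where "B = {y\<in>Espace n. \<forall>j<n. \<bar>y j - p j\<bar> < e}"
 have B: "y : S" "si * pderiv_at G i y > 0" if "y : B" for y
  using e(2)[of y] that by (auto simp: B_def)
 have pE: "p : Espace n" using Eopen_subset[OF S] p by (rule subsetD)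
 have BS: "B <= S" using B(1) by blast
 interpret coordinate_replacement n i e si p G B
  by (rule coordinate_replacement.intro[OF i e(1) pE B_def smooth_fun_mono[OF G BS] B(2)])
 show thesis
 proof (rule that[OF Eopen_B _ _ Eopen_W smooth_g])
  show "p : B" using pE e(1) by (simp add: B_def)
  show "B <= S" by (rule BS)
  show "x(i := G x) : W & g (x(i := G x)) = x i" if "x : B" for x
   using that by (intro g_eqI) simp_all
  show "z(i := g z) : B & G (z(i := g z)) = z i" if "z : W" for z
   using that by (rule g_spec)
 qed
qed

subsection \<open>Straightening a submersion\<close>

lemma pderiv_at_cong:
 assumes "Eopen n S" "x : S" "i < n" "smooth_fun n S F" "\<And>x. x : S ==> F x = G x"
 shows "pderiv_at G i x = pderiv_at F i x"
 by (rule has_pd_pderiv_at, rule has_pd_cong[OF assms(1-3,5) smooth_fun_has_pd[OF assms(4,2,3)]])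

text \<open>Local coordinates in which a submersion is a projection, found one component at a time:
  composing the next component with the inverse of the coordinates found so far, some partial
  derivative along a remaining coordinate does not vanish.\<close>

lemma straighten_submersion:
 fixes F :: "(nat => real) => nat => real"
 assumes S: "Eopen m S" and p: "p : S"
 shows "(\<And>j. j < n ==> smooth_fun m S (%x. F x j)) ==>
   (\<And>v :: nat => real. \<exists>u. \<forall>j<n. v j = (\<Sum>i<m. pderiv_at (%x. F x j) i p * u i)) ==>
   n \<le> m & (\<exists>S' W PP Ph. Eopen m S' & p : S' & S' <= S & Eopen m W \<and>
    (\<forall>j<m. smooth_fun m S' (%x. PP x j)) & (\<forall>j<m. smooth_fun m W (%x. Ph x j)) \<and>
    (\<forall>x\<in>S'. PP x : W & Ph (PP x) = x) & (\<forall>z\<in>W. Ph z : S' & PP (Ph z) = z) \<and>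
    (\<forall>x\<in>S'. \<forall>j<n. PP x j = F x j))"
proof (induction n)
 case 0
 show ?case
  using S p by (intro conjI exI[of _ S] exI[of _ "%x. x"]) (auto simp: smooth_fun_coord)
next
 case (Suc n)
 have IH: "\<exists>u. \<forall>j<n. v j = (\<Sum>i<m. pderiv_at (%x. F x j) i p * u i)" for v :: "nat => real"
 proof -
  obtain u where "\<forall>j<Suc n. v j = (\<Sum>i<m. pderiv_at (%x. F x j) i p * u i)"
   using Suc.prems(2)[of v] by (rule exE)
  then show ?thesis by (intro exI[of _ u]) simp
 qed
 have "n \<le> m & (\<exists>S' W PP Ph. Eopen m S' & p : S' & S' <= S & Eopen m W \<and>
    (\<forall>j<m. smooth_fun m S' (%x. PP x j)) & (\<forall>j<m. smooth_fun m W (%x. Ph x j)) \<and>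
    (\<forall>x\<in>S'. PP x : W & Ph (PP x) = x) & (\<forall>z\<in>W. Ph z : S' & PP (Ph z) = z) \<and>
    (\<forall>x\<in>S'. \<forall>j<n. PP x j = F x j))"
  by (rule Suc.IH[OF Suc.prems(1) IH]) simp
 then obtain S' W PP Ph where nm: "n \<le> m" and S': "Eopen m S'" "p : S'" "S' <= S" and W: "Eopen m W"
  and PPa: "\<forall>j<m. smooth_fun m S' (%x. PP x j)" and Pha: "\<forall>j<m. smooth_fun m W (%x. Ph x j)"
  and PPPha: "\<forall>x\<in>S'. PP x : W & Ph (PP x) = x" "\<forall>z\<in>W. Ph z : S' & PP (Ph z) = z"
  and PPFa: "\<forall>x\<in>S'. \<forall>j<n. PP x j = F x j"
  by (elim conjE exE) (rule that; assumption)
 note PP = PPa[rule_format] and Ph = Pha[rule_format] and PPF = PPFa[rule_format]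
 have PPPh: "x : S' ==> PP x : W" "x : S' ==> Ph (PP x) = x"
  "z : W ==> Ph z : S'" "z : W ==> PP (Ph z) = z" for x z
  using PPPha by simp_all
 \<comment> \<open>The next component of \<open>F\<close>, read in the coordinates found so
   far.\<close>
 define G where "G z = F (Ph z) n" for z
 define q where "q = PP p"
 have q: "q : W" unfolding q_def by (rule PPPh(1)[OF S'(2)])
 have Fn: "smooth_fun m S' (%x. F x j)" if "j \<le> n" for j
  by (rule smooth_fun_mono[OF Suc.prems(1) S'(3)]) (use that in simp)
 have G: "smooth_fun m W G"
  unfolding G_def by (rule smooth_fun_compose[OF S'(1) W PPPh(3) Fn[OF order_refl] Ph])
 \<comment> \<open>\<open>u\<close> is a tangent vector along which, among the components up to
   \<open>n\<close>, only component \<open>n\<close> of \<open>F\<close> changes, at rate 1. Its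
   image \<open>u'\<close> under the derivative of \<open>PP\<close> has zero entries below
   \<open>n\<close>, where \<open>PP\<close> shows components of \<open>F\<close>, so some
   derivative of \<open>G\<close> in a direction \<open>i >= n\<close> does not vanish.\<close>
 obtain u where ua: "\<forall>j<Suc n.
   (if j = n then 1 else 0) = (\<Sum>l<m. pderiv_at (%x. F x j) l p * u l)"
  using Suc.prems(2)[of "%j. if j = n then 1 else 0"] by (rule exE)
 note u = ua[rule_format]
 define u' where "u' i = (\<Sum>l<m. pderiv_at (%x. PP x i) l p * u l)" for i
 have u'0: "u' j = 0" if "j < n" for j
 proof -
  have "u' j = (\<Sum>l<m. pderiv_at (%x. F x j) l p * u l)"
   unfolding u'_def
  proof (intro sum.cong refl arg_cong2[where f = "(*)"])
   fix l assume "l : {..<m}"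
   then show "pderiv_at (%x. PP x j) l p = pderiv_at (%x. F x j) l p"
    using that PPF by (intro pderiv_at_cong[OF S'(1,2) _ Fn]) auto
  qed
  then show ?thesis using u[of j] that by simp
 qed
 have "1 = (\<Sum>l<m. pderiv_at (%x. F x n) l p * u l)" using u[of n] by simp
 also have "\<dots> = (\<Sum>l<m. (\<Sum>i<m. pderiv_at G i q * pderiv_at (%x. PP x i) l p) * u l)"
 proof (intro sum.cong refl arg_cong2[where f = "(*)"])
  fix l assume "l : {..<m}"
  then have l: "l < m" by simp
  have pd: "has_pd (%x. G (PP x)) l p (\<Sum>i<m. pderiv_at G i (PP p) * pderiv_at (%x. PP x i) l p)"
   using smooth_fun_has_pd[OF PP S'(2) l] by (intro chain_rule_pd[OF W S'(1) PPPh(1) smooth_funD[OF G] S'(2) l])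
  have GF: "G (PP x) = F x n" if "x : S'" for x using PPPh(2)[OF that] by (simp add: G_def)
  show "pderiv_at (%x. F x n) l p = (\<Sum>i<m. pderiv_at G i q * pderiv_at (%x. PP x i) l p)"
   unfolding q_def by (rule has_pd_pderiv_at[OF has_pd_cong[OF S'(1,2) l GF pd]])
 qed
 also have "\<dots> = (\<Sum>i<m. pderiv_at G i q * u' i)"
  unfolding u'_def sum_distrib_left sum_distrib_right by (subst sum.swap) (simp only: mult.assoc)
 finally have "(\<Sum>i<m. pderiv_at G i q * u' i) ~= 0" by simp
 then obtain i where i: "i < m" "pderiv_at G i q * u' i ~= 0"
  using sum.neutral[of "{..<m}" "%i. pderiv_at G i q * u' i"] by auto
 then have "n \<le> i" using u'0[of i] by (cases "i < n") auto
 obtain B V g where B: "Eopen m B" "q : B" "B <= W" and V: "Eopen m V" "smooth_fun m V g"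
  and BV: "\<And>x. x : B ==> x(i := G x) : V & g (x(i := G x)) = x i"
  and VB: "\<And>z. z : V ==> z(i := g z) : B & G (z(i := g z)) = z i"
  using coordinate_replacement_exists[OF W G q i(1)] i(2) by auto
 \<comment> \<open>The transposition of \<open>n\<close> and \<open>i\<close>: replacing a
   coordinate by \<open>G\<close> puts the new component in place \<open>i\<close>, from where it
   has to move to place \<open>n\<close>. The earlier places stay fixed, since
   \<open>n <= i\<close>.\<close>
 define t where "t j = (if j = i then n else if j = n then i else j)" for j
 have t: "t (t j) = j" "t n = i" "j < n ==> t j = j" for j
  using \<open>n \<le> i\<close> by (auto simp: t_def)
 have tm: "t j < m \<longleftrightarrow> j < m" for j using i(1) \<open>n \<le> i\<close> by (auto simp: t_def)
 have tt: "(z \<circ> t) \<circ> t = z" for z :: "nat => real" by (simp add: fun_eq_iff t)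
 have tE: "z \<circ> t : Espace m" if "z : Espace m" for z
  using that tm by (auto simp: not_less[symmetric])
 define S'' where "S'' = {x\<in>S'. PP x : B}"
 define V' where "V' = {z\<in>Espace m. z \<circ> t : V}"
 define PP' where "PP' x = ((PP x)(i := G (PP x))) \<circ> t" for x
 define Ph' where "Ph' z = Ph ((z \<circ> t)(i := g (z \<circ> t)))" for z
 have PPE: "PP x : Espace m" if "x : S'" for x
  using Eopen_subset[OF W] PPPh(1)[OF that] by (rule subsetD)
 have cont_PP: "continuous_on S' PP"
  by (rule continuous_on_Espace_map[OF smooth_fun_continuous[OF PP] PPE])
 have S'': "Eopen m S''"
 proof -
  obtain T where T: "open T" "B = Espace m \<inter> T"
   using B(1) by (auto simp: Euclidean_space_top_of_set openin_open)
  have "S'' = {x\<in>S'. PP x : T}" using T(2) PPE by (auto simp: S''_def)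
  then show ?thesis using Eopen_preimage[OF S'(1) cont_PP T(1)] by simp
 qed
 have V': "Eopen m V'"
 proof -
  obtain T where T: "open T" "V = Espace m \<inter> T"
   using V(1) by (auto simp: Euclidean_space_top_of_set openin_open)
  have E: "Eopen m (Espace m)" by (metis openin_topspace topspace_Euclidean_space)
  have "continuous_on (Espace m) (%z. z \<circ> t)"
   by (rule continuous_on_coordinatewise_then_product)
    (simp add: continuous_on_subset[OF continuous_on_product_coordinates])
  from Eopen_preimage[OF E this T(1)] show ?thesis
   using T(2) tE by (auto simp: V'_def conj_commute cong: conj_cong)
 qed
 have sG: "smooth_fun m S'' (%x. PP' x j)" if "j < m" for j
 proof (cases "t j = i")
  case True
  have "smooth_fun m S'' (%x. G (PP x))"
  proof (rule smooth_fun_compose[OF W S'' _ G])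
   show "PP x : W" if "x : S''" for x using that PPPh(1)[of x] by (simp add: S''_def)
   show "smooth_fun m S'' (%x. PP x l)" if "l < m" for l
    by (rule smooth_fun_mono[OF PP[OF that]]) (auto simp: S''_def)
  qed
  then show ?thesis using True by (simp add: PP'_def)
 next
  case False
  have "smooth_fun m S'' (%x. PP x (t j))"
   using that tm[of j] by (intro smooth_fun_mono[OF PP]) (simp_all add: S''_def Collect_restrict)
  then show ?thesis using False by (simp add: PP'_def)
 qed
 have sg: "smooth_fun m V' (%z. g (z \<circ> t))"
  by (rule smooth_fun_compose[OF V(1) V' _ V(2)]) (auto simp: V'_def smooth_fun_coord)
 have sPh: "smooth_fun m V' (%z. Ph' z j)" if "j < m" for j
  unfolding Ph'_def
 proof (rule smooth_fun_compose[OF W V' _ Ph[OF that]])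
  show "(z \<circ> t)(i := g (z \<circ> t)) : W" if "z : V'" for z
   using VB B(3) that by (auto simp: V'_def)
  show "smooth_fun m V' (%z. ((z \<circ> t)(i := g (z \<circ> t))) l)" for l
   using sg by (cases "l = i") (simp_all add: smooth_fun_coord)
 qed
 have 1: "PP' x : V' & Ph' (PP' x) = x" if "x : S''" for x
 proof -
  have x: "x : S'" "PP x : B" using that by (auto simp: S''_def)
  have "PP' x \<circ> t = (PP x)(i := G (PP x))" by (simp add: PP'_def tt)
  moreover have "PP' x : Espace m"
   unfolding PP'_def by (rule tE[OF Espace_upd[OF PPE[OF x(1)] i(1)]])
  ultimately show ?thesis using BV[OF x(2)] PPPh(2)[OF x(1)] by (simp add: V'_def Ph'_def)
 qed
 have 2: "Ph' z : S'' & PP' (Ph' z) = z" if "z : V'" for z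
 proof -
  let ?y = "(z \<circ> t)(i := g (z \<circ> t))"
  have y: "?y : B" "G ?y = (z \<circ> t) i" using VB[of "z \<circ> t"] that by (auto simp: V'_def)
  have yW: "?y : W" using y(1) B(3) by blast
  have "PP (Ph' z) = ?y" unfolding Ph'_def by (rule PPPh(4)[OF yW])
  moreover have "PP' (Ph' z) = (?y(i := G ?y)) \<circ> t" unfolding PP'_def calculation ..
  moreover have "?y(i := G ?y) = z \<circ> t" unfolding y(2) by (simp add: fun_eq_iff)
  ultimately show ?thesis
   using PPPh(3)[OF yW] y(1) by (simp add: S''_def tt Ph'_def)
 qed
 have 3: "PP' x j = F x j" if "x : S''" "j < Suc n" for x j
 proof (cases "j = n")
  case True
  then show ?thesis using that PPPh(2)[of x] by (simp add: PP'_def t G_def S''_def)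
 next
  case False
  then have "j < n" "j ~= i" using that \<open>n \<le> i\<close> by auto
  then show ?thesis using that PPF[of x j] by (simp add: PP'_def t S''_def)
 qed
 have "p : S''" using S'(2) B(2) by (simp add: S''_def q_def)
 moreover have "S'' <= S" using S'(3) by (auto simp: S''_def)
 moreover have "Suc n \<le> m" using i(1) \<open>n \<le> i\<close> by simp
 ultimately show ?case
  using S'' V' sG sPh 1 2 3
  by (intro conjI exI[of _ S''] exI[of _ V'] exI[of _ PP'] exI[of _ Ph'] allI impI ballI) simp_all
qed

section \<open>Smooth maps\<close>

lemma is_chart_open: "is_chart X n (U, ph) ==> openin X U"
 and is_chart_open_image: "is_chart X n (U, ph) ==> Eopen n (ph ` U)"
 by (simp_all add: is_chart_def)

lemma is_chart_homeomorphic: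
 assumes "is_chart X n (U, ph)"
 shows "homeomorphic_map (subtopology X U) (subtopology (Euclidean_space n) (ph ` U)) ph"
 using assms by (simp add: is_chart_def)

lemma is_chart_topspace:
 assumes "is_chart X n (U, ph)"
 shows "topspace (subtopology X U) = U" "topspace (subtopology (Euclidean_space n) (ph ` U)) = ph ` U"
 using openin_subset[OF is_chart_open[OF assms]] openin_subset[OF is_chart_open_image[OF assms]] by auto

lemma is_chart_inj: "is_chart X n (U, ph) ==> inj_on ph U"
 using is_chart_homeomorphic[THEN homeomorphic_imp_injective_map] is_chart_topspace(1) by metis

lemma is_chart_continuous:
 assumes "is_chart X n (U, ph)" shows "continuous_map (subtopology X U) (Euclidean_space n) ph"
 using homeomorphic_imp_continuous_map[OF is_chart_homeomorphic[OF assms]]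
 by (rule continuous_map_into_fulltopology)

lemma is_chart_inv: "is_chart X n (U, ph) ==> x : U ==> inv_into U ph (ph x) = x"
 using is_chart_inj inv_into_f_f by metis

lemma is_chart_continuous_inv:
 assumes "is_chart X n (U, ph)"
 shows "continuous_map (subtopology (Euclidean_space n) (ph ` U)) X (inv_into U ph)"
proof -
 obtain g where g: "homeomorphic_maps (subtopology X U) (subtopology (Euclidean_space n) (ph ` U)) ph g"
  using is_chart_homeomorphic[OF assms] homeomorphic_map_maps by metis
 have cg: "continuous_map (subtopology (Euclidean_space n) (ph ` U)) X g"
  using g unfolding homeomorphic_maps_def by (metis continuous_map_into_fulltopology)
 have geq: "g z = inv_into U ph z" if z: "z : ph ` U" for z
 proof -
  obtain x where x: "x : U" "z = ph x" using z by blast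
  then have "g z = x" using g is_chart_topspace(1)[OF assms] by (metis homeomorphic_maps_def)
  then show ?thesis using is_chart_inv[OF assms x(1)] x(2) by simp
 qed
 show ?thesis
  by (rule continuous_map_eq[OF cg geq]) (simp only: is_chart_topspace(2)[OF assms])
qed

lemma is_chart_Eopen_image:
 assumes "is_chart X n (U, ph)" "openin X T" "T <= U" shows "Eopen n (ph ` T)"
proof -
 have "openin (subtopology X U) T"
  using assms openin_open_subtopology[OF is_chart_open[OF assms(1)]] by simp
 then have "openin (subtopology (Euclidean_space n) (ph ` U)) (ph ` T)"
  using homeomorphic_imp_open_map[OF is_chart_homeomorphic[OF assms(1)]] by (simp add: open_map_def)
 then show ?thesis
  using openin_open_subtopology[OF is_chart_open_image[OF assms(1)]] by simp
qed

text \<open>Charts are built below together with a formula for their inverse; giving it turns the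
  homeomorphism condition into two continuity statements.\<close>

lemma is_chartI:
 assumes "openin X U" "Eopen n O'" "continuous_map (subtopology X U) (Euclidean_space n) ph"
  and "continuous_map (subtopology (Euclidean_space n) O') X g"
  and "\<And>x. x : U ==> ph x : O' & g (ph x) = x" "\<And>z. z : O' ==> g z : U & ph (g z) = z"
 shows "is_chart X n (U, ph)" "ph ` U = O'"
proof -
 show im: "ph ` U = O'" using assms(5,6) by (force simp: image_iff)
 have ts: "topspace (subtopology X U) = U" "topspace (subtopology (Euclidean_space n) O') = O'"
  using openin_subset[OF assms(1)] openin_subset[OF assms(2)] by auto
 have "homeomorphic_maps (subtopology X U) (subtopology (Euclidean_space n) O') ph g"
  unfolding homeomorphic_maps_def ts using assms(3-6) ts
  by (intro conjI continuous_map_into_subtopology) auto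
 then show "is_chart X n (U, ph)"
  unfolding is_chart_def using assms(1,2) im homeomorphic_map_maps by auto
qed

lemma manifold_chart: "manifold M ==> (U, ph) : charts M ==> is_chart (mtop M) (mdim M) (U, ph)"
 by (simp add: manifold_def)

lemma manifold_chart_at:
 assumes "manifold M" "x : points M" obtains U ph where "(U, ph) : charts M" "x : U"
proof -
 have "x : (\<Union>(U, ph)\<in>charts M. U)" using assms by (simp add: manifold_def)
 then show thesis using that by auto
qed

lemma manifold_chart_at':
 assumes "manifold M" "x : points M" obtains c where "c : charts M" "x : fst c"
proof -
 obtain U ph where "(U, ph) : charts M" "x : U" by (rule manifold_chart_at[OF assms])
 then show thesis using that[of "(U, ph)"] by simp
qed

section \<open>Maps in a pair of charts\<close>

lemma smooth_coords_iff: "smooth_coords n m S F \<longleftrightarrow> (\<forall>j<m. smooth_fun n S (%x. F x j))"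
 by (simp add: smooth_coords_def smooth_fun_def)

text \<open>Smoothness in one pair of charts, on an open set \<open>T\<close> that lies in the first
  chart and is mapped into the second. Carrying \<open>T\<close> along lets representatives be
  restricted, composed and moved to other charts before they are assembled by
  \<open>smooth_mapI\<close>.\<close>

definition smooth_rep :: "'a mfd => 'b mfd => 'a chart => 'b chart => 'a set => ('a => 'b) => bool" where
 "smooth_rep M N c d T f \<longleftrightarrow> openin (mtop M) T & T <= fst c & f ` T <= fst d \<and>
   (\<forall>j<mdim N. smooth_fun (mdim M) (snd c ` T) (%z. snd d (f (inv_into (fst c) (snd c) z)) j))"

lemma smooth_rep_subset:
 "smooth_rep M N c d T f ==> openin (mtop M) S ==> S <= T ==> smooth_rep M N c d S f"
 unfolding smooth_rep_def
 by (intro conjI allI impI) (auto intro: smooth_fun_mono[OF _ image_mono])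

lemma smooth_rep_compose:
 assumes c: "is_chart (mtop M) (mdim M) c" and d: "is_chart (mtop N) (mdim N) d"
  and f: "smooth_rep M N c d T f" and g: "smooth_rep N K d e T' g" and TT': "f ` T <= T'"
 shows "smooth_rep M K c e T (g \<circ> f)"
proof -
 obtain U ph V pp where cd: "c = (U, ph)" "d = (V, pp)" by fastforce
 have T: "openin (mtop M) T" "T <= U" "f ` T <= V" and T': "openin (mtop N) T'" "T' <= V" "g ` T' <= fst e"
  using f g by (auto simp: smooth_rep_def cd)
 have "smooth_fun (mdim M) (ph ` T) (%z. snd e ((g \<circ> f) (inv_into U ph z)) j)" if j: "j < mdim K" for j
 proof -
  have inT: "inv_into U ph z : T" if "z : ph ` T" for z
   using that T(2) is_chart_inv[OF c[unfolded cd]] by auto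
  have s: "smooth_fun (mdim M) (ph ` T) (%z. snd e (g (inv_into V pp (pp (f (inv_into U ph z))))) j)"
  proof (rule smooth_fun_compose[where F = "%w. snd e (g (inv_into V pp w)) j"])
   show "Eopen (mdim N) (pp ` T')" by (rule is_chart_Eopen_image[OF d[unfolded cd] T'(1,2)])
   show "Eopen (mdim M) (ph ` T)" by (rule is_chart_Eopen_image[OF c[unfolded cd] T(1,2)])
   show "pp (f (inv_into U ph z)) : pp ` T'" if "z : ph ` T" for z
    using inT[OF that] TT' by auto
   show "smooth_fun (mdim N) (pp ` T') (%w. snd e (g (inv_into V pp w)) j)"
    using g j by (simp add: smooth_rep_def cd)
   show "smooth_fun (mdim M) (ph ` T) (%z. pp (f (inv_into U ph z)) l)" if "l < mdim N" for l
    using f that by (simp add: smooth_rep_def cd)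
  qed
  show ?thesis
  proof (rule smooth_fun_cong[OF is_chart_Eopen_image[OF c[unfolded cd] T(1,2)] _ s])
   fix z assume "z : ph ` T"
   then have "f (inv_into U ph z) : V" using inT T(3) by blast
   then show "snd e (g (inv_into V pp (pp (f (inv_into U ph z))))) j = snd e ((g \<circ> f) (inv_into U ph z)) j"
    using is_chart_inv[OF d[unfolded cd]] by simp
  qed
 qed
 moreover have "(g \<circ> f) ` T <= fst e"
  using T'(3) image_mono[OF TT', of g] unfolding image_comp[symmetric] by (rule order_trans[rotated])
 ultimately show ?thesis using T by (simp add: smooth_rep_def cd)
qed

lemma smooth_rep_transition:
 assumes M: "manifold M" and c: "c : charts M" "c' : charts M"
 shows "smooth_rep M M c c' (fst c \<inter> fst c') (%x. x)"
proof -
 obtain U ph V pp where cd: "c = (U, ph)" "c' = (V, pp)" by fastforce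
 have "\<forall>(U, ph)\<in>charts M. \<forall>(V, pp)\<in>charts M.
    smooth_coords (mdim M) (mdim M) (ph ` (U \<inter> V)) (pp \<circ> inv_into U ph)"
  using M unfolding manifold_def by (elim conjE)
 from bspec[OF bspec[OF this c(1), unfolded cd split_conv] c(2), unfolded cd split_conv]
 have "smooth_coords (mdim M) (mdim M) (ph ` (U \<inter> V)) (pp \<circ> inv_into U ph)" .
 moreover have "openin (mtop M) U" "openin (mtop M) V"
  using c[unfolded cd, THEN manifold_chart[OF M], THEN is_chart_open] .
 ultimately show ?thesis by (auto simp: smooth_rep_def cd smooth_coords_iff)
qed

lemma manifold_chart': "manifold M ==> c : charts M ==> is_chart (mtop M) (mdim M) c"
 by (simp add: manifold_def)

text \<open>Compatibility of two charts is smoothness of the identity map in these charts, so the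
  rules for \<open>smooth_rep\<close> also serve to build atlases.\<close>

lemma manifoldI:
 assumes "Hausdorff_space (mtop M)" "second_countable (mtop M)"
  and c: "\<And>c. c : charts M ==> is_chart (mtop M) (mdim M) c"
  and x: "\<And>x. x : points M ==> \<exists>c\<in>charts M. x : fst c"
  and cc: "\<And>c d. c : charts M ==> d : charts M ==> smooth_rep M M c d (fst c \<inter> fst d) (%x. x)"
 shows "manifold M"
 unfolding manifold_def
proof (intro conjI ballI assms(1,2) c)
 show "(\<Union>(U, ph)\<in>charts M. U) = points M"
 proof (intro equalityI subsetI)
  fix y assume "y : (\<Union>(U, ph)\<in>charts M. U)"
  then obtain U ph where "(U, ph) : charts M" "y : U" by blast
  then show "y : points M" using openin_subset[OF is_chart_open[OF c]] by blast
 next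
  fix y assume "y : points M"
  then obtain c where "c : charts M" "y : fst c" using x by blast
  then show "y : (\<Union>(U, ph)\<in>charts M. U)" by (intro UN_I[of c]) (simp_all add: case_prod_beta)
 qed
 show "case c of (U, ph) => \<forall>(V, pp)\<in>charts M.
   smooth_coords (mdim M) (mdim M) (ph ` (U \<inter> V)) (pp \<circ> inv_into U ph)" if "c : charts M" for c
  unfolding case_prod_beta
 proof
  fix d assume "d : charts M"
  from cc[OF that this] show "smooth_coords (mdim M) (mdim M) (snd c ` (fst c \<inter> fst d)) (snd d \<circ> inv_into (fst c) (snd c))"
   by (simp add: smooth_rep_def smooth_coords_iff)
 qed
qed

lemma manifold_chart_fst_open: "manifold M ==> c : charts M ==> openin (mtop M) (fst c)"
 using is_chart_open manifold_chart' by (metis prod.collapse)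

text \<open>Composition with the transition maps of \<open>M\<close> and of \<open>N\<close> on
  either side moves a representative to other charts, while \<open>T\<close> stays the same.\<close>

lemma smooth_rep_charts:
 assumes M: "manifold M" and N: "manifold N" and c: "c : charts M" "c' : charts M" and d: "d : charts N" "d' : charts N"
  and f: "smooth_rep M N c d T f" and T: "T <= fst c'" "f ` T <= fst d'"
 shows "smooth_rep M N c' d' T f"
proof -
 have fT: "openin (mtop M) T" "T <= fst c" "f ` T <= fst d" using f by (auto simp: smooth_rep_def)
 have 1: "smooth_rep M M c' c T (%x. x)"
  by (rule smooth_rep_subset[OF smooth_rep_transition[OF M c(2,1)] fT(1)]) (use fT T in auto)
 have 2: "smooth_rep M N c d' T ((%x. x) \<circ> f)"
  by (rule smooth_rep_compose[OF manifold_chart'[OF M c(1)] manifold_chart'[OF N d(1)] f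
     smooth_rep_transition[OF N d]]) (use fT T in auto)
 have "smooth_rep M N c' d' T (((%x. x) \<circ> f) \<circ> (%x. x))"
  by (rule smooth_rep_compose[OF manifold_chart'[OF M c(2)] manifold_chart'[OF M c(1)] 1 2]) auto
 then show ?thesis by (simp add: comp_def)
qed

lemma smooth_mapD:
 assumes "manifold M" "manifold N" "smooth M N f" "c : charts M" "d : charts N"
 shows "smooth_rep M N c d {x\<in>fst c. f x : fst d} f"
proof -
 obtain U ph V pp where cd: "c = (U, ph)" "d = (V, pp)" by fastforce
 have "\<forall>(U, ph)\<in>charts M. \<forall>(V, pp)\<in>charts N.
    smooth_coords (mdim M) (mdim N) (ph ` {x\<in>U. f x : V}) (pp \<circ> f \<circ> inv_into U ph)"
  using assms(3) unfolding smooth_map_def by (elim conjE)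
 from bspec[OF bspec[OF this assms(4), unfolded cd split_conv] assms(5), unfolded cd split_conv]
 have "smooth_coords (mdim M) (mdim N) (ph ` {x\<in>U. f x : V}) (pp \<circ> f \<circ> inv_into U ph)" .
 moreover have "openin (mtop M) {x\<in>U. f x : V}"
  using assms manifold_chart_fst_open[OF assms(1,4)] manifold_chart_fst_open[OF assms(2,5)]
  by (auto simp: cd smooth_map_def intro: openin_continuous_map_preimage_gen)
 ultimately show ?thesis by (auto simp: smooth_rep_def cd smooth_coords_iff)
qed

lemma sm_continuous: "smooth M N f ==> continuous_map (mtop M) (mtop N) f"
 by (simp add: smooth_map_def)

lemma sm_point: "smooth M N f ==> x : points M ==> f x : points N"
 using continuous_map_image_subset_topspace[OF sm_continuous] by blast

lemma continuous_map_top_of_set: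
 assumes "continuous_map X (Euclidean_space n) f" "\<And>x. x : topspace X ==> f x : S"
 shows "continuous_map X (top_of_set S) f"
proof (rule continuous_map_into_subtopology)
 show "continuous_map X euclidean f"
  using assms(1) unfolding Euclidean_space_top_of_set by (rule continuous_map_into_fulltopology)
qed (use assms(2) in blast)

lemma continuous_map_into_Euclidean_space:
 assumes f: "continuous_map X euclidean f" and S: "S <= Espace n" "\<And>x. x : topspace X ==> f x : S"
 shows "continuous_map X (subtopology (Euclidean_space n) S) f"
proof -
 have "continuous_map X (top_of_set S) f"
  by (rule continuous_map_into_subtopology[OF f]) (use S(2) in blast)
 moreover have "subtopology (Euclidean_space n) S = top_of_set S"
  unfolding Euclidean_space_top_of_set subtopology_subtopology using S(1) by (simp only: inf_absorb2)
 ultimately show ?thesis by simp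
qed

text \<open>Continuity is no part of \<open>smooth_rep\<close>. It is recovered from that of the
  coordinate expression, by composing with the chart of \<open>M\<close> and the inverse chart of
  \<open>N\<close>, which cancel on \<open>T\<close>.\<close>

lemma smooth_rep_continuous:
 assumes M: "is_chart (mtop M) (mdim M) c" and N: "is_chart (mtop N) (mdim N) d"
  and f: "smooth_rep M N c d T f"
 shows "continuous_map (subtopology (mtop M) T) (mtop N) f"
proof -
 obtain U ph V pp where cd: "c = (U, ph)" "d = (V, pp)" by fastforce
 note M = M[unfolded cd] and N = N[unfolded cd]
 let ?F = "%z. pp (f (inv_into U ph z))"
 have T: "openin (mtop M) T" "T <= U" "f ` T <= V" using f by (auto simp: smooth_rep_def cd)
 have tT: "topspace (subtopology (mtop M) T) = T" using openin_subset[OF T(1)] by auto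
 have FV: "?F z : pp ` V" if z: "z : ph ` T" for z
 proof -
  obtain x where x: "x : T" "z = ph x" using z by blast
  then have "inv_into U ph z = x" using T(2) is_chart_inv[OF M, of x] by blast
  then show ?thesis using x T(3) by blast
 qed
 have "continuous_on (ph ` T) ?F"
 proof (rule continuous_on_Espace_map)
  show "continuous_on (ph ` T) (%z. ?F z j)" if "j < mdim N" for j
   using f that by (intro smooth_fun_continuous[where n = "mdim M"]) (simp add: smooth_rep_def cd)
  show "?F z : Espace (mdim N)" if "z : ph ` T" for z
   by (rule subsetD[OF Eopen_subset[OF is_chart_open_image[OF N]] FV[OF that]])
 qed
 then have F: "continuous_map (top_of_set (ph ` T)) euclidean ?F" by simp
 have E: "ph ` T <= Espace (mdim M)" by (rule Eopen_subset[OF is_chart_Eopen_image[OF M T(1,2)]])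
 have "continuous_map (subtopology (mtop M) T) (Euclidean_space (mdim M)) ph"
  by (rule continuous_map_from_subtopology_mono[OF is_chart_continuous[OF M] T(2)])
 then have "continuous_map (subtopology (mtop M) T) (top_of_set (ph ` T)) ph"
  by (rule continuous_map_top_of_set) (simp only: tT, rule imageI)
 from continuous_map_compose[OF this F]
 have "continuous_map (subtopology (mtop M) T) euclidean (?F \<circ> ph)" .
 then have "continuous_map (subtopology (mtop M) T) (subtopology (Euclidean_space (mdim N)) (pp ` V)) (?F \<circ> ph)"
 proof (rule continuous_map_into_Euclidean_space)
  show "pp ` V <= Espace (mdim N)" by (rule Eopen_subset[OF is_chart_open_image[OF N]])
  show "(?F \<circ> ph) x : pp ` V" if "x : topspace (subtopology (mtop M) T)" for x
   using FV[of "ph x"] that unfolding tT comp_def by blast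
 qed
 from continuous_map_compose[OF this is_chart_continuous_inv[OF N]]
 show ?thesis
 proof (rule continuous_map_eq)
  fix x assume "x : topspace (subtopology (mtop M) T)"
  then have x: "x : T" using tT by simp
  then have "x : U" "f x : V" using T by auto
  then show "(inv_into V pp \<circ> (?F \<circ> ph)) x = f x"
   using is_chart_inv[OF M] is_chart_inv[OF N] by simp
 qed
qed

lemma continuous_map_local:
 assumes "\<And>x. x : topspace X ==> \<exists>T. openin X T & x : T & continuous_map (subtopology X T) Y f"
 shows "continuous_map X Y f"
 unfolding continuous_map_def
proof (intro conjI allI impI)
 show "f : topspace X \<rightarrow> topspace Y"
 proof
  fix x assume x: "x : topspace X"
  then obtain T where "x : T" "continuous_map (subtopology X T) Y f" using assms by blast
  then show "f x : topspace Y" using x by (auto simp: continuous_map_def)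
 qed
 fix V assume V: "openin Y V"
 show "openin X {x\<in>topspace X. f x : V}"
 proof (rule openin_subopen[THEN iffD2], rule ballI)
  fix x assume x: "x : {x\<in>topspace X. f x : V}"
  then obtain T where T: "openin X T" "x : T" "continuous_map (subtopology X T) Y f" using assms by blast
  have "openin (subtopology X T) {x\<in>topspace (subtopology X T). f x : V}"
   by (rule openin_continuous_map_preimage[OF T(3) V])
  then have "openin X {x\<in>topspace (subtopology X T). f x : V}"
   using openin_open_subtopology[OF T(1)] by simp
  then show "\<exists>S. openin X S & x : S & S <= {x\<in>topspace X. f x : V}"
   using x T(2) by (intro exI[of _ "{x\<in>topspace (subtopology X T). f x : V}"]) auto
 qed
qed

text \<open>One pair of charts around each point suffices: a change of charts carries the
  representative to any other pair near that point, and smoothness and continuity are both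
  local.\<close>

lemma smooth_mapI:
 assumes M: "manifold M" and N: "manifold N"
  and loc: "\<And>x. x : points M ==> \<exists>c\<in>charts M. \<exists>d\<in>charts N. \<exists>T. x : T & smooth_rep M N c d T f"
 shows "smooth M N f"
proof -
 have cont: "continuous_map (mtop M) (mtop N) f"
 proof (rule continuous_map_local)
  fix x assume "x : points M"
  then obtain c d T where "c : charts M" "d : charts N" "x : T" "smooth_rep M N c d T f" using loc by blast
  then show "\<exists>T. openin (mtop M) T & x : T & continuous_map (subtopology (mtop M) T) (mtop N) f"
   using smooth_rep_continuous[OF manifold_chart'[OF M] manifold_chart'[OF N]]
   by (intro exI[of _ T]) (auto simp: smooth_rep_def)
 qed
 have "smooth_fun (mdim M) (ph ` {x\<in>U. f x : V}) (%z. pp (f (inv_into U ph z)) j)"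
  if c: "(U, ph) : charts M" and d: "(V, pp) : charts N" and j: "j < mdim N" for U ph V pp j
 proof -
  note cM = manifold_chart[OF M c]
  have oS: "openin (mtop M) {x\<in>U. f x : V}"
   by (rule openin_continuous_map_preimage_gen[OF cont is_chart_open[OF cM] is_chart_open[OF manifold_chart[OF N d]]])
  have SU: "{x\<in>U. f x : V} <= U" by auto
  show ?thesis
   unfolding smooth_fun_def
  proof (intro allI Ck_on_local[OF is_chart_Eopen_image[OF cM oS SU]])
   fix k z assume "z : ph ` {x\<in>U. f x : V}"
   then obtain x where x: "z = ph x" "x : U" "f x : V" by auto
   then have "x : points M" using openin_subset[OF is_chart_open[OF cM]] by blast
   then obtain c' d' T where cd': "c' : charts M" "d' : charts N" "x : T" "smooth_rep M N c' d' T f"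
    using loc by blast
   define T' where "T' = T \<inter> {x\<in>U. f x : V}"
   have oT': "openin (mtop M) T'"
    using cd'(4) oS by (auto simp: T'_def smooth_rep_def)
   have "smooth_rep M N (U, ph) (V, pp) T' f"
    by (rule smooth_rep_charts[OF M N cd'(1) c cd'(2) d smooth_rep_subset[OF cd'(4) oT']]) (auto simp: T'_def)
   then have "Ck_on k (mdim M) (ph ` T') (%z. pp (f (inv_into U ph z)) j)"
    using j by (intro smooth_funD) (simp add: smooth_rep_def)
   moreover have "Eopen (mdim M) (ph ` T')"
    by (rule is_chart_Eopen_image[OF cM oT']) (auto simp: T'_def)
   ultimately show "\<exists>S. Eopen (mdim M) S & z : S & S <= ph ` {x\<in>U. f x : V} \<and>
     Ck_on k (mdim M) S (%z. pp (f (inv_into U ph z)) j)"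
    using x cd'(3) by (intro exI[of _ "ph ` T'"]) (auto simp: T'_def)
  qed
 qed
 then show ?thesis
  unfolding smooth_map_def using cont by (auto simp: smooth_coords_iff)
qed

lemma sm_rep_at:
 assumes M: "manifold M" and N: "manifold N" and f: "smooth M N f"
  and x: "x : points M" and c: "c : charts M" "x : fst c" and d: "d : charts N" "f x : fst d"
  and T: "openin (mtop M) T" "x : T"
 obtains S where "x : S" "S <= T" "smooth_rep M N c d S f"
proof (rule that)
 have r: "smooth_rep M N c d {x\<in>fst c. f x : fst d} f" by (rule smooth_mapD[OF M N f c(1) d(1)])
 then have "openin (mtop M) {x\<in>fst c. f x : fst d}" by (simp add: smooth_rep_def)
 then show "smooth_rep M N c d (T \<inter> {x\<in>fst c. f x : fst d}) f"
  using T by (intro smooth_rep_subset[OF r] openin_Int) auto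
qed (use c d T in auto)

lemma sm_compose:
 assumes M: "manifold M" and N: "manifold N" and K: "manifold K"
  and f: "smooth M N f" and g: "smooth N K g"
 shows "smooth M K (g \<circ> f)"
proof (rule smooth_mapI[OF M K])
 fix x assume x: "x : points M"
 have fx: "f x : points N" by (rule sm_point[OF f x])
 have gx: "g (f x) : points K" by (rule sm_point[OF g fx])
 obtain c where c: "c : charts M" "x : fst c" by (rule manifold_chart_at'[OF M x])
 obtain d where d: "d : charts N" "f x : fst d" by (rule manifold_chart_at'[OF N fx])
 obtain e where e: "e : charts K" "g (f x) : fst e" by (rule manifold_chart_at'[OF K gx])
 obtain S where S: "f x : S" "S <= points N" "smooth_rep N K d e S g"
  by (rule sm_rep_at[OF N K g fx d e openin_topspace fx])
 have "openin (mtop N) S" using S(3) by (simp add: smooth_rep_def)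
 from openin_continuous_map_preimage[OF sm_continuous[OF f] this]
 have oS: "openin (mtop M) {x\<in>points M. f x : S}" .
 have xS: "x : {x\<in>points M. f x : S}" using x S(1) by simp
 obtain T where T: "x : T" "T <= {x\<in>points M. f x : S}" "smooth_rep M N c d T f"
  by (rule sm_rep_at[OF M N f x c d oS xS])
 have "smooth_rep M K c e T (g \<circ> f)"
  by (rule smooth_rep_compose[OF manifold_chart'[OF M c(1)] manifold_chart'[OF N d(1)] T(3) S(3)]) (use T(2) in blast)
 then show "\<exists>c\<in>charts M. \<exists>d\<in>charts K. \<exists>T. x : T & smooth_rep M K c d T (g \<circ> f)"
  using c(1) e(1) T(1) by blast
qed

lemma sm_compose':
 assumes "manifold M" "manifold N" "manifold K" "smooth M N f" "smooth N K g"
 shows "smooth M K (%x. g (f x))"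
 using sm_compose[OF assms] by (simp add: comp_def)

lemma smooth_rep_cong:
 assumes c: "is_chart (mtop M) (mdim M) c" and f: "smooth_rep M N c d T f" and eq: "\<And>x. x : T ==> f x = g x"
 shows "smooth_rep M N c d T g"
proof -
 obtain U ph where cd: "c = (U, ph)" by fastforce
 have T: "openin (mtop M) T" "T <= U" "f ` T <= fst d" using f by (auto simp: smooth_rep_def cd)
 have "smooth_fun (mdim M) (ph ` T) (%z. snd d (g (inv_into U ph z)) j)" if "j < mdim N" for j
 proof (rule smooth_fun_cong[OF is_chart_Eopen_image[OF c[unfolded cd] T(1,2)]])
  show "smooth_fun (mdim M) (ph ` T) (%z. snd d (f (inv_into U ph z)) j)"
   using f that by (simp add: smooth_rep_def cd)
  show "snd d (f (inv_into U ph z)) j = snd d (g (inv_into U ph z)) j" if "z : ph ` T" for z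
   using that T(2) eq is_chart_inv[OF c[unfolded cd]] by auto
 qed
 then show ?thesis using T eq by (auto simp: smooth_rep_def cd)
qed

lemma sm_cong:
 assumes M: "manifold M" and N: "manifold N" and f: "smooth M N f" and eq: "\<And>x. x : points M ==> f x = g x"
 shows "smooth M N g"
proof (rule smooth_mapI[OF M N])
 fix x assume x: "x : points M"
 obtain c where c: "c : charts M" "x : fst c" by (rule manifold_chart_at'[OF M x])
 obtain d where d: "d : charts N" "f x : fst d" by (rule manifold_chart_at'[OF N sm_point[OF f x]])
 obtain S where S: "x : S" "S <= points M" "smooth_rep M N c d S f"
  by (rule sm_rep_at[OF M N f x c d openin_topspace x])
 have "smooth_rep M N c d S g"
  using eq S(2) by (intro smooth_rep_cong[OF manifold_chart'[OF M c(1)] S(3)]) blast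
 then show "\<exists>c\<in>charts M. \<exists>d\<in>charts N. \<exists>T. x : T & smooth_rep M N c d T g"
  using c(1) d(1) S(1) by blast
qed

lemma sm_ident:
 assumes M: "manifold M" shows "smooth M M (%x. x)"
proof (rule smooth_mapI[OF M M])
 fix x assume "x : points M"
 then obtain c where c: "c : charts M" "x : fst c" using manifold_chart_at'[OF M] by blast
 then show "\<exists>c\<in>charts M. \<exists>d\<in>charts M. \<exists>T. x : T & smooth_rep M M c d T (%x. x)"
  using smooth_rep_transition[OF M c(1) c(1)] by auto
qed

lemma sm_const:
 assumes M: "manifold M" and N: "manifold N" and y: "y : points N" shows "smooth M N (%x. y)"
proof (rule smooth_mapI[OF M N])
 fix x assume x: "x : points M"
 obtain c where c: "c : charts M" "x : fst c" by (rule manifold_chart_at'[OF M x])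
 obtain d where d: "d : charts N" "y : fst d" by (rule manifold_chart_at'[OF N y])
 have "smooth_rep M N c d (fst c) (%x. y)"
  using d manifold_chart_fst_open[OF M c(1)] by (auto simp: smooth_rep_def smooth_fun_const)
 then show "\<exists>c\<in>charts M. \<exists>d\<in>charts N. \<exists>T. x : T & smooth_rep M N c d T (%x. y)"
  using c d by blast
qed

subsection \<open>Open submanifolds\<close>

definition sub_mfd :: "'a mfd => 'a set => 'a mfd" where
 "sub_mfd M T = \<lparr>mtop = subtopology (mtop M) T, mdim = mdim M, charts = (%(U, ph). (U \<inter> T, ph)) ` charts M\<rparr>"

lemma sub_mfd_simps [simp]: "mtop (sub_mfd M T) = subtopology (mtop M) T" "mdim (sub_mfd M T) = mdim M"
 by (simp_all add: sub_mfd_def)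

lemma points_sub_mfd: "openin (mtop M) T ==> points (sub_mfd M T) = T"
 using openin_subset[of "mtop M" T] by auto

lemma sub_chart: "c : charts M ==> (fst c \<inter> T, snd c) : charts (sub_mfd M T)"
 by (force simp: sub_mfd_def)

lemma inv_into_subset:
 assumes "inj_on f U" "V <= U" "z : f ` V" shows "inv_into V f z = inv_into U f z"
proof -
 obtain x where x: "x : V" "z = f x" using assms(3) by blast
 have "inj_on f V" using assms(1,2) by (rule inj_on_subset)
 then show ?thesis
  using x assms(1,2) by (simp add: inv_into_f_f subset_eq)
qed

lemma is_chart_restrict:
 assumes c: "is_chart X n (U, ph)" and T: "openin X T"
 shows "is_chart (subtopology X T) n (U \<inter> T, ph)"
proof (rule is_chartI(1))
 note U = is_chart_open[OF c]
 show "openin (subtopology X T) (U \<inter> T)" using U T by (simp add: openin_subtopology_Int)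
 show E: "Eopen n (ph ` (U \<inter> T))" using U T by (intro is_chart_Eopen_image[OF c]) auto
 show "continuous_map (subtopology (subtopology X T) (U \<inter> T)) (Euclidean_space n) ph"
  unfolding subtopology_subtopology by (rule continuous_map_from_subtopology_mono[OF is_chart_continuous[OF c]]) auto
 have ts: "topspace (subtopology (Euclidean_space n) (ph ` (U \<inter> T))) = ph ` (U \<inter> T)"
  using openin_subset[OF E] by auto
 show "continuous_map (subtopology (Euclidean_space n) (ph ` (U \<inter> T))) (subtopology X T) (inv_into U ph)"
 proof (rule continuous_map_into_subtopology)
  show "continuous_map (subtopology (Euclidean_space n) (ph ` (U \<inter> T))) X (inv_into U ph)"
   by (rule continuous_map_from_subtopology_mono[OF is_chart_continuous_inv[OF c]]) auto
  show "inv_into U ph : topspace (subtopology (Euclidean_space n) (ph ` (U \<inter> T))) \<rightarrow> T"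
   unfolding ts using is_chart_inv[OF c] by auto
 qed
qed (use is_chart_inv[OF c] in auto)

text \<open>Restricting a chart changes its inverse formally, from \<open>inv_into U\<close> to
  \<open>inv_into (U \<inter> T)\<close>, but the two agree on the coordinates of points of
  \<open>S\<close>.\<close>

lemma smooth_rep_sub:
 assumes c: "is_chart (mtop M) (mdim M) c" and T: "openin (mtop M) T" and S: "S <= T"
 shows "smooth_rep (sub_mfd M T) N (fst c \<inter> T, snd c) d S f \<longleftrightarrow> smooth_rep M N c d S f"
proof -
 obtain U ph where cd: "c = (U, ph)" by fastforce
 note c = c[unfolded cd]
 have o: "openin (subtopology (mtop M) T) S \<longleftrightarrow> openin (mtop M) S"
  using S openin_open_subtopology[OF T] by auto
 have *: "smooth_fun (mdim M) (ph ` S) (%z. snd d (f (inv_into (U \<inter> T) ph z)) j) \<longleftrightarrow>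
   smooth_fun (mdim M) (ph ` S) (%z. snd d (f (inv_into U ph z)) j)"
  if "openin (mtop M) S" "S <= U" for j
 proof -
  have eq: "inv_into (U \<inter> T) ph z = inv_into U ph z" if "z : ph ` S" for z
   using that S \<open>S <= U\<close> by (intro inv_into_subset[OF is_chart_inj[OF c]]) auto
  show ?thesis
   by (rule iffI; rule smooth_fun_cong[OF is_chart_Eopen_image[OF c that], rotated], assumption) (simp_all only: eq)
 qed
 show ?thesis
  unfolding smooth_rep_def cd fst_conv snd_conv sub_mfd_simps o using S * by blast
qed

lemma smooth_rep_into_sub:
 "smooth_rep K (sub_mfd M T) e (fst c \<inter> T, snd c) S f \<longleftrightarrow> smooth_rep K M e c S f & f ` S <= T"
 by (auto simp: smooth_rep_def)

lemma manifold_sub: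
 assumes M: "manifold M" and T: "openin (mtop M) T" shows "manifold (sub_mfd M T)"
proof (rule manifoldI)
 show "Hausdorff_space (mtop (sub_mfd M T))" "second_countable (mtop (sub_mfd M T))"
  using M by (simp_all add: manifold_def Hausdorff_space_subtopology second_countable_subtopology)
 have ex: "\<exists>c'\<in>charts M. c = (fst c' \<inter> T, snd c')" if "c : charts (sub_mfd M T)" for c
  using that by (auto simp: sub_mfd_def intro: bexI[rotated])
 show "is_chart (mtop (sub_mfd M T)) (mdim (sub_mfd M T)) c" if c: "c : charts (sub_mfd M T)" for c
 proof -
  obtain U ph where "(U, ph) : charts M" "c = (U \<inter> T, ph)" using c by (auto simp: sub_mfd_def)
  then show ?thesis using is_chart_restrict[OF manifold_chart[OF M] T] by simp
 qed
 show "\<exists>c\<in>charts (sub_mfd M T). x : fst c" if x: "x : points (sub_mfd M T)" for x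
 proof -
  have x': "x : points M" "x : T" using x by simp_all
  obtain c where "c : charts M" "x : fst c" by (rule manifold_chart_at'[OF M x'(1)])
  then show ?thesis using x'(2) by (intro bexI[OF _ sub_chart]) simp_all
 qed
 show "smooth_rep (sub_mfd M T) (sub_mfd M T) c d (fst c \<inter> fst d) (%x. x)"
  if cd: "c : charts (sub_mfd M T)" "d : charts (sub_mfd M T)" for c d
 proof -
  obtain c' d' where c: "c = (fst c' \<inter> T, snd c')" "c' : charts M" and d: "d = (fst d' \<inter> T, snd d')" "d' : charts M"
   using ex[OF cd(1)] ex[OF cd(2)] by blast
  let ?S = "fst c \<inter> fst d"
  have S: "?S = fst c' \<inter> fst d' \<inter> T" by (subst c(1), subst d(1)) auto
  have oS: "openin (mtop M) ?S"
   unfolding S by (intro openin_Int T manifold_chart_fst_open[OF M] c d)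
  have "smooth_rep M M c' d' ?S (%x. x)"
   by (rule smooth_rep_subset[OF smooth_rep_transition[OF M c(2) d(2)] oS]) (use S in blast)
  then have "smooth_rep (sub_mfd M T) M (fst c' \<inter> T, snd c') d' ?S (%x. x)"
   by (subst smooth_rep_sub[OF manifold_chart'[OF M c(2)] T]) (use S in blast)+
  then have "smooth_rep (sub_mfd M T) (sub_mfd M T) (fst c' \<inter> T, snd c') (fst d' \<inter> T, snd d') ?S (%x. x)"
   unfolding smooth_rep_into_sub using S by blast
  then show ?thesis using c(1) d(1) by simp
 qed
qed

lemma sm_restrict:
 assumes M: "manifold M" and N: "manifold N" and T: "openin (mtop M) T" and f: "smooth M N f"
 shows "smooth (sub_mfd M T) N f"
proof (rule smooth_mapI[OF manifold_sub[OF M T] N])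
 fix x assume "x : points (sub_mfd M T)"
 then have x: "x : points M" "x : T" by auto
 obtain c where c: "c : charts M" "x : fst c" by (rule manifold_chart_at'[OF M x(1)])
 obtain d where d: "d : charts N" "f x : fst d" by (rule manifold_chart_at'[OF N sm_point[OF f x(1)]])
 obtain S where S: "x : S" "S <= T" "smooth_rep M N c d S f"
  by (rule sm_rep_at[OF M N f x(1) c d T x(2)])
 then have "smooth_rep (sub_mfd M T) N (fst c \<inter> T, snd c) d S f"
  using smooth_rep_sub[OF manifold_chart'[OF M c(1)] T S(2)] by blast
 then show "\<exists>c\<in>charts (sub_mfd M T). \<exists>d\<in>charts N. \<exists>S. x : S & smooth_rep (sub_mfd M T) N c d S f"
  using sub_chart[OF c(1)] d(1) S(1) by blast
qed

lemma sm_into_sub: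
 assumes K: "manifold K" and M: "manifold M" and T: "openin (mtop M) T"
  and f: "smooth K M f" "\<And>x. x : points K ==> f x : T"
 shows "smooth K (sub_mfd M T) f"
proof (rule smooth_mapI[OF K manifold_sub[OF M T]])
 fix x assume x: "x : points K"
 obtain c where c: "c : charts K" "x : fst c" by (rule manifold_chart_at'[OF K x])
 obtain d where d: "d : charts M" "f x : fst d" by (rule manifold_chart_at'[OF M sm_point[OF f(1) x]])
 obtain S where S: "x : S" "S <= points K" "smooth_rep K M c d S f"
  by (rule sm_rep_at[OF K M f(1) x c d openin_topspace x])
 then have "smooth_rep K (sub_mfd M T) c (fst d \<inter> T, snd d) S f"
  using f(2) unfolding smooth_rep_into_sub by blast
 then show "\<exists>c\<in>charts K. \<exists>d\<in>charts (sub_mfd M T). \<exists>S. x : S & smooth_rep K (sub_mfd M T) c d S f"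
  using c(1) sub_chart[OF d(1)] S(1) by blast
qed

lemma sm_sub_mono:
 assumes M: "manifold M" and N: "manifold N" and T: "openin (mtop M) T" and S: "openin (mtop M) S" "S <= T"
  and f: "smooth (sub_mfd M T) N f"
 shows "smooth (sub_mfd M S) N f"
proof -
 have "smooth (sub_mfd M S) (sub_mfd M T) (%x. x)"
  using S sm_restrict[OF M M S(1) sm_ident[OF M]]
  by (intro sm_into_sub[OF manifold_sub[OF M S(1)] M T]) auto
 from sm_compose'[OF manifold_sub[OF M S(1)] manifold_sub[OF M T] N this f] show ?thesis .
qed

lemma smooth_repI:
 assumes "openin (mtop M) T" "T <= fst c" "\<And>x. x : T ==> f x : fst d"
  and "\<And>j. j < mdim N ==> smooth_fun (mdim M) (snd c ` T) (%z. snd d (f (inv_into (fst c) (snd c) z)) j)"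
 shows "smooth_rep M N c d T f"
 unfolding smooth_rep_def using assms by (intro conjI allI impI) blast+

subsection \<open>Open subsets of coordinate spaces\<close>

definition euc :: "nat => (nat => real) set => (nat => real) mfd" where
 "euc n S = \<lparr>mtop = subtopology (Euclidean_space n) S, mdim = n, charts = {(S, %x. x)}\<rparr>"

lemma euc_simps [simp]: "mtop (euc n S) = subtopology (Euclidean_space n) S" "mdim (euc n S) = n"
 "charts (euc n S) = {(S, %x. x)}"
 by (simp_all add: euc_def)

lemma points_euc: "Eopen n S ==> points (euc n S) = S"
 using openin_subset[of "Euclidean_space n" S] by auto

lemma inv_into_ident: "z : S ==> inv_into S (%x. x) z = z"
 by (rule inv_into_f_f[where f = "%x. x"]) simp_all

lemma openin_euc: "Eopen n S ==> openin (mtop (euc n S)) T \<longleftrightarrow> Eopen n T & T <= S"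
 by (simp add: openin_open_subtopology)

lemma second_countable_Euclidean_space: "second_countable (Euclidean_space n)"
proof -
 obtain B :: "(nat => real) set set" where B: "countable B" "topological_basis B"
  using ex_countable_basis by blast
 have "second_countable (euclidean :: (nat => real) topology)"
  unfolding second_countable_def
 proof (intro exI[of _ B] conjI ballI allI impI)
  show "openin euclidean V" if "V : B" for V
   using topological_basis_open[OF B(2) that] by simp
  show "\<exists>V\<in>B. x : V & V <= U" if "openin euclidean U & x : U" for U x
   using topological_basisE[OF B(2), of U x] that by (metis open_openin)
 qed (rule B(1))
 then show ?thesis
  unfolding Euclidean_space_top_of_set by (rule second_countable_subtopology)
qed

lemma smooth_rep_euc:
 assumes S: "Eopen n S" and T: "Eopen n T" "T <= S" and F: "\<And>j. j < mdim N ==> smooth_fun n T (%z. snd d (F z) j)"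
  and d: "\<And>z. z : T ==> F z : fst d"
 shows "smooth_rep (euc n S) N (S, %x. x) d T F"
proof (rule smooth_repI)
 show "openin (mtop (euc n S)) T" using T openin_euc[OF S] by simp
 show "smooth_fun (mdim (euc n S)) (snd (S, %x. x) ` T) (%z. snd d (F (inv_into (fst (S, %x. x)) (snd (S, %x. x)) z)) j)"
  if "j < mdim N" for j
  unfolding euc_simps fst_conv snd_conv image_ident
 proof (rule smooth_fun_cong[OF T(1) _ F[OF that]])
  show "snd d (F z) j = snd d (F (inv_into S (%x. x) z)) j" if "z : T" for z
   using inv_into_ident[of z S] T(2) that by (metis subsetD)
 qed
qed (use T(2) d in simp_all)

lemma manifold_euc:
 assumes S: "Eopen n S" shows "manifold (euc n S)"
proof (rule manifoldI)
 have "Hausdorff_space (Euclidean_space n)" by (rule Hausdorff_Euclidean_space)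
 then show "Hausdorff_space (mtop (euc n S))"
  unfolding euc_simps by (rule Hausdorff_space_subtopology)
 show "second_countable (mtop (euc n S))"
  unfolding euc_simps by (rule second_countable_subtopology[OF second_countable_Euclidean_space])
 have ts: "topspace (subtopology (Euclidean_space n) S) = S"
  using openin_subset[OF S] by auto
 have S': "openin (subtopology (Euclidean_space n) S) S"
  using openin_topspace[of "subtopology (Euclidean_space n) S"] unfolding ts .
 have id1: "continuous_map (subtopology (Euclidean_space n) S) (subtopology (Euclidean_space n) S) (%x. x)"
  using continuous_map_id by (simp add: id_def)
 have "is_chart (mtop (euc n S)) n (S, %x. x)"
  unfolding euc_simps
 proof (rule is_chartI(1)[OF S' S, where g = "%x. x"])
  show "continuous_map (subtopology (subtopology (Euclidean_space n) S) S) (Euclidean_space n) (%x. x)"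
   by (rule continuous_map_from_subtopology[OF continuous_map_into_fulltopology[OF id1]])
 qed (use id1 in simp_all)
 then show "is_chart (mtop (euc n S)) (mdim (euc n S)) c" if "c : charts (euc n S)" for c
  using that by simp
 show "\<exists>c\<in>charts (euc n S). x : fst c" if "x : points (euc n S)" for x
  using that unfolding points_euc[OF S] by simp
 show "smooth_rep (euc n S) (euc n S) c d (fst c \<inter> fst d) (%x. x)"
  if "c : charts (euc n S)" "d : charts (euc n S)" for c d
  using that S smooth_rep_euc[OF S S order_refl, of "euc n S" "(S, %x. x)" "%x. x"] by (simp add: smooth_fun_coord)
qed

lemma sm_euc:
 assumes S: "Eopen n S" and T: "Eopen m T" and F: "\<And>j. j < m ==> smooth_fun n S (%z. F z j)"
  and ST: "\<And>z. z : S ==> F z : T"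
 shows "smooth (euc n S) (euc m T) F"
proof (rule smooth_mapI[OF manifold_euc[OF S] manifold_euc[OF T]])
 fix x assume "x : points (euc n S)"
 then have "x : S" unfolding points_euc[OF S] .
 moreover have "smooth_rep (euc n S) (euc m T) (S, %x. x) (T, %x. x) S F"
  using F ST by (intro smooth_rep_euc[OF S S order_refl]) simp_all
 ultimately show "\<exists>c\<in>charts (euc n S). \<exists>d\<in>charts (euc m T). \<exists>U. x : U & smooth_rep (euc n S) (euc m T) c d U F"
  by auto
qed

text \<open>Charts become smooth maps between manifolds, so that local constructions in coordinates
  can be composed with global maps by \<open>sm_compose'\<close>.\<close>

lemma sm_chart:
 assumes M: "manifold M" and c: "(U, ph) : charts M"
 shows "smooth (sub_mfd M U) (euc (mdim M) (ph ` U)) ph"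
  and "smooth (euc (mdim M) (ph ` U)) M (inv_into U ph)"
proof -
 note ch = manifold_chart[OF M c]
 note U = is_chart_open[OF ch] and E = is_chart_open_image[OF ch]
 have "smooth_rep M (euc (mdim M) (ph ` U)) (U, ph) (ph ` U, %x. x) U ph"
 proof (rule smooth_repI)
  show "smooth_fun (mdim M) (snd (U, ph) ` U) (%z. snd (ph ` U, %x. x) (ph (inv_into (fst (U, ph)) (snd (U, ph)) z)) j)" for j
   unfolding fst_conv snd_conv
   by (rule smooth_fun_cong[OF E _ smooth_fun_coord[of _ _ j]]) (simp only: f_inv_into_f)
 qed (use U in simp_all)
 then have r: "smooth_rep (sub_mfd M U) (euc (mdim M) (ph ` U)) (fst (U, ph) \<inter> U, snd (U, ph)) (ph ` U, %x. x) U ph"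
  by (subst smooth_rep_sub[OF ch U order_refl])
 show "smooth (sub_mfd M U) (euc (mdim M) (ph ` U)) ph"
 proof (rule smooth_mapI[OF manifold_sub[OF M U] manifold_euc[OF E]])
  fix x assume "x : points (sub_mfd M U)"
  then have "x : U" by simp
  then show "\<exists>c\<in>charts (sub_mfd M U). \<exists>d\<in>charts (euc (mdim M) (ph ` U)). \<exists>T. x : T \<and>
    smooth_rep (sub_mfd M U) (euc (mdim M) (ph ` U)) c d T ph"
   using r by (intro bexI[OF _ sub_chart[OF c]] bexI[of _ "(ph ` U, %x. x)"] exI[of _ U]) simp_all
 qed
 show "smooth (euc (mdim M) (ph ` U)) M (inv_into U ph)"
 proof (rule smooth_mapI[OF manifold_euc[OF E] M])
  fix z assume "z : points (euc (mdim M) (ph ` U))"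
  then have "z : ph ` U" by simp
  moreover have "smooth_rep (euc (mdim M) (ph ` U)) M (ph ` U, %x. x) (U, ph) (ph ` U) (inv_into U ph)"
  proof (rule smooth_rep_euc[OF E E order_refl])
   show "smooth_fun (mdim M) (ph ` U) (%z. snd (U, ph) (inv_into U ph z) j)" for j
    unfolding snd_conv
    by (rule smooth_fun_cong[OF E _ smooth_fun_coord[of _ _ j]]) (simp only: f_inv_into_f)
   show "inv_into U ph z : fst (U, ph)" if "z : ph ` U" for z
    using inv_into_into[OF that] by simp
  qed
  ultimately show "\<exists>c'\<in>charts (euc (mdim M) (ph ` U)). \<exists>d\<in>charts M. \<exists>T. z : T \<and>
    smooth_rep (euc (mdim M) (ph ` U)) M c' d T (inv_into U ph)"
   using c by (intro bexI[of _ "(ph ` U, %x. x)"] bexI[of _ "(U, ph)"] exI[of _ "ph ` U"]) simp_all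
 qed
qed

subsection \<open>Products\<close>

text \<open>The linear isomorphism from the product of the coordinate spaces of dimensions
  \<open>m\<close> and \<open>n\<close> to that of dimension \<open>m + n\<close>, as used in the
  charts of \<open>prod_mfd\<close>; \<open>take_coords\<close> and \<open>drop_coords\<close> are
  its two inverse projections.\<close>

definition cat :: "nat => (nat => real) => (nat => real) => nat => real" where
 "cat m x y = (%i. if i < m then x i else y (i - m))"

definition take_coords :: "nat => (nat => real) => nat => real" where
 "take_coords m z = (%i. if i < m then z i else 0)"

definition drop_coords :: "nat => (nat => real) => nat => real" where
 "drop_coords m z = (%i. z (i + m))"

lemma cat_simps: "x : Espace m ==> take_coords m (cat m x y) = x" "drop_coords m (cat m x y) = y"
 "cat m (take_coords m z) (drop_coords m z) = z"
 by (auto simp: cat_def take_coords_def drop_coords_def fun_eq_iff)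

lemma cat_Espace: "y : Espace n ==> cat m x y : Espace (m + n)"
 by (auto simp: cat_def)

lemma drop_Espace: "z : Espace (m + n) ==> drop_coords m z : Espace n"
 by (auto simp: drop_coords_def)

lemma take_Espace: "take_coords m z : Espace m"
 by (auto simp: take_coords_def)

definition prod_chart :: "nat => 'a chart => 'b chart => ('a \<times> 'b) chart" where
 "prod_chart m c d = (fst c \<times> fst d, %p. cat m (snd c (fst p)) (snd d (snd p)))"

lemma prod_mfd_simps [simp]: "mtop (prod_mfd M N) = prod_topology (mtop M) (mtop N)"
 "mdim (prod_mfd M N) = mdim M + mdim N"
 by (simp_all add: prod_mfd_def)

lemma charts_prod_mfd: "charts (prod_mfd M N) = {prod_chart (mdim M) c d | c d. c : charts M & d : charts N}"
proof -
 have *: "(U \<times> V, %(x, y) i. if i < m then ph x i else pp y (i - m)) = prod_chart m (U, ph) (V, pp)"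
  for U :: "'a set" and ph and V :: "'b set" and pp m
  by (auto simp: prod_chart_def cat_def fun_eq_iff)
 show ?thesis unfolding prod_mfd_def mfd.simps * by auto
qed

lemma prod_chart_in: "c : charts M ==> d : charts N ==> prod_chart (mdim M) c d : charts (prod_mfd M N)"
 unfolding charts_prod_mfd by blast

lemma continuous_map_Espace_iff:
 "continuous_map X (Euclidean_space n) f \<longleftrightarrow>
   (\<forall>i. continuous_map X euclideanreal (%x. f x i)) & (\<forall>x\<in>topspace X. f x : Espace n)"
 unfolding Euclidean_space_def continuous_map_in_subtopology continuous_map_componentwise_UNIV
 by (simp add: Pi_iff)

lemma continuous_map_coordinate: "continuous_map (Euclidean_space n) euclideanreal (%x. x i)"
proof -
 have "continuous_map (Euclidean_space n) (Euclidean_space n) (%x. x)" using continuous_map_id by (simp add: id_def)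
 then show ?thesis unfolding continuous_map_Espace_iff by blast
qed

lemma continuous_map_take: "continuous_map (Euclidean_space n) (Euclidean_space m) (take_coords m)"
 unfolding continuous_map_Espace_iff
proof (intro conjI allI ballI take_Espace)
 show "continuous_map (Euclidean_space n) euclideanreal (%x. take_coords m x i)" for i
  using continuous_map_coordinate[of n i] by (cases "i < m") (simp_all add: take_coords_def)
qed

lemma continuous_map_drop: "continuous_map (Euclidean_space (m + n)) (Euclidean_space n) (drop_coords m)"
 unfolding continuous_map_Espace_iff
proof (intro conjI allI ballI)
 show "continuous_map (Euclidean_space (m + n)) euclideanreal (%x. drop_coords m x i)" for i
  using continuous_map_coordinate[of "m + n" "i + m"] by (simp add: drop_coords_def)
 show "drop_coords m x : Espace n" if "x : topspace (Euclidean_space (m + n))" for x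
  using that unfolding topspace_Euclidean_space by (rule drop_Espace)
qed

lemma is_chart_prod:
 assumes c: "is_chart X m (U, ph)" and d: "is_chart Y n (V, pp)"
 shows "is_chart (prod_topology X Y) (m + n) (prod_chart m (U, ph) (V, pp))"
proof -
 define O' where "O' = {z\<in>topspace (Euclidean_space (m + n)). take_coords m z : ph ` U} \<inter>
  {z\<in>topspace (Euclidean_space (m + n)). drop_coords m z : pp ` V}"
 let ?g = "%z. (inv_into U ph (take_coords m z), inv_into V pp (drop_coords m z))"
 let ?E = "subtopology (Euclidean_space (m + n)) O'"
 have O': "Eopen (m + n) O'"
  unfolding O'_def
  by (intro openin_Int openin_continuous_map_preimage[OF continuous_map_take is_chart_open_image[OF c]]
    openin_continuous_map_preimage[OF continuous_map_drop is_chart_open_image[OF d]])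
 have tO: "topspace ?E = O'" using openin_subset[OF O'] by auto
 have phE: "ph x : Espace m" if "x : U" for x
  by (rule subsetD[OF Eopen_subset[OF is_chart_open_image[OF c]] imageI[OF that]])
 have ppE: "pp y : Espace n" if "y : V" for y
  by (rule subsetD[OF Eopen_subset[OF is_chart_open_image[OF d]] imageI[OF that]])
 show ?thesis
  unfolding prod_chart_def fst_conv snd_conv
 proof (rule is_chartI(1)[OF _ O', where g = ?g])
  show "openin (prod_topology X Y) (U \<times> V)"
   unfolding openin_prod_Times_iff using is_chart_open[OF c] is_chart_open[OF d] by simp
  show "continuous_map (subtopology (prod_topology X Y) (U \<times> V)) (Euclidean_space (m + n))
    (%p. cat m (ph (fst p)) (pp (snd p)))"
   unfolding subtopology_Times continuous_map_Espace_iff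
  proof (intro conjI allI ballI)
   fix p assume "p : topspace (prod_topology (subtopology X U) (subtopology Y V))"
   then have "snd p : V" by auto
   then show "cat m (ph (fst p)) (pp (snd p)) : Espace (m + n)" by (rule cat_Espace[OF ppE])
  next
   fix i
   have 1: "continuous_map (prod_topology (subtopology X U) (subtopology Y V)) (Euclidean_space m) (ph \<circ> fst)"
    by (rule continuous_map_compose[OF continuous_map_fst is_chart_continuous[OF c]])
   have 2: "continuous_map (prod_topology (subtopology X U) (subtopology Y V)) (Euclidean_space n) (pp \<circ> snd)"
    by (rule continuous_map_compose[OF continuous_map_snd is_chart_continuous[OF d]])
   show "continuous_map (prod_topology (subtopology X U) (subtopology Y V)) euclideanreal
     (%p. cat m (ph (fst p)) (pp (snd p)) i)"
    using 1 2 unfolding continuous_map_Espace_iff cat_def by (cases "i < m") simp_all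
  qed
  show "continuous_map ?E (prod_topology X Y) ?g"
  proof (rule continuous_map_pairedI)
   have "continuous_map ?E (subtopology (Euclidean_space m) (ph ` U)) (take_coords m)"
    by (rule continuous_map_into_subtopology[OF continuous_map_from_subtopology[OF continuous_map_take]])
     (simp only: tO, auto simp: O'_def)
   from continuous_map_compose[OF this is_chart_continuous_inv[OF c]]
   show "continuous_map ?E X (%z. inv_into U ph (take_coords m z))" by (simp add: comp_def)
   have "continuous_map ?E (subtopology (Euclidean_space n) (pp ` V)) (drop_coords m)"
    by (rule continuous_map_into_subtopology[OF continuous_map_from_subtopology[OF continuous_map_drop]])
     (simp only: tO, auto simp: O'_def)
   from continuous_map_compose[OF this is_chart_continuous_inv[OF d]]
   show "continuous_map ?E Y (%z. inv_into V pp (drop_coords m z))" by (simp add: comp_def)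
  qed
  show "cat m (ph (fst p)) (pp (snd p)) : O' & ?g (cat m (ph (fst p)) (pp (snd p))) = p" if "p : U \<times> V" for p
  proof -
   have p: "fst p : U" "snd p : V" using that by auto
   have "cat m (ph (fst p)) (pp (snd p)) : O'"
    unfolding O'_def topspace_Euclidean_space using cat_Espace[OF ppE[OF p(2)], of m "ph (fst p)"] p
    by (simp add: cat_simps(1)[OF phE[OF p(1)]] cat_simps(2))
   then show ?thesis
    using is_chart_inv[OF c p(1)] is_chart_inv[OF d p(2)] by (simp add: cat_simps(1)[OF phE[OF p(1)]] cat_simps(2))
  qed
  show "?g z : U \<times> V & cat m (ph (fst (?g z))) (pp (snd (?g z))) = z" if "z : O'" for z
  proof -
   have z: "take_coords m z : ph ` U" "drop_coords m z : pp ` V" using that by (auto simp: O'_def)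
   then show ?thesis by (simp add: inv_into_into f_inv_into_f cat_simps(3))
  qed
 qed
qed

lemma smooth_rep_pair:
 assumes "smooth_rep K M e c S f" "smooth_rep K N e d S g"
 shows "smooth_rep K (prod_mfd M N) e (prod_chart (mdim M) c d) S (%x. (f x, g x))"
proof (rule smooth_repI)
 show "smooth_fun (mdim K) (snd e ` S) (%z. snd (prod_chart (mdim M) c d)
   (f (inv_into (fst e) (snd e) z), g (inv_into (fst e) (snd e) z)) j)" if "j < mdim (prod_mfd M N)" for j
  using assms that by (cases "j < mdim M") (simp_all add: smooth_rep_def prod_chart_def cat_def)
qed (use assms in \<open>auto simp: smooth_rep_def prod_chart_def\<close>)

lemma smooth_rep_fst_snd:
 assumes c: "is_chart (mtop M) (mdim M) c" and d: "is_chart (mtop N) (mdim N) d"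
 shows "smooth_rep (prod_mfd M N) M (prod_chart (mdim M) c d) c (fst c \<times> fst d) fst" (is ?fst)
  and "smooth_rep (prod_mfd M N) N (prod_chart (mdim M) c d) d (fst c \<times> fst d) snd" (is ?snd)
proof -
 obtain U ph V pp where cd: "c = (U, ph)" "d = (V, pp)" by fastforce
 note pc = is_chart_prod[OF c[unfolded cd] d[unfolded cd]]
 let ?Ph = "snd (prod_chart (mdim M) c d)"
 have E: "Eopen (mdim M + mdim N) (?Ph ` (U \<times> V))"
  using is_chart_open_image[of _ _ "U \<times> V" ?Ph] pc by (simp add: cd prod_chart_def)
 have o: "openin (mtop (prod_mfd M N)) (U \<times> V)"
  using is_chart_open[OF c[unfolded cd]] is_chart_open[OF d[unfolded cd]] by (simp add: openin_prod_Times_iff)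
 have inv: "inv_into (U \<times> V) ?Ph z : U \<times> V & ?Ph (inv_into (U \<times> V) ?Ph z) = z" if "z : ?Ph ` (U \<times> V)" for z
  using inv_into_into[OF that] f_inv_into_f[OF that] by blast
 have fp: "fst (prod_chart (mdim M) c d) = U \<times> V" by (simp add: cd prod_chart_def)
 show ?fst
 proof (rule smooth_repI)
  show "openin (mtop (prod_mfd M N)) (fst c \<times> fst d)" using o by (simp add: cd)
  fix j assume j: "j < mdim M"
  have "z j = snd c (fst (inv_into (U \<times> V) ?Ph z)) j" if "z : ?Ph ` (U \<times> V)" for z
   using arg_cong[OF conjunct2[OF inv[OF that]], of "%f. f j"] j by (simp add: prod_chart_def cat_def)
  then show "smooth_fun (mdim (prod_mfd M N)) (?Ph ` (fst c \<times> fst d))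
    (%z. snd c (fst (inv_into (fst (prod_chart (mdim M) c d)) ?Ph z)) j)"
   unfolding fp cd(1)[THEN arg_cong, of fst, unfolded fst_conv] cd(2)[THEN arg_cong, of fst, unfolded fst_conv] prod_mfd_simps
   by (rule smooth_fun_cong[OF E _ smooth_fun_coord])
 qed (auto simp: prod_chart_def)
 show ?snd
 proof (rule smooth_repI)
  show "openin (mtop (prod_mfd M N)) (fst c \<times> fst d)" using o by (simp add: cd)
  fix j assume j: "j < mdim N"
  have "z (j + mdim M) = snd d (snd (inv_into (U \<times> V) ?Ph z)) j" if "z : ?Ph ` (U \<times> V)" for z
   using arg_cong[OF conjunct2[OF inv[OF that]], of "%f. f (j + mdim M)"] j by (simp add: prod_chart_def cat_def)
  then show "smooth_fun (mdim (prod_mfd M N)) (?Ph ` (fst c \<times> fst d))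
    (%z. snd d (snd (inv_into (fst (prod_chart (mdim M) c d)) ?Ph z)) j)"
   unfolding fp cd(1)[THEN arg_cong, of fst, unfolded fst_conv] cd(2)[THEN arg_cong, of fst, unfolded fst_conv] prod_mfd_simps
   by (rule smooth_fun_cong[OF E _ smooth_fun_coord])
 qed (auto simp: prod_chart_def)
qed

lemma is_chart_prod':
 "is_chart X m c ==> is_chart Y n d ==> is_chart (prod_topology X Y) (m + n) (prod_chart m c d)"
 using is_chart_prod by (metis prod.collapse)

lemma second_countable_prod_topology:
 assumes "second_countable X" "second_countable Y" shows "second_countable (prod_topology X Y)"
proof -
 obtain B where B: "countable B" "\<forall>V\<in>B. openin X V" "\<forall>U x. openin X U & x : U --> (\<exists>V\<in>B. x : V & V <= U)"
  using assms(1) unfolding second_countable_def by (elim exE conjE)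
 obtain C where C: "countable C" "\<forall>V\<in>C. openin Y V" "\<forall>U x. openin Y U & x : U --> (\<exists>V\<in>C. x : V & V <= U)"
  using assms(2) unfolding second_countable_def by (elim exE conjE)
 show ?thesis
  unfolding second_countable_def
 proof (intro exI[of _ "(%(b, c). b \<times> c) ` (B \<times> C)"] conjI ballI allI impI)
  show "countable ((%(b, c). b \<times> c) ` (B \<times> C))" using B(1) C(1) by blast
  show "openin (prod_topology X Y) V" if "V : (%(b, c). b \<times> c) ` (B \<times> C)" for V
   using that B(2) C(2) by (auto simp: openin_prod_Times_iff)
  show "\<exists>V\<in>(%(b, c). b \<times> c) ` (B \<times> C). p : V & V <= W" if W: "openin (prod_topology X Y) W & p : W" for W p
  proof -
   obtain U V where "openin X U" "openin Y V" "fst p : U" "snd p : V" "U \<times> V <= W"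
    using W unfolding openin_prod_topology_alt by (metis prod.collapse)
   moreover then obtain b c where "b : B" "fst p : b" "b <= U" "c : C" "snd p : c" "c <= V"
    using B(3) C(3) by meson
   ultimately show ?thesis by (intro bexI[of _ "b \<times> c"] conjI) (auto simp: mem_Times_iff)
  qed
 qed
qed

lemma manifold_prod:
 assumes M: "manifold M" and N: "manifold N" shows "manifold (prod_mfd M N)"
proof (rule manifoldI)
 show "Hausdorff_space (mtop (prod_mfd M N))"
  using M N by (simp add: manifold_def Hausdorff_space_prod_topology)
 show "second_countable (mtop (prod_mfd M N))"
  using M N by (simp add: manifold_def second_countable_prod_topology)
 show "is_chart (mtop (prod_mfd M N)) (mdim (prod_mfd M N)) e" if "e : charts (prod_mfd M N)" for e
  using that is_chart_prod'[OF manifold_chart'[OF M] manifold_chart'[OF N]] by (auto simp: charts_prod_mfd)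
 show "\<exists>e\<in>charts (prod_mfd M N). p : fst e" if p: "p : points (prod_mfd M N)" for p
 proof -
  have p': "fst p : points M" "snd p : points N" using p by auto
  obtain c where c: "c : charts M" "fst p : fst c" by (rule manifold_chart_at'[OF M p'(1)])
  obtain d where d: "d : charts N" "snd p : fst d" by (rule manifold_chart_at'[OF N p'(2)])
  show ?thesis
   using c d by (intro bexI[OF _ prod_chart_in[OF c(1) d(1)]]) (simp add: prod_chart_def mem_Times_iff)
 qed
 show "smooth_rep (prod_mfd M N) (prod_mfd M N) e e' (fst e \<inter> fst e') (%x. x)"
  if e: "e : charts (prod_mfd M N)" "e' : charts (prod_mfd M N)" for e e'
 proof -
  obtain c d c' d' where cd: "c : charts M" "d : charts N" "c' : charts M" "d' : charts N"
   and ee: "e = prod_chart (mdim M) c d" "e' = prod_chart (mdim M) c' d'"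
   using e unfolding charts_prod_mfd by blast
  let ?S = "fst e \<inter> fst e'"
  have S: "?S = (fst c \<inter> fst c') \<times> (fst d \<inter> fst d')" by (auto simp: ee prod_chart_def)
  have oS: "openin (mtop (prod_mfd M N)) ?S"
   unfolding S using cd manifold_chart_fst_open[OF M] manifold_chart_fst_open[OF N]
   by (simp add: openin_prod_Times_iff openin_Int)
  note ce = is_chart_prod'[OF manifold_chart'[OF M cd(1)] manifold_chart'[OF N cd(2)], folded ee prod_mfd_simps]
  \<comment> \<open>The identity of the product is the pair of its projections, so a change of
    product charts is put together from the changes of charts of the factors.\<close>
  have "smooth_rep (prod_mfd M N) M e c' ?S ((%x. x) \<circ> fst)"
   by (rule smooth_rep_compose[OF ce manifold_chart'[OF M cd(1)] smooth_rep_subset[OF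
      smooth_rep_fst_snd(1)[OF manifold_chart'[OF M cd(1)] manifold_chart'[OF N cd(2)], folded ee] oS]
     smooth_rep_transition[OF M cd(1,3)]]) (auto simp: S)
  moreover have "smooth_rep (prod_mfd M N) N e d' ?S ((%x. x) \<circ> snd)"
   by (rule smooth_rep_compose[OF ce manifold_chart'[OF N cd(2)] smooth_rep_subset[OF
      smooth_rep_fst_snd(2)[OF manifold_chart'[OF M cd(1)] manifold_chart'[OF N cd(2)], folded ee] oS]
     smooth_rep_transition[OF N cd(2,4)]]) (auto simp: S)
  ultimately have "smooth_rep (prod_mfd M N) (prod_mfd M N) e e' ?S (%x. (((%x. x) \<circ> fst) x, ((%x. x) \<circ> snd) x))"
   unfolding ee(2) by (rule smooth_rep_pair)
  then show ?thesis by simp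
 qed
qed

lemma sm_fst_snd:
 assumes M: "manifold M" and N: "manifold N"
 shows "smooth (prod_mfd M N) M fst" "smooth (prod_mfd M N) N snd"
proof -
 have ex: "\<exists>c\<in>charts M. \<exists>d\<in>charts N. p : fst c \<times> fst d & prod_chart (mdim M) c d : charts (prod_mfd M N)"
  if p: "p : points (prod_mfd M N)" for p
 proof -
  have p': "fst p : points M" "snd p : points N" using p by auto
  obtain c where c: "c : charts M" "fst p : fst c" by (rule manifold_chart_at'[OF M p'(1)])
  obtain d where d: "d : charts N" "snd p : fst d" by (rule manifold_chart_at'[OF N p'(2)])
  show ?thesis
   using c(2) d(2) prod_chart_in[OF c(1) d(1)]
   by (rule_tac bexI[OF _ c(1)], rule_tac bexI[OF _ d(1)]) (simp add: mem_Times_iff)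
 qed
 show "smooth (prod_mfd M N) M fst"
 proof (rule smooth_mapI[OF manifold_prod[OF M N] M])
  fix p assume "p : points (prod_mfd M N)"
  from ex[OF this] obtain c d where c: "c : charts M" and d: "d : charts N"
   and p: "p : fst c \<times> fst d" "prod_chart (mdim M) c d : charts (prod_mfd M N)" by blast
  from smooth_rep_fst_snd(1)[OF manifold_chart'[OF M c] manifold_chart'[OF N d]]
  show "\<exists>e\<in>charts (prod_mfd M N). \<exists>c\<in>charts M. \<exists>T. p : T & smooth_rep (prod_mfd M N) M e c T fst"
   using p(1) by (intro bexI[OF _ p(2)] bexI[OF _ c] exI conjI)
 qed
 show "smooth (prod_mfd M N) N snd"
 proof (rule smooth_mapI[OF manifold_prod[OF M N] N])
  fix p assume "p : points (prod_mfd M N)"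
  from ex[OF this] obtain c d where c: "c : charts M" and d: "d : charts N"
   and p: "p : fst c \<times> fst d" "prod_chart (mdim M) c d : charts (prod_mfd M N)" by blast
  from smooth_rep_fst_snd(2)[OF manifold_chart'[OF M c] manifold_chart'[OF N d]]
  show "\<exists>e\<in>charts (prod_mfd M N). \<exists>c\<in>charts N. \<exists>T. p : T & smooth_rep (prod_mfd M N) N e c T snd"
   using p(1) by (intro bexI[OF _ p(2)] bexI[OF _ d] exI conjI)
 qed
qed

lemma sm_pair:
 assumes K: "manifold K" and M: "manifold M" and N: "manifold N" and f: "smooth K M f" and g: "smooth K N g"
 shows "smooth K (prod_mfd M N) (%x. (f x, g x))"
proof (rule smooth_mapI[OF K manifold_prod[OF M N]])
 fix x assume x: "x : points K"
 obtain e where e: "e : charts K" "x : fst e" by (rule manifold_chart_at'[OF K x])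
 obtain c where c: "c : charts M" "f x : fst c" by (rule manifold_chart_at'[OF M sm_point[OF f x]])
 obtain d where d: "d : charts N" "g x : fst d" by (rule manifold_chart_at'[OF N sm_point[OF g x]])
 obtain S where S: "x : S" "S <= points K" "smooth_rep K M e c S f"
  by (rule sm_rep_at[OF K M f x e c openin_topspace x])
 have oS: "openin (mtop K) S" using S(3) by (simp add: smooth_rep_def)
 obtain T where T: "x : T" "T <= S" "smooth_rep K N e d T g"
  by (rule sm_rep_at[OF K N g x e d oS S(1)])
 have "openin (mtop K) T" using T(3) by (simp add: smooth_rep_def)
 then have "smooth_rep K (prod_mfd M N) e (prod_chart (mdim M) c d) T (%x. (f x, g x))"
  by (intro smooth_rep_pair smooth_rep_subset[OF S(3) _ T(2)] T(3))
 moreover have "prod_chart (mdim M) c d : charts (prod_mfd M N)"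
  by (rule prod_chart_in[OF c(1) d(1)])
 ultimately show "\<exists>e\<in>charts K. \<exists>d\<in>charts (prod_mfd M N). \<exists>T. x : T & smooth_rep K (prod_mfd M N) e d T (%x. (f x, g x))"
  using e(1) T(1) by blast
qed

section \<open>Submersions and fibre products\<close>

subsection \<open>Embedded submanifolds\<close>

text \<open>The points of the submanifold are those of \<open>P\<close>, seen in the ambient manifold \<open>Q\<close> through the
  injection \<open>j\<close>; \<open>r\<close> and \<open>e\<close> are a local chart and its inverse with values in the model \<open>L\<close>.\<close>

definition slice :: "('x => 'q) => 'x set => 'q mfd => 'l mfd => 'q set => 'l set => ('q => 'l) => ('l => 'q) => bool" where
 "slice j P Q L U R r e \<longleftrightarrow> openin (mtop Q) U & openin (mtop L) R \<and>
   smooth (sub_mfd Q U) L r & smooth (sub_mfd L R) Q e \<and>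
   (\<forall>x\<in>P. j x : U --> r (j x) : R & e (r (j x)) = j x) \<and>
   (\<forall>c\<in>R. e c : U & e c : j ` P & r (e c) = c)"

definition slice_chart :: "('x => 'q) => 'x set => 'q set => ('q => 'l) => 'l chart => 'x chart" where
 "slice_chart j P U r d = ({x\<in>P. j x : U & r (j x) : fst d}, %x. snd d (r (j x)))"

definition emb_mfd :: "('x => 'q) => 'x set => 'q mfd => 'l mfd => 'x mfd" where
 "emb_mfd j P Q L = \<lparr>mtop = pullback_topology P j (mtop Q), mdim = mdim L,
   charts = {slice_chart j P U r d | U R r e d. slice j P Q L U R r e & d : charts L}\<rparr>"

lemma emb_mfd_simps [simp]: "mtop (emb_mfd j P Q L) = pullback_topology P j (mtop Q)"
 "mdim (emb_mfd j P Q L) = mdim L"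
 by (simp_all add: emb_mfd_def)

locale embedded =
 fixes j :: "'x => 'q" and P :: "'x set" and Q :: "'q mfd" and L :: "'l mfd"
 assumes Q: "manifold Q" and L: "manifold L" and inj: "inj_on j P" and jP: "\<And>x. x : P ==> j x : points Q"
  and slices: "\<And>x. x : P ==> \<exists>U R r e. slice j P Q L U R r e & j x : U"
begin

abbreviation "E \<equiv> emb_mfd j P Q L"

lemma points_E: "points E = P"
 using jP by (auto simp: topspace_pullback_topology)

lemma cont_j: "continuous_map (mtop E) (mtop Q) j"
 using continuous_map_pullback[OF continuous_map_id, of P j "mtop Q"] by (simp add: id_def comp_def)

lemma openin_preimage_j: "openin (mtop Q) U ==> openin (mtop E) {x\<in>P. j x : U}"
 using openin_continuous_map_preimage[OF cont_j] points_E by simp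

lemma sliceD:
 assumes "slice j P Q L U R r e"
 shows "openin (mtop Q) U" "openin (mtop L) R" "smooth (sub_mfd Q U) L r" "smooth (sub_mfd L R) Q e"
  "x : P ==> j x : U ==> r (j x) : R" "x : P ==> j x : U ==> e (r (j x)) = j x"
  "c : R ==> e c : U" "c : R ==> inv_into P j (e c) : P" "c : R ==> j (inv_into P j (e c)) = e c"
  "c : R ==> r (e c) = c"
proof -
 show "openin (mtop Q) U" "openin (mtop L) R" "smooth (sub_mfd Q U) L r" "smooth (sub_mfd L R) Q e"
  "x : P ==> j x : U ==> r (j x) : R" "x : P ==> j x : U ==> e (r (j x)) = j x"
  "c : R ==> e c : U" "c : R ==> r (e c) = c"
  using assms unfolding slice_def by blast+
 have *: "e c : j ` P" if "c : R" using assms that unfolding slice_def by blast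
 show "c : R ==> inv_into P j (e c) : P" "c : R ==> j (inv_into P j (e c)) = e c"
  using inv_into_into[OF *] f_inv_into_f[OF *] by blast+
qed

lemma slice_open:
 assumes s: "slice j P Q L U R r e" and S: "openin (mtop L) S"
 shows "openin (mtop E) {x\<in>P. j x : U & r (j x) : S}"
proof -
 note oU = sliceD(1)[OF s]
 have "openin (mtop (sub_mfd Q U)) {q\<in>points (sub_mfd Q U). r q : S}"
  by (rule openin_continuous_map_preimage[OF sm_continuous[OF sliceD(3)[OF s]] S])
 then have "openin (mtop Q) {q\<in>U. r q : S}"
  unfolding points_sub_mfd[OF oU] using openin_open_subtopology[OF oU] by simp
 from openin_preimage_j[OF this] show ?thesis by simp
qed

lemma is_chart_slice:
 assumes s: "slice j P Q L U R r e" and d: "d : charts L"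
 shows "is_chart (mtop E) (mdim L) (slice_chart j P U r d)"
proof -
 obtain D ka where dd: "d = (D, ka)" by fastforce
 note D = manifold_chart[OF L d[unfolded dd]]
 note sD = sliceD[OF s]
 let ?C = "{x\<in>P. j x : U & r (j x) : D}"
 have oD: "openin (mtop L) (D \<inter> R)" using is_chart_open[OF D] sD(2) by (rule openin_Int)
 have O': "Eopen (mdim L) (ka ` (D \<inter> R))" by (rule is_chart_Eopen_image[OF D oD]) simp
 have tO: "topspace (subtopology (Euclidean_space (mdim L)) (ka ` (D \<inter> R))) = ka ` (D \<inter> R)"
  using openin_subset[OF O'] by auto
 have oC: "openin (mtop E) ?C" by (rule slice_open[OF s is_chart_open[OF D]])
 have tC: "topspace (subtopology (mtop E) ?C) = ?C" using openin_subset[OF oC] by auto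
 have inv: "inv_into D ka z : D \<inter> R & ka (inv_into D ka z) = z" if z: "z : ka ` (D \<inter> R)" for z
 proof -
  obtain y where y: "y : D" "y : R" "z = ka y" using z by blast
  then show ?thesis using is_chart_inv[OF D y(1)] by simp
 qed
 show ?thesis
  unfolding slice_chart_def dd fst_conv snd_conv
 proof (rule is_chartI(1)[OF oC O', where g = "%z. inv_into P j (e (inv_into D ka z))"])
  have "continuous_map (subtopology (mtop E) ?C) (mtop (sub_mfd Q U)) j"
   unfolding sub_mfd_simps
   by (rule continuous_map_into_subtopology[OF continuous_map_from_subtopology[OF cont_j]]) (simp only: tC, blast)
  from continuous_map_compose[OF this sm_continuous[OF sD(3)]]
  have "continuous_map (subtopology (mtop E) ?C) (subtopology (mtop L) D) (r \<circ> j)"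
   by (rule continuous_map_into_subtopology) (simp only: tC comp_def, blast)
  from continuous_map_compose[OF this is_chart_continuous[OF D]]
  show "continuous_map (subtopology (mtop E) ?C) (Euclidean_space (mdim L)) (%x. ka (r (j x)))"
   by (simp add: comp_def)
  have "continuous_map (subtopology (Euclidean_space (mdim L)) (ka ` (D \<inter> R))) (mtop L) (inv_into D ka)"
   by (rule continuous_map_from_subtopology_mono[OF is_chart_continuous_inv[OF D]]) blast
  then have "continuous_map (subtopology (Euclidean_space (mdim L)) (ka ` (D \<inter> R))) (mtop (sub_mfd L R)) (inv_into D ka)"
   unfolding sub_mfd_simps by (rule continuous_map_into_subtopology) (simp only: tO, use inv in blast)
  from continuous_map_compose[OF this sm_continuous[OF sD(4)]]
  have ce: "continuous_map (subtopology (Euclidean_space (mdim L)) (ka ` (D \<inter> R))) (mtop Q) (e \<circ> inv_into D ka)" .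
  show "continuous_map (subtopology (Euclidean_space (mdim L)) (ka ` (D \<inter> R))) (mtop E)
    (%z. inv_into P j (e (inv_into D ka z)))"
   unfolding emb_mfd_simps
  proof (rule continuous_map_pullback')
   show "continuous_map (subtopology (Euclidean_space (mdim L)) (ka ` (D \<inter> R))) (mtop Q)
     (j \<circ> (%z. inv_into P j (e (inv_into D ka z))))"
    by (rule continuous_map_eq[OF ce]) (simp only: tO comp_def, use inv sD(9) in simp)
   show "topspace (subtopology (Euclidean_space (mdim L)) (ka ` (D \<inter> R)))
     <= (%z. inv_into P j (e (inv_into D ka z))) -` P"
    unfolding tO using inv sD(8) by blast
  qed
  show "ka (r (j x)) : ka ` (D \<inter> R) & inv_into P j (e (inv_into D ka (ka (r (j x))))) = x" if "x : ?C" for x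
   using that sD(5,6)[of x] is_chart_inv[OF D, of "r (j x)"] inv_into_f_f[OF inj, of x] by auto
  show "inv_into P j (e (inv_into D ka z)) : ?C & ka (r (j (inv_into P j (e (inv_into D ka z))))) = z"
   if "z : ka ` (D \<inter> R)" for z
   using inv[OF that] sD(7-10)[of "inv_into D ka z"] by simp
 qed
qed

lemma inv_slice_chart:
 assumes s: "slice j P Q L U R r e" and d: "d : charts L" and y: "y : fst d" "y : R"
 shows "inv_into (fst (slice_chart j P U r d)) (snd (slice_chart j P U r d)) (snd d y) = inv_into P j (e y)"
proof -
 let ?x = "inv_into P j (e y)"
 note sD = sliceD[OF s]
 have "?x : fst (slice_chart j P U r d)" "snd (slice_chart j P U r d) ?x = snd d y"
  using sD(7-10)[OF y(2)] y(1) by (simp_all add: slice_chart_def)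
 then show ?thesis
  using is_chart_inv[OF is_chart_slice[OF s d, unfolded slice_chart_def], of ?x] by (simp add: slice_chart_def)
qed

lemma smooth_rep_from_slice:
 assumes s: "slice j P Q L U R r e" and d: "d : charts L" and S: "openin (mtop L) S" "S <= fst d" "S <= R"
  and f: "smooth_rep L K d k S (%y. f (inv_into P j (e y)))"
 shows "smooth_rep E K (slice_chart j P U r d) k {x\<in>P. j x : U & r (j x) : S} f"
proof (rule smooth_repI)
 note sD = sliceD[OF s]
 let ?S = "{x\<in>P. j x : U & r (j x) : S}" and ?c = "slice_chart j P U r d"
 show o: "openin (mtop E) ?S" by (rule slice_open[OF s S(1)])
 show sub: "?S <= fst ?c" using S(2) by (auto simp: slice_chart_def)
 show "f x : fst k" if "x : ?S" for x
 proof -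
  have "f (inv_into P j (e (r (j x)))) : fst k" using f that unfolding smooth_rep_def by blast
  moreover have "inv_into P j (e (r (j x))) = x" using that sD(6)[of x] inv_into_f_f[OF inj, of x] by simp
  ultimately show ?thesis by simp
 qed
 have im: "snd ?c ` ?S = snd d ` S"
 proof (intro equalityI subsetI)
  fix z assume "z : snd d ` S"
  then obtain y where y: "y : S" "z = snd d y" by blast
  then have "y : R" using S(3) by blast
  then have "inv_into P j (e y) : ?S" "snd ?c (inv_into P j (e y)) = z"
   using sD(7-10)[of y] y by (simp_all add: slice_chart_def)
  then show "z : snd ?c ` ?S" by blast
 qed (auto simp: slice_chart_def)
 fix i assume i: "i < mdim K"
 have dD: "is_chart (mtop L) (mdim L) (fst d, snd d)" using manifold_chart'[OF L d] by simp
 have "smooth_fun (mdim L) (snd d ` S) (%z. snd k (f (inv_into (fst ?c) (snd ?c) z)) i)"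
 proof (rule smooth_fun_cong[OF is_chart_Eopen_image[OF dD S(1,2)]])
  show "smooth_fun (mdim L) (snd d ` S) (%z. snd k (f (inv_into P j (e (inv_into (fst d) (snd d) z)))) i)"
   using f i by (simp add: smooth_rep_def)
  show "snd k (f (inv_into P j (e (inv_into (fst d) (snd d) z)))) i = snd k (f (inv_into (fst ?c) (snd ?c) z)) i"
   if z: "z : snd d ` S" for z
  proof -
   obtain y where y: "y : S" "z = snd d y" using z by blast
   then have "y : fst d" "y : R" using S by blast+
   then show ?thesis using inv_slice_chart[OF s d] is_chart_inv[OF dD] y by simp
  qed
 qed
 then show "smooth_fun (mdim E) (snd ?c ` ?S) (%z. snd k (f (inv_into (fst ?c) (snd ?c) z)) i)"
  unfolding im by simp
qed

lemma smooth_rep_into_slice: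
 assumes "smooth_rep K L k d S (%x. r (j (f x)))" "\<And>x. x : S ==> f x : P & j (f x) : U"
 shows "smooth_rep K E k (slice_chart j P U r d) S f"
 using assms unfolding smooth_rep_def by (auto simp: slice_chart_def)

lemma charts_E: "c : charts E \<longleftrightarrow> (\<exists>U R r e d. c = slice_chart j P U r d & slice j P Q L U R r e & d : charts L)"
 by (auto simp: emb_mfd_def)

lemma smooth_rep_sub':
 assumes M: "manifold M" and K: "manifold K" and T: "openin (mtop M) T" and f: "smooth (sub_mfd M T) K f"
  and c: "c : charts M" and d: "d : charts K"
 shows "smooth_rep M K c d {x\<in>T. x : fst c & f x : fst d} f"
proof -
 have "smooth_rep (sub_mfd M T) K (fst c \<inter> T, snd c) d {x\<in>fst (fst c \<inter> T, snd c). f x : fst d} f"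
  by (rule smooth_mapD[OF manifold_sub[OF M T] K f sub_chart[OF c] d])
 moreover have "{x\<in>fst (fst c \<inter> T, snd c). f x : fst d} = {x\<in>T. x : fst c & f x : fst d}" by auto
 ultimately have "smooth_rep (sub_mfd M T) K (fst c \<inter> T, snd c) d {x\<in>T. x : fst c & f x : fst d} f" by simp
 then show ?thesis by (rule smooth_rep_sub[OF manifold_chart'[OF M c] T, THEN iffD1, rotated]) blast
qed

lemma chart_at:
 assumes "x : P"
 obtains U R r e d where "slice j P Q L U R r e" "d : charts L" "j x : U" "r (j x) : R" "r (j x) : fst d"
  "slice_chart j P U r d : charts E"
proof -
 obtain U R r e where s: "slice j P Q L U R r e" "j x : U" using slices[OF assms] by blast
 have "r (j x) : R" by (rule sliceD(5)[OF s(1) assms s(2)])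
 moreover then have "r (j x) : points L" using openin_subset[OF sliceD(2)[OF s(1)]] by blast
 then obtain d where d: "d : charts L" "r (j x) : fst d" by (rule manifold_chart_at'[OF L])
 moreover have "slice_chart j P U r d : charts E" unfolding charts_E using s d by blast
 ultimately show thesis using that s by blast
qed

lemma manifold_E: "manifold E"
proof (rule manifoldI)
 show "Hausdorff_space (mtop E)"
  by (rule Hausdorff_space_injective_preimage[OF _ cont_j]) (use Q inj points_E in \<open>simp_all add: manifold_def\<close>)
 obtain B where B: "countable B" "\<forall>V\<in>B. openin (mtop Q) V" "\<forall>U x. openin (mtop Q) U & x : U --> (\<exists>V\<in>B. x : V & V <= U)"
  using Q unfolding manifold_def second_countable_def by (elim exE conjE)
 show "second_countable (mtop E)"
  unfolding second_countable_def
 proof (intro exI[of _ "(%V. {x\<in>P. j x : V}) ` B"] conjI ballI allI impI)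
  show "countable ((%V. {x\<in>P. j x : V}) ` B)" using B(1) by simp
  show "openin (mtop E) V" if "V : (%V. {x\<in>P. j x : V}) ` B" for V
   using that B(2) openin_preimage_j by auto
  show "\<exists>V\<in>(%V. {x\<in>P. j x : V}) ` B. x : V & V <= W" if W: "openin (mtop E) W & x : W" for W x
  proof -
   obtain U where U: "openin (mtop Q) U" "W = j -` U \<inter> P"
    using W by (auto simp: openin_pullback_topology)
   then obtain V where "V : B" "j x : V" "V <= U" using B(3) W by blast
   then show ?thesis using U W by (intro bexI[of _ "{x\<in>P. j x : V}"]) auto
  qed
 qed
 show "is_chart (mtop E) (mdim E) c" if "c : charts E" for c
  using that is_chart_slice unfolding charts_E by auto
 show "\<exists>c\<in>charts E. x : fst c" if "x : points E" for x
 proof -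
  have x: "x : P" using that unfolding points_E .
  obtain U R r e d where s: "slice j P Q L U R r e" "d : charts L" "j x : U" "r (j x) : R" "r (j x) : fst d"
   "slice_chart j P U r d : charts E"
   by (rule chart_at[OF x])
  then show ?thesis using x by (intro bexI[OF _ s(6)]) (simp add: slice_chart_def)
 qed
 show "smooth_rep E E c c' (fst c \<inter> fst c') (%x. x)" if "c : charts E" "c' : charts E" for c c'
 proof -
  obtain U R r e d where c: "c = slice_chart j P U r d" and s: "slice j P Q L U R r e" and d: "d : charts L"
   using \<open>c : charts E\<close> unfolding charts_E by blast
  obtain U' R' r' e' d' where c': "c' = slice_chart j P U' r' d'" and s': "slice j P Q L U' R' r' e'" and d': "d' : charts L"
   using \<open>c' : charts E\<close> unfolding charts_E by blast
  note sD = sliceD[OF s] and sD' = sliceD[OF s']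
  \<comment> \<open>The part of the first model that \<open>e\<close> maps into the second slice.
    There the change of charts is the composite of \<open>e\<close> and \<open>r'\<close>, smooth
    because it passes through the ambient manifold.\<close>
  define R2 where "R2 = {y\<in>R. e y : U'}"
  have oR2: "openin (mtop L) R2"
   using openin_continuous_map_preimage[OF sm_continuous[OF sD(4)] sD'(1)]
   unfolding points_sub_mfd[OF sD(2)] R2_def[symmetric] unfolding sub_mfd_simps openin_open_subtopology[OF sD(2)] by blast
  have R2: "R2 <= R" by (auto simp: R2_def)
  have e: "smooth (sub_mfd L R2) (sub_mfd Q U') e"
   by (rule sm_into_sub[OF manifold_sub[OF L oR2] Q sD'(1) sm_sub_mono[OF L Q sD(2) oR2 R2 sD(4)]])
    (simp add: R2_def)
  have "smooth (sub_mfd L R2) L (%y. r' (e y))"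
   by (rule sm_compose'[OF manifold_sub[OF L oR2] manifold_sub[OF Q sD'(1)] L e sD'(3)])
  then have rep: "smooth_rep L L d d' {y\<in>R2. y : fst d & r' (e y) : fst d'} (%y. r' (e y))"
   by (rule smooth_rep_sub'[OF L L oR2 _ d d'])
  let ?S = "{y\<in>R2. y : fst d & r' (e y) : fst d'}"
  have "smooth_rep L L d d' ?S (%y. r' (j (inv_into P j (e y))))"
   by (rule smooth_rep_cong[OF manifold_chart'[OF L d] rep]) (use R2 sD(9) in auto)
  then have "smooth_rep L E d c' ?S (%y. inv_into P j (e y))"
   unfolding c' by (rule smooth_rep_into_slice) (use R2 sD(8,9) in \<open>auto simp: R2_def\<close>)
  then have "smooth_rep E E c c' {x\<in>P. j x : U & r (j x) : ?S} (%x. x)"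
   unfolding c by (intro smooth_rep_from_slice[OF s d]) (use R2 in \<open>auto simp: smooth_rep_def\<close>)
  moreover have "{x\<in>P. j x : U & r (j x) : ?S} = fst c \<inter> fst c'"
   using sD(5,6) by (auto simp: c c' slice_chart_def R2_def)
  ultimately show ?thesis by simp
 qed
qed

lemma sm_j: "smooth E Q j"
proof (rule smooth_mapI[OF manifold_E Q])
 fix x assume "x : points E"
 then have x: "x : P" unfolding points_E .
 obtain U R r e d where s: "slice j P Q L U R r e" and d: "d : charts L" and jx: "j x : U" "r (j x) : R" "r (j x) : fst d"
  and c: "slice_chart j P U r d : charts E"
  by (rule chart_at[OF x])
 obtain k where k: "k : charts Q" "j x : fst k" by (rule manifold_chart_at'[OF Q jP[OF x]])
 note sD = sliceD[OF s]
 let ?S = "{y\<in>R. y : fst d & e y : fst k}"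
 have rep: "smooth_rep L Q d k ?S e" by (rule smooth_rep_sub'[OF L Q sD(2,4) d k(1)])
 then have "smooth_rep L Q d k ?S (%y. j (inv_into P j (e y)))"
  by (rule smooth_rep_cong[OF manifold_chart'[OF L d]]) (use sD(9) in auto)
 then have "smooth_rep E Q (slice_chart j P U r d) k {x\<in>P. j x : U & r (j x) : ?S} j"
  by (intro smooth_rep_from_slice[OF s d]) (use rep in \<open>auto simp: smooth_rep_def\<close>)
 moreover have "x : {x\<in>P. j x : U & r (j x) : ?S}" using x jx k(2) sD(6)[OF x jx(1)] by simp
 ultimately show "\<exists>c\<in>charts E. \<exists>k\<in>charts Q. \<exists>T. x : T & smooth_rep E Q c k T j"
  by (intro bexI[OF _ c] bexI[OF _ k(1)] exI conjI)
qed

text \<open>The map \<open>r\<close> of a slice is smooth on an open set of the ambient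
  \<open>Q\<close> and not just on the submanifold, so the chart expression of \<open>f\<close> is a
  composite of smooth maps through \<open>Q\<close>.\<close>

lemma sm_lift:
 assumes T: "manifold T" and f: "smooth T Q (%t. j (f t))" and fP: "\<And>t. t : points T ==> f t : P"
 shows "smooth T E f"
proof (rule smooth_mapI[OF T manifold_E])
 fix t assume t: "t : points T"
 obtain U R r e d where s: "slice j P Q L U R r e" and d: "d : charts L" and jx: "j (f t) : U" "r (j (f t)) : R" "r (j (f t)) : fst d"
  and c: "slice_chart j P U r d : charts E"
  by (rule chart_at[OF fP[OF t]])
 obtain k where k: "k : charts T" "t : fst k" by (rule manifold_chart_at'[OF T t])
 note sD = sliceD[OF s]
 let ?V = "{t\<in>points T. j (f t) : U}"
 have V: "openin (mtop T) ?V" by (rule openin_continuous_map_preimage[OF sm_continuous[OF f] sD(1)])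
 have "smooth (sub_mfd T ?V) (sub_mfd Q U) (%t. j (f t))"
  by (rule sm_into_sub[OF manifold_sub[OF T V] Q sD(1) sm_restrict[OF T Q V f]]) simp
 then have "smooth (sub_mfd T ?V) L (%t. r (j (f t)))"
  by (rule sm_compose'[OF manifold_sub[OF T V] manifold_sub[OF Q sD(1)] L _ sD(3)])
 then have "smooth_rep T L k d {t\<in>?V. t : fst k & r (j (f t)) : fst d} (%t. r (j (f t)))"
  by (rule smooth_rep_sub'[OF T L V _ k(1) d])
 then have "smooth_rep T E k (slice_chart j P U r d) {t\<in>?V. t : fst k & r (j (f t)) : fst d} f"
  by (rule smooth_rep_into_slice) (use fP in simp)
 moreover have "t : {t\<in>?V. t : fst k & r (j (f t)) : fst d}" using t k jx by simp
 ultimately show "\<exists>c\<in>charts T. \<exists>d\<in>charts E. \<exists>S. t : S & smooth_rep T E c d S f"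
  by (intro bexI[OF _ c] bexI[OF _ k(1)] exI conjI)
qed

end

subsection \<open>Submersions\<close>

text \<open>The form in which submersions are used. For smooth maps it is equivalent to the rank
  condition, by the lemmas below, and unlike the latter it passes directly to base changes.\<close>

definition has_local_sections :: "'a mfd => 'b mfd => ('a => 'b) => bool" where
 "has_local_sections M N f \<longleftrightarrow> (\<forall>x\<in>points M. \<exists>V si. openin (mtop N) V & f x : V \<and>
   smooth (sub_mfd N V) M si & si (f x) = x & (\<forall>z\<in>V. f (si z) = z))"

lemma submersion_smooth: "submersion M N f ==> smooth M N f"
 by (simp add: submersion_def)

lemma Eopen_Espace: "Eopen n (Espace n)"
 using openin_topspace[of "Euclidean_space n"] unfolding topspace_Euclidean_space .

text \<open>Near a point, the source is an open part of the product of the target with the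
  coordinate space of the fibre: \<open>(s, q)\<close> is the identification and \<open>H\<close>
  its inverse. In straightened coordinates, the first \<open>mdim N\<close> entries are those of
  \<open>s\<close> and the remaining ones define \<open>q\<close>.\<close>

lemma submersion_local_product:
 assumes M: "manifold M" and N: "manifold N" and s: "submersion M N s" and x: "x : points M"
 obtains U R q H where "openin (mtop M) U" "x : U"
  "openin (mtop (prod_mfd N (euc (mdim M - mdim N) (Espace (mdim M - mdim N))))) R"
  "smooth (sub_mfd M U) (euc (mdim M - mdim N) (Espace (mdim M - mdim N))) q"
  "smooth (sub_mfd (prod_mfd N (euc (mdim M - mdim N) (Espace (mdim M - mdim N)))) R) M H"
  "\<And>y. y : U ==> (s y, q y) : R & H (s y, q y) = y"
  "\<And>p. p : R ==> H p : U & s (H p) = fst p & q (H p) = snd p"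
proof -
 define m n k where "m = mdim M" and "n = mdim N" and "k = m - n"
 obtain U0 ph where c: "(U0, ph) : charts M" "x : U0" by (rule manifold_chart_at[OF M x])
 obtain V0 pp where d: "(V0, pp) : charts N" "s x : V0"
  by (rule manifold_chart_at[OF N sm_point[OF submersion_smooth[OF s] x]])
 note ch = manifold_chart[OF M c(1)] and dh = manifold_chart[OF N d(1)]
 let ?T = "{y\<in>U0. s y : V0}"
 let ?F = "%z. pp (s (inv_into U0 ph z))"
 have rep: "smooth_rep M N (U0, ph) (V0, pp) ?T s"
  using smooth_mapD[OF M N submersion_smooth[OF s] c(1) d(1)] by simp
 have oT: "openin (mtop M) ?T" using rep by (simp add: smooth_rep_def)
 have ET: "Eopen m (ph ` ?T)" unfolding m_def by (rule is_chart_Eopen_image[OF ch oT]) blast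
 have F: "smooth_fun m (ph ` ?T) (%z. ?F z j)" if "j < n" for j
  using rep that by (simp add: smooth_rep_def m_def n_def)
 have "\<forall>(U, ph)\<in>charts M. \<forall>(V, pp)\<in>charts N. \<forall>x\<in>U. s x : V \<longrightarrow>
    (\<forall>v :: nat => real. \<exists>u :: nat => real. \<forall>j<mdim N.
      v j = (\<Sum>i<mdim M. pderiv_at (%z. (pp \<circ> s \<circ> inv_into U ph) z j) i (ph x) * u i))"
  using s unfolding submersion_def by (elim conjE)
 from bspec[OF bspec[OF this c(1), unfolded split_conv] d(1), unfolded split_conv, rule_format, OF c(2) d(2)]
 have surj: "\<exists>u. \<forall>j<n. v j = (\<Sum>i<m. pderiv_at (%z. ?F z j) i (ph x) * u i)" for v :: "nat => real"
  by (simp add: m_def n_def)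
 have phx: "ph x : ph ` ?T" using c(2) d(2) by blast
 obtain S' W PP Ph where nm: "n \<le> m" and S': "Eopen m S'" "ph x : S'" "S' <= ph ` ?T" and W: "Eopen m W"
  and PPa: "\<forall>j<m. smooth_fun m S' (%x. PP x j)" and Pha: "\<forall>j<m. smooth_fun m W (%x. Ph x j)"
  and PPPh: "\<forall>x\<in>S'. PP x : W & Ph (PP x) = x" and PhPP: "\<forall>z\<in>W. Ph z : S' & PP (Ph z) = z"
  and PPF: "\<forall>x\<in>S'. \<forall>j<n. PP x j = ?F x j"
 proof -
  have "n \<le> m & (\<exists>S' W PP Ph. Eopen m S' & ph x : S' & S' <= ph ` ?T & Eopen m W \<and>
    (\<forall>j<m. smooth_fun m S' (%x. PP x j)) & (\<forall>j<m. smooth_fun m W (%x. Ph x j)) \<and>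
    (\<forall>x\<in>S'. PP x : W & Ph (PP x) = x) & (\<forall>z\<in>W. Ph z : S' & PP (Ph z) = z) \<and>
    (\<forall>x\<in>S'. \<forall>j<n. PP x j = ?F x j))"
   by (rule straighten_submersion[OF ET phx F surj])
  then show thesis by (elim conjE exE) (rule that; assumption)
 qed
 have mnk: "m = n + k" using nm by (simp add: k_def)
 let ?K = "euc k (Espace k)"
 let ?NK = "prod_mfd N ?K"
 have K: "manifold ?K" by (rule manifold_euc[OF Eopen_Espace])
 have NK: "manifold ?NK" by (rule manifold_prod[OF N K])
 define U where "U = {y\<in>U0. ph y : S'}"
 define q where "q y = drop_coords n (PP (ph y))" for y
 define R where "R = {p\<in>V0 \<times> Espace k. cat n (pp (fst p)) (snd p) : W}"
 define H where "H p = inv_into U0 ph (Ph (cat n (pp (fst p)) (snd p)))" for p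
 have phsmooth: "smooth (sub_mfd M U0) (euc m (ph ` U0)) ph"
  and phinv: "smooth (euc m (ph ` U0)) M (inv_into U0 ph)"
  using sm_chart[OF M c(1)] by (simp_all add: m_def)
 have S'U0: "S' <= ph ` U0" using S'(3) by blast
 have oU0: "openin (mtop M) U0" by (rule is_chart_open[OF ch])
 have oU: "openin (mtop M) U"
 proof -
  have "openin (mtop (euc m (ph ` U0))) S'"
   using openin_euc[OF is_chart_open_image[OF ch]] S'(1) S'U0 by (simp add: m_def)
  from openin_continuous_map_preimage[OF sm_continuous[OF phsmooth] this]
  have "openin (subtopology (mtop M) U0) U" unfolding points_sub_mfd[OF oU0] U_def by simp
  then show ?thesis using openin_open_subtopology[OF oU0] by simp
 qed
 have UU0: "U <= U0" by (auto simp: U_def)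
 have EU0: "Eopen m (ph ` U0)" using is_chart_open_image[OF ch] by (simp add: m_def)
 have ch0: "is_chart (mtop (euc m (ph ` U0))) (mdim (euc m (ph ` U0))) (ph ` U0, %x. x)"
  by (rule manifold_chart'[OF manifold_euc[OF EU0]]) simp
 have W_E: "W <= Espace m" by (rule Eopen_subset[OF W])
 have q: "smooth (sub_mfd M U) ?K q"
  unfolding q_def
 proof (rule sm_compose'[where f = ph and g = "%z. drop_coords n (PP z)",
    OF manifold_sub[OF M oU] manifold_euc[OF S'(1)] K])
  have oS': "openin (mtop (euc m (ph ` U0))) S'" using S'(1) S'U0 openin_euc[OF EU0] by simp
  have "smooth (sub_mfd M U) (euc m (ph ` U0)) ph"
   by (rule sm_sub_mono[OF M manifold_euc[OF EU0] oU0 oU UU0 phsmooth])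
  then have A: "smooth (sub_mfd M U) (sub_mfd (euc m (ph ` U0)) S') ph"
   by (rule sm_into_sub[OF manifold_sub[OF M oU] manifold_euc[OF EU0] oS']) (simp add: U_def)
  have B: "smooth (sub_mfd (euc m (ph ` U0)) S') (euc m S') (%x. x)"
  proof -
   show ?thesis
   proof (rule smooth_mapI[OF manifold_sub[OF manifold_euc[OF EU0] oS'] manifold_euc[OF S'(1)]])
    let ?c0 = "(ph ` U0, %x. x) :: (nat => real) chart"
    fix z assume "z : points (sub_mfd (euc m (ph ` U0)) S')"
    then have z: "z : S'" by simp
    have "smooth_rep (euc m (ph ` U0)) (euc m S') (ph ` U0, %x. x) (S', %x. x) S' (%x. x)"
     by (rule smooth_rep_euc[OF EU0 S'(1) S'U0]) (simp_all add: smooth_fun_coord)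
    then have "smooth_rep (sub_mfd (euc m (ph ` U0)) S') (euc m S') (fst ?c0 \<inter> S', snd ?c0) (S', %x. x) S' (%x. x)"
     by (rule iffD2[OF smooth_rep_sub[OF ch0 oS' order_refl]])
    moreover have "(fst ?c0 \<inter> S', snd ?c0) : charts (sub_mfd (euc m (ph ` U0)) S')"
     by (rule sub_chart) simp
    ultimately show "\<exists>c\<in>charts (sub_mfd (euc m (ph ` U0)) S'). \<exists>d\<in>charts (euc m S'). \<exists>T. z : T \<and>
      smooth_rep (sub_mfd (euc m (ph ` U0)) S') (euc m S') c d T (%x. x)"
     using z by (intro bexI[of _ "(fst ?c0 \<inter> S', snd ?c0)"] bexI[of _ "(S', %x. x)"] exI[of _ S']) simp_all
   qed
  qed
  show "smooth (sub_mfd M U) (euc m S') ph"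
   by (rule sm_compose'[OF manifold_sub[OF M oU] manifold_sub[OF manifold_euc[OF EU0] oS'] manifold_euc[OF S'(1)] A B])
  show "smooth (euc m S') ?K (%z. drop_coords n (PP z))"
  proof (rule sm_euc[OF S'(1) Eopen_Espace])
   show "smooth_fun m S' (%z. drop_coords n (PP z) j)" if "j < k" for j
    using PPa that mnk by (simp add: drop_coords_def)
   show "drop_coords n (PP z) : Espace k" if "z : S'" for z
    using PPPh W_E that by (intro drop_Espace) (simp add: mnk subset_iff)
  qed
 qed
 have e: "(Espace k, %x. x) : charts ?K" by simp
 have pc: "(V0 \<times> Espace k, %p. cat n (pp (fst p)) (snd p)) : charts ?NK"
  using prod_chart_in[OF d(1) e] by (simp add: prod_chart_def n_def)
 note pch = manifold_chart[OF NK pc]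
 have dNK: "mdim ?NK = m" using mnk by (simp add: n_def)
 note pcs = sm_chart(1)[OF NK pc, unfolded dNK]
 let ?pc = "%p. cat n (pp (fst p)) (snd p)" and ?VK = "V0 \<times> Espace k"
 note oVK = is_chart_open[OF pch]
 have Epc: "Eopen m (?pc ` ?VK)" using is_chart_open_image[OF pch] unfolding dNK .
 have ch1: "is_chart (mtop (euc m (?pc ` ?VK))) (mdim (euc m (?pc ` ?VK))) (?pc ` ?VK, %x. x)"
  by (rule manifold_chart'[OF manifold_euc[OF Epc]]) simp
 have oWp: "openin (mtop (euc m (?pc ` ?VK))) (W \<inter> ?pc ` ?VK)"
  using openin_euc[OF Epc] openin_Int[OF W Epc] by blast
 have oR: "openin (mtop ?NK) R"
 proof -
  from openin_continuous_map_preimage[OF sm_continuous[OF pcs] oWp]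
  have "openin (subtopology (mtop ?NK) ?VK) {p\<in>?VK. ?pc p : W \<inter> ?pc ` ?VK}"
   unfolding points_sub_mfd[OF oVK] by simp
  moreover have "{p\<in>?VK. ?pc p : W \<inter> ?pc ` ?VK} = R" unfolding R_def by blast
  ultimately show ?thesis using openin_open_subtopology[OF oVK] by simp
 qed
 have RVK: "R <= ?VK" by (auto simp: R_def)
 have Ws: "smooth (sub_mfd (euc m (?pc ` ?VK)) (W \<inter> ?pc ` ?VK)) M (%z. inv_into U0 ph (Ph z))"
 proof (rule sm_compose'[OF manifold_sub[OF manifold_euc[OF Epc] oWp] manifold_euc[OF EU0] M _ phinv])
  show "smooth (sub_mfd (euc m (?pc ` ?VK)) (W \<inter> ?pc ` ?VK)) (euc m (ph ` U0)) Ph"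
  proof (rule smooth_mapI[OF manifold_sub[OF manifold_euc[OF Epc] oWp] manifold_euc[OF EU0]])
   let ?S = "W \<inter> ?pc ` ?VK" and ?c = "(?pc ` ?VK, %x. x) :: (nat => real) chart"
   fix z assume "z : points (sub_mfd (euc m (?pc ` ?VK)) ?S)"
   then have z: "z : ?S" by simp
   have "smooth_rep (euc m (?pc ` ?VK)) (euc m (ph ` U0)) ?c (ph ` U0, %x. x) ?S Ph"
   proof (rule smooth_rep_euc[OF Epc openin_Int[OF W Epc]])
    show "smooth_fun m ?S (%z. snd (ph ` U0, %x. x) (Ph z) j)" if "j < mdim (euc m (ph ` U0))" for j
     using smooth_fun_mono[OF Pha[rule_format], of j ?S] that by simp
    show "Ph z : fst (ph ` U0, %x. x)" if "z : ?S" for z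
    proof -
     have "Ph z : S'" using PhPP that by blast
     then show ?thesis using S'U0 by (simp add: subset_iff)
    qed
   qed simp
   then have "smooth_rep (sub_mfd (euc m (?pc ` ?VK)) ?S) (euc m (ph ` U0)) (fst ?c \<inter> ?S, snd ?c) (ph ` U0, %x. x) ?S Ph"
    by (rule iffD2[OF smooth_rep_sub[OF ch1 oWp order_refl]])
   moreover have "(fst ?c \<inter> ?S, snd ?c) : charts (sub_mfd (euc m (?pc ` ?VK)) ?S)"
    by (rule sub_chart) simp
   ultimately show "\<exists>c\<in>charts (sub_mfd (euc m (?pc ` ?VK)) ?S). \<exists>d\<in>charts (euc m (ph ` U0)). \<exists>T. z : T \<and>
     smooth_rep (sub_mfd (euc m (?pc ` ?VK)) ?S) (euc m (ph ` U0)) c d T Ph"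
    using z by (intro bexI[of _ "(fst ?c \<inter> ?S, snd ?c)"] bexI[of _ "(ph ` U0, %x. x)"] exI[of _ ?S]) simp_all
  qed
 qed
 have H: "smooth (sub_mfd ?NK R) M H"
  unfolding H_def
 proof (rule sm_compose'[OF manifold_sub[OF NK oR] manifold_sub[OF manifold_euc[OF Epc] oWp] M _ Ws])
  show "smooth (sub_mfd ?NK R) (sub_mfd (euc m (?pc ` ?VK)) (W \<inter> ?pc ` ?VK)) ?pc"
  proof (rule sm_into_sub[OF manifold_sub[OF NK oR] manifold_euc[OF Epc] oWp])
   show "smooth (sub_mfd ?NK R) (euc m (?pc ` ?VK)) ?pc"
    by (rule sm_sub_mono[OF NK manifold_euc[OF Epc] oVK oR RVK pcs])
   show "?pc p : W \<inter> ?pc ` ?VK" if "p : points (sub_mfd ?NK R)" for p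
   proof -
    have "p : R" using that by simp
    then show ?thesis unfolding R_def by blast
   qed
  qed
 qed
 have ppE: "pp y : Espace n" if "y : V0" for y
  unfolding n_def by (rule subsetD[OF Eopen_subset[OF is_chart_open_image[OF dh]] imageI[OF that]])
 have UT: "s y : V0 & inv_into U0 ph (ph y) = y" if "y : U" for y
 proof -
  have y: "y : U0" "ph y : ph ` ?T" using that S'(3) by (auto simp: U_def)
  then obtain y' where y': "y' : ?T" "ph y = ph y'" by blast
  have "y = y'" by (rule inj_onD[OF is_chart_inj[OF ch] y'(2) y(1)]) (use y'(1) in simp)
  then show ?thesis using y'(1) is_chart_inv[OF ch y(1)] by simp
 qed
 have A: "(s y, q y) : R & H (s y, q y) = y" if y: "y : U" for y
 proof -
  have yS: "ph y : S'" using y by (simp add: U_def)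
  note UTy = UT[OF y]
  have WE: "PP (ph y) : W" "Ph (PP (ph y)) = ph y" using PPPh yS by blast+
  \<comment> \<open>Below place \<open>n\<close> the straightened coordinates are those of
    \<open>s y\<close>, and \<open>q y\<close> holds the rest, so gluing the two gives
    \<open>PP (ph y)\<close> back.\<close>
  have eq: "cat n (pp (s y)) (q y) = PP (ph y)"
   using PPF yS UTy by (auto simp: cat_def q_def drop_coords_def fun_eq_iff)
  have "q y : Espace k" unfolding q_def by (rule drop_Espace) (use WE W_E in \<open>simp add: mnk subset_iff\<close>)
  then show ?thesis using eq WE UTy by (simp add: R_def H_def)
 qed
 have B: "H p : U & s (H p) = fst p & q (H p) = snd p" if p: "p : R" for p
 proof -
  let ?w = "?pc p"
  have pV: "fst p : V0" "snd p : Espace k" "?w : W" using p by (auto simp: R_def)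
  have w: "Ph ?w : S'" "PP (Ph ?w) = ?w" using PhPP pV(3) by blast+
  have "Ph ?w : ph ` U0" using w(1) S'U0 by blast
  then have phH: "H p : U0" "ph (H p) = Ph ?w" by (simp_all add: H_def inv_into_into f_inv_into_f)
  then have HU: "H p : U" using w(1) by (simp add: U_def)
  have "q (H p) = snd p" using phH(2) w(2) by (simp add: q_def cat_simps)
  \<comment> \<open>Injectivity of \<open>pp\<close> needs equality in every coordinate: below
    \<open>n\<close> it comes from the straightening, from \<open>n\<close> on both sides
    vanish.\<close>
  moreover have "pp (s (H p)) = pp (fst p)"
  proof -
   have "pp (s (H p)) j = pp (fst p) j" for j
   proof (cases "j < n")
    case True
    have "?F (Ph ?w) j = ?w j" using PPF w True by metis
    moreover have "?F (Ph ?w) = pp (s (H p))" using phH(2) UT[OF HU] by simp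
    ultimately show ?thesis using True by (simp add: cat_def)
   next
    case False
    then show ?thesis using ppE[OF pV(1)] ppE[of "s (H p)"] UT[OF HU] by simp
   qed
   then show ?thesis by (rule ext)
  qed
  moreover have "s (H p) : V0" using UT[OF HU] by blast
  ultimately show ?thesis
   using HU pV(1) is_chart_inv[OF dh] by metis
 qed
 have "x : U" using c(2) S'(2) by (simp add: U_def)
 from that[OF oU this oR[unfolded k_def m_def n_def] q[unfolded k_def m_def n_def] H[unfolded k_def m_def n_def] A B]
 show thesis .
qed

text \<open>In the local product, freezing the fibre coordinate at its value \<open>q x\<close>
  gives the section \<open>H (z, q x)\<close> through \<open>x\<close>.\<close>

lemma submersion_has_local_sections:
 assumes M: "manifold M" and N: "manifold N" and s: "submersion M N s"
 shows "has_local_sections M N s"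
 unfolding has_local_sections_def
proof
 fix x assume x: "x : points M"
 let ?K = "euc (mdim M - mdim N) (Espace (mdim M - mdim N))"
 have K: "manifold ?K" by (rule manifold_euc[OF Eopen_Espace])
 obtain U R q H where U: "openin (mtop M) U" "x : U" and R: "openin (mtop (prod_mfd N ?K)) R"
  and q: "smooth (sub_mfd M U) ?K q" and H: "smooth (sub_mfd (prod_mfd N ?K) R) M H"
  and A: "\<And>y. y : U ==> (s y, q y) : R & H (s y, q y) = y"
  and B: "\<And>p. p : R ==> H p : U & s (H p) = fst p & q (H p) = snd p"
  by (rule submersion_local_product[OF M N s x]) (rule that; assumption)
 have NK: "manifold (prod_mfd N ?K)" by (rule manifold_prod[OF N K])
 have qx: "q x : points ?K" by (rule sm_point[OF q]) (simp add: x U)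
 have i: "smooth N (prod_mfd N ?K) (%z. (z, q x))"
  by (rule sm_pair[OF N N K sm_ident[OF N] sm_const[OF N K qx]])
 let ?V = "{z\<in>points N. (z, q x) : R}"
 have V: "openin (mtop N) ?V" by (rule openin_continuous_map_preimage[OF sm_continuous[OF i] R])
 have "smooth (sub_mfd N ?V) (sub_mfd (prod_mfd N ?K) R) (%z. (z, q x))"
  by (rule sm_into_sub[OF manifold_sub[OF N V] NK R sm_restrict[OF N NK V i]]) simp
 from sm_compose'[OF manifold_sub[OF N V] manifold_sub[OF NK R] M this H]
 have "smooth (sub_mfd N ?V) M (%z. H (z, q x))" .
 moreover have "s x : ?V" using A[OF U(2)] sm_point[OF submersion_smooth[OF s] x] by simp
 moreover have "s (H (z, q x)) = z" if "z : ?V" for z using B[of "(z, q x)"] that by simp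
 ultimately show "\<exists>V si. openin (mtop N) V & s x : V & smooth (sub_mfd N V) M si & si (s x) = x & (\<forall>z\<in>V. s (si z) = z)"
  using V A[OF U(2)] by (intro exI[of _ ?V] exI[of _ "%z. H (z, q x)"]) simp
qed

text \<open>The chain rule for \<open>f (si z) = z\<close> makes the Jacobian matrix of the section
  a right inverse of that of \<open>f\<close>; the preimage \<open>u\<close> of \<open>v\<close> is
  the derivative of the section applied to \<open>v\<close>.\<close>

lemma local_sections_submersion:
 assumes M: "manifold M" and N: "manifold N" and f: "smooth M N f" and sec: "has_local_sections M N f"
 shows "submersion M N f"
proof -
 have "\<exists>u :: nat => real. \<forall>j<mdim N. v j = (\<Sum>i<mdim M. pderiv_at (%z. (pp \<circ> f \<circ> inv_into U ph) z j) i (ph x) * u i)"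
  if c: "(U, ph) : charts M" and d: "(V, pp) : charts N" and x: "x : U" "f x : V" for U ph V pp x and v :: "nat => real"
 proof -
  note ch = manifold_chart[OF M c] and dh = manifold_chart[OF N d]
  have xM: "x : points M" using openin_subset[OF is_chart_open[OF ch]] x by blast
  obtain V' si where V': "openin (mtop N) V'" "f x : V'" and si: "smooth (sub_mfd N V') M si" "si (f x) = x"
   and fsi: "\<forall>z\<in>V'. f (si z) = z"
   using sec xM unfolding has_local_sections_def by blast
  let ?T = "{y\<in>U. f y : V}" and ?S = "{z\<in>V'. z : V & si z : U}"
  let ?F = "%z. pp (f (inv_into U ph z))" and ?H = "%w. ph (si (inv_into V pp w))"
  have rf: "smooth_rep M N (U, ph) (V, pp) ?T f" using smooth_mapD[OF M N f c d] by simp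
  have rs: "smooth_rep N M (V, pp) (U, ph) ?S si"
  proof -
   have "smooth_rep (sub_mfd N V') M (fst (V, pp) \<inter> V', snd (V, pp)) (U, ph) {z\<in>fst (fst (V, pp) \<inter> V', snd (V, pp)). si z : fst (U, ph)} si"
    by (rule smooth_mapD[OF manifold_sub[OF N V'(1)] M si(1) sub_chart[OF d] c])
   moreover have "{z\<in>fst (fst (V, pp) \<inter> V', snd (V, pp)). si z : fst (U, ph)} = ?S" by auto
   ultimately have "smooth_rep (sub_mfd N V') M (fst (V, pp) \<inter> V', snd (V, pp)) (U, ph) ?S si" by simp
   then show ?thesis by (rule smooth_rep_sub[OF dh V'(1), THEN iffD1, rotated]) blast
  qed
  have oT: "openin (mtop M) ?T" and oS: "openin (mtop N) ?S" using rf rs by (simp_all add: smooth_rep_def)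
  have ET: "Eopen (mdim M) (ph ` ?T)" by (rule is_chart_Eopen_image[OF ch oT]) blast
  have ES: "Eopen (mdim N) (pp ` ?S)" by (rule is_chart_Eopen_image[OF dh oS]) blast
  have FT: "smooth_fun (mdim M) (ph ` ?T) (%z. ?F z j)" if "j < mdim N" for j
   using rf that by (simp add: smooth_rep_def)
  have HS: "smooth_fun (mdim N) (pp ` ?S) (%w. ?H w i)" if "i < mdim M" for i
   using rs that by (simp add: smooth_rep_def)
  have invS: "inv_into V pp w : ?S & pp (inv_into V pp w) = w" if w: "w : pp ` ?S" for w
  proof -
   obtain z where z: "z : ?S" "w = pp z" using w by blast
   then have "inv_into V pp w = z" using is_chart_inv[OF dh] by simp
   then show ?thesis using z by simp
  qed
  have HT: "?H w : ph ` ?T" and FH: "?F (?H w) = w" if w: "w : pp ` ?S" for w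
  proof -
   let ?z = "inv_into V pp w"
   have z: "?z : V'" "?z : V" "si ?z : U" "pp ?z = w" using invS[OF w] by auto
   have fz: "f (si ?z) = ?z" using fsi z(1) by blast
   have "si ?z : ?T" using z fz by simp
   then show "?H w : ph ` ?T" by (rule imageI)
   show "?F (?H w) = w" using is_chart_inv[OF ch z(3)] fz z(4) by simp
  qed
  have p: "pp (f x) : pp ` ?S" using V'(2) x si(2) by (intro imageI) simp
  have Hp: "?H (pp (f x)) = ph x" using is_chart_inv[OF dh x(2)] si(2) by simp
  have delta: "(\<Sum>i<mdim M. pderiv_at (%z. ?F z j) i (ph x) * pderiv_at (%w. ?H w i) l (pp (f x))) = (if l = j then 1 else 0)"
   if j: "j < mdim N" and l: "l < mdim N" for j l
  proof -
   have "has_pd (%w. ?F (?H w) j) l (pp (f x))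
     (\<Sum>i<mdim M. pderiv_at (%z. ?F z j) i (?H (pp (f x))) * pderiv_at (%w. ?H w i) l (pp (f x)))"
   proof (rule chain_rule_pd[OF ET ES HT smooth_funD[OF FT[OF j]] p l])
    show "has_pd (%w. ?H w i) l (pp (f x)) (pderiv_at (%w. ?H w i) l (pp (f x)))" if "i < mdim M" for i
     by (rule smooth_fun_has_pd[OF HS[OF that] p l])
   qed
   moreover have "has_pd (%w. ?F (?H w) j) l (pp (f x)) (if l = j then 1 else 0)"
   proof (rule has_pd_cong[OF ES p l _ has_pd_coord])
    show "w j = ?F (?H w) j" if "w : pp ` ?S" for w using FH[OF that] by simp
   qed
   ultimately show ?thesis unfolding Hp by (auto dest!: has_pd_pderiv_at)
  qed
  let ?u = "%i. \<Sum>l<mdim N. pderiv_at (%w. ?H w i) l (pp (f x)) * v l"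
  have "v j = (\<Sum>i<mdim M. pderiv_at (%z. ?F z j) i (ph x) * ?u i)" if j: "j < mdim N" for j
  proof -
   have "(\<Sum>i<mdim M. pderiv_at (%z. ?F z j) i (ph x) * ?u i) =
    (\<Sum>l<mdim N. (\<Sum>i<mdim M. pderiv_at (%z. ?F z j) i (ph x) * pderiv_at (%w. ?H w i) l (pp (f x))) * v l)"
    unfolding sum_distrib_left sum_distrib_right by (subst sum.swap) (simp only: mult.assoc)
   also have "\<dots> = (\<Sum>l<mdim N. (if l = j then 1 else 0) * v l)"
    by (intro sum.cong refl arg_cong2[where f = "(*)"] delta[OF j]) simp
   also have "\<dots> = v j" using j by (simp add: if_distrib[of "%a. a * _"] cong: if_cong)
   finally show ?thesis ..
  qed
  then show ?thesis by (intro exI[of _ ?u]) (simp add: comp_def)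
 qed
 then show ?thesis
  unfolding submersion_def using f by auto
qed

subsection \<open>Fibre products along submersions\<close>

text \<open>\<open>b\<close> decodes points as pairs. The model has dimension
  \<open>mdim K + (mdim M - mdim N)\<close>: locally, a point over \<open>y\<close> is given by
  \<open>y\<close> and a coordinate in the fibre of the submersion from \<open>M\<close> to
  \<open>N\<close>.\<close>

definition fibre_mfd :: "'x set => ('x => 'a \<times> 'b) => 'a mfd => 'c mfd => 'b mfd => 'x mfd" where
 "fibre_mfd P b M N K = emb_mfd b P (prod_mfd M K)
   (prod_mfd K (euc (mdim M - mdim N) (Espace (mdim M - mdim N))))"

text \<open>The local product structure of \<open>s\<close> provides the slices: a pair
  \<open>(x, y)\<close> has coordinates \<open>(y, q x)\<close>, and \<open>(H (f y, c), y)\<close>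
  is the pair with coordinates \<open>(y, c)\<close>.\<close>

lemma fibre_product_embedded:
 assumes M: "manifold M" and N: "manifold N" and K: "manifold K" and s: "submersion M N s" and f: "smooth K N f"
  and b: "inj_on b P" "b ` P = {(x, y). x : points M & y : points K & s x = f y}"
 shows "embedded b P (prod_mfd M K) (prod_mfd K (euc (mdim M - mdim N) (Espace (mdim M - mdim N))))"
proof
 let ?D = "euc (mdim M - mdim N) (Espace (mdim M - mdim N))"
 have D: "manifold ?D" by (rule manifold_euc[OF Eopen_Espace])
 show MK: "manifold (prod_mfd M K)" and KD: "manifold (prod_mfd K ?D)"
  by (rule manifold_prod[OF M K], rule manifold_prod[OF K D])
 have ND: "manifold (prod_mfd N ?D)" by (rule manifold_prod[OF N D])
 show "inj_on b P" by (rule b(1))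
 have bP: "fst (b p) : points M & snd (b p) : points K & s (fst (b p)) = f (snd (b p))" if "p : P" for p
 proof -
  have "b p : {(x, y). x : points M & y : points K & s x = f y}"
   unfolding b(2)[symmetric] using that by (rule imageI)
  then show ?thesis by auto
 qed
 show "b p : points (prod_mfd M K)" if "p : P" for p
  using bP[OF that] by (simp add: mem_Times_iff)
 show "\<exists>U R r e. slice b P (prod_mfd M K) (prod_mfd K ?D) U R r e & b p : U" if p: "p : P" for p
 proof -
  have x: "fst (b p) : points M" using bP[OF p] by blast
  obtain U R q H where U: "openin (mtop M) U" "fst (b p) : U" and R: "openin (mtop (prod_mfd N ?D)) R"
   and q: "smooth (sub_mfd M U) ?D q" and H: "smooth (sub_mfd (prod_mfd N ?D) R) M H"
   and A: "\<And>y. y : U ==> (s y, q y) : R & H (s y, q y) = y"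
   and B: "\<And>p. p : R ==> H p : U & s (H p) = fst p & q (H p) = snd p"
   by (rule submersion_local_product[OF M N s x]) (rule that; assumption)
  let ?U = "U \<times> points K" and ?r = "%(x, y). (y, q x)"
  let ?g = "%(y, c). (f y, c)" and ?e = "%(y, c). (H (f y, c), y)"
  have oU: "openin (mtop (prod_mfd M K)) ?U" using U(1) by (simp add: openin_prod_Times_iff)
  note MKs = sm_fst_snd[OF M K] and KDs = sm_fst_snd[OF K D]
  have g: "smooth (prod_mfd K ?D) (prod_mfd N ?D) ?g"
   using sm_pair[OF KD N D sm_compose'[OF KD K N KDs(1) f] KDs(2)] by (simp add: case_prod_beta')
  let ?R = "{p\<in>points (prod_mfd K ?D). ?g p : R}"
  have oR: "openin (mtop (prod_mfd K ?D)) ?R"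
   by (rule openin_continuous_map_preimage[OF sm_continuous[OF g] R])
  have fstU: "smooth (sub_mfd (prod_mfd M K) ?U) (sub_mfd M U) fst"
   by (rule sm_into_sub[OF manifold_sub[OF MK oU] M U(1) sm_restrict[OF MK M oU MKs(1)]]) auto
  have r: "smooth (sub_mfd (prod_mfd M K) ?U) (prod_mfd K ?D) ?r"
   using sm_pair[OF manifold_sub[OF MK oU] K D sm_restrict[OF MK K oU MKs(2)]
     sm_compose'[OF manifold_sub[OF MK oU] manifold_sub[OF M U(1)] D fstU q]]
   by (simp add: case_prod_beta')
  have gR: "smooth (sub_mfd (prod_mfd K ?D) ?R) (sub_mfd (prod_mfd N ?D) R) ?g"
   by (rule sm_into_sub[OF manifold_sub[OF KD oR] ND R sm_restrict[OF KD ND oR g]]) auto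
  have e: "smooth (sub_mfd (prod_mfd K ?D) ?R) (prod_mfd M K) ?e"
   using sm_pair[OF manifold_sub[OF KD oR] M K
     sm_compose'[OF manifold_sub[OF KD oR] manifold_sub[OF ND R] M gR H] sm_restrict[OF KD K oR KDs(1)]]
   by (simp add: case_prod_beta')
  have tD: "topspace (Euclidean_space k) = Espace k" for k by (rule topspace_Euclidean_space)
  have "slice b P (prod_mfd M K) (prod_mfd K ?D) ?U ?R ?r ?e"
   unfolding slice_def
  proof (intro conjI ballI impI oU oR r e)
   fix p' assume p': "p' : P" "b p' : ?U"
   obtain x' y' where xy: "b p' = (x', y')" by fastforce
   have *: "x' : U" "y' : points K" "s x' = f y'" using bP[OF p'(1)] p'(2) xy by auto
   have qx: "q x' : points ?D" by (rule sm_point[OF q]) (use * openin_subset[OF U(1)] in auto)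
   show "?r (b p') : ?R" using A[OF *(1)] * qx by (simp add: xy)
   show "?e (?r (b p')) = b p'" using A[OF *(1)] * by (simp add: xy)
  next
   fix c assume c: "c : ?R"
   obtain y d where yd: "c = (y, d)" by fastforce
   have *: "y : points K" "(f y, d) : R" using c yd by auto
   have HU: "H (f y, d) : U" "s (H (f y, d)) = f y" "q (H (f y, d)) = d" using B[OF *(2)] by auto
   have HM: "H (f y, d) : points M" using HU(1) openin_subset[OF U(1)] by blast
   show "?e c : ?U" using HU * by (simp add: yd)
   show "?e c : b ` P" unfolding b(2) using HU HM * by (simp add: yd)
   show "?r (?e c) = c" using HU by (simp add: yd)
  qed
  moreover have "b p : ?U" using U(2) bP[OF p] by (simp add: mem_Times_iff)
  ultimately show ?thesis by (intro exI conjI)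
 qed
qed

context
 fixes P :: "'x set" and b :: "'x => 'a \<times> 'b" and M :: "'a mfd" and N :: "'c mfd" and K :: "'b mfd" and s f
 assumes M: "manifold M" and N: "manifold N" and K: "manifold K" and s: "submersion M N s" and f: "smooth K N f"
  and b: "inj_on b P" "b ` P = {(x, y). x : points M & y : points K & s x = f y}"
begin

interpretation embedded b P "prod_mfd M K" "prod_mfd K (euc (mdim M - mdim N) (Espace (mdim M - mdim N)))"
 by (rule fibre_product_embedded[OF M N K s f b])

lemma manifold_fibre: "manifold (fibre_mfd P b M N K)"
 unfolding fibre_mfd_def by (rule manifold_E)

lemma points_fibre: "points (fibre_mfd P b M N K) = P"
 unfolding fibre_mfd_def by (rule points_E)

lemma smooth_fibre_proj:
 "smooth (fibre_mfd P b M N K) M (%p. fst (b p))" "smooth (fibre_mfd P b M N K) K (%p. snd (b p))"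
 unfolding fibre_mfd_def
 using sm_compose'[OF manifold_E Q M sm_j sm_fst_snd(1)[OF M K]]
  sm_compose'[OF manifold_E Q K sm_j sm_fst_snd(2)[OF M K]] by blast+

lemma smooth_fibre_lift:
 assumes T: "manifold T" and g: "smooth T M (%t. fst (b (g t)))" "smooth T K (%t. snd (b (g t)))"
  and gP: "\<And>t. t : points T ==> g t : P"
 shows "smooth T (fibre_mfd P b M N K) g"
 unfolding fibre_mfd_def
 by (rule sm_lift[OF T _ gP]) (use sm_pair[OF T M K g] in simp)

text \<open>Base change of a submersion: a local section \<open>si\<close> of \<open>s\<close> gives
  the section that sends \<open>y\<close> to the code of \<open>(si (f y), y)\<close>.\<close>

lemma fibre_snd_sections: "has_local_sections (fibre_mfd P b M N K) K (%p. snd (b p))"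
 unfolding has_local_sections_def
proof
 fix p assume "p : points (fibre_mfd P b M N K)"
 then have p: "p : P" unfolding points_fibre .
 have "b p : {(x, y). x : points M & y : points K & s x = f y}"
  unfolding b(2)[symmetric] using p by (rule imageI)
 then obtain x y where xy: "b p = (x, y)" "x : points M" "y : points K" "s x = f y" by blast
 obtain V si where V: "openin (mtop N) V" "s x : V" and si: "smooth (sub_mfd N V) M si" "si (s x) = x"
  and ssi: "\<forall>z\<in>V. s (si z) = z"
  using submersion_has_local_sections[OF M N s] xy(2) unfolding has_local_sections_def by blast
 let ?W = "{y\<in>points K. f y : V}" and ?t = "%y. inv_into P b (si (f y), y)"
 have W: "openin (mtop K) ?W" by (rule openin_continuous_map_preimage[OF sm_continuous[OF f] V(1)])
 have fW: "smooth (sub_mfd K ?W) (sub_mfd N V) f"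
  by (rule sm_into_sub[OF manifold_sub[OF K W] N V(1) sm_restrict[OF K N W f]]) simp
 have sif: "smooth (sub_mfd K ?W) M (%y. si (f y))"
  by (rule sm_compose'[OF manifold_sub[OF K W] manifold_sub[OF N V(1)] M fW si(1)])
 have inP: "(si (f y), y) : b ` P" if "y : ?W" for y
 proof -
  have "si (f y) : points M" by (rule sm_point[OF sif]) (use that in simp)
  then show ?thesis unfolding b(2) using that ssi by simp
 qed
 have bt: "b (?t y) = (si (f y), y)" "?t y : P" if "y : ?W" for y
  using f_inv_into_f[OF inP[OF that]] inv_into_into[OF inP[OF that]] by blast+
 have "smooth (sub_mfd K ?W) (fibre_mfd P b M N K) ?t"
 proof (rule smooth_fibre_lift[OF manifold_sub[OF K W]])
  show "smooth (sub_mfd K ?W) M (%y. fst (b (?t y)))"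
   by (rule sm_cong[OF manifold_sub[OF K W] M sif]) (simp add: bt)
  show "smooth (sub_mfd K ?W) K (%y. snd (b (?t y)))"
   by (rule sm_cong[OF manifold_sub[OF K W] K sm_restrict[OF K K W sm_ident[OF K]]]) (simp add: bt)
  show "?t y : P" if "y : points (sub_mfd K ?W)" for y using bt(2)[of y] that by simp
 qed
 moreover have yW: "y : ?W" using xy V(2) by simp
 moreover have "?t y = p"
 proof -
  have "b (?t y) = b p" using bt(1)[OF yW] xy si(2) by simp
  then show ?thesis using inj_onD[OF b(1)] bt(2)[OF yW] p by blast
 qed
 ultimately show "\<exists>V si. openin (mtop K) V & snd (b p) : V & smooth (sub_mfd K V) (fibre_mfd P b M N K) si \<and>
   si (snd (b p)) = p & (\<forall>z\<in>V. snd (b (si z)) = z)"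
  using W bt by (intro exI[of _ ?W] exI[of _ ?t]) (simp add: xy(1))
qed

lemma fibre_snd_submersion: "submersion (fibre_mfd P b M N K) K (%p. snd (b p))"
 by (rule local_sections_submersion[OF manifold_fibre K smooth_fibre_proj(2) fibre_snd_sections])

end

section \<open>Lie groupoids and essential equivalences\<close>

text \<open>The universal property yields some smooth map that agrees with the pair on the points of
  \<open>T\<close>; smoothness does not see values elsewhere, so it passes to the pair
  itself.\<close>

lemma fibre_product_lift:
 fixes T :: "'a mfd" and M :: "'a mfd"
 assumes P: "is_fibre_product M N f g P" and T: "manifold T" and ab: "smooth T M a" "smooth T N b"
  "\<And>t. t : points T ==> f (a t) = g (b t)" and N: "manifold N" and M: "manifold M"
 shows "smooth T P (%t. (a t, b t))"
proof -
 have pb: "is_pullback M N f g P fst snd" using P by (simp add: is_fibre_product_def)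
 have mP: "manifold P" using pb by (simp add: is_pullback_def)
 have "manifold T & smooth T M a & smooth T N b & (\<forall>z\<in>points T. f (a z) = g (b z))"
  using T ab by blast
 then have "\<exists>!u. u : extensional (points T) & smooth T P u & (\<forall>z\<in>points T. fst (u z) = a z & snd (u z) = b z)"
  using pb unfolding is_pullback_def by blast
 then obtain u where u: "smooth T P u" "\<forall>z\<in>points T. fst (u z) = a z & snd (u z) = b z" by blast
 show ?thesis
  by (rule sm_cong[OF T mP u(1)]) (use u(2) in \<open>simp add: prod_eq_iff\<close>)
qed

text \<open>A copy of \<open>T\<close> along an injection is an embedded submanifold of
  \<open>T\<close> itself, seen through the inverse of the injection, with a single global
  slice.\<close>

lemma rename_embedded:
 assumes T: "manifold T" and i: "inj i"
 shows "embedded (inv_into (points T) i) (i ` points T) T T"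
proof
 let ?j = "inv_into (points T) i"
 have j: "?j (i t) = t" if "t : points T" for t
  using inv_into_f_f[OF inj_on_subset[OF i subset_UNIV] that] .
 show "inj_on ?j (i ` points T)" by (rule inj_on_inv_into) simp
 show "?j x : points T" if "x : i ` points T" for x using that j by auto
 have sT: "smooth (sub_mfd T (points T)) T (%t. t)"
  by (rule sm_restrict[OF T T openin_topspace sm_ident[OF T]])
 have "slice ?j (i ` points T) T T (points T) (points T) (%t. t) (%t. t)"
  unfolding slice_def using sT j by (auto simp: image_iff intro: rev_bexI)
 then show "\<exists>U R r e. slice ?j (i ` points T) T T U R r e & ?j x : U" if "x : i ` points T" for x
  using that j by (intro exI[of _ "points T"] exI[of _ "points T"] exI[of _ "%t. t"] exI[of _ "%t. t"]) auto
qed (rule T)+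

text \<open>In \<open>is_pullback\<close> the test manifolds have their points in one fixed type. A
  manifold over another type is moved there by an injection before the universal property is
  applied.\<close>

lemma rename_mfd:
 fixes T :: "'t mfd" and i :: "'t => 'p"
 assumes T: "manifold T" and i: "inj i"
 obtains T' :: "'p mfd" and j where "manifold T'" "smooth T' T j" "smooth T T' i"
  "\<And>t. t : points T ==> j (i t) = t"
proof -
 interpret embedded "inv_into (points T) i" "i ` points T" T T by (rule rename_embedded[OF T i])
 have j: "inv_into (points T) i (i t) = t" if "t : points T" for t
  using inv_into_f_f[OF inj_on_subset[OF i subset_UNIV] that] .
 have iE: "smooth T E i"
  by (rule sm_lift[OF T sm_cong[OF T T sm_ident[OF T]]]) (simp_all add: j)
 show thesis by (rule that[OF manifold_E sm_j iE j])
qed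

lemma fibre_mfd_is_fibre_product:
 fixes M :: "'a mfd"
 assumes M: "manifold M" and N: "manifold N" and K: "manifold K" and s: "submersion M N s" and f: "smooth K N f"
 defines "P \<equiv> fibre_mfd {(x, y). x : points M & y : points K & s x = f y} (%p. p) M N K"
 shows "is_fibre_product M K s f P"
proof -
 let ?S = "{(x, y). x : points M & y : points K & s x = f y}"
 have b: "inj_on (%p. p) ?S" "(%p. p) ` ?S = ?S" by auto
 note fib = M N K s f b
 note mP = manifold_fibre[OF fib, folded P_def] and pP = points_fibre[OF fib, folded P_def]
  and prP = smooth_fibre_proj[OF fib, folded P_def]
 show ?thesis
  unfolding is_fibre_product_def is_pullback_def
 proof (intro conjI allI impI pP mP prP ballI)
  show "s (fst z) = f (snd z)" if "z : points P" for z using that unfolding pP by auto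
  fix T :: "'a mfd" and a b'
  assume T: "manifold T & smooth T M a & smooth T K b' & (\<forall>z\<in>points T. s (a z) = f (b' z))"
  let ?u = "\<lambda>t\<in>points T. (a t, b' t)"
  have l: "smooth T P (%t. (a t, b' t))"
   unfolding P_def
  proof (rule smooth_fibre_lift[OF fib])
   show "(a t, b' t) : ?S" if t: "t : points T" for t
    using T t sm_point[OF _ t, of M a] sm_point[OF _ t, of K b'] by simp
  qed (use T in simp_all)
  have mT: "manifold T" using T by blast
  have u: "smooth T P ?u" by (rule sm_cong[OF mT mP l]) simp
  show "\<exists>!u. u : extensional (points T) & smooth T P u & (\<forall>z\<in>points T. fst (u z) = a z & snd (u z) = b' z)"
  proof (rule ex1I[of _ ?u])
   show "?u : extensional (points T) & smooth T P ?u & (\<forall>z\<in>points T. fst (?u z) = a z & snd (?u z) = b' z)"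
    using u by simp
   fix u assume u: "u : extensional (points T) & smooth T P u & (\<forall>z\<in>points T. fst (u z) = a z & snd (u z) = b' z)"
   show "u = ?u"
   proof (rule extensionalityI[of _ "points T"])
    show "u t = ?u t" if "t : points T" for t using u that by (simp add: prod_eq_iff)
   qed (use u in simp_all)
  qed
 qed
qed

section \<open>Lie groupoids\<close>

locale lie_gpd =
 fixes X :: "'p groupoid_data"
 assumes lie: "lie_groupoid X"
begin

lemma mfd_Ob: "manifold (Ob X)" and mfd_Ar: "manifold (Ar X)"
 and sub_sr: "submersion (Ar X) (Ob X) (sr X)" and sub_tg: "submersion (Ar X) (Ob X) (tg X)"
 and smooth_un: "smooth (Ob X) (Ar X) (un X)" and smooth_iv: "smooth (Ar X) (Ar X) (iv X)"
 using lie unfolding lie_groupoid_def by blast+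

lemma smooth_sr: "smooth (Ar X) (Ob X) (sr X)" and smooth_tg: "smooth (Ar X) (Ob X) (tg X)"
 by (rule submersion_smooth[OF sub_sr], rule submersion_smooth[OF sub_tg])

lemma X2_iff: "(ph, pp) : X2 X \<longleftrightarrow> ph : X1 X & pp : X1 X & sr X ph = tg X pp"
 by (simp add: X2_def)

lemma sr_in: "ph : X1 X ==> sr X ph : X0 X" and tg_in: "ph : X1 X ==> tg X ph : X0 X"
 and un_in: "x : X0 X ==> un X x : X1 X" and iv_in: "ph : X1 X ==> iv X ph : X1 X"
 by (rule sm_point[OF smooth_sr] sm_point[OF smooth_tg] sm_point[OF smooth_un]
   sm_point[OF smooth_iv], assumption)+

lemma mu_P:
 obtains P where "is_fibre_product (Ar X) (Ar X) (sr X) (tg X) P" "smooth P (Ar X) (%(ph, pp). mu X ph pp)"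
 using lie unfolding lie_groupoid_def by blast

lemma mu_in: "ph : X1 X ==> pp : X1 X ==> sr X ph = tg X pp ==> mu X ph pp : X1 X"
proof -
 assume *: "ph : X1 X" "pp : X1 X" "sr X ph = tg X pp"
 obtain P where P: "is_fibre_product (Ar X) (Ar X) (sr X) (tg X) P" "smooth P (Ar X) (%(ph, pp). mu X ph pp)"
  by (rule mu_P)
 have "(ph, pp) : points P" using P(1) * unfolding is_fibre_product_def by simp
 from sm_point[OF P(2) this] show ?thesis by simp
qed

lemma sr_un: "x : X0 X ==> sr X (un X x) = x" and tg_un: "x : X0 X ==> tg X (un X x) = x"
 and unit_r: "ph : X1 X ==> mu X ph (un X (sr X ph)) = ph" and unit_l: "ph : X1 X ==> mu X (un X (tg X ph)) ph = ph"
 and sr_iv: "ph : X1 X ==> sr X (iv X ph) = tg X ph" and tg_iv: "ph : X1 X ==> tg X (iv X ph) = sr X ph"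
 and iv_l: "ph : X1 X ==> mu X (iv X ph) ph = un X (sr X ph)" and iv_r: "ph : X1 X ==> mu X ph (iv X ph) = un X (tg X ph)"
 using lie unfolding lie_groupoid_def by blast+

lemma sr_mu: "ph : X1 X ==> pp : X1 X ==> sr X ph = tg X pp ==> sr X (mu X ph pp) = sr X pp"
 and tg_mu: "ph : X1 X ==> pp : X1 X ==> sr X ph = tg X pp ==> tg X (mu X ph pp) = tg X ph"
proof -
 have *: "\<forall>(ph, pp)\<in>X2 X. sr X (mu X ph pp) = sr X pp & tg X (mu X ph pp) = tg X ph"
  using lie unfolding lie_groupoid_def by (elim conjE)
 show "ph : X1 X ==> pp : X1 X ==> sr X ph = tg X pp ==> sr X (mu X ph pp) = sr X pp"
  "ph : X1 X ==> pp : X1 X ==> sr X ph = tg X pp ==> tg X (mu X ph pp) = tg X ph"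
  using bspec[OF *, of "(ph, pp)"] by (simp_all add: X2_iff)
qed

lemma mu_assoc: "ph : X1 X ==> pp : X1 X ==> xi : X1 X ==> sr X ph = tg X pp ==> sr X pp = tg X xi ==>
  mu X (mu X ph pp) xi = mu X ph (mu X pp xi)"
proof -
 have "\<forall>ph pp xi. (ph, pp) : X2 X & (pp, xi) : X2 X --> mu X (mu X ph pp) xi = mu X ph (mu X pp xi)"
  using lie unfolding lie_groupoid_def by (elim conjE)
 then show "ph : X1 X ==> pp : X1 X ==> xi : X1 X ==> sr X ph = tg X pp ==> sr X pp = tg X xi ==>
  mu X (mu X ph pp) xi = mu X ph (mu X pp xi)"
  by (simp add: X2_iff)
qed

lemmas gpd_simps = sr_in tg_in un_in iv_in mu_in sr_un tg_un sr_iv tg_iv sr_mu tg_mu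

lemma unit_r': "ph : X1 X ==> x = sr X ph ==> mu X ph (un X x) = ph"
 and unit_l': "ph : X1 X ==> x = tg X ph ==> mu X (un X x) ph = ph"
 by (simp_all add: unit_r unit_l)

lemma cancel_iv1: "ph : X1 X ==> pp : X1 X ==> sr X ph = tg X pp ==> mu X (iv X ph) (mu X ph pp) = pp"
 using mu_assoc[of "iv X ph" ph pp] by (simp add: gpd_simps iv_l unit_l')

lemma cancel_iv2: "ph : X1 X ==> pp : X1 X ==> tg X ph = tg X pp ==> mu X ph (mu X (iv X ph) pp) = pp"
 using mu_assoc[of ph "iv X ph" pp] by (simp add: gpd_simps iv_r unit_l')

lemma cancel_iv3: "ph : X1 X ==> pp : X1 X ==> sr X ph = tg X pp ==> mu X (mu X ph pp) (iv X pp) = ph"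
 using mu_assoc[of ph pp "iv X pp"] by (simp add: gpd_simps iv_r unit_r')

lemma cancel_iv4: "ph : X1 X ==> pp : X1 X ==> sr X ph = sr X pp ==> mu X (mu X ph (iv X pp)) pp = ph"
 using mu_assoc[of ph "iv X pp" pp] by (simp add: gpd_simps iv_l unit_r')

lemma cancel_l: "ph : X1 X ==> pp : X1 X ==> xi : X1 X ==> sr X ph = tg X pp ==> sr X ph = tg X xi ==>
  mu X ph pp = mu X ph xi ==> pp = xi"
 by (metis cancel_iv1)

lemma cancel_r: "ph : X1 X ==> pp : X1 X ==> xi : X1 X ==> sr X ph = tg X xi ==> sr X pp = tg X xi ==>
  mu X ph xi = mu X pp xi ==> ph = pp"
 by (metis cancel_iv3)

lemma iv_iv: "ph : X1 X ==> iv X (iv X ph) = ph"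
 using cancel_iv1[of "iv X ph" ph] by (simp add: gpd_simps iv_l unit_r')

text \<open>Smoothness of the multiplication is given on some fibre product, known only through its
  universal property for test manifolds over \<open>'p\<close>; hence \<open>T\<close> is first
  replaced by a copy over \<open>'p\<close>.\<close>

lemma smooth_mu:
 fixes T :: "'t mfd" and i :: "'t => 'p"
 assumes T: "manifold T" and i: "inj i" and a: "smooth T (Ar X) a" and b: "smooth T (Ar X) b"
  and ab: "\<And>t. t : points T ==> sr X (a t) = tg X (b t)"
 shows "smooth T (Ar X) (%t. mu X (a t) (b t))"
proof -
 obtain T' :: "'p mfd" and j where T': "manifold T'" and j: "smooth T' T j" and i': "smooth T T' i"
  and ji: "\<And>t. t : points T ==> j (i t) = t" by (rule rename_mfd[OF T i]) (rule that; assumption)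
 obtain P where P: "is_fibre_product (Ar X) (Ar X) (sr X) (tg X) P" "smooth P (Ar X) (%(ph, pp). mu X ph pp)"
  by (rule mu_P)
 have mP: "manifold P" using P(1) by (simp add: is_fibre_product_def is_pullback_def)
 have "smooth T' P (%t. (a (j t), b (j t)))"
  by (rule fibre_product_lift[OF P(1) T' sm_compose'[OF T' T mfd_Ar j a]
     sm_compose'[OF T' T mfd_Ar j b] _ mfd_Ar mfd_Ar]) (rule ab, rule sm_point[OF j])
 from sm_compose'[OF T' mP mfd_Ar this P(2)]
 have m: "smooth T' (Ar X) (%t. mu X (a (j t)) (b (j t)))" by simp
 show ?thesis
  by (rule sm_cong[OF T mfd_Ar sm_compose'[OF T T' mfd_Ar i' m]]) (simp add: ji)
qed

lemma smooth_mu':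
 fixes T :: "'p mfd"
 assumes "manifold T" "smooth T (Ar X) a" "smooth T (Ar X) b" "\<And>t. t : points T ==> sr X (a t) = tg X (b t)"
 shows "smooth T (Ar X) (%t. mu X (a t) (b t))"
 by (rule smooth_mu[OF assms(1) inj_on_id2 assms(2-4)])

end

section \<open>Smooth functors and essential equivalences\<close>

locale smooth_fctr =
 dom: lie_gpd X + cod: lie_gpd Y for X Y :: "'p groupoid_data" +
 fixes f :: "'p functor_data"
 assumes fctr: "smooth_functor X Y f"
begin

lemma smooth0: "smooth (Ob X) (Ob Y) (fst f)" and smooth1: "smooth (Ar X) (Ar Y) (snd f)"
 and ext0: "fst f : extensional (X0 X)" and ext1: "snd f : extensional (X1 X)"
 using fctr by (auto simp: smooth_functor_def split_beta)

lemma f_sr: "ph : X1 X ==> sr Y (snd f ph) = fst f (sr X ph)" and f_tg: "ph : X1 X ==> tg Y (snd f ph) = fst f (tg X ph)"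
 and f_un: "x : X0 X ==> snd f (un X x) = un Y (fst f x)"
 using fctr by (auto simp: smooth_functor_def split_beta)

lemma f_mu: "ph : X1 X ==> pp : X1 X ==> sr X ph = tg X pp ==> snd f (mu X ph pp) = mu Y (snd f ph) (snd f pp)"
proof -
 assume *: "ph : X1 X" "pp : X1 X" "sr X ph = tg X pp"
 have "\<forall>(ph, pp)\<in>X2 X. snd f (mu X ph pp) = mu Y (snd f ph) (snd f pp)"
  using fctr by (simp add: smooth_functor_def split_beta)
 from bspec[OF this, of "(ph, pp)"] * show ?thesis by (simp add: dom.X2_iff)
qed

lemma f0_in: "x : X0 X ==> fst f x : X0 Y" and f1_in: "ph : X1 X ==> snd f ph : X1 Y"
 by (rule sm_point[OF smooth0] sm_point[OF smooth1], assumption)+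

lemmas f_simps = f_sr f_tg f0_in f1_in

end

text \<open>\<open>essential_equivalence\<close> is split into four conditions without fibre
  products. This one and \<open>ess_surjective\<close> say that the target map on arrows out of the
  image is a surjective submersion, in terms of local sections with components \<open>a\<close> and
  \<open>b\<close>; \<open>smoothly_full\<close> and \<open>faithful\<close> are existence and
  uniqueness in the pullback square.\<close>

definition lifts_locally where
 "lifts_locally X Y f \<longleftrightarrow> (\<forall>ph\<in>X1 Y. \<forall>x\<in>X0 X. sr Y ph = fst f x \<longrightarrow>
   (\<exists>V a b. openin (mtop (Ob Y)) V & tg Y ph : V & smooth (sub_mfd (Ob Y) V) (Ar Y) a \<and>
    smooth (sub_mfd (Ob Y) V) (Ob X) b & a (tg Y ph) = ph & b (tg Y ph) = x \<and>
    (\<forall>y\<in>V. sr Y (a y) = fst f (b y) & tg Y (a y) = y)))"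

definition ess_surjective where
 "ess_surjective X Y f \<longleftrightarrow> (\<forall>y\<in>X0 Y. \<exists>ph\<in>X1 Y. \<exists>x\<in>X0 X. sr Y ph = fst f x & tg Y ph = y)"

definition smoothly_full :: "'p groupoid_data => 'p groupoid_data => 'p functor_data => bool" where
 "smoothly_full X Y f \<longleftrightarrow> (\<forall>(T :: 'p mfd) a b c. manifold T & smooth T (Ar Y) a & smooth T (Ob X) b \<and>
   smooth T (Ob X) c & (\<forall>t\<in>points T. sr Y (a t) = fst f (b t) & tg Y (a t) = fst f (c t)) \<longrightarrow>
   (\<exists>u. smooth T (Ar X) u & (\<forall>t\<in>points T. snd f (u t) = a t & sr X (u t) = b t & tg X (u t) = c t)))"

definition faithful where
 "faithful X f \<longleftrightarrow> (\<forall>ph\<in>X1 X. \<forall>pp\<in>X1 X. sr X ph = sr X pp & tg X ph = tg X pp & snd f ph = snd f pp --> ph = pp)"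

context smooth_fctr
begin

lemma smooth_src_tgt: "smooth (Ar X) (prod_mfd (Ob X) (Ob X)) (%ph. (sr X ph, tg X ph))"
 by (rule sm_pair[OF dom.mfd_Ar dom.mfd_Ob dom.mfd_Ob dom.smooth_sr dom.smooth_tg])

lemma ess_equiv_imp:
 assumes "essential_equivalence X Y f"
 shows "lifts_locally X Y f & ess_surjective X Y f & smoothly_full X Y f & faithful X f"
proof -
 obtain P where P: "is_fibre_product (Ar Y) (Ob X) (sr Y) (fst f) P" and PS: "surjective_submersion P (Ob Y) (%(ph, x). tg Y ph)"
  and pb: "is_pullback (Ar Y) (prod_mfd (Ob X) (Ob X)) (%ph. (sr Y ph, tg Y ph)) (map_prod (fst f) (fst f))
    (Ar X) (snd f) (%ph. (sr X ph, tg X ph))"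
  using assms unfolding essential_equivalence_def by blast
 have pP: "points P = {(ph, x). ph : X1 Y & x : X0 X & sr Y ph = fst f x}"
  and mP: "manifold P" and Ps: "smooth P (Ar Y) fst" "smooth P (Ob X) snd"
  using P unfolding is_fibre_product_def is_pullback_def by blast+
 have sP: "submersion P (Ob Y) (%(ph, x). tg Y ph)" and iP: "(%(ph, x). tg Y ph) ` points P = X0 Y"
  using PS by (simp_all add: surjective_submersion_def)
 have 1: "lifts_locally X Y f"
  unfolding lifts_locally_def
 proof (intro ballI impI)
  fix ph x assume *: "ph : X1 Y" "x : X0 X" "sr Y ph = fst f x"
  then have "(ph, x) : points P" unfolding pP by simp
  then obtain V si where V: "openin (mtop (Ob Y)) V" "tg Y ph : V" and si: "smooth (sub_mfd (Ob Y) V) P si"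
   "si (tg Y ph) = (ph, x)" "\<forall>z\<in>V. tg Y (fst (si z)) = z"
   using submersion_has_local_sections[OF mP cod.mfd_Ob sP] unfolding has_local_sections_def split_beta
   by (metis (no_types, lifting) fst_conv)
  have mV: "manifold (sub_mfd (Ob Y) V)" by (rule manifold_sub[OF cod.mfd_Ob V(1)])
  have "sr Y (fst (si y)) = fst f (snd (si y))" if "y : V" for y
  proof -
   have "si y : points P" by (rule sm_point[OF si(1)]) (use that points_sub_mfd[OF V(1)] in simp)
   then show ?thesis unfolding pP by auto
  qed
  then show "\<exists>V a b. openin (mtop (Ob Y)) V & tg Y ph : V & smooth (sub_mfd (Ob Y) V) (Ar Y) a \<and>
    smooth (sub_mfd (Ob Y) V) (Ob X) b & a (tg Y ph) = ph & b (tg Y ph) = x \<and>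
    (\<forall>y\<in>V. sr Y (a y) = fst f (b y) & tg Y (a y) = y)"
   using V si(2,3) sm_compose'[OF mV mP cod.mfd_Ar si(1) Ps(1)] sm_compose'[OF mV mP dom.mfd_Ob si(1) Ps(2)]
   by (intro exI[of _ V] exI[of _ "%y. fst (si y)"] exI[of _ "%y. snd (si y)"]) simp
 qed
 have 2: "ess_surjective X Y f"
  unfolding ess_surjective_def
 proof
  fix y assume "y : X0 Y"
  then obtain p where "p : points P" "y = (%(ph, x). tg Y ph) p" using iP by blast
  then show "\<exists>ph\<in>X1 Y. \<exists>x\<in>X0 X. sr Y ph = fst f x & tg Y ph = y" unfolding pP by auto
 qed
 have ex1: "\<exists>!u. u : extensional (points T) & smooth T (Ar X) u \<and>
   (\<forall>t\<in>points T. snd f (u t) = a t & (sr X (u t), tg X (u t)) = (b t, c t))"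
  if T: "manifold T" and a: "smooth T (Ar Y) a" and b: "smooth T (Ob X) b" and c: "smooth T (Ob X) c"
   and abc: "\<forall>t\<in>points T. sr Y (a t) = fst f (b t) & tg Y (a t) = fst f (c t)" for T :: "'p mfd" and a b c
 proof -
  have "manifold T & smooth T (Ar Y) a & smooth T (prod_mfd (Ob X) (Ob X)) (%t. (b t, c t)) \<and>
    (\<forall>t\<in>points T. (sr Y (a t), tg Y (a t)) = map_prod (fst f) (fst f) (b t, c t))"
   using sm_pair[OF T dom.mfd_Ob dom.mfd_Ob b c] T a abc by simp
  then show ?thesis using pb unfolding is_pullback_def by blast
 qed
 have 3: "smoothly_full X Y f"
  unfolding smoothly_full_def
 proof (intro allI impI)
  fix T :: "'p mfd" and a b c
  assume "manifold T & smooth T (Ar Y) a & smooth T (Ob X) b \<and>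
   smooth T (Ob X) c & (\<forall>t\<in>points T. sr Y (a t) = fst f (b t) & tg Y (a t) = fst f (c t))"
  then have "\<exists>!u. u : extensional (points T) & smooth T (Ar X) u \<and>
   (\<forall>t\<in>points T. snd f (u t) = a t & (sr X (u t), tg X (u t)) = (b t, c t))" by (intro ex1) blast+
  then obtain u where "smooth T (Ar X) u" "\<forall>t\<in>points T. snd f (u t) = a t & (sr X (u t), tg X (u t)) = (b t, c t)" by blast
  then show "\<exists>u. smooth T (Ar X) u & (\<forall>t\<in>points T. snd f (u t) = a t & sr X (u t) = b t & tg X (u t) = c t)" by auto
 qed
 have 4: "faithful X f"
  unfolding faithful_def
 proof (intro ballI impI)
  fix ph pp assume ph: "ph : X1 X" and pp: "pp : X1 X" and eq: "sr X ph = sr X pp & tg X ph = tg X pp & snd f ph = snd f pp"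
  \<comment> \<open>Uniqueness in the pullback is about maps on manifolds, \<open>faithful\<close>
    about two arrows. Constant maps on \<open>Ob X\<close> mediate; they determine their value
    because \<open>sr X ph\<close> is a point of \<open>Ob X\<close>.\<close>
  let ?T = "Ob X"
  note c = sm_const[OF dom.mfd_Ob]
  let ?Q = "%u. u : extensional (points ?T) & smooth ?T (Ar X) u \<and>
   (\<forall>t\<in>points ?T. snd f (u t) = snd f ph & (sr X (u t), tg X (u t)) = (sr X ph, tg X ph))"
  have "\<exists>!u. ?Q u"
   using ph by (intro ex1 dom.mfd_Ob c cod.mfd_Ar dom.mfd_Ob) (simp_all add: f_simps dom.gpd_simps)
  moreover have Q: "?Q (\<lambda>t\<in>points ?T. ze)" if "ze : X1 X" "sr X ze = sr X ph" "tg X ze = tg X ph" "snd f ze = snd f ph" for ze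
   using that sm_cong[OF dom.mfd_Ob dom.mfd_Ar c[OF dom.mfd_Ar that(1)], of "\<lambda>t\<in>points ?T. ze"] by simp
  ultimately have "(\<lambda>t\<in>points ?T. ph) = (\<lambda>t\<in>points ?T. pp)"
   using Q[OF ph] Q[OF pp] eq by (metis (no_types, lifting))
  from fun_cong[OF this, of "sr X ph"] show "ph = pp" using dom.sr_in[OF ph] by simp
 qed
 show ?thesis using 1 2 3 4 by blast
qed

abbreviation arrows_from_image :: "('p \<times> 'p) mfd" where
 "arrows_from_image \<equiv> fibre_mfd {(ph, x). ph : X1 Y & x : X0 X & sr Y ph = fst f x} (%p. p) (Ar Y) (Ob Y) (Ob X)"

lemma arrows_from_image_fib: "inj_on (%p. p) {(ph, x). ph : X1 Y & x : X0 X & sr Y ph = fst f x}"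
 "(%p. p) ` {(ph, x). ph : X1 Y & x : X0 X & sr Y ph = fst f x} = {(ph, x). ph : X1 Y & x : X0 X & sr Y ph = fst f x}"
 by auto

lemmas arrows_from_image_rules = cod.mfd_Ar cod.mfd_Ob dom.mfd_Ob cod.sub_sr smooth0 arrows_from_image_fib

text \<open>The components \<open>a\<close> and \<open>b\<close> of a local lift form a section
  through the given pair. Besides the criterion that follows, the fibre product of (BF3) depends on
  this.\<close>

lemma arrows_from_image_submersion:
 assumes l: "lifts_locally X Y f"
 shows "submersion arrows_from_image (Ob Y) (%p. tg Y (fst p))"
proof -
 let ?P = arrows_from_image
 note fib = arrows_from_image_rules
 note mP = manifold_fibre[OF fib] and pP = points_fibre[OF fib] and prP = smooth_fibre_proj[OF fib]
 have t: "smooth ?P (Ob Y) (%p. tg Y (fst p))"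
  by (rule sm_compose'[OF mP cod.mfd_Ar cod.mfd_Ob prP(1) cod.smooth_tg])
 have "has_local_sections ?P (Ob Y) (%p. tg Y (fst p))"
  unfolding has_local_sections_def
 proof
  fix p assume "p : points ?P"
  then have p: "fst p : X1 Y" "snd p : X0 X" "sr Y (fst p) = fst f (snd p)" unfolding pP by auto
  obtain V a b where V: "openin (mtop (Ob Y)) V" "tg Y (fst p) : V" and a: "smooth (sub_mfd (Ob Y) V) (Ar Y) a"
   and b': "smooth (sub_mfd (Ob Y) V) (Ob X) b" and ab: "a (tg Y (fst p)) = fst p" "b (tg Y (fst p)) = snd p"
   "\<forall>y\<in>V. sr Y (a y) = fst f (b y) & tg Y (a y) = y"
   using l[unfolded lifts_locally_def, rule_format, OF p] by (elim exE conjE) (rule that; assumption)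
  have mV: "manifold (sub_mfd (Ob Y) V)" by (rule manifold_sub[OF cod.mfd_Ob V(1)])
  note pV = points_sub_mfd[OF V(1)]
  have "smooth (sub_mfd (Ob Y) V) ?P (%y. (a y, b y))"
   by (rule smooth_fibre_lift[OF fib mV])
    (use a b' ab(3) sm_point[OF a, unfolded pV] sm_point[OF b', unfolded pV] pV in auto)
  then show "\<exists>V si. openin (mtop (Ob Y)) V & tg Y (fst p) : V & smooth (sub_mfd (Ob Y) V) ?P si \<and>
    si (tg Y (fst p)) = p & (\<forall>z\<in>V. tg Y (fst (si z)) = z)"
   using V ab by (intro exI[of _ V] exI[of _ "%y. (a y, b y)"]) simp
 qed
 from local_sections_submersion[OF mP cod.mfd_Ob t this] show ?thesis .
qed

lemma ess_equivI:
 assumes l: "lifts_locally X Y f" and es: "ess_surjective X Y f" and fu: "smoothly_full X Y f" and fa: "faithful X f"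
 shows "essential_equivalence X Y f"
 unfolding essential_equivalence_def
proof (intro conjI fctr)
 let ?P = arrows_from_image
 note fib = arrows_from_image_rules
 note pP = points_fibre[OF fib]
 have "is_fibre_product (Ar Y) (Ob X) (sr Y) (fst f) ?P"
  by (rule fibre_mfd_is_fibre_product[OF fib(1-5)])
 moreover have "surjective_submersion ?P (Ob Y) (%(ph, x). tg Y ph)"
  unfolding surjective_submersion_def
 proof (intro conjI)
  show "submersion ?P (Ob Y) (%(ph, x). tg Y ph)"
   using arrows_from_image_submersion[OF l] by (simp add: split_beta')
  show "(%(ph, x). tg Y ph) ` points ?P = points (Ob Y)"
   unfolding pP using es cod.tg_in by (force simp: ess_surjective_def image_iff)
 qed
 ultimately show "\<exists>P. is_fibre_product (Ar Y) (Ob X) (sr Y) (fst f) P & surjective_submersion P (Ob Y) (%(ph, x). tg Y ph)"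
  by blast
 show "is_pullback (Ar Y) (prod_mfd (Ob X) (Ob X)) (%ph. (sr Y ph, tg Y ph)) (map_prod (fst f) (fst f))
    (Ar X) (snd f) (%ph. (sr X ph, tg X ph))"
  unfolding is_pullback_def
 proof (intro conjI allI impI dom.mfd_Ar smooth1 smooth_src_tgt ballI)
  show "(sr Y (snd f z), tg Y (snd f z)) = map_prod (fst f) (fst f) (sr X z, tg X z)" if "z : X1 X" for z
   using that by (simp add: f_simps)
  fix T :: "'p mfd" and a bc
  assume T: "manifold T & smooth T (Ar Y) a & smooth T (prod_mfd (Ob X) (Ob X)) bc \<and>
   (\<forall>z\<in>points T. (sr Y (a z), tg Y (a z)) = map_prod (fst f) (fst f) (bc z))"
  have OO: "manifold (prod_mfd (Ob X) (Ob X))" by (rule manifold_prod[OF dom.mfd_Ob dom.mfd_Ob])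
  note bs = sm_compose'[OF _ OO dom.mfd_Ob _ sm_fst_snd(1)[OF dom.mfd_Ob dom.mfd_Ob]]
   sm_compose'[OF _ OO dom.mfd_Ob _ sm_fst_snd(2)[OF dom.mfd_Ob dom.mfd_Ob]]
  have abc: "sr Y (a t) = fst f (fst (bc t)) & tg Y (a t) = fst f (snd (bc t))" if "t : points T" for t
   using T that by (simp add: map_prod_def split_beta)
  obtain u where u: "smooth T (Ar X) u"
   "\<forall>t\<in>points T. snd f (u t) = a t & sr X (u t) = fst (bc t) & tg X (u t) = snd (bc t)"
   using fu[unfolded smoothly_full_def, rule_format, of T a "%t. fst (bc t)" "%t. snd (bc t)"] T abc bs by blast
  show "\<exists>!u. u : extensional (points T) & smooth T (Ar X) u \<and>
    (\<forall>z\<in>points T. snd f (u z) = a z & (sr X (u z), tg X (u z)) = bc z)"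
  proof (rule ex1I[of _ "restrict u (points T)"])
   have su: "smooth T (Ar X) (restrict u (points T))"
    by (rule sm_cong[OF conjunct1[OF T] dom.mfd_Ar u(1)]) simp
   have sz: "snd f (restrict u (points T) z) = a z & (sr X (restrict u (points T) z), tg X (restrict u (points T) z)) = bc z"
    if z: "z : points T" for z
    unfolding restrict_apply'[OF z] using u(2)[rule_format, OF z] by (metis prod.collapse)
   show "restrict u (points T) : extensional (points T) & smooth T (Ar X) (restrict u (points T)) \<and>
    (\<forall>z\<in>points T. snd f (restrict u (points T) z) = a z & (sr X (restrict u (points T) z), tg X (restrict u (points T) z)) = bc z)"
    by (intro conjI restrict_extensional su ballI sz[THEN conjunct1] sz[THEN conjunct2])
   fix u' assume u': "u' : extensional (points T) & smooth T (Ar X) u' \<and>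
    (\<forall>z\<in>points T. snd f (u' z) = a z & (sr X (u' z), tg X (u' z)) = bc z)"
   show "u' = restrict u (points T)"
   proof (rule extensionalityI[of _ "points T"])
    fix t assume t: "t : points T"
    have "u' t : X1 X" "u t : X1 X" by (rule sm_point[OF _ t], use u' u(1) in blast)+
    moreover have "(sr X (u' t), tg X (u' t)) = bc t" "snd f (u' t) = a t" using u' t by blast+
    moreover have "sr X (u t) = fst (bc t)" "tg X (u t) = snd (bc t)" "snd f (u t) = a t" using u(2)[rule_format, OF t] by blast+
    ultimately have "u' t : X1 X" "u t : X1 X" "sr X (u' t) = sr X (u t) & tg X (u' t) = tg X (u t) & snd f (u' t) = snd f (u t)"
     by (simp_all add: prod_eq_iff)
    then have "u' t = u t" by (rule fa[unfolded faithful_def, rule_format])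
    then show "u' t = restrict u (points T) t" using t by simp
   qed (use u' in blast, simp)
  qed
 qed
qed

end

text \<open>A section defined near a point is composed with a second one after shrinking its domain
  to the preimage of the domain of the second.\<close>

lemma sub_preimage:
 assumes M: "manifold M" and N: "manifold N" and V: "openin (mtop M) V" and b: "smooth (sub_mfd M V) N b"
  and V': "openin (mtop N) V'"
 shows "openin (mtop M) {z\<in>V. b z : V'}" "smooth (sub_mfd M {z\<in>V. b z : V'}) (sub_mfd N V') b"
proof -
 have "openin (subtopology (mtop M) V) {z\<in>V. b z : V'}"
  using openin_continuous_map_preimage[OF sm_continuous[OF b] V'] unfolding points_sub_mfd[OF V] by simp
 then show W: "openin (mtop M) {z\<in>V. b z : V'}" using openin_open_subtopology[OF V] by simp
 show "smooth (sub_mfd M {z\<in>V. b z : V'}) (sub_mfd N V') b"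
  by (rule sm_into_sub[OF manifold_sub[OF M W] N V' sm_sub_mono[OF M N V W _ b]]) auto
qed

lemma comp_functor_simps [simp]:
 "x : X0 X ==> fst (comp_functor X g f) x = fst g (fst f x)"
 "ph : X1 X ==> snd (comp_functor X g f) ph = snd g (snd f ph)"
 by (simp_all add: comp_functor_def)

lemma id_functor_simps [simp]:
 "x : X0 X ==> fst (id_functor X) x = x" "ph : X1 X ==> snd (id_functor X) ph = ph"
 by (simp_all add: id_functor_def)

lemma smooth_functorI:
 assumes "fst f : extensional (X0 X)" "snd f : extensional (X1 X)"
  "smooth (Ob X) (Ob Y) (fst f)" "smooth (Ar X) (Ar Y) (snd f)"
  "\<And>ph. ph : X1 X ==> sr Y (snd f ph) = fst f (sr X ph)" "\<And>ph. ph : X1 X ==> tg Y (snd f ph) = fst f (tg X ph)"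
  "\<And>x. x : X0 X ==> snd f (un X x) = un Y (fst f x)"
  "\<And>ph pp. ph : X1 X ==> pp : X1 X ==> sr X ph = tg X pp ==> snd f (mu X ph pp) = mu Y (snd f ph) (snd f pp)"
 shows "smooth_functor X Y f"
 unfolding smooth_functor_def split_beta X2_def using assms by (intro conjI ballI) auto

lemma smooth_functor_comp:
 assumes "smooth_fctr X Y f" "smooth_fctr Y Z g"
 shows "smooth_functor X Z (comp_functor X g f)"
proof -
 interpret F: smooth_fctr X Y f by (rule assms)
 interpret G: smooth_fctr Y Z g by (rule assms)
 show ?thesis
 proof (rule smooth_functorI)
  show "smooth (Ob X) (Ob Z) (fst (comp_functor X g f))"
   by (rule sm_cong[OF F.dom.mfd_Ob G.cod.mfd_Ob
      sm_compose'[OF F.dom.mfd_Ob F.cod.mfd_Ob G.cod.mfd_Ob F.smooth0 G.smooth0]]) simp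
  show "smooth (Ar X) (Ar Z) (snd (comp_functor X g f))"
   by (rule sm_cong[OF F.dom.mfd_Ar G.cod.mfd_Ar
      sm_compose'[OF F.dom.mfd_Ar F.cod.mfd_Ar G.cod.mfd_Ar F.smooth1 G.smooth1]]) simp
 qed (simp_all add: F.dom.gpd_simps F.f_simps G.f_simps F.f_un G.f_un F.f_mu G.f_mu, simp_all add: comp_functor_def)
qed

lemma smooth_functor_id: "lie_gpd X ==> smooth_functor X X (id_functor X)"
proof -
 assume "lie_gpd X"
 then interpret lie_gpd X .
 show ?thesis
 proof (rule smooth_functorI)
  show "smooth (Ob X) (Ob X) (fst (id_functor X))"
   by (rule sm_cong[OF mfd_Ob mfd_Ob sm_ident[OF mfd_Ob]]) simp
  show "smooth (Ar X) (Ar X) (snd (id_functor X))"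
   by (rule sm_cong[OF mfd_Ar mfd_Ar sm_ident[OF mfd_Ar]]) simp
 qed (simp_all add: gpd_simps, simp_all add: id_functor_def)
qed

lemma smooth_fctrI: "lie_groupoid X ==> lie_groupoid Y ==> smooth_functor X Y f ==> smooth_fctr X Y f"
 by (simp add: smooth_fctr_def lie_gpd_def smooth_fctr_axioms_def)

lemma smooth_fctrI': "lie_gpd X ==> lie_gpd Y ==> smooth_functor X Y f ==> smooth_fctr X Y f"
 by (simp add: smooth_fctr_def smooth_fctr_axioms_def)

lemma lifts_locallyE:
 assumes "lifts_locally X Y f" "ph : X1 Y" "x : X0 X" "sr Y ph = fst f x"
 obtains V a b where "openin (mtop (Ob Y)) V" "tg Y ph : V" "smooth (sub_mfd (Ob Y) V) (Ar Y) a"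
  "smooth (sub_mfd (Ob Y) V) (Ob X) b" "a (tg Y ph) = ph" "b (tg Y ph) = x"
  "\<forall>y\<in>V. sr Y (a y) = fst f (b y) & tg Y (a y) = y"
proof -
 from assms(1)[unfolded lifts_locally_def, rule_format, OF assms(2-4)] show thesis
  by (elim exE conjE) (rule that; assumption)
qed

lemma smoothly_fullE:
 fixes T :: "'p mfd" and X :: "'p groupoid_data"
 assumes "smoothly_full X Y f" "manifold T" "smooth T (Ar Y) a" "smooth T (Ob X) b" "smooth T (Ob X) c"
  "\<And>t. t : points T ==> sr Y (a t) = fst f (b t) & tg Y (a t) = fst f (c t)"
 obtains u where "smooth T (Ar X) u" "\<forall>t\<in>points T. snd f (u t) = a t & sr X (u t) = b t & tg X (u t) = c t"
proof -
 have "\<exists>u. smooth T (Ar X) u & (\<forall>t\<in>points T. snd f (u t) = a t & sr X (u t) = b t & tg X (u t) = c t)"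
  using assms(1)[unfolded smoothly_full_def, rule_format, of T a b c] assms(2-6) by blast
 then show thesis using that by blast
qed

lemma faithfulD: "faithful X f ==> ph : X1 X ==> pp : X1 X ==> sr X ph = sr X pp ==> tg X ph = tg X pp ==>
  snd f ph = snd f pp ==> ph = pp"
 by (simp add: faithful_def)

lemma ess_equiv_comp:
 assumes Ff: "smooth_fctr X Y f" and Gf: "smooth_fctr Y Z g"
  and f: "essential_equivalence X Y f" and g: "essential_equivalence Y Z g"
 shows "essential_equivalence X Z (comp_functor X g f)"
proof -
 interpret F: smooth_fctr X Y f by (rule Ff)
 interpret G: smooth_fctr Y Z g by (rule Gf)
 interpret GF: smooth_fctr X Z "comp_functor X g f"
  by (rule smooth_fctrI'[OF F.dom.lie_gpd_axioms G.cod.lie_gpd_axioms smooth_functor_comp[OF Ff Gf]])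
 have fl: "lifts_locally X Y f" and fe: "ess_surjective X Y f" and ff: "smoothly_full X Y f" and fa: "faithful X f"
  using F.ess_equiv_imp[OF f] by auto
 have gl: "lifts_locally Y Z g" and ge: "ess_surjective Y Z g" and gf: "smoothly_full Y Z g" and ga: "faithful Y g"
  using G.ess_equiv_imp[OF g] by auto
 show ?thesis
 proof (rule GF.ess_equivI)
  show "lifts_locally X Z (comp_functor X g f)"
   unfolding lifts_locally_def
  proof (intro ballI impI)
   fix ph x assume ph: "ph : X1 Z" and x: "x : X0 X" and s: "sr Z ph = fst (comp_functor X g f) x"
   obtain V a b where V: "openin (mtop (Ob Z)) V" "tg Z ph : V" and a: "smooth (sub_mfd (Ob Z) V) (Ar Z) a"
    and b: "smooth (sub_mfd (Ob Z) V) (Ob Y) b" and at: "a (tg Z ph) = ph" "b (tg Z ph) = fst f x"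
    and ab: "\<forall>y\<in>V. sr Z (a y) = fst g (b y) & tg Z (a y) = y"
    by (rule lifts_locallyE[OF gl ph F.f0_in[OF x]]) (use s x in simp)
   \<comment> \<open>The lift of \<open>ph\<close> through \<open>g\<close> moves in objects of
     \<open>Y\<close> near \<open>fst f x\<close>; these are lifted through \<open>f\<close>
     starting from the unit at \<open>fst f x\<close>, so that the product of both lifts still
     passes through \<open>ph\<close>.\<close>
   have u: "un Y (fst f x) : X1 Y" "sr Y (un Y (fst f x)) = fst f x" "tg Y (un Y (fst f x)) = fst f x"
    using x by (simp_all add: F.f_simps F.cod.gpd_simps)
   obtain V' a' b' where V': "openin (mtop (Ob Y)) V'" "tg Y (un Y (fst f x)) : V'"
    and a': "smooth (sub_mfd (Ob Y) V') (Ar Y) a'" and b': "smooth (sub_mfd (Ob Y) V') (Ob X) b'"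
    and at': "a' (tg Y (un Y (fst f x))) = un Y (fst f x)" "b' (tg Y (un Y (fst f x))) = x"
    and ab': "\<forall>y\<in>V'. sr Y (a' y) = fst f (b' y) & tg Y (a' y) = y"
    by (rule lifts_locallyE[OF fl u(1) x u(2)])
   let ?W = "{z\<in>V. b z : V'}"
   note W = sub_preimage[OF G.cod.mfd_Ob F.cod.mfd_Ob V(1) b V'(1)]
   have mW: "manifold (sub_mfd (Ob Z) ?W)" by (rule manifold_sub[OF G.cod.mfd_Ob W(1)])
   have mV': "manifold (sub_mfd (Ob Y) V')" by (rule manifold_sub[OF F.cod.mfd_Ob V'(1)])
   have pW: "points (sub_mfd (Ob Z) ?W) = ?W" by (rule points_sub_mfd[OF W(1)])
   have a'b: "smooth (sub_mfd (Ob Z) ?W) (Ar Y) (%z. a' (b z))"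
    by (rule sm_compose'[OF mW mV' F.cod.mfd_Ar W(2) a'])
   have b'b: "smooth (sub_mfd (Ob Z) ?W) (Ob X) (%z. b' (b z))"
    by (rule sm_compose'[OF mW mV' F.dom.mfd_Ob W(2) b'])
   have aW: "smooth (sub_mfd (Ob Z) ?W) (Ar Z) a"
    by (rule sm_sub_mono[OF G.cod.mfd_Ob G.cod.mfd_Ar V(1) W(1) _ a]) auto
   have ga'b: "smooth (sub_mfd (Ob Z) ?W) (Ar Z) (%z. snd g (a' (b z)))"
    by (rule sm_compose'[OF mW F.cod.mfd_Ar G.cod.mfd_Ar a'b G.smooth1])
   have in1: "a z : X1 Z" "a' (b z) : X1 Y" "b' (b z) : X0 X" if "z : ?W" for z
    using sm_point[OF aW, unfolded pW] sm_point[OF a'b, unfolded pW] sm_point[OF b'b, unfolded pW] that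
    by blast+
   have m: "smooth (sub_mfd (Ob Z) ?W) (Ar Z) (%z. mu Z (a z) (snd g (a' (b z))))"
    by (rule G.cod.smooth_mu'[OF mW aW ga'b]) (use in1 ab ab' pW in \<open>simp add: G.f_simps\<close>)
   have "mu Z (a (tg Z ph)) (snd g (a' (b (tg Z ph)))) = ph"
    using at at' u x s ph by (simp add: G.f_un F.f_simps G.cod.unit_r')
   moreover have "sr Z (mu Z (a z) (snd g (a' (b z)))) = fst (comp_functor X g f) (b' (b z)) & tg Z (mu Z (a z) (snd g (a' (b z)))) = z"
    if "z : ?W" for z
    using in1[OF that] that ab ab' by (simp add: G.cod.gpd_simps G.f_simps)
   ultimately show "\<exists>V a b. openin (mtop (Ob Z)) V & tg Z ph : V & smooth (sub_mfd (Ob Z) V) (Ar Z) a \<and>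
    smooth (sub_mfd (Ob Z) V) (Ob X) b & a (tg Z ph) = ph & b (tg Z ph) = x \<and>
    (\<forall>y\<in>V. sr Z (a y) = fst (comp_functor X g f) (b y) & tg Z (a y) = y)"
    using W(1) V(2) V'(2) at at' u m b'b
    by (intro exI[of _ ?W] exI[of _ "%z. mu Z (a z) (snd g (a' (b z)))"] exI[of _ "%z. b' (b z)"]) simp
  qed
  show "ess_surjective X Z (comp_functor X g f)"
   unfolding ess_surjective_def
  proof
   fix z assume "z : X0 Z"
   then obtain ph y where ph: "ph : X1 Z" "y : X0 Y" "sr Z ph = fst g y" "tg Z ph = z" using ge unfolding ess_surjective_def by blast
   then obtain pp x where pp: "pp : X1 Y" "x : X0 X" "sr Y pp = fst f x" "tg Y pp = y" using fe unfolding ess_surjective_def by blast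
   show "\<exists>ph\<in>X1 Z. \<exists>x\<in>X0 X. sr Z ph = fst (comp_functor X g f) x & tg Z ph = z"
    using ph pp by (intro bexI[of _ "mu Z ph (snd g pp)"] bexI[of _ x]) (simp_all add: G.cod.gpd_simps G.f_simps)
  qed
  show "smoothly_full X Z (comp_functor X g f)"
   unfolding smoothly_full_def
  proof (intro allI impI)
   fix T :: "'a mfd" and a b c
   assume "manifold T & smooth T (Ar Z) a & smooth T (Ob X) b & smooth T (Ob X) c \<and>
    (\<forall>t\<in>points T. sr Z (a t) = fst (comp_functor X g f) (b t) & tg Z (a t) = fst (comp_functor X g f) (c t))"
   then have T: "manifold T" and a: "smooth T (Ar Z) a" and b: "smooth T (Ob X) b" and c: "smooth T (Ob X) c"
    and abc: "\<forall>t\<in>points T. sr Z (a t) = fst (comp_functor X g f) (b t) & tg Z (a t) = fst (comp_functor X g f) (c t)"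
    by blast+
   have bc: "b t : X0 X" "c t : X0 X" if "t : points T" for t
    using sm_point[OF b that] sm_point[OF c that] .
   obtain u where u: "smooth T (Ar Y) u"
    "\<forall>t\<in>points T. snd g (u t) = a t & sr Y (u t) = fst f (b t) & tg Y (u t) = fst f (c t)"
    by (rule smoothly_fullE[OF gf T a sm_compose'[OF T F.dom.mfd_Ob F.cod.mfd_Ob b F.smooth0]
       sm_compose'[OF T F.dom.mfd_Ob F.cod.mfd_Ob c F.smooth0]]) (use abc bc in simp)
   obtain u' where u': "smooth T (Ar X) u'"
    "\<forall>t\<in>points T. snd f (u' t) = u t & sr X (u' t) = b t & tg X (u' t) = c t"
    by (rule smoothly_fullE[OF ff T u(1) b c]) (use u(2) in simp)
   show "\<exists>u. smooth T (Ar X) u & (\<forall>t\<in>points T. snd (comp_functor X g f) (u t) = a t & sr X (u t) = b t & tg X (u t) = c t)"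
    using u(2) u' sm_point[OF u'(1)] by (intro exI[of _ u']) simp
  qed
  show "faithful X (comp_functor X g f)"
   unfolding faithful_def
  proof (intro ballI impI)
   fix ph pp assume phpp: "ph : X1 X" "pp : X1 X"
    and eq: "sr X ph = sr X pp & tg X ph = tg X pp & snd (comp_functor X g f) ph = snd (comp_functor X g f) pp"
   have "snd f ph = snd f pp"
    by (rule faithfulD[OF ga]) (use phpp eq in \<open>simp_all add: F.f_simps\<close>)
   then show "ph = pp" using faithfulD[OF fa phpp] eq by simp
  qed
 qed
qed

section \<open>Natural transformations\<close>

locale nat_trans =
 F: smooth_fctr X Y f + G: smooth_fctr X Y g for X Y :: "'p groupoid_data" and f g +
 fixes ta :: "'p => 'p"
 assumes nat: "smooth_nat_trans X Y f g ta"
begin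

lemma smooth_ta: "smooth (Ob X) (Ar Y) ta" and ext_ta: "ta : extensional (X0 X)"
 and ta_sr: "x : X0 X ==> sr Y (ta x) = fst f x" and ta_tg: "x : X0 X ==> tg Y (ta x) = fst g x"
 and ta_nat: "ph : X1 X ==> mu Y (ta (tg X ph)) (snd f ph) = mu Y (snd g ph) (ta (sr X ph))"
 using nat unfolding smooth_nat_trans_def by blast+

lemma ta_in: "x : X0 X ==> ta x : X1 Y"
 by (rule sm_point[OF smooth_ta])

lemmas ta_simps = ta_sr ta_tg ta_in

lemma smooth_ta_comp: "manifold T ==> smooth T (Ob X) a ==> smooth T (Ar Y) (%t. ta (a t))"
 using sm_compose'[OF _ F.dom.mfd_Ob F.cod.mfd_Ar _ smooth_ta] .

lemma smooth_iv_ta_comp: "manifold T ==> smooth T (Ob X) a ==> smooth T (Ar Y) (%t. iv Y (ta (a t)))"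
 using sm_compose'[OF _ F.cod.mfd_Ar F.cod.mfd_Ar smooth_ta_comp F.cod.smooth_iv] .

end

lemma nat_transI: "smooth_fctr X Y f ==> smooth_fctr X Y g ==> smooth_nat_trans X Y f g ta ==> nat_trans X Y f g ta"
 by (simp add: nat_trans_def nat_trans_axioms_def)

text \<open>Conjugation with \<open>ta\<close> turns the action of \<open>f\<close> on arrows into
  that of \<open>g\<close>. Lifts through \<open>f\<close> are lifts through \<open>g\<close>, with
  the arrow shifted by the inverse of \<open>ta\<close> before and by \<open>ta\<close>
  after.\<close>

lemma (in nat_trans) ess_equiv_iso:
 assumes g: "essential_equivalence X Y g" shows "essential_equivalence X Y f"
proof -
 have gl: "lifts_locally X Y g" and ge: "ess_surjective X Y g" and gf: "smoothly_full X Y g" and ga: "faithful X g"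
  using G.ess_equiv_imp[OF g] by auto
 have conj_f: "mu Y (ta (tg X ph)) (mu Y (snd f ph) (iv Y (ta (sr X ph)))) = snd g ph" if "ph : X1 X" for ph
  using that F.cod.mu_assoc[of "ta (tg X ph)" "snd f ph" "iv Y (ta (sr X ph))"] ta_nat[OF that] F.cod.cancel_iv3[of "snd g ph" "ta (sr X ph)"]
  by (simp add: ta_simps F.f_simps G.f_simps F.dom.gpd_simps F.cod.gpd_simps)
 show ?thesis
 proof (rule F.ess_equivI)
  show "lifts_locally X Y f"
   unfolding lifts_locally_def
  proof (intro ballI impI)
   fix ph x assume ph: "ph : X1 Y" and x: "x : X0 X" and s: "sr Y ph = fst f x"
   let ?ph = "mu Y ph (iv Y (ta x))"
   have ph': "?ph : X1 Y" "sr Y ?ph = fst g x" "tg Y ?ph = tg Y ph"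
    using ph x s by (simp_all add: ta_simps F.cod.gpd_simps)
   obtain V a b where V: "openin (mtop (Ob Y)) V" "tg Y ?ph : V" and a: "smooth (sub_mfd (Ob Y) V) (Ar Y) a"
    and b: "smooth (sub_mfd (Ob Y) V) (Ob X) b" and at: "a (tg Y ?ph) = ?ph" "b (tg Y ?ph) = x"
    and ab: "\<forall>y\<in>V. sr Y (a y) = fst g (b y) & tg Y (a y) = y"
    by (rule lifts_locallyE[OF gl ph'(1) x ph'(2)])
   have mV: "manifold (sub_mfd (Ob Y) V)" by (rule manifold_sub[OF F.cod.mfd_Ob V(1)])
   have pV: "points (sub_mfd (Ob Y) V) = V" by (rule points_sub_mfd[OF V(1)])
   have in1: "a y : X1 Y" "b y : X0 X" if "y : V" for y
    using sm_point[OF a, unfolded pV] sm_point[OF b, unfolded pV] that by blast+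
   have m: "smooth (sub_mfd (Ob Y) V) (Ar Y) (%y. mu Y (a y) (ta (b y)))"
    by (rule F.cod.smooth_mu'[OF mV a smooth_ta_comp[OF mV b]]) (use in1 ab pV in \<open>simp add: ta_simps\<close>)
   have "mu Y (a (tg Y ph)) (ta (b (tg Y ph))) = ph"
    using at ph' ph x s by (simp add: F.cod.cancel_iv4 ta_simps)
   moreover have "sr Y (mu Y (a y) (ta (b y))) = fst f (b y) & tg Y (mu Y (a y) (ta (b y))) = y" if "y : V" for y
    using in1[OF that] that ab by (simp add: F.cod.gpd_simps ta_simps)
   ultimately show "\<exists>V a b. openin (mtop (Ob Y)) V & tg Y ph : V & smooth (sub_mfd (Ob Y) V) (Ar Y) a \<and>
    smooth (sub_mfd (Ob Y) V) (Ob X) b & a (tg Y ph) = ph & b (tg Y ph) = x \<and>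
    (\<forall>y\<in>V. sr Y (a y) = fst f (b y) & tg Y (a y) = y)"
    using V at ph' m b
    by (intro exI[of _ V] exI[of _ "%y. mu Y (a y) (ta (b y))"] exI[of _ b]) simp
  qed
  show "ess_surjective X Y f"
   unfolding ess_surjective_def
  proof
   fix y assume "y : X0 Y"
   then obtain ph x where ph: "ph : X1 Y" "x : X0 X" "sr Y ph = fst g x" "tg Y ph = y" using ge unfolding ess_surjective_def by blast
   show "\<exists>ph\<in>X1 Y. \<exists>x\<in>X0 X. sr Y ph = fst f x & tg Y ph = y"
    using ph by (intro bexI[of _ "mu Y ph (ta x)"] bexI[of _ x]) (simp_all add: ta_simps F.cod.gpd_simps)
  qed
  show "smoothly_full X Y f"
   unfolding smoothly_full_def
  proof (intro allI impI)
   fix T :: "'p mfd" and a b c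
   assume "manifold T & smooth T (Ar Y) a & smooth T (Ob X) b & smooth T (Ob X) c \<and>
    (\<forall>t\<in>points T. sr Y (a t) = fst f (b t) & tg Y (a t) = fst f (c t))"
   then have T: "manifold T" and a: "smooth T (Ar Y) a" and b: "smooth T (Ob X) b" and c: "smooth T (Ob X) c"
    and abc: "\<forall>t\<in>points T. sr Y (a t) = fst f (b t) & tg Y (a t) = fst f (c t)"
    by blast+
   have bc: "b t : X0 X" "c t : X0 X" "a t : X1 Y" if "t : points T" for t
    using sm_point[OF b that] sm_point[OF c that] sm_point[OF a that] .
   have 1: "smooth T (Ar Y) (%t. mu Y (a t) (iv Y (ta (b t))))"
    by (rule F.cod.smooth_mu'[OF T a smooth_iv_ta_comp[OF T b]]) (use bc abc in \<open>simp add: ta_simps F.cod.gpd_simps\<close>)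
   have 2: "smooth T (Ar Y) (%t. mu Y (ta (c t)) (mu Y (a t) (iv Y (ta (b t)))))"
    by (rule F.cod.smooth_mu'[OF T smooth_ta_comp[OF T c] 1]) (use bc abc in \<open>simp add: ta_simps F.cod.gpd_simps\<close>)
   obtain u where u: "smooth T (Ar X) u"
    "\<forall>t\<in>points T. snd g (u t) = mu Y (ta (c t)) (mu Y (a t) (iv Y (ta (b t)))) & sr X (u t) = b t & tg X (u t) = c t"
    by (rule smoothly_fullE[OF gf T 2 b c]) (use bc abc in \<open>simp add: ta_simps F.cod.gpd_simps\<close>)
   have "snd f (u t) = a t" if t: "t : points T" for t
   proof -
    have ut: "u t : X1 X" "sr X (u t) = b t" "tg X (u t) = c t" using sm_point[OF u(1) t] u(2) t by blast+
    have "mu Y (ta (c t)) (mu Y (snd f (u t)) (iv Y (ta (b t)))) = mu Y (ta (c t)) (mu Y (a t) (iv Y (ta (b t))))"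
     using conj_f[OF ut(1)] u(2) t ut by simp
    then have "mu Y (snd f (u t)) (iv Y (ta (b t))) = mu Y (a t) (iv Y (ta (b t)))"
     by (rule F.cod.cancel_l[rotated -1]) (use bc[OF t] ut abc t in \<open>simp_all add: ta_simps F.cod.gpd_simps F.f_simps\<close>)
    then show ?thesis
     by (rule F.cod.cancel_r[rotated -1]) (use bc[OF t] ut abc t in \<open>simp_all add: ta_simps F.cod.gpd_simps F.f_simps\<close>)
   qed
   then show "\<exists>u. smooth T (Ar X) u & (\<forall>t\<in>points T. snd f (u t) = a t & sr X (u t) = b t & tg X (u t) = c t)"
    using u by (intro exI[of _ u]) simp
  qed
  show "faithful X f"
   unfolding faithful_def
  proof (intro ballI impI)
   fix ph pp assume phpp: "ph : X1 X" "pp : X1 X"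
    and eq: "sr X ph = sr X pp & tg X ph = tg X pp & snd f ph = snd f pp"
   then have "snd g ph = snd g pp" using conj_f[OF phpp(1)] conj_f[OF phpp(2)] by simp
   then show "ph = pp" using faithfulD[OF ga phpp] eq by simp
  qed
 qed
qed

text \<open>A functor with an inverse up to isomorphism: a lift through a given arrow is obtained from the
  global one given by the counit, corrected by a local section of the source map.\<close>

lemma quasi_inverse_ess_equiv:
 fixes X Y :: "'p groupoid_data"
 assumes Ff: "smooth_fctr X Y f" and Gf: "smooth_fctr Y X g"
  and et: "smooth_nat_trans X X (comp_functor X g f) (id_functor X) et"
  and ep: "smooth_nat_trans Y Y (comp_functor Y f g) (id_functor Y) ep"
 shows "essential_equivalence X Y f"
proof -
 interpret F: smooth_fctr X Y f by (rule Ff)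
 interpret G: smooth_fctr Y X g by (rule Gf)
 interpret N: nat_trans X X "comp_functor X g f" "id_functor X" et
  by (rule nat_transI[OF smooth_fctrI'[OF F.dom.lie_gpd_axioms F.dom.lie_gpd_axioms smooth_functor_comp[OF Ff Gf]]
     smooth_fctrI'[OF F.dom.lie_gpd_axioms F.dom.lie_gpd_axioms smooth_functor_id[OF F.dom.lie_gpd_axioms]] et])
 interpret E: nat_trans Y Y "comp_functor Y f g" "id_functor Y" ep
  by (rule nat_transI[OF smooth_fctrI'[OF F.cod.lie_gpd_axioms F.cod.lie_gpd_axioms smooth_functor_comp[OF Gf Ff]]
     smooth_fctrI'[OF F.cod.lie_gpd_axioms F.cod.lie_gpd_axioms smooth_functor_id[OF F.cod.lie_gpd_axioms]] ep])
 have et: "et x : X1 X" "sr X (et x) = fst g (fst f x)" "tg X (et x) = x" if "x : X0 X" for x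
  using N.ta_in[OF that] N.ta_sr[OF that] N.ta_tg[OF that] that by simp_all
 have ep: "ep y : X1 Y" "sr Y (ep y) = fst f (fst g y)" "tg Y (ep y) = y" if "y : X0 Y" for y
  using E.ta_in[OF that] E.ta_sr[OF that] E.ta_tg[OF that] that by simp_all
 have etnat: "mu X (et (tg X ph)) (snd g (snd f ph)) = mu X ph (et (sr X ph))" if "ph : X1 X" for ph
  using N.ta_nat[OF that] that by simp
 have epnat: "mu Y (ep (tg Y ph)) (snd f (snd g ph)) = mu Y ph (ep (sr Y ph))" if "ph : X1 Y" for ph
  using E.ta_nat[OF that] that by simp
 \<comment> \<open>Naturality of the unit determines an arrow by its image under \<open>f\<close>
   and then \<open>g\<close> together with its end points; in the same way the counit makes
   \<open>g\<close> faithful, which fullness of \<open>f\<close> will need.\<close>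
 have fa: "ph = pp" if "ph : X1 X" "pp : X1 X" "sr X ph = sr X pp" "tg X ph = tg X pp" "snd f ph = snd f pp" for ph pp
  by (rule F.dom.cancel_r[of _ _ "et (sr X ph)"])
   (use that etnat[OF that(1)] etnat[OF that(2)] et[OF F.dom.sr_in[OF that(1)]] in simp_all)
 have ga: "ph = pp" if "ph : X1 Y" "pp : X1 Y" "sr Y ph = sr Y pp" "tg Y ph = tg Y pp" "snd g ph = snd g pp" for ph pp
  by (rule F.cod.cancel_r[of _ _ "ep (sr Y ph)"])
   (use that epnat[OF that(1)] epnat[OF that(2)] ep[OF F.cod.sr_in[OF that(1)]] in simp_all)
 have full: "smoothly_full X Y f"
  unfolding smoothly_full_def
 proof (intro allI impI)
  fix T :: "'p mfd" and a b c
  assume "manifold T & smooth T (Ar Y) a & smooth T (Ob X) b & smooth T (Ob X) c \<and>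
   (\<forall>t\<in>points T. sr Y (a t) = fst f (b t) & tg Y (a t) = fst f (c t))"
  then have T: "manifold T" and a: "smooth T (Ar Y) a" and b: "smooth T (Ob X) b" and c: "smooth T (Ob X) c"
   and abc: "\<forall>t\<in>points T. sr Y (a t) = fst f (b t) & tg Y (a t) = fst f (c t)"
   by blast+
  have bc: "b t : X0 X" "c t : X0 X" "a t : X1 Y" if "t : points T" for t
   using sm_point[OF b that] sm_point[OF c that] sm_point[OF a that] .
  have 1: "smooth T (Ar X) (%t. mu X (snd g (a t)) (iv X (et (b t))))"
   by (rule F.dom.smooth_mu'[OF T sm_compose'[OF T F.cod.mfd_Ar F.dom.mfd_Ar a G.smooth1] N.smooth_iv_ta_comp[OF T b]])
    (use bc abc in \<open>simp add: et F.dom.gpd_simps G.f_simps\<close>)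
  \<comment> \<open>The arrow that naturality of the unit forces: its image under \<open>f\<close>
    and then \<open>g\<close> is that of \<open>a t\<close> under \<open>g\<close>, and faithfulness
    of \<open>g\<close> removes the \<open>g\<close>.\<close>
  let ?u = "%t. mu X (et (c t)) (mu X (snd g (a t)) (iv X (et (b t))))"
  have 2: "smooth T (Ar X) ?u"
   by (rule F.dom.smooth_mu'[OF T N.smooth_ta_comp[OF T c] 1]) (use bc abc in \<open>simp add: et F.dom.gpd_simps G.f_simps\<close>)
  have "snd f (?u t) = a t & sr X (?u t) = b t & tg X (?u t) = c t" if t: "t : points T" for t
  proof -
   note abct = bc[OF t] abc[rule_format, OF t]
   have ga': "snd g (a t) : X1 X" "sr X (snd g (a t)) = fst g (fst f (b t))" "tg X (snd g (a t)) = fst g (fst f (c t))"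
    using abct by (simp_all add: G.f_simps)
   have gi: "mu X (snd g (a t)) (iv X (et (b t))) : X1 X" "sr X (mu X (snd g (a t)) (iv X (et (b t)))) = b t"
    "tg X (mu X (snd g (a t)) (iv X (et (b t)))) = fst g (fst f (c t))"
    using abct ga' by (simp_all add: et F.dom.gpd_simps)
   have u: "?u t : X1 X" "sr X (?u t) = b t" "tg X (?u t) = c t"
    using abct gi by (simp_all add: et F.dom.gpd_simps)
   have "mu X (et (c t)) (snd g (snd f (?u t))) = mu X (?u t) (et (b t))"
    using etnat[OF u(1)] u(2,3) by simp
   also have "\<dots> = mu X (et (c t)) (mu X (mu X (snd g (a t)) (iv X (et (b t)))) (et (b t)))"
    using abct gi by (intro F.dom.mu_assoc) (simp_all add: et)
   also have "mu X (mu X (snd g (a t)) (iv X (et (b t)))) (et (b t)) = snd g (a t)"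
    using abct ga' by (intro F.dom.cancel_iv4) (simp_all add: et)
   finally have "snd g (snd f (?u t)) = snd g (a t)"
    by (rule F.dom.cancel_l[rotated -1]) (use abct ga' u in \<open>simp_all add: et G.f_simps F.f_simps\<close>)
   from _ _ _ _ this have "snd f (?u t) = a t"
    by (rule ga) (use abct u in \<open>simp_all add: F.f_simps\<close>)
   then show ?thesis using u by blast
  qed
  with 2 show "\<exists>u. smooth T (Ar X) u & (\<forall>t\<in>points T. snd f (u t) = a t & sr X (u t) = b t & tg X (u t) = c t)"
   by blast
 qed
 show ?thesis
 proof (rule F.ess_equivI[OF _ _ full])
  show "faithful X f" unfolding faithful_def using fa by blast
  show "ess_surjective X Y f"
   unfolding ess_surjective_def
  proof
   fix y assume "y : X0 Y"
   then show "\<exists>ph\<in>X1 Y. \<exists>x\<in>X0 X. sr Y ph = fst f x & tg Y ph = y"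
    by (intro bexI[of _ "ep y"] bexI[of _ "fst g y"]) (simp_all add: ep G.f_simps)
  qed
  show "lifts_locally X Y f"
   unfolding lifts_locally_def
  proof (intro ballI impI)
   fix ph x assume ph: "ph : X1 Y" and x: "x : X0 X" and s: "sr Y ph = fst f x"
   let ?y = "tg Y ph"
   \<comment> \<open>\<open>ep ?y\<close> is a lift with end point \<open>?y\<close>, but not the
     prescribed \<open>ph\<close>; \<open>?pp\<close> is the discrepancy. It is the image of an
     arrow \<open>p\<close> of \<open>X\<close>, and a local section of the source map through
     \<open>p\<close> spreads the correction to nearby points.\<close>
   let ?pp = "mu Y (iv Y ph) (ep ?y)"
   have y: "?y : X0 Y" "fst g ?y : X0 X" using ph by (simp_all add: F.cod.gpd_simps G.f_simps)
   have pp: "?pp : X1 Y" "sr Y ?pp = fst f (fst g ?y)" "tg Y ?pp = fst f x"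
    using ph s y by (simp_all add: ep F.cod.gpd_simps)
   \<comment> \<open>Fullness speaks of families of arrows; the constant family over
     \<open>Ob X\<close>, evaluated at \<open>x\<close>, yields a single arrow.\<close>
   note const = sm_const[OF F.dom.mfd_Ob]
   obtain u where u: "smooth (Ob X) (Ar X) u" "\<forall>t\<in>X0 X. snd f (u t) = ?pp & sr X (u t) = fst g ?y & tg X (u t) = x"
    by (rule smoothly_fullE[OF full F.dom.mfd_Ob const[OF F.cod.mfd_Ar pp(1)] const[OF F.dom.mfd_Ob y(2)] const[OF F.dom.mfd_Ob x]])
     (use pp in simp)
   define p where "p = u x"
   have p: "p : X1 X" "snd f p = ?pp" "sr X p = fst g ?y" "tg X p = x"
    using u(2) x sm_point[OF u(1) x] by (simp_all add: p_def)
   obtain V si where V: "openin (mtop (Ob X)) V" "sr X p : V" and si: "smooth (sub_mfd (Ob X) V) (Ar X) si" "si (sr X p) = p"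
    and ssi: "\<forall>z\<in>V. sr X (si z) = z"
    using submersion_has_local_sections[OF F.dom.mfd_Ar F.dom.mfd_Ob F.dom.sub_sr] p(1) unfolding has_local_sections_def by blast
   let ?W = "{y\<in>X0 Y. fst g y : V}"
   have W: "openin (mtop (Ob Y)) ?W" by (rule openin_continuous_map_preimage[OF sm_continuous[OF G.smooth0] V(1)])
   have mW: "manifold (sub_mfd (Ob Y) ?W)" by (rule manifold_sub[OF F.cod.mfd_Ob W])
   have mV: "manifold (sub_mfd (Ob X) V)" by (rule manifold_sub[OF F.dom.mfd_Ob V(1)])
   have pW: "points (sub_mfd (Ob Y) ?W) = ?W" by (rule points_sub_mfd[OF W])
   have gW: "smooth (sub_mfd (Ob Y) ?W) (sub_mfd (Ob X) V) (fst g)"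
    by (rule sm_into_sub[OF mW F.dom.mfd_Ob V(1) sm_restrict[OF F.cod.mfd_Ob F.dom.mfd_Ob W G.smooth0]]) simp
   have sig: "smooth (sub_mfd (Ob Y) ?W) (Ar X) (%y. si (fst g y))"
    by (rule sm_compose'[OF mW mV F.dom.mfd_Ar gW si(1)])
   have isig: "smooth (sub_mfd (Ob Y) ?W) (Ar Y) (%y. iv Y (snd f (si (fst g y))))"
    by (rule sm_compose'[OF mW F.cod.mfd_Ar F.cod.mfd_Ar sm_compose'[OF mW F.dom.mfd_Ar F.cod.mfd_Ar sig F.smooth1] F.cod.smooth_iv])
   have tsig: "smooth (sub_mfd (Ob Y) ?W) (Ob X) (%y. tg X (si (fst g y)))"
    by (rule sm_compose'[OF mW F.dom.mfd_Ar F.dom.mfd_Ob sig F.dom.smooth_tg])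
   have in1: "y : X0 Y" "si (fst g y) : X1 X" "sr X (si (fst g y)) = fst g y" if "y : ?W" for y
    using sm_point[OF sig, unfolded pW] that ssi by auto
   have epW: "smooth (sub_mfd (Ob Y) ?W) (Ar Y) ep"
    by (rule sm_restrict[OF F.cod.mfd_Ob F.cod.mfd_Ar W E.smooth_ta])
   let ?a = "%y. mu Y (ep y) (iv Y (snd f (si (fst g y))))"
   have st: "sr Y (ep y) = tg Y (iv Y (snd f (si (fst g y))))" if "y : ?W" for y
    using in1[OF that] by (simp add: ep F.cod.gpd_simps F.f_simps)
   have m: "smooth (sub_mfd (Ob Y) ?W) (Ar Y) ?a"
    by (rule F.cod.smooth_mu'[OF mW epW isig]) (unfold pW, rule st)
   have "?a ?y = ph"
   proof -
    have "mu Y ph ?pp = ep ?y" using ph y by (intro F.cod.cancel_iv2) (simp_all add: ep)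
    moreover have "mu Y (mu Y ph ?pp) (iv Y ?pp) = ph" using ph pp s by (intro F.cod.cancel_iv3) simp_all
    ultimately show ?thesis using si(2) p by simp
   qed
   moreover have "sr Y (?a y) = fst f (tg X (si (fst g y))) & tg Y (?a y) = y" if "y : ?W" for y
    using in1[OF that] by (simp add: ep F.cod.gpd_simps F.f_simps)
   ultimately show "\<exists>V a b. openin (mtop (Ob Y)) V & tg Y ph : V & smooth (sub_mfd (Ob Y) V) (Ar Y) a \<and>
    smooth (sub_mfd (Ob Y) V) (Ob X) b & a (tg Y ph) = ph & b (tg Y ph) = x \<and>
    (\<forall>y\<in>V. sr Y (a y) = fst f (b y) & tg Y (a y) = y)"
    using W V(2) y p si(2) m tsig
    by (intro exI[of _ ?W] exI[of _ ?a] exI[of _ "%y. tg X (si (fst g y))"]) simp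
  qed
 qed
qed

section \<open>Base change along a surjective submersion\<close>

text \<open>The groupoid induced on \<open>B\<close> by a surjective submersion to the objects of
  \<open>Y\<close>. Its arrows are triples of a target, an arrow of \<open>Y\<close> and a source,
  coded by \<open>c\<close>, because objects and arrows of a groupoid share one type.\<close>

locale base_change = lie_gpd Y for Y :: "'p groupoid_data" +
 fixes B :: "'p mfd" and v0 :: "'p => 'p" and c :: "'p \<times> 'p \<times> 'p => 'p"
 assumes mB: "manifold B" and sub_v0: "submersion B (Ob Y) v0" and onto: "v0 ` points B = X0 Y" and c: "inj c"
begin

definition pt :: "'p => 'p" where "pt u = fst (inv c u)"
definition pa :: "'p => 'p" where "pa u = fst (snd (inv c u))"
definition ps :: "'p => 'p" where "ps u = snd (snd (inv c u))"

definition trip :: "('p \<times> 'p \<times> 'p) set" where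
 "trip = {(y, ph, x). y : points B & ph : X1 Y & x : points B & v0 y = tg Y ph & sr Y ph = v0 x}"

abbreviation Q :: "('p \<times> 'p) mfd" where
 "Q \<equiv> fibre_mfd {(ph, x). ph : X1 Y & x : points B & sr Y ph = v0 x} (%p. p) (Ar Y) (Ob Y) B"

text \<open>The triples arise from two fibre products in succession, so that each is taken along a
  submersion: \<open>Q\<close> attaches the source along \<open>sr Y\<close>, and \<open>R\<close>
  the target along \<open>v0\<close>.\<close>

definition R :: "'p mfd" where
 "R = fibre_mfd (c ` trip) (inv c) B (Ob Y) Q"

definition U :: "'p groupoid_data" where
 "U = \<lparr>Ob = B, Ar = R, sr = ps, tg = pt, un = %x. c (x, un Y (v0 x), x),
   iv = %u. c (ps u, iv Y (pa u), pt u), mu = %u w. c (pt u, mu Y (pa u) (pa w), ps w)\<rparr>"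

lemma U_sel [simp]: "Ob U = B" "Ar U = R" "sr U = ps" "tg U = pt" "un U x = c (x, un Y (v0 x), x)"
 "iv U u = c (ps u, iv Y (pa u), pt u)" "mu U u w = c (pt u, mu Y (pa u) (pa w), ps w)"
 by (simp_all add: U_def)

lemma parts [simp]: "pt (c (y, ph, x)) = y" "pa (c (y, ph, x)) = ph" "ps (c (y, ph, x)) = x"
 by (simp_all add: pt_def pa_def ps_def inv_f_f[OF c])

lemma smooth_v0: "smooth B (Ob Y) v0"
 by (rule submersion_smooth[OF sub_v0])

lemma v0_in: "x : points B ==> v0 x : X0 Y"
 by (rule sm_point[OF smooth_v0])

lemma Q_fib: "inj_on (%p. p) {(ph, x). ph : X1 Y & x : points B & sr Y ph = v0 x}"
 "(%p. p) ` {(ph, x). ph : X1 Y & x : points B & sr Y ph = v0 x} = {(ph, x). ph : X1 Y & x : points B & sr Y ph = v0 x}"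
 by auto

lemmas Q_rules = mfd_Ar mfd_Ob mB sub_sr smooth_v0 Q_fib
lemmas mfd_Q = manifold_fibre[OF Q_rules]
lemmas points_Q = points_fibre[OF Q_rules]
lemmas Q_proj = smooth_fibre_proj[OF Q_rules]

lemma R_fib: "inj_on (inv c) (c ` trip)"
 "inv c ` (c ` trip) = {(y, q). y : points B & q : points Q & v0 y = tg Y (fst q)}"
proof -
 show "inj_on (inv c) (c ` trip)" by (rule inj_on_inv_into) auto
 have "inv c ` (c ` trip) = trip" unfolding image_image inv_f_f[OF c] by simp
 also have "trip = {(y, q). y : points B & q : points Q & v0 y = tg Y (fst q)}"
  unfolding points_Q trip_def by auto
 finally show "inv c ` (c ` trip) = {(y, q). y : points B & q : points Q & v0 y = tg Y (fst q)}" .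
qed

lemmas smooth_Q_tg = sm_compose'[OF mfd_Q mfd_Ar mfd_Ob Q_proj(1) smooth_tg]
lemmas R_rules = mB mfd_Ob mfd_Q sub_v0 smooth_Q_tg R_fib

lemma mfd_R: "manifold R" unfolding R_def by (rule manifold_fibre[OF R_rules])
lemma points_R: "points R = c ` trip" unfolding R_def by (rule points_fibre[OF R_rules])

lemma R_cases:
 assumes "u : points R"
 obtains y ph x where "u = c (y, ph, x)" "y : points B" "ph : X1 Y" "x : points B" "tg Y ph = v0 y" "sr Y ph = v0 x"
 using assms unfolding points_R trip_def by force

lemma R_I: "y : points B ==> ph : X1 Y ==> x : points B ==> v0 y = tg Y ph ==> sr Y ph = v0 x ==> c (y, ph, x) : points R"
 unfolding points_R trip_def by blast

lemma R_D: "u : points R ==> pt u : points B" "u : points R ==> pa u : X1 Y" "u : points R ==> ps u : points B"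
 "u : points R ==> tg Y (pa u) = v0 (pt u)" "u : points R ==> sr Y (pa u) = v0 (ps u)"
 "u : points R ==> c (pt u, pa u, ps u) = u"
 by (erule R_cases, simp)+

lemma R_eqI: "u : points R ==> w : points R ==> pt u = pt w ==> pa u = pa w ==> ps u = ps w ==> u = w"
 by (metis R_D(6))

lemma smooth_parts: "smooth R B pt" "smooth R (Ar Y) pa" "smooth R B ps"
proof -
 have q: "smooth R Q (%u. snd (inv c u))" unfolding R_def by (rule smooth_fibre_proj(2)[OF R_rules])
 have "smooth R B (%u. fst (inv c u))" unfolding R_def by (rule smooth_fibre_proj(1)[OF R_rules])
 then show "smooth R B pt" unfolding pt_def[abs_def] .
 show "smooth R (Ar Y) pa" unfolding pa_def[abs_def]
  by (rule sm_compose'[OF mfd_R mfd_Q mfd_Ar q Q_proj(1)])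
 show "smooth R B ps" unfolding ps_def[abs_def]
  by (rule sm_compose'[OF mfd_R mfd_Q mB q Q_proj(2)])
qed

lemma smooth_R_lift:
 assumes T: "manifold T" and y: "smooth T B y" and ph: "smooth T (Ar Y) ph" and x: "smooth T B x"
  and st: "\<And>t. t : points T ==> v0 (y t) = tg Y (ph t) & sr Y (ph t) = v0 (x t)"
 shows "smooth T R (%t. c (y t, ph t, x t))"
 unfolding R_def
proof (rule smooth_fibre_lift[OF R_rules T])
 show "smooth T B (%t. fst (inv c (c (y t, ph t, x t))))" using y by (simp add: inv_f_f[OF c])
 have "smooth T Q (%t. (ph t, x t))"
 proof (rule smooth_fibre_lift[OF Q_rules T])
  show "(ph t, x t) : {(ph, x). ph : X1 Y & x : points B & sr Y ph = v0 x}" if "t : points T" for t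
   using st[OF that] sm_point[OF ph that] sm_point[OF x that] by simp
 qed (simp_all add: ph x)
 then show "smooth T Q (%t. snd (inv c (c (y t, ph t, x t))))" by (simp add: inv_f_f[OF c])
 show "c (y t, ph t, x t) : c ` trip" if "t : points T" for t
  unfolding points_R[symmetric]
  using st[OF that] sm_point[OF y that] sm_point[OF ph that] sm_point[OF x that] by (intro R_I) simp_all
qed

lemma smooth_iv_R: "smooth R R (iv U)"
proof -
 have "smooth R (Ar Y) (%u. iv Y (pa u))"
  by (rule sm_compose'[OF mfd_R mfd_Ar mfd_Ar smooth_parts(2) smooth_iv])
 from smooth_R_lift[OF mfd_R smooth_parts(3) this smooth_parts(1)] show ?thesis
  unfolding U_sel by (simp add: R_D gpd_simps)
qed

text \<open>When the source moves, a section of \<open>sr Y\<close> extends the arrow, and a section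
  of \<open>v0\<close> picks a target in \<open>B\<close> over the end point of the extended
  arrow.\<close>

lemma ps_sections: "has_local_sections R B ps"
 unfolding has_local_sections_def
proof
 fix u assume u: "u : points R"
 let ?y = "pt u" and ?ph = "pa u" and ?x = "ps u"
 note u' = R_D[OF u]
 obtain V si where V: "openin (mtop (Ob Y)) V" "sr Y ?ph : V" and si: "smooth (sub_mfd (Ob Y) V) (Ar Y) si"
  "si (sr Y ?ph) = ?ph" "\<forall>z\<in>V. sr Y (si z) = z"
  using submersion_has_local_sections[OF mfd_Ar mfd_Ob sub_sr, unfolded has_local_sections_def, rule_format, OF u'(2)]
  by (elim exE conjE) (rule that; assumption)
 obtain V' si' where V': "openin (mtop (Ob Y)) V'" "v0 ?y : V'" and si': "smooth (sub_mfd (Ob Y) V') B si'"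
  "si' (v0 ?y) = ?y" "\<forall>z\<in>V'. v0 (si' z) = z"
  using submersion_has_local_sections[OF mB mfd_Ob sub_v0, unfolded has_local_sections_def, rule_format, OF u'(1)]
  by (elim exE conjE) (rule that; assumption)
 let ?W1 = "{z\<in>points B. v0 z : V}" and ?g = "%z. tg Y (si (v0 z))"
 have W1: "openin (mtop B) ?W1" by (rule openin_continuous_map_preimage[OF sm_continuous[OF smooth_v0] V(1)])
 have mW1: "manifold (sub_mfd B ?W1)" by (rule manifold_sub[OF mB W1])
 have mV: "manifold (sub_mfd (Ob Y) V)" by (rule manifold_sub[OF mfd_Ob V(1)])
 have mV': "manifold (sub_mfd (Ob Y) V')" by (rule manifold_sub[OF mfd_Ob V'(1)])
 have "smooth (sub_mfd B ?W1) (sub_mfd (Ob Y) V) v0"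
  by (rule sm_into_sub[OF mW1 mfd_Ob V(1) sm_restrict[OF mB mfd_Ob W1 smooth_v0]]) simp
 from sm_compose'[OF mW1 mV mfd_Ar this si(1)]
 have s1: "smooth (sub_mfd B ?W1) (Ar Y) (%z. si (v0 z))" .
 have s2: "smooth (sub_mfd B ?W1) (Ob Y) ?g"
  by (rule sm_compose'[OF mW1 mfd_Ar mfd_Ob s1 smooth_tg])
 let ?W = "{z\<in>?W1. ?g z : V'}"
 note W = sub_preimage[OF mB mfd_Ob W1 s2 V'(1)]
 have mW: "manifold (sub_mfd B ?W)" by (rule manifold_sub[OF mB W(1)])
 have pW: "points (sub_mfd B ?W) = ?W" by (rule points_sub_mfd[OF W(1)])
 have a: "smooth (sub_mfd B ?W) (Ar Y) (%z. si (v0 z))"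
  by (rule sm_sub_mono[OF mB mfd_Ar W1 W(1) _ s1]) auto
 have b: "smooth (sub_mfd B ?W) B (%z. si' (?g z))"
  by (rule sm_compose'[OF mW mV' mB W(2) si'(1)])
 have i: "smooth (sub_mfd B ?W) B (%z. z)"
  by (rule sm_restrict[OF mB mB W(1) sm_ident[OF mB]])
 let ?s = "%z. c (si' (?g z), si (v0 z), z)"
 have st: "v0 (si' (?g z)) = tg Y (si (v0 z)) & sr Y (si (v0 z)) = v0 z" if "z : ?W" for z
  using that si(3) si'(3) by blast
 have "smooth (sub_mfd B ?W) R ?s"
  by (rule smooth_R_lift[OF mW b a i]) (unfold pW, rule st)
 moreover have "?x : ?W" using u' V(2) V'(2) si(2) by simp
 moreover have "?s ?x = u" using u' si(2) si'(2) by simp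
 moreover have "\<forall>z\<in>?W. ps (?s z) = z" by simp
 ultimately show "\<exists>V si. openin (mtop B) V & ps u : V & smooth (sub_mfd B V) R si & si (ps u) = u & (\<forall>z\<in>V. ps (si z) = z)"
  using W(1) by (intro exI[of _ ?W] exI[of _ ?s] conjI)
qed

text \<open>Inversion exchanges source and target, so sections of \<open>ps\<close> through the
  inverse arrow become sections of \<open>pt\<close>.\<close>

lemma pt_sections: "has_local_sections R B pt"
 unfolding has_local_sections_def
proof
 fix u assume u: "u : points R"
 have iu: "iv U u : points R" by (rule sm_point[OF smooth_iv_R u])
 have "pt u = ps (iv U u)" by simp
 obtain V si where V: "openin (mtop B) V" "pt u : V" and si: "smooth (sub_mfd B V) R si" "si (pt u) = iv U u" "\<forall>z\<in>V. ps (si z) = z"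
  using ps_sections[unfolded has_local_sections_def, rule_format, OF iu, folded \<open>pt u = ps (iv U u)\<close>]
  by (elim exE conjE) (rule that; assumption)
 have "smooth (sub_mfd B V) R (%z. iv U (si z))"
  by (rule sm_compose'[OF manifold_sub[OF mB V(1)] mfd_R mfd_R si(1) smooth_iv_R])
 moreover have "iv U (si (pt u)) = u"
  unfolding si(2) using R_D[OF u] iv_iv by simp
 moreover have "\<forall>z\<in>V. pt (iv U (si z)) = z" using si(3) by simp
 ultimately show "\<exists>V si. openin (mtop B) V & pt u : V & smooth (sub_mfd B V) R si & si (pt u) = u & (\<forall>z\<in>V. pt (si z) = z)"
  using V by (intro exI[of _ V] exI[of _ "%z. iv U (si z)"] conjI)
qed

lemma sub_ps: "submersion R B ps" by (rule local_sections_submersion[OF mfd_R mB smooth_parts(3) ps_sections])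
lemma sub_pt: "submersion R B pt" by (rule local_sections_submersion[OF mfd_R mB smooth_parts(1) pt_sections])

lemma mu_R: "u : points R ==> w : points R ==> ps u = pt w ==> mu U u w : points R"
 unfolding U_sel by (rule R_I) (simp_all add: R_D gpd_simps)

lemma smooth_mu_R:
 defines "P \<equiv> fibre_mfd {(u, w). u : points R & w : points R & ps u = pt w} (%p. p) R B R"
 shows "is_fibre_product R R ps pt P & smooth P R (%(u, w). mu U u w)"
proof
 show "is_fibre_product R R ps pt P"
  unfolding P_def by (rule fibre_mfd_is_fibre_product[OF mfd_R mB mfd_R sub_ps smooth_parts(1)])
 let ?S = "{(u, w). u : points R & w : points R & ps u = pt w}"
 have b: "inj_on (%p. p) ?S" "(%p. p) ` ?S = ?S" by auto
 note fib = mfd_R mB mfd_R sub_ps smooth_parts(1) b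
 note mP = manifold_fibre[OF fib, folded P_def] and pP = points_fibre[OF fib, folded P_def]
  and prP = smooth_fibre_proj[OF fib, folded P_def]
 have st: "sr Y (pa (fst p)) = tg Y (pa (snd p))" if "p : points P" for p
  using that R_D(5)[of "fst p"] R_D(4)[of "snd p"] unfolding pP by auto
 \<comment> \<open>\<open>smooth_mu\<close> asks for an injection of pairs into \<open>'p\<close>;
   repeating the second component makes the coding of triples serve as one.\<close>
 have k: "inj (\<lambda>p :: 'p \<times> 'p. c (fst p, snd p, snd p))" 
  by (rule injI) (drule injD[OF c], simp add: prod_eq_iff)
 have m: "smooth P (Ar Y) (%p. mu Y (pa (fst p)) (pa (snd p)))"
  by (rule smooth_mu[OF mP k sm_compose'[OF mP mfd_R mfd_Ar prP(1) smooth_parts(2)]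
     sm_compose'[OF mP mfd_R mfd_Ar prP(2) smooth_parts(2)] st])
 have st2: "v0 (pt (fst p)) = tg Y (mu Y (pa (fst p)) (pa (snd p))) & sr Y (mu Y (pa (fst p)) (pa (snd p))) = v0 (ps (snd p))"
  if p: "p : points P" for p
 proof -
  have q: "fst p : points R" "snd p : points R" using p unfolding pP by auto
  show ?thesis using R_D[OF q(1)] R_D[OF q(2)] st[OF p] by (simp add: gpd_simps)
 qed
 have "smooth P R (%p. c (pt (fst p), mu Y (pa (fst p)) (pa (snd p)), ps (snd p)))"
  by (rule smooth_R_lift[OF mP sm_compose'[OF mP mfd_R mB prP(1) smooth_parts(1)] m
     sm_compose'[OF mP mfd_R mB prP(2) smooth_parts(3)] st2])
 then show "smooth P R (%(u, w). mu U u w)" by (simp add: split_beta')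
qed

lemma lie_U: "lie_groupoid U"
 unfolding lie_groupoid_def
proof (intro conjI)
 show "manifold (Ob U)" "manifold (Ar U)" "submersion (Ar U) (Ob U) (sr U)" "submersion (Ar U) (Ob U) (tg U)"
  using mB mfd_R sub_ps sub_pt by simp_all
 show "smooth (Ar U) (Ar U) (iv U)" using smooth_iv_R by simp
 have "smooth B R (%x. c (x, un Y (v0 x), x))"
  by (rule smooth_R_lift[OF mB sm_ident[OF mB] sm_compose'[OF mB mfd_Ob mfd_Ar smooth_v0 smooth_un] sm_ident[OF mB]])
   (simp add: gpd_simps v0_in)
 then show "smooth (Ob U) (Ar U) (un U)" unfolding U_def by simp
 show "\<exists>P. is_fibre_product (Ar U) (Ar U) (sr U) (tg U) P & smooth P (Ar U) (%(ph, pp). mu U ph pp)"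
  unfolding U_sel(1-4)
  by (rule exI[of _ "fibre_mfd {(u, w). u : points R & w : points R & ps u = pt w} (%p. p) R B R"]) (rule smooth_mu_R)
 show "\<forall>x\<in>X0 U. sr U (un U x) = x & tg U (un U x) = x" by simp
 show "\<forall>(ph, pp)\<in>X2 U. sr U (mu U ph pp) = sr U pp & tg U (mu U ph pp) = tg U ph" by simp
 show "\<forall>ph pp xi. (ph, pp) : X2 U & (pp, xi) : X2 U --> mu U (mu U ph pp) xi = mu U ph (mu U pp xi)"
 proof (intro allI impI)
  fix ph pp xi assume "(ph, pp) : X2 U & (pp, xi) : X2 U"
  then have R: "ph : points R" "pp : points R" "xi : points R" and st: "ps ph = pt pp" "ps pp = pt xi"
   unfolding X2_def by simp_all
  have "mu Y (mu Y (pa ph) (pa pp)) (pa xi) = mu Y (pa ph) (mu Y (pa pp) (pa xi))"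
   by (rule mu_assoc) (use R_D[OF R(1)] R_D[OF R(2)] R_D[OF R(3)] st in simp_all)
  then show "mu U (mu U ph pp) xi = mu U ph (mu U pp xi)" by simp
 qed
 show "\<forall>ph\<in>X1 U. mu U ph (un U (sr U ph)) = ph & mu U (un U (tg U ph)) ph = ph"
  by (simp add: R_D unit_r' unit_l')
 show "\<forall>ph\<in>X1 U. sr U (iv U ph) = tg U ph & tg U (iv U ph) = sr U ph \<and>
    mu U (iv U ph) ph = un U (sr U ph) & mu U ph (iv U ph) = un U (tg U ph)"
  by (simp add: R_D iv_l iv_r)
qed

definition proj :: "'p functor_data" where
 "proj = (\<lambda>x\<in>points B. v0 x, \<lambda>u\<in>points R. pa u)"

lemma proj_simps [simp]: "x : points B ==> fst proj x = v0 x" "u : points R ==> snd proj u = pa u"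
 by (simp_all add: proj_def)

lemma smooth_functor_proj: "smooth_functor U Y proj"
proof (rule smooth_functorI)
 show "smooth (Ob U) (Ob Y) (fst proj)"
  unfolding U_sel by (rule sm_cong[OF mB mfd_Ob smooth_v0]) simp
 show "smooth (Ar U) (Ar Y) (snd proj)"
  unfolding U_sel by (rule sm_cong[OF mfd_R mfd_Ar smooth_parts(2)]) simp
 show "snd proj (un U x) = un Y (fst proj x)" if "x : X0 U" for x
  using that R_I[of x "un Y (v0 x)" x] by (simp add: gpd_simps v0_in)
 show "snd proj (mu U ph pp) = mu Y (snd proj ph) (snd proj pp)" if "ph : X1 U" "pp : X1 U" "sr U ph = tg U pp" for ph pp
  using that mu_R[of ph pp] by simp
qed (simp_all add: R_D, simp_all add: proj_def)

text \<open>An arrow of \<open>U\<close> is an arrow of \<open>Y\<close> with chosen end points in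
  \<open>B\<close>, so the projection is fully faithful by construction. For local lifts, a section
  of \<open>tg Y\<close> provides the arrows and a section of \<open>v0\<close> objects of
  \<open>B\<close> over their sources.\<close>

lemma ess_equiv_proj: "essential_equivalence U Y proj"
proof -
 interpret v: smooth_fctr U Y proj
  by (rule smooth_fctrI[OF lie_U lie smooth_functor_proj])
 show ?thesis
 proof (rule v.ess_equivI)
  show "lifts_locally U Y proj"
   unfolding lifts_locally_def U_sel
  proof (intro ballI impI)
   fix ph x assume ph: "ph : X1 Y" and x: "x : points B" and "sr Y ph = fst proj x"
   then have s: "v0 x = sr Y ph" by simp
   obtain V si where V: "openin (mtop (Ob Y)) V" "tg Y ph : V" and si: "smooth (sub_mfd (Ob Y) V) (Ar Y) si"
    "si (tg Y ph) = ph" "\<forall>z\<in>V. tg Y (si z) = z"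
    using submersion_has_local_sections[OF mfd_Ar mfd_Ob sub_tg, unfolded has_local_sections_def, rule_format, OF ph]
    by (elim exE conjE) (rule that; assumption)
   obtain V' si' where V': "openin (mtop (Ob Y)) V'" "v0 x : V'" and si': "smooth (sub_mfd (Ob Y) V') B si'"
    "si' (v0 x) = x" "\<forall>z\<in>V'. v0 (si' z) = z"
    using submersion_has_local_sections[OF mB mfd_Ob sub_v0, unfolded has_local_sections_def, rule_format, OF x]
    by (elim exE conjE) (rule that; assumption)
   let ?g = "%y. sr Y (si y)"
   have mV: "manifold (sub_mfd (Ob Y) V)" by (rule manifold_sub[OF mfd_Ob V(1)])
   have mV': "manifold (sub_mfd (Ob Y) V')" by (rule manifold_sub[OF mfd_Ob V'(1)])
   have g: "smooth (sub_mfd (Ob Y) V) (Ob Y) ?g" by (rule sm_compose'[OF mV mfd_Ar mfd_Ob si(1) smooth_sr])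
   let ?W = "{y\<in>V. ?g y : V'}"
   note W = sub_preimage[OF mfd_Ob mfd_Ob V(1) g V'(1)]
   have mW: "manifold (sub_mfd (Ob Y) ?W)" by (rule manifold_sub[OF mfd_Ob W(1)])
   have pW: "points (sub_mfd (Ob Y) ?W) = ?W" by (rule points_sub_mfd[OF W(1)])
   have a: "smooth (sub_mfd (Ob Y) ?W) (Ar Y) si"
    by (rule sm_sub_mono[OF mfd_Ob mfd_Ar V(1) W(1) _ si(1)]) auto
   have b: "smooth (sub_mfd (Ob Y) ?W) B (%y. si' (?g y))"
    by (rule sm_compose'[OF mW mV' mB W(2) si'(1)])
   have l: "sr Y (si y) = fst proj (si' (?g y)) & tg Y (si y) = y" if y: "y : ?W" for y
   proof -
    have "si' (?g y) : points B" using sm_point[OF b, unfolded pW, OF y] .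
    moreover have "v0 (si' (?g y)) = ?g y" "tg Y (si y) = y" using y si(3) si'(3) by blast+
    ultimately show ?thesis by simp
   qed
   have gx: "si' (?g (tg Y ph)) = x" using s si(2) si'(2) by simp
   have tW: "tg Y ph : ?W" using s V V' si(2) by simp
   show "\<exists>V a b. openin (mtop (Ob Y)) V & tg Y ph : V & smooth (sub_mfd (Ob Y) V) (Ar Y) a \<and>
    smooth (sub_mfd (Ob Y) V) B b & a (tg Y ph) = ph & b (tg Y ph) = x \<and>
    (\<forall>y\<in>V. sr Y (a y) = fst proj (b y) & tg Y (a y) = y)"
    by (intro exI[of _ ?W] exI[of _ si] exI[of _ "%y. si' (?g y)"] conjI ballI W(1) tW a b si(2) gx
      conjunct1[OF l] conjunct2[OF l])
  qed
  show "ess_surjective U Y proj"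
   unfolding ess_surjective_def U_sel
  proof
   fix y assume y: "y : X0 Y"
   then have "y : v0 ` points B" unfolding onto .
   then obtain x where x: "x : points B" "v0 x = y" by (rule imageE) (rule that, assumption, rule sym)
   show "\<exists>ph\<in>X1 Y. \<exists>x\<in>points B. sr Y ph = fst proj x & tg Y ph = y"
    by (rule bexI[of _ "un Y y"], rule bexI[of _ x]) (use x y in \<open>simp_all add: gpd_simps\<close>)
  qed
  show "smoothly_full U Y proj"
   unfolding smoothly_full_def U_sel
  proof (intro allI impI)
   fix T :: "'p mfd" and a b d
   assume "manifold T & smooth T (Ar Y) a & smooth T B b & smooth T B d \<and>
    (\<forall>t\<in>points T. sr Y (a t) = fst proj (b t) & tg Y (a t) = fst proj (d t))"
   then have T: "manifold T" and a: "smooth T (Ar Y) a" and b: "smooth T B b" and d: "smooth T B d"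
    and abd: "\<forall>t\<in>points T. sr Y (a t) = fst proj (b t) & tg Y (a t) = fst proj (d t)"
    by blast+
   have st: "v0 (d t) = tg Y (a t) & sr Y (a t) = v0 (b t)" if t: "t : points T" for t
    using abd[rule_format, OF t] sm_point[OF b t] sm_point[OF d t] by simp
   have l: "smooth T R (%t. c (d t, a t, b t))" by (rule smooth_R_lift[OF T d a b st])
   have "snd proj (c (d t, a t, b t)) = a t" if "t : points T" for t
    using sm_point[OF l that] by simp
   with l show "\<exists>u. smooth T R u & (\<forall>t\<in>points T. snd proj (u t) = a t & ps (u t) = b t & pt (u t) = d t)"
    by (intro exI[of _ "%t. c (d t, a t, b t)"]) simp
  qed
  show "faithful U proj"
   unfolding faithful_def U_sel
  proof (intro ballI impI)
   fix u w assume u: "u : points R" and w: "w : points R" and eq: "ps u = ps w & pt u = pt w & snd proj u = snd proj w"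
   show "u = w" by (rule R_eqI[OF u w]) (use u w eq in simp_all)
  qed
 qed
qed

end

section \<open>Cocycle identities\<close>

locale cocycle3 =
 fixes al :: "'g::group_add => 'g => 'g => 'a::ab_group_add"
 assumes normalized: "normalized_3cocycle al"
begin

lemma al_0 [simp]: "al 0 g h = 0" "al g 0 h = 0" "al g h 0 = 0"
 using normalized unfolding normalized_3cocycle_def by blast+

lemma cocycle: "al g2 g3 g4 + al g1 (g2 + g3) g4 + al g1 g2 g3 = al (g1 + g2) g3 g4 + al g1 g2 (g3 + g4)"
 using normalized unfolding normalized_3cocycle_def by blast

text \<open>The homogeneous form of \<open>al\<close>: a cochain on tetrahedra whose vertices carry
  potentials. The cocycle condition becomes the vanishing of its coboundary \<open>cob\<close> on
  4-simplices.\<close>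

definition hom3 :: "'g => 'g => 'g => 'g => 'a" where
 "hom3 w x y z = al (w - x) (x - y) (y - z)"

definition cob :: "'g => 'g => 'g => 'g => 'g => 'a" where
 "cob v w x y z = hom3 w x y z + hom3 v w y z + hom3 v w x y - hom3 v x y z - hom3 v w x z"

lemma cob_0: "cob v w x y z = 0"
 using cocycle[of "w - x" "x - y" "y - z" "v - w"] by (simp add: cob_def hom3_def add_diff_eq)

text \<open>Vertices are named after the functors applied to the source \<open>s\<close>, middle
  \<open>t\<close> and target \<open>u\<close> of two composable arrows. Given the condition
  \<open>P1\<close> of the second 1-morphism, that of the composite is equivalent to that of the
  first; composition reads this one way, division the other.\<close>

lemma comp1_algebra:
 assumes P1: "e1 + e2 - e3 = g1 - g2 + al l1 l2 l3 - al l1 l4 l5 - al l6 l7 l3" (is "?A1 = ?B1")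
  and lab: "l1 = gfu - gft" "l2 = gft - ft" "l3 = ft - fs" "l4 = gft - gfs" "l5 = gfs - fs"
  "l6 = gfu - fu" "l7 = fu - ft" "l8 = ft - t" "l9 = t - s" "l10 = fs - s"
  "l11 = fu - u" "l12 = u - t" "l13 = fu - fs" "l14 = gfu - gfs" "l15 = u - s"
  "l16 = gft - t" "l17 = gfs - s" "l18 = gfu - u"
 shows "(e1 + e4 + al l6 l7 l8 - al l1 l2 l8 - al l6 l11 l12) + (e2 + e5 + al l2 l3 l10 - al l4 l5 l10 - al l2 l8 l9) - ((e3 + e6 + al l6 l13 l10 - al l14 l5 l10 - al l6 l11 l15)) = g3 - g2 + al l1 l16 l9 - al l1 l4 l17 - al l18 l12 l9 \<longleftrightarrow> e4 + e5 - e6 = g3 - g1 + al l7 l8 l9 - al l7 l3 l10 - al l11 l12 l9" (is "?L = ?R \<longleftrightarrow> ?A = ?B")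
proof -
 \<comment> \<open>The 4-simplices listed here fill the diagram. With \<open>cob\<close> and the
   labels unfolded, only additive arithmetic in the values of \<open>al\<close> remains. The
   certificates below have the same form.\<close>
 have *: "?L - ?R =
  0 - cob gfu fu ft fs s + cob gfu fu ft t s - cob gfu fu u t s + cob gfu gft ft fs s - cob gfu gft ft t s
  - cob gfu gft gfs fs s + (?A - ?B) + (?A1 - ?B1)"
  by (simp add: cob_def hom3_def lab algebra_simps)
 show ?thesis
  unfolding eq_iff_diff_eq_0[of ?L] * by (simp add: cob_0 P1)
qed

text \<open>\<open>P1\<close> to \<open>P3\<close> are cocycle conditions for \<open>gamma\<close>,
  and \<open>P4\<close> is the condition on the first 2-cell. The equivalence gives vertical
  composites in one direction and inverse 2-cells in the other.\<close>

lemma vcomp_algebra: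
 assumes P1: "g8 + g6 - g9 - g10 = al l4 l6 l7" (is "?A1 = ?B1")
  and P2: "g5 + g6 - g3 - g7 = al l4 l5 l3" (is "?A2 = ?B2")
  and P3: "g1 + g2 - g3 - g4 = al l1 l2 l3" (is "?A3 = ?B3")
  and P4: "w2 - w1 = g8 - g5 + e1 + al l6 l7 l8 - al l5 l3 l8 - al l6 l9 l10 - e2" (is "?A4 = ?B4")
  and lab: "l1 = ht - hs" "l2 = hs - gs" "l3 = gs - fs" "l4 = ht - gt" "l5 = gt - gs"
  "l6 = gt - ft" "l7 = ft - fs" "l8 = fs - s" "l9 = ft - t" "l10 = t - s"
  "l11 = gs - s" "l12 = gt - t" "l13 = ht - ft" "l14 = hs - fs"
 shows "(w4 + w2 + al l2 l3 l8 + g1) - (w3 + w1 + al l4 l6 l9 + g10) = g9 - g2 + e1 + al l13 l7 l8 - al l1 l14 l8 - al l13 l9 l10 - e3 \<longleftrightarrow> w4 - w3 = g7 - g4 + e2 + al l4 l5 l11 - al l1 l2 l11 - al l4 l12 l10 - e3" (is "?L = ?R \<longleftrightarrow> ?A = ?B")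
proof -
 have *: "?L - ?R =
  0 + cob ht gt ft fs s - cob ht gt ft t s - cob ht gt gs fs s + cob ht hs gs fs s + (?A1 - ?B1)
  - (?A2 - ?B2) + (?A3 - ?B3) + (?A4 - ?B4) + (?A - ?B)"
  by (simp add: cob_def hom3_def lab algebra_simps)
 show ?thesis
  unfolding eq_iff_diff_eq_0[of ?L] * by (simp add: cob_0 P1 P2 P3 P4)
qed

text \<open>\<open>P1\<close> and \<open>P2\<close> concern \<open>eta\<close> of the outer target
  1-morphism on the two sides of a naturality square, \<open>P3\<close> to \<open>P5\<close> concern
  \<open>gamma\<close>, and \<open>P6\<close> is the condition on the outer 2-cell. Read backwards,
  it gives the condition on a 2-cell from that on its whiskering.\<close>

lemma hcomp_algebra:
 assumes P1: "e8 + e4 - e7 = g11 - g10 + al l4 l20 l9 - al l4 l7 l18 - al l19 l8 l9" (is "?A1 = ?B1")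
  and P2: "e5 + e6 - e7 = g12 - g4 + al l1 l17 l12 - al l1 l2 l18 - al l19 l11 l12" (is "?A2 = ?B2")
  and P3: "g5 + g6 - g7 - g8 = al l4 l5 l6" (is "?A3 = ?B3")
  and P4: "g9 + g6 - g3 - g10 = al l4 l7 l3" (is "?A4 = ?B4")
  and P5: "g1 + g2 - g3 - g4 = al l1 l2 l3" (is "?A5 = ?B5")
  and P6: "w4 - w3 = g5 - g9 + e3 + al l5 l6 l15 - al l7 l3 l15 - al l5 l16 l9 - e4" (is "?A6 = ?B6")
  and lab: "l1 = f4f2t - f4f2s" "l2 = f4f2s - f4f1s" "l3 = f4f1s - f3f1s" "l4 = f4f2t - f4f1t" "l5 = f4f1t - f3f1t"
  "l6 = f3f1t - f3f1s" "l7 = f4f1t - f4f1s" "l8 = f2t - f1t" "l9 = f1t - f1s" "l10 = f1s - s"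
  "l11 = f2t - f2s" "l12 = f2s - f1s" "l13 = f1t - t" "l14 = t - s" "l15 = f3f1s - f1s"
  "l16 = f3f1t - f1t" "l17 = f4f2s - f2s" "l18 = f4f1s - f1s" "l19 = f4f2t - f2t" "l20 = f4f1t - f1t"
  "l21 = f3f1t - t" "l22 = f3f1s - s" "l23 = f2s - s" "l24 = f2t - t" "l25 = f4f2t - f3f1t"
  "l26 = f4f2s - f3f1s"
 shows "(w4 + w2 + e6 + g1 + al l2 l3 l22 + al l17 l12 l10 - al l3 l15 l10 - al l2 l18 l10) - (w3 + w1 + e8 + g8 + al l4 l5 l21 + al l19 l8 l13 - al l5 l16 l13 - al l4 l20 l13) = g7 - g2 + (e3 + e1 + al l16 l9 l10 - al l6 l15 l10 - al l16 l13 l14) + al l25 l6 l22 - al l1 l26 l22 - al l25 l21 l14 - (e5 + e2 + al l19 l11 l23 - al l1 l17 l23 - al l19 l24 l14) \<longleftrightarrow> w2 - w1 = g11 - g12 + e1 + al l8 l9 l10 - al l11 l12 l10 - al l8 l13 l14 - e2" (is "?L = ?R \<longleftrightarrow> ?A = ?B")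
proof -
 have *: "?L - ?R =
  0 - cob f4f2s f4f1s f3f1s f1s s + cob f4f2t f2t f1t f1s s - cob f4f2t f2t f1t t s - cob f4f2t f2t f2s f1s s - cob f4f2t f3f1t f1t f1s s
  + cob f4f2t f3f1t f1t t s + cob f4f2t f3f1t f3f1s f1s s - cob f4f2t f4f1t f3f1t f1t f1s + cob f4f2t f4f1t f3f1t f1t t + cob f4f2t f4f1t f3f1t f3f1s f1s
  - cob f4f2t f4f1t f4f1s f3f1s f1s + cob f4f2t f4f2s f2s f1s s - cob f4f2t f4f2s f3f1s f1s s + cob f4f2t f4f2s f4f1s f3f1s f1s - (?A1 - ?B1)
  + (?A2 - ?B2) + (?A3 - ?B3) - (?A4 - ?B4) + (?A5 - ?B5) + (?A - ?B)
  + (?A6 - ?B6)"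
  by (simp add: cob_def hom3_def lab algebra_simps)
 show ?thesis
  unfolding eq_iff_diff_eq_0[of ?L] * by (simp add: cob_0 P1 P2 P3 P4 P5 P6)
qed

text \<open>Interchange moves a component of the second outer 2-cell past the image of a component
  of the first inner one; \<open>P6\<close>, the 2-cell condition at that arrow, accounts for this.
  \<open>P1\<close> splits \<open>eta\<close> on a product of components, and \<open>P2\<close> to
  \<open>P5\<close> rebracket \<open>gamma\<close>.\<close>

lemma interchange_algebra:
 assumes P1: "e1 + e2 - e3 = g13 - g7 + al l1 l9 l10 - al l1 l4 l11 - al l12 l13 l10" (is "?A1 = ?B1")
  and P2: "g11 + g1 - g9 - g12 = al l2 l8 l7" (is "?A2 = ?B2")
  and P3: "g8 + g5 - g9 - g10 = al l4 l6 l7" (is "?A3 = ?B3")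
  and P4: "g1 + g2 - g3 - g4 = al l1 l2 l3" (is "?A4 = ?B4")
  and P5: "g5 + g2 - g6 - g7 = al l1 l4 l5" (is "?A5 = ?B5")
  and P6: "w2 - w1 = g12 - g10 + e4 + al l2 l8 l14 - al l4 l6 l14 - al l2 l15 l10 - e2" (is "?A6 = ?B6")
  and lab: "l1 = g3f3x - g3f2x" "l2 = g3f2x - g2f2x" "l3 = g2f2x - g1f1x" "l4 = g3f2x - g3f1x" "l5 = g3f1x - g1f1x"
  "l6 = g3f1x - g2f1x" "l7 = g2f1x - g1f1x" "l8 = g2f2x - g2f1x" "l9 = g3f2x - f2x" "l10 = f2x - f1x"
  "l11 = g3f1x - f1x" "l12 = g3f3x - f3x" "l13 = f3x - f2x" "l14 = g2f1x - f1x" "l15 = g2f2x - f2x"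
  "l16 = g1f1x - f1x" "l17 = f1x - x" "l18 = g3f3x - g3f1x" "l19 = g1f1x - x" "l20 = f3x - f1x"
  "l21 = g2f2x - x" "l22 = f2x - x" "l23 = g3f3x - g2f2x"
 shows "(w2 + w3 + al l6 l7 l16 + g8) + (w4 + w5 + al l13 l10 l17 + g13) + e3 + g6 + al l18 l5 l19 + al l12 l20 l17 - al l5 l16 l17 - al l18 l11 l17 = (w1 + w4 + e1 + g4 + al l1 l2 l21 + al l12 l13 l22 - al l2 l15 l22 - al l1 l9 l22) + (w3 + w5 + e4 + g11 + al l8 l7 l19 + al l15 l10 l17 - al l7 l16 l17 - al l8 l14 l17) + al l23 l3 l19 + g3" (is "?L = ?R")
proof -
 have *: "?L - ?R =
  0 + cob g2f2x g2f1x g1f1x f1x x - cob g3f2x g2f2x f2x f1x x - cob g3f2x g2f2x g2f1x g1f1x f1x + cob g3f2x g3f1x g2f1x g1f1x f1x + cob g3f3x f3x f2x f1x x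
  + cob g3f3x g2f2x g1f1x f1x x - cob g3f3x g3f1x g1f1x f1x x - cob g3f3x g3f2x f2x f1x x + cob g3f3x g3f2x g2f2x f1x x + cob g3f3x g3f2x g2f2x g1f1x f1x
  - cob g3f3x g3f2x g3f1x g1f1x f1x - (?A1 - ?B1) - (?A2 - ?B2) + (?A3 - ?B3) + (?A4 - ?B4)
  - (?A5 - ?B5) + (?A6 - ?B6)"
  by (simp add: cob_def hom3_def lab algebra_simps)
 show ?thesis
  unfolding eq_iff_diff_eq_0[of ?L] * by (simp add: cob_0 P1 P2 P3 P4 P5 P6)
qed

text \<open>The terms \<open>e1\<close>, \<open>e2\<close> and \<open>e3\<close> cancel, and what is
  left is an identity for \<open>al\<close> alone, on the images of one arrow under three successive
  functors.\<close>

lemma assoc_algebra: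
 assumes lab: "l1 = hgft - gft" "l2 = gft - gfs" "l3 = gfs - fs" "l4 = hgft - hgfs" "l5 = hgfs - gfs"
  "l6 = gft - ft" "l7 = ft - fs" "l8 = hgft - ft" "l9 = fs - s" "l10 = hgfs - fs"
  "l11 = ft - t" "l12 = t - s" "l13 = gfs - s" "l14 = gft - t"
 shows "al l5 l3 l9 - al l1 l6 l11 = ((e1 + e2 + al l1 l2 l3 - al l4 l5 l3 - al l1 l6 l7) + e3 + al l8 l7 l9 - al l4 l10 l9 - al l8 l11 l12) - (e1 + (e2 + e3 + al l6 l7 l9 - al l2 l3 l9 - al l6 l11 l12) + al l1 l2 l13 - al l4 l5 l13 - al l1 l14 l12)" (is "?L = ?R")
proof -
 have *: "?L - ?R =
  0 + cob hgft gft ft fs s - cob hgft gft ft t s - cob hgft gft gfs fs s + cob hgft hgfs gfs fs s"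
  by (simp add: cob_def hom3_def lab algebra_simps)
 show ?thesis
  unfolding eq_iff_diff_eq_0[of ?L] * by (simp add: cob_0 )
qed

text \<open>\<open>P1\<close> is the condition on \<open>eta\<close> of the outermost 1-morphism at
  two composable components, and \<open>P2\<close> that on \<open>gamma\<close> at three.\<close>

lemma assoc_natural_algebra:
 assumes P1: "e2 + e1 - e4 = g3 - g5 + al l14 l7 l8 - al l14 l4 l11 - al l1 l12 l8" (is "?A1 = ?B1")
  and P2: "g1 + g2 - g4 - g5 = al l14 l4 l5" (is "?A2 = ?B2")
  and lab: "l1 = rqpx - qpx" "l2 = qpx - px" "l3 = px - x" "l4 = rqfx - rgfx" "l5 = rgfx - hgfx"
  "l6 = hgfx - fx" "l7 = rqfx - qfx" "l8 = qfx - gfx" "l9 = gfx - fx" "l10 = hgfx - gfx"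
  "l11 = rgfx - gfx" "l12 = qpx - qfx" "l13 = qfx - fx" "l14 = rqpx - rqfx" "l15 = px - fx"
  "l16 = rqfx - hgfx" "l17 = hgfx - x" "l18 = rqpx - px" "l19 = fx - x" "l20 = rqfx - fx"
  "l21 = gfx - x" "l22 = rqpx - rgfx" "l23 = qpx - gfx"
 shows "al l1 l2 l3 + ((w1 + w2 + e1 + g1 + al l4 l5 l6 + al l7 l8 l9 - al l5 l10 l9 - al l4 l11 l9) + w3 + (e2 + e3 + al l1 l12 l13 - al l14 l7 l13 - al l1 l2 l15) + g2 + al l14 l16 l17 + al l18 l15 l19 - al l16 l6 l19 - al l14 l20 l19) = w1 + (w2 + w3 + e3 + g3 + al l12 l8 l21 + al l2 l15 l19 - al l8 l9 l19 - al l12 l13 l19) + e4 + g4 + al l22 l5 l17 + al l1 l23 l21 - al l5 l10 l21 - al l22 l11 l21 + al l10 l9 l19" (is "?L = ?R")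
proof -
 have *: "?L - ?R =
  0 + cob qpx qfx gfx fx x - cob rgfx hgfx gfx fx x + cob rqpx qpx gfx fx x - cob rqpx qpx px fx x - cob rqpx qpx qfx gfx fx
  - cob rqpx rgfx gfx fx x + cob rqpx rgfx hgfx fx x - cob rqpx rqfx hgfx fx x + cob rqpx rqfx qfx gfx fx - cob rqpx rqfx rgfx gfx fx
  + cob rqpx rqfx rgfx hgfx fx + (?A1 - ?B1) + (?A2 - ?B2)"
  by (simp add: cob_def hom3_def lab algebra_simps)
 show ?thesis
  unfolding eq_iff_diff_eq_0[of ?L] * by (simp add: cob_0 P1 P2)
qed

end

section \<open>Bundles, their morphisms and 2-cells\<close>

lemma locally_constant_map:
 assumes "locally_constant T f" shows "locally_constant T (%t. k (f t))"
 using continuous_map_compose[OF assms, of "discrete_topology UNIV" k] by (simp add: o_def)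

text \<open>A product of two discrete spaces is discrete. Therefore arbitrary operations, such as
  \<open>al\<close>, preserve local constancy in several arguments.\<close>

lemma locally_constant_pair:
 assumes "locally_constant T f" "locally_constant T g" shows "locally_constant T (%t. (f t, g t))"
 unfolding UNIV_Times_UNIV[symmetric] prod_topology_discrete_topology continuous_map_pairwise
 using assms by (simp add: o_def)

lemma locally_constant_map2:
 assumes "locally_constant T f" "locally_constant T g" shows "locally_constant T (%t. k (f t) (g t))"
 using locally_constant_map[OF locally_constant_pair[OF assms], of "%(x, y). k x y"] by simp

lemma locally_constant_map3:
 assumes "locally_constant T f" "locally_constant T g" "locally_constant T h" shows "locally_constant T (%t. k (f t) (g t) (h t))"
 using locally_constant_map2[OF locally_constant_pair[OF assms(1,2)] assms(3), of "%(x, y). k x y"] by simp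

lemma locally_constant_restrict:
 "locally_constant T f ==> locally_constant T (restrict f (topspace T))"
 by (rule continuous_map_eq) simp_all

lemma locally_constant_const: "locally_constant T (%t. c)" by simp

lemmas lc_intros = locally_constant_restrict locally_constant_const
 locally_constant_map2[where k="(+)"] locally_constant_map2[where k="(-)"]

section \<open>Bundles on one groupoid\<close>

locale bun_gpd = cocycle3 al + lie_gpd "base a"
 for al :: "'g::group_add => 'g => 'g => 'a::ab_group_add" and a :: "('p, 'g, 'a) obj" +
 assumes ob: "a : Bun_cells0 al"
begin

abbreviation "X \<equiv> base a"

lemma rho_mu: "ph : X1 X ==> pp : X1 X ==> sr X ph = tg X pp ==> rho a (mu X ph pp) = rho a ph + rho a pp"
 using ob unfolding Bun_cells0_def bun_ob_def split_beta X2_def by auto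

lemma gam_coc: "ph : X1 X ==> pp : X1 X ==> xi : X1 X ==> sr X ph = tg X pp ==> sr X pp = tg X xi ==>
  gam a (pp, xi) + gam a (ph, mu X pp xi) - gam a (mu X ph pp, xi) - gam a (ph, pp) = al (rho a ph) (rho a pp) (rho a xi)"
 using ob unfolding Bun_cells0_def bun_ob_def split_beta X2_def by auto

lemma gam_un: "ph : X1 X ==> x = tg X ph ==> gam a (un X x, ph) = 0" "ph : X1 X ==> x = sr X ph ==> gam a (ph, un X x) = 0"
 using ob unfolding Bun_cells0_def bun_ob_def split_beta by auto

lemma rho_un: "x : X0 X ==> rho a (un X x) = 0"
 using rho_mu[of "un X x" "un X x"] add_left_cancel[of "rho a (un X x)" "rho a (un X x)" 0] by (simp add: gpd_simps unit_r')

lemma rho_iv: "ph : X1 X ==> rho a (iv X ph) = - rho a ph"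
 using rho_mu[of "iv X ph" ph] by (simp add: gpd_simps iv_l rho_un eq_neg_iff_add_eq_0)

text \<open>Stated along a smooth map \<open>g\<close>, so that local constancy of the long
  expressions for \<open>eta\<close> and \<open>omega\<close> is assembled by introduction rules,
  one for each symbol.\<close>

lemma lc_rho: "smooth T (Ar X) g ==> locally_constant (mtop T) (%t. rho a (g t))"
proof -
 assume g: "smooth T (Ar X) g"
 have "locally_constant (mtop (Ar X)) (rho a)" using ob unfolding Bun_cells0_def bun_ob_def split_beta by blast
 from continuous_map_compose[OF sm_continuous[OF g] this] show ?thesis by (simp add: o_def)
qed

lemma lc_gam:
 assumes g: "smooth T (Ar X) g" and h: "smooth T (Ar X) h" and gh: "\<And>t. t : points T ==> sr X (g t) = tg X (h t)"
 shows "locally_constant (mtop T) (%t. gam a (g t, h t))"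
proof -
 have lc: "locally_constant (X2_top X) (gam a)" using ob unfolding Bun_cells0_def bun_ob_def split_beta by blast
 have "continuous_map (mtop T) (X2_top X) (%t. (g t, h t))"
  unfolding X2_top_def continuous_map_in_subtopology
 proof
  show "continuous_map (mtop T) (prod_topology (mtop (Ar X)) (mtop (Ar X))) (%t. (g t, h t))"
   using sm_continuous[OF g] sm_continuous[OF h] by (simp add: continuous_map_pairwise o_def)
  show "(%t. (g t, h t)) : points T \<rightarrow> X2 X"
   using gh sm_point[OF g] sm_point[OF h] by (simp add: Pi_iff X2_iff)
 qed
 from continuous_map_compose[OF this lc] show ?thesis by (simp add: o_def)
qed

lemma lc_al: "locally_constant T f ==> locally_constant T g ==> locally_constant T h ==>
  locally_constant T (%t. al (f t) (g t) (h t))"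
 by (rule locally_constant_map3)

end

lemma bun_gpdI: "normalized_3cocycle al ==> a : Bun_cells0 al ==> bun_gpd al a"
 by (simp add: bun_gpd_def bun_gpd_axioms_def cocycle3_def lie_gpd_def Bun_cells0_def)

section \<open>1-morphisms\<close>

locale bun_mor = A: bun_gpd al a + B: bun_gpd al b + smooth_fctr "base a" "base b" "fn F"
 for al :: "'g::group_add => 'g => 'g => 'a::ab_group_add" and a b :: "('p, 'g, 'a) obj" and F :: "('p, 'g, 'a) mor" +
 assumes mor: "F : Bun_cells1 al" and sob: "sob F = a" and tob: "tob F = b"
begin

lemma bmor: "bun_1mor al (base a) (bun_of a) (pull_ob (base a) (fn F) (bun_of b)) (bmor F)"
 using mor sob tob by (simp add: Bun_cells1_def)

lemma ext_hh: "hh F : extensional (X0 (base a))" and ext_eta: "eta F : extensional (X1 (base a))"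
 using bmor unfolding bun_1mor_def split_beta by blast+

lemma square: "ph : X1 (base a) ==> rho b (f_ar F ph) + hh F (sr (base a) ph) = hh F (tg (base a) ph) + rho a ph"
 using bmor unfolding bun_1mor_def split_beta pull_ob_def by simp

lemma eta_coc: "ph : X1 (base a) ==> pp : X1 (base a) ==> sr (base a) ph = tg (base a) pp ==>
  eta F ph + eta F pp - eta F (mu (base a) ph pp) =
  gam a (ph, pp) - gam b (f_ar F ph, f_ar F pp) + al (rho b (f_ar F ph)) (hh F (tg (base a) pp)) (rho a pp)
  - al (rho b (f_ar F ph)) (rho b (f_ar F pp)) (hh F (sr (base a) pp)) - al (hh F (tg (base a) ph)) (rho a ph) (rho a pp)"
proof -
 assume *: "ph : X1 (base a)" "pp : X1 (base a)" "sr (base a) ph = tg (base a) pp"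
 have m: "(ph, pp) : X2 (base a)" using * by (simp add: X2_def)
 have "\<forall>p\<in>X2 (base a). eta F (fst p) + eta F (snd p) - eta F (mu (base a) (fst p) (snd p)) =
  gam a (fst p, snd p) - snd (pull_ob (base a) (fn F) (bun_of b)) (fst p, snd p)
  + al (fst (pull_ob (base a) (fn F) (bun_of b)) (fst p)) (hh F (tg (base a) (snd p))) (rho a (snd p))
  - al (fst (pull_ob (base a) (fn F) (bun_of b)) (fst p)) (fst (pull_ob (base a) (fn F) (bun_of b)) (snd p)) (hh F (sr (base a) (snd p)))
  - al (hh F (tg (base a) (fst p))) (rho a (fst p)) (rho a (snd p))"
  using bmor unfolding bun_1mor_def split_beta by (elim conjE)
 from bspec[OF this m] show ?thesis using * m unfolding pull_ob_def split_beta by simp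
qed

text \<open>At a pair of equal units all terms in \<open>gamma\<close> and \<open>al\<close> vanish
  by normalization, and the left side of the condition reduces to the value itself.\<close>

lemma eta_un: "x : X0 (base a) ==> eta F (un (base a) x) = 0"
 using eta_coc[of "un (base a) x" "un (base a) x"]
 by (simp add: A.gpd_simps f_simps A.unit_r' f_un A.gam_un B.gam_un A.rho_un B.rho_un B.gpd_simps)

lemma lc_hh: "smooth T (Ob (base a)) g ==> locally_constant (mtop T) (%t. hh F (g t))"
 and lc_eta: "smooth T (Ar (base a)) k ==> locally_constant (mtop T) (%t. eta F (k t))"
proof -
 have lc: "locally_constant (mtop (Ob (base a))) (hh F)" "locally_constant (mtop (Ar (base a))) (eta F)"
  using bmor unfolding bun_1mor_def split_beta by blast+
 show "smooth T (Ob (base a)) g ==> locally_constant (mtop T) (%t. hh F (g t))"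
  using continuous_map_compose[OF sm_continuous[of T _ g] lc(1)] by (simp add: o_def)
 show "smooth T (Ar (base a)) k ==> locally_constant (mtop T) (%t. eta F (k t))"
  using continuous_map_compose[OF sm_continuous[of T _ k] lc(2)] by (simp add: o_def)
qed

lemma sm0: "manifold T ==> smooth T (Ob (base a)) g ==> smooth T (Ob (base b)) (%t. f_ob F (g t))"
 using sm_compose'[OF _ A.mfd_Ob B.mfd_Ob _ smooth0] .

lemma sm1: "manifold T ==> smooth T (Ar (base a)) g ==> smooth T (Ar (base b)) (%t. f_ar F (g t))"
 using sm_compose'[OF _ A.mfd_Ar B.mfd_Ar _ smooth1] .

end

lemma bun_morI: "normalized_3cocycle al ==> F : Bun_cells1 al ==> sob F = a ==> tob F = b ==> bun_mor al a b F"
 using bun_gpdI[of al a] bun_gpdI[of al b]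
 by (auto simp: bun_mor_def bun_mor_axioms_def smooth_fctr_def smooth_fctr_axioms_def Bun_cells1_def bun_gpd_def)

text \<open>The pulled back bundle is unfolded here once; the conditions then speak about
  \<open>b\<close> along \<open>F\<close>, where the algebraic identities apply.\<close>

lemma bun_mor_intro:
 assumes a: "bun_gpd al a" and b: "bun_gpd al b" and ab: "sob F = a" "tob F = b" and f: "smooth_functor (base a) (base b) (fn F)"
  and ext: "hh F : extensional (X0 (base a))" "eta F : extensional (X1 (base a))"
  and lc: "locally_constant (mtop (Ob (base a))) (hh F)" "locally_constant (mtop (Ar (base a))) (eta F)"
  and sq: "\<And>ph. ph : X1 (base a) ==> rho b (f_ar F ph) + hh F (sr (base a) ph) = hh F (tg (base a) ph) + rho a ph"
  and coc: "\<And>ph pp. ph : X1 (base a) ==> pp : X1 (base a) ==> sr (base a) ph = tg (base a) pp ==>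
   eta F ph + eta F pp - eta F (mu (base a) ph pp) =
   gam a (ph, pp) - gam b (f_ar F ph, f_ar F pp) + al (rho b (f_ar F ph)) (hh F (tg (base a) pp)) (rho a pp)
   - al (rho b (f_ar F ph)) (rho b (f_ar F pp)) (hh F (sr (base a) pp)) - al (hh F (tg (base a) ph)) (rho a ph) (rho a pp)"
 shows "bun_mor al a b F"
proof -
 interpret A: bun_gpd al a by (rule a)
 interpret B: bun_gpd al b by (rule b)
 let ?p = "pull_ob (base a) (fn F) (bun_of b)"
 have p: "ph : X1 (base a) ==> fst ?p ph = rho b (f_ar F ph)" "(ph, pp) : X2 (base a) ==> snd ?p (ph, pp) = gam b (f_ar F ph, f_ar F pp)" for ph pp
  by (simp_all add: pull_ob_def split_beta)
 have "bun_1mor al (base a) (bun_of a) ?p (bmor F)"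
  unfolding bun_1mor_def split_beta
 proof (intro conjI ext lc ballI)
  show "fst ?p ph + hh F (sr (base a) ph) = hh F (tg (base a) ph) + rho a ph" if "ph : X1 (base a)" for ph
   using sq[OF that] by (simp add: p that)
  fix c assume c: "c : X2 (base a)"
  obtain ph pp where [simp]: "c = (ph, pp)" by (cases c)
  have m: "ph : X1 (base a)" "pp : X1 (base a)" "sr (base a) ph = tg (base a) pp" using c by (simp_all add: X2_def)
  show "eta F (fst c) + eta F (snd c) - eta F (mu (base a) (fst c) (snd c)) = gam a (fst c, snd c) - snd ?p (fst c, snd c)
    + al (fst ?p (fst c)) (hh F (tg (base a) (snd c))) (rho a (snd c))
    - al (fst ?p (fst c)) (fst ?p (snd c)) (hh F (sr (base a) (snd c)))
    - al (hh F (tg (base a) (fst c))) (rho a (fst c)) (rho a (snd c))"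
   using coc[OF m] c m by (simp only: fst_conv snd_conv \<open>c = (ph, pp)\<close> p)
 qed
 then show ?thesis
  by (intro bun_morI A.normalized) (simp_all add: Bun_cells1_def ab f A.ob B.ob)
qed

section \<open>2-cells\<close>

locale bun_cell = F: bun_mor al a b F + G: bun_mor al a b G + nat_trans "base a" "base b" "fn F" "fn G" "tau Th"
 for al :: "'g::group_add => 'g => 'g => 'a::ab_group_add" and a b :: "('p, 'g, 'a) obj" and F G :: "('p, 'g, 'a) mor"
  and Th :: "('p, 'g, 'a) cell" +
 assumes cell: "Th : Bun_cells2 al" and smor: "smor Th = F" and tmor: "tmor Th = G"
begin

lemma b2: "bun_2mor (base a) (bun_comp al (base a) (bun_of a) (pull_ob (base a) (fn F) (bun_of b)) (pull_ob (base a) (fn G) (bun_of b))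
   (tau_tilde (base a) (fn F) (fn G) (tau Th) (bun_of b)) (bmor F)) (bmor G) (omega Th)"
 using cell unfolding Bun_cells2_def Let_def mem_Collect_eq smor tmor F.sob F.tob by (elim conjE)

lemma ext_omega: "omega Th : extensional (X0 (base a))"
 using b2 unfolding bun_2mor_def split_beta by blast

lemma hh_eq: "x : X0 (base a) ==> hh G x = rho b (tau Th x) + hh F x"
proof -
 assume x: "x : X0 (base a)"
 have "fst (bun_comp al (base a) (bun_of a) (pull_ob (base a) (fn F) (bun_of b)) (pull_ob (base a) (fn G) (bun_of b))
   (tau_tilde (base a) (fn F) (fn G) (tau Th) (bun_of b)) (bmor F)) = hh G"
  using b2 unfolding bun_2mor_def split_beta by blast
 from fun_cong[OF this, of x] x show ?thesis by (simp add: bun_comp_def tau_tilde_def split_beta)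
qed

lemma cond: "ph : X1 (base a) ==> omega Th (sr (base a) ph) - omega Th (tg (base a) ph) =
  gam b (tau Th (tg (base a) ph), f_ar F ph) - gam b (f_ar G ph, tau Th (sr (base a) ph)) + eta F ph
  + al (rho b (tau Th (tg (base a) ph))) (rho b (f_ar F ph)) (hh F (sr (base a) ph))
  - al (rho b (f_ar G ph)) (rho b (tau Th (sr (base a) ph))) (hh F (sr (base a) ph))
  - al (rho b (tau Th (tg (base a) ph))) (hh F (tg (base a) ph)) (rho a ph) - eta G ph"
proof -
 assume ph: "ph : X1 (base a)"
 have "omega Th (sr (base a) ph) - omega Th (tg (base a) ph) =
  snd (bun_comp al (base a) (bun_of a) (pull_ob (base a) (fn F) (bun_of b)) (pull_ob (base a) (fn G) (bun_of b))
   (tau_tilde (base a) (fn F) (fn G) (tau Th) (bun_of b)) (bmor F)) ph - eta G ph"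
  using b2 ph unfolding bun_2mor_def split_beta by blast
 then show ?thesis using ph by (simp add: bun_comp_def tau_tilde_def pull_ob_def split_beta F.A.gpd_simps)
qed

lemma lc_omega: "smooth T (Ob (base a)) g ==> locally_constant (mtop T) (%t. omega Th (g t))"
proof -
 assume g: "smooth T (Ob (base a)) g"
 have "locally_constant (mtop (Ob (base a))) (omega Th)" using b2 unfolding bun_2mor_def split_beta by blast
 from continuous_map_compose[OF sm_continuous[OF g] this] show ?thesis by (simp add: o_def)
qed

end

lemma bun_cellI:
 assumes n: "normalized_3cocycle al" and c: "Th : Bun_cells2 al"
 shows "bun_cell al (sob (smor Th)) (tob (smor Th)) (smor Th) (tmor Th) Th"
proof -
 have "smor Th : Bun_cells1 al" "tmor Th : Bun_cells1 al" "sob (smor Th) = sob (tmor Th)" "tob (smor Th) = tob (tmor Th)"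
  "smooth_nat_trans (base (sob (smor Th))) (base (tob (smor Th))) (fn (smor Th)) (fn (tmor Th)) (tau Th)"
  using c unfolding Bun_cells2_def Let_def mem_Collect_eq by blast+
 moreover from this have "bun_mor al (sob (smor Th)) (tob (smor Th)) (smor Th)" "bun_mor al (sob (smor Th)) (tob (smor Th)) (tmor Th)"
  by (auto intro: bun_morI n)
 ultimately show ?thesis
  using c by (simp add: bun_cell_def bun_cell_axioms_def nat_trans_def nat_trans_axioms_def bun_mor_def)
qed

lemma bun_cell_intro:
 assumes F: "bun_mor al a b F" and G: "bun_mor al a b G" and st: "smor Th = F" "tmor Th = G"
  and t: "smooth (Ob (base a)) (Ar (base b)) (tau Th)" "tau Th : extensional (X0 (base a))"
   "\<And>x. x : X0 (base a) ==> sr (base b) (tau Th x) = f_ob F x" "\<And>x. x : X0 (base a) ==> tg (base b) (tau Th x) = f_ob G x"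
   "\<And>ph. ph : X1 (base a) ==> mu (base b) (tau Th (tg (base a) ph)) (f_ar F ph) = mu (base b) (f_ar G ph) (tau Th (sr (base a) ph))"
  and o: "omega Th : extensional (X0 (base a))" "locally_constant (mtop (Ob (base a))) (omega Th)"
  and hh: "\<And>x. x : X0 (base a) ==> hh G x = rho b (tau Th x) + hh F x"
  and cond: "\<And>ph. ph : X1 (base a) ==> omega Th (sr (base a) ph) - omega Th (tg (base a) ph) =
  gam b (tau Th (tg (base a) ph), f_ar F ph) - gam b (f_ar G ph, tau Th (sr (base a) ph)) + eta F ph
  + al (rho b (tau Th (tg (base a) ph))) (rho b (f_ar F ph)) (hh F (sr (base a) ph))
  - al (rho b (f_ar G ph)) (rho b (tau Th (sr (base a) ph))) (hh F (sr (base a) ph))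
  - al (rho b (tau Th (tg (base a) ph))) (hh F (tg (base a) ph)) (rho a ph) - eta G ph"
 shows "bun_cell al a b F G Th"
proof -
 interpret F: bun_mor al a b F by (rule F)
 interpret G: bun_mor al a b G by (rule G)
 let ?c = "bun_comp al (base a) (bun_of a) (pull_ob (base a) (fn F) (bun_of b)) (pull_ob (base a) (fn G) (bun_of b))
   (tau_tilde (base a) (fn F) (fn G) (tau Th) (bun_of b)) (bmor F)"
 have h: "fst ?c = hh G"
 proof (rule extensionalityI[of _ "X0 (base a)"])
  show "fst ?c : extensional (X0 (base a))" by (simp add: bun_comp_def split_beta)
  show "fst ?c x = hh G x" if "x : X0 (base a)" for x using that hh[OF that] by (simp add: bun_comp_def tau_tilde_def split_beta)
 qed (rule G.ext_hh)
 have "bun_2mor (base a) ?c (bmor G) (omega Th)"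
  unfolding bun_2mor_def split_beta
 proof (intro conjI h o ballI)
  show "omega Th (sr (base a) ph) - omega Th (tg (base a) ph) = snd ?c ph - eta G ph" if "ph : X1 (base a)" for ph
   using cond[OF that] that by (simp add: bun_comp_def tau_tilde_def pull_ob_def split_beta F.A.gpd_simps)
 qed
 moreover have "smooth_nat_trans (base a) (base b) (fn F) (fn G) (tau Th)"
  unfolding smooth_nat_trans_def by (intro conjI ballI t)
 ultimately have "Th : Bun_cells2 al"
  unfolding Bun_cells2_def Let_def using F.mor G.mor F.sob F.tob G.sob G.tob st by simp
 from bun_cellI[OF F.A.normalized this] show ?thesis unfolding st F.sob F.tob .
qed

lemma cell_eqI:
 assumes "bun_cell al a b F G Th" "bun_cell al a b F G Xi"
  and "\<And>x. x : X0 (base a) ==> tau Th x = tau Xi x" "\<And>x. x : X0 (base a) ==> omega Th x = omega Xi x"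
 shows "Th = Xi"
proof -
 interpret T: bun_cell al a b F G Th by (rule assms)
 interpret S: bun_cell al a b F G Xi by (rule assms)
 have "tau Th = tau Xi" by (rule extensionalityI[OF T.ext_ta S.ext_ta assms(3)])
 moreover have "omega Th = omega Xi" by (rule extensionalityI[OF T.ext_omega S.ext_omega assms(4)])
 ultimately show ?thesis using T.smor S.smor T.tmor S.tmor by (intro cell.equality) simp_all
qed

text \<open>The labels of a diagram act on the potentials of its vertices; this closes the action law
  under composition.\<close>

lemma add_act: "l + r = q ==> l + (r + z) = q + (z :: 'g :: group_add)"
 by (simp add: add.assoc[symmetric])

section \<open>Composition of 1-morphisms\<close>

locale mor_pair = F: bun_mor al a b F + G: bun_mor al b c G
 for al :: "'g::group_add => 'g => 'g => 'a::ab_group_add" and a b c :: "('p, 'g, 'a) obj" and F G :: "('p, 'g, 'a) mor"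
begin

lemma sob_comp: "sob (cmp al G F) = a" and tob_comp: "tob (cmp al G F) = c"
 and fn_comp: "fn (cmp al G F) = comp_functor (base a) (fn G) (fn F)"
 by (simp_all add: Bun_comp1_def Let_def F.sob G.tob)

lemma hh_comp: "x : X0 (base a) ==> hh (cmp al G F) x = hh G (f_ob F x) + hh F x"
 by (simp add: Bun_comp1_def Let_def F.sob F.tob G.tob bun_comp_def pull_mor_def pull_ob_def split_beta)

lemma eta_comp: "ph : X1 (base a) ==> eta (cmp al G F) ph = eta G (f_ar F ph) + eta F ph
  + al (hh G (f_ob F (tg (base a) ph))) (rho b (f_ar F ph)) (hh F (sr (base a) ph))
  - al (rho c (f_ar G (f_ar F ph))) (hh G (f_ob F (sr (base a) ph))) (hh F (sr (base a) ph))
  - al (hh G (f_ob F (tg (base a) ph))) (hh F (tg (base a) ph)) (rho a ph)"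
 by (simp add: Bun_comp1_def Let_def F.sob F.tob G.tob bun_comp_def pull_mor_def pull_ob_def split_beta F.A.gpd_simps)

lemma f_comp: "x : X0 (base a) ==> f_ob (cmp al G F) x = f_ob G (f_ob F x)"
 "ph : X1 (base a) ==> f_ar (cmp al G F) ph = f_ar G (f_ar F ph)"
 by (simp_all add: fn_comp)

lemma comp_mor: "bun_mor al a c (cmp al G F)"
proof (rule bun_mor_intro)
 let ?H = "cmp al G F"
 show "bun_gpd al a" by unfold_locales
 show "bun_gpd al c" by unfold_locales
 show "smooth_functor (base a) (base c) (fn ?H)"
  unfolding fn_comp by (rule smooth_functor_comp[OF F.smooth_fctr_axioms G.smooth_fctr_axioms])
 show "hh ?H : extensional (X0 (base a))" "eta ?H : extensional (X1 (base a))"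
  by (simp_all add: Bun_comp1_def Let_def F.sob bun_comp_def split_beta)
 note ids = sm_ident[OF F.A.mfd_Ob] sm_ident[OF F.A.mfd_Ar]
 note f0 = F.sm0[OF F.A.mfd_Ob ids(1)] and f1 = F.sm1[OF F.A.mfd_Ar ids(2)]
 note s1 = F.A.smooth_sr F.A.smooth_tg
 show "locally_constant (mtop (Ob (base a))) (hh ?H)"
  by (rule continuous_map_eq[OF locally_constant_map2[OF G.lc_hh[OF f0] F.lc_hh[OF ids(1)], of "(+)"]])
   (simp add: hh_comp)
 have "locally_constant (mtop (Ar (base a))) (%ph. eta G (f_ar F ph) + eta F ph
  + al (hh G (f_ob F (tg (base a) ph))) (rho b (f_ar F ph)) (hh F (sr (base a) ph))
  - al (rho c (f_ar G (f_ar F ph))) (hh G (f_ob F (sr (base a) ph))) (hh F (sr (base a) ph))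
  - al (hh G (f_ob F (tg (base a) ph))) (hh F (tg (base a) ph)) (rho a ph))"
  by (intro lc_intros F.A.lc_al F.lc_eta G.lc_eta F.lc_hh G.lc_hh F.A.lc_rho F.B.lc_rho G.B.lc_rho F.sm0 F.sm1 G.sm1 ids s1 F.A.mfd_Ar)
 then show "locally_constant (mtop (Ar (base a))) (eta ?H)"
  by (rule continuous_map_eq) (simp add: eta_comp)
 show "rho c (f_ar ?H ph) + hh ?H (sr (base a) ph) = hh ?H (tg (base a) ph) + rho a ph" if "ph : X1 (base a)" for ph
  using that F.square[OF that] add_act[OF G.square[OF F.f1_in[OF that], unfolded F.f_sr[OF that] F.f_tg[OF that]]]
  by (simp add: f_comp hh_comp F.A.gpd_simps add.assoc)
 show "eta ?H ph + eta ?H pp - eta ?H (mu (base a) ph pp) =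
   gam a (ph, pp) - gam c (f_ar ?H ph, f_ar ?H pp) + al (rho c (f_ar ?H ph)) (hh ?H (tg (base a) pp)) (rho a pp)
   - al (rho c (f_ar ?H ph)) (rho c (f_ar ?H pp)) (hh ?H (sr (base a) pp)) - al (hh ?H (tg (base a) ph)) (rho a ph) (rho a pp)"
  if ph: "ph : X1 (base a)" and pp: "pp : X1 (base a)" and st: "sr (base a) ph = tg (base a) pp" for ph pp
 proof -
  let ?s = "sr (base a) pp" and ?t = "tg (base a) pp" and ?u = "tg (base a) ph" and ?m = "mu (base a) ph pp"
  have X: "?s : X0 (base a)" "?t : X0 (base a)" "?u : X0 (base a)" "?m : X1 (base a)" "sr (base a) ph = ?t"
   "sr (base a) ?m = ?s" "tg (base a) ?m = ?u"
   using ph pp st by (simp_all add: F.A.gpd_simps)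
  have Y: "f_ar F ph : X1 (base b)" "f_ar F pp : X1 (base b)" "sr (base b) (f_ar F ph) = tg (base b) (f_ar F pp)"
   "sr (base b) (f_ar F pp) = f_ob F ?s" "tg (base b) (f_ar F pp) = f_ob F ?t" "tg (base b) (f_ar F ph) = f_ob F ?u"
   using ph pp st by (simp_all add: F.f_simps)
  have m: "f_ar F ?m = mu (base b) (f_ar F ph) (f_ar F pp)" by (rule F.f_mu[OF ph pp st])
  have Gm: "f_ar G (mu (base b) (f_ar F ph) (f_ar F pp)) = mu (base c) (f_ar G (f_ar F ph)) (f_ar G (f_ar F pp))"
   by (rule G.f_mu[OF Y(1-3)])
  have Z: "f_ar G (f_ar F ph) : X1 (base c)" "f_ar G (f_ar F pp) : X1 (base c)"
   "sr (base c) (f_ar G (f_ar F ph)) = tg (base c) (f_ar G (f_ar F pp))"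
   using Y by (simp_all add: G.f_simps)
  note sqF = F.square[OF ph, unfolded X(5)] F.square[OF pp]
  note sqG = G.square[OF Y(1), unfolded Y(3) Y(5) Y(6)] G.square[OF Y(2), unfolded Y(4,5)]
  note eqs = sqF sqG F.A.rho_mu[OF ph pp st] F.B.rho_mu[OF Y(1-3)] G.B.rho_mu[OF Z]
  note acts = eqs sqF[THEN add_act] sqG[THEN add_act] add.assoc
  \<comment> \<open>The potential of a vertex is the total label of a path to it from the source,
    which gets 0. By the square laws the path does not matter, and each label is the difference of
    the potentials at its ends. The later diagrams are labelled in the same way.\<close>
  show ?thesis
   unfolding eta_comp[OF ph] eta_comp[OF pp] eta_comp[OF X(4)] f_comp(2)[OF ph] f_comp(2)[OF pp] hh_comp[OF X(1)] hh_comp[OF X(2)]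
    hh_comp[OF X(3)] X(5-7) m Gm
   by (rule F.A.comp1_algebra[where s=0 and t="rho a pp" and u="rho a ph + rho a pp"
      and fs="hh F ?s" and ft="hh F ?t + rho a pp" and fu="hh F ?u + (rho a ph + rho a pp)"
      and gfs="hh G (f_ob F ?s) + hh F ?s" and gft="hh G (f_ob F ?t) + (hh F ?t + rho a pp)"
      and gfu="hh G (f_ob F ?u) + (hh F ?u + (rho a ph + rho a pp))",
      OF G.eta_coc[OF Y(1-3), unfolded Y(3-6)], THEN iffD2])
    (rule F.eta_coc[OF ph pp st] | simp add: acts eq_diff_eq)+
 qed
qed (rule sob_comp tob_comp)+

end

context bun_gpd
begin

lemma id1_mor: "bun_mor al a a (Bun_id1 a)"
proof (rule bun_mor_intro)
 show "bun_gpd al a" "bun_gpd al a" by unfold_locales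
 show "smooth_functor (base a) (base a) (fn (Bun_id1 a))"
  using smooth_functor_id[OF lie_gpd_axioms] by (simp add: Bun_id1_def)
 show "locally_constant (mtop (Ob (base a))) (hh (Bun_id1 a))" "locally_constant (mtop (Ar (base a))) (eta (Bun_id1 a))"
  using locally_constant_restrict[OF locally_constant_const, of _ 0] by (simp_all add: Bun_id1_def)
qed (simp_all add: Bun_id1_def gpd_simps)

end

context bun_mor
begin

lemma id2_cell: "bun_cell al a b F F (Bun_id2 F)"
proof (rule bun_cell_intro)
 show "bun_mor al a b F" "bun_mor al a b F" by unfold_locales
 note id = sm_ident[OF A.mfd_Ob]
 have "smooth (Ob (base a)) (Ar (base b)) (%x. un (base b) (f_ob F x))"
  by (rule sm_compose'[OF A.mfd_Ob B.mfd_Ob B.mfd_Ar smooth0 B.smooth_un])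
 then show "smooth (Ob (base a)) (Ar (base b)) (tau (Bun_id2 F))"
  by (rule sm_cong[OF A.mfd_Ob B.mfd_Ar]) (simp add: Bun_id2_def sob tob)
 show "locally_constant (mtop (Ob (base a))) (omega (Bun_id2 F))"
  using locally_constant_restrict[OF locally_constant_const, of _ 0] by (simp add: Bun_id2_def sob)
qed (simp_all add: Bun_id2_def sob tob B.gpd_simps f_simps A.gpd_simps B.unit_r' B.unit_l' B.rho_un B.gam_un)

lemma tau_id2: "x : X0 (base a) ==> tau (Bun_id2 F) x = un (base b) (f_ob F x)"
 and omega_id2: "x : X0 (base a) ==> omega (Bun_id2 F) x = 0"
 by (simp_all add: Bun_id2_def sob tob)

lemma mor_eqI:
 assumes "bun_mor al a b G" and "\<And>x. x : X0 (base a) ==> f_ob F x = f_ob G x" "\<And>ph. ph : X1 (base a) ==> f_ar F ph = f_ar G ph"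
  "\<And>x. x : X0 (base a) ==> hh F x = hh G x" "\<And>ph. ph : X1 (base a) ==> eta F ph = eta G ph"
 shows "F = G"
proof -
 interpret G: bun_mor al a b G by (rule assms)
 have "f_ob F = f_ob G" by (rule extensionalityI[OF ext0 G.ext0 assms(2)])
 moreover have "f_ar F = f_ar G" by (rule extensionalityI[OF ext1 G.ext1 assms(3)])
 moreover have "hh F = hh G" by (rule extensionalityI[OF ext_hh G.ext_hh assms(4)])
 moreover have "eta F = eta G" by (rule extensionalityI[OF ext_eta G.ext_eta assms(5)])
 ultimately show ?thesis using sob G.sob tob G.tob by (intro mor.equality) (simp_all add: prod_eq_iff)
qed

lemma id1_comp: "cmp al (Bun_id1 b) F = F"
proof -
 interpret I: bun_mor al b b "Bun_id1 b" by (rule B.id1_mor)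
 interpret P: mor_pair al a b b F "Bun_id1 b" ..
 interpret C: bun_mor al a b "cmp al (Bun_id1 b) F" by (rule P.comp_mor)
 show ?thesis
  by (rule C.mor_eqI) (unfold_locales, simp_all add: P.f_comp P.hh_comp P.eta_comp, simp_all add: Bun_id1_def f_simps A.gpd_simps)
qed

lemma comp_id1: "cmp al F (Bun_id1 a) = F"
proof -
 interpret I: bun_mor al a a "Bun_id1 a" by (rule A.id1_mor)
 interpret P: mor_pair al a a b "Bun_id1 a" F ..
 interpret C: bun_mor al a b "cmp al F (Bun_id1 a)" by (rule P.comp_mor)
 show ?thesis
  by (rule C.mor_eqI) (unfold_locales, simp_all add: P.f_comp P.hh_comp P.eta_comp, simp_all add: Bun_id1_def f_simps A.gpd_simps)
qed

end

text \<open>A 2-cell without its \<open>omega\<close>. Inverses and lifts have their transformation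
  before their \<open>omega\<close> is known to satisfy the condition, so the equivalences below are
  stated at this level.\<close>

locale bun_tr = F: bun_mor al a b F + G: bun_mor al a b G + nat_trans "base a" "base b" "fn F" "fn G" ta
 for al :: "'g::group_add => 'g => 'g => 'a::ab_group_add" and a b :: "('p, 'g, 'a) obj" and F G :: "('p, 'g, 'a) mor"
  and ta :: "'p => 'p" +
 assumes hh_eq: "x : X0 (base a) ==> hh G x = rho b (ta x) + hh F x"

locale tr_vpair = X: bun_cell al a b F G Xi + T: bun_tr al a b G H si
 for al :: "'g::group_add => 'g => 'g => 'a::ab_group_add" and a b :: "('p, 'g, 'a) obj" and F G H :: "('p, 'g, 'a) mor"
  and Xi :: "('p, 'g, 'a) cell" and si :: "'p => 'p"
begin

text \<open>\<open>o'\<close> is only a candidate for \<open>omega\<close> over \<open>si\<close>,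
  and \<open>ov\<close> is what the formula for vertical composition makes of it. Since
  \<open>Xi\<close> is a genuine 2-cell, \<open>ov\<close> satisfies its condition exactly when
  \<open>o'\<close> does.\<close>

lemma vcomp_cond_iff:
 assumes ph: "ph : X1 (base a)"
  and o: "\<And>x. x : X0 (base a) ==> ov x = o' x + omega Xi x + al (rho b (si x)) (rho b (tau Xi x)) (hh F x) + gam b (si x, tau Xi x)"
 shows "ov (sr (base a) ph) - ov (tg (base a) ph) =
   gam b (mu (base b) (si (tg (base a) ph)) (tau Xi (tg (base a) ph)), f_ar F ph)
   - gam b (f_ar H ph, mu (base b) (si (sr (base a) ph)) (tau Xi (sr (base a) ph))) + eta F ph
   + al (rho b (mu (base b) (si (tg (base a) ph)) (tau Xi (tg (base a) ph)))) (rho b (f_ar F ph)) (hh F (sr (base a) ph))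
   - al (rho b (f_ar H ph)) (rho b (mu (base b) (si (sr (base a) ph)) (tau Xi (sr (base a) ph)))) (hh F (sr (base a) ph))
   - al (rho b (mu (base b) (si (tg (base a) ph)) (tau Xi (tg (base a) ph)))) (hh F (tg (base a) ph)) (rho a ph) - eta H ph \<longleftrightarrow>
  o' (sr (base a) ph) - o' (tg (base a) ph) =
   gam b (si (tg (base a) ph), f_ar G ph) - gam b (f_ar H ph, si (sr (base a) ph)) + eta G ph
   + al (rho b (si (tg (base a) ph))) (rho b (f_ar G ph)) (hh G (sr (base a) ph))
   - al (rho b (f_ar H ph)) (rho b (si (sr (base a) ph))) (hh G (sr (base a) ph))
   - al (rho b (si (tg (base a) ph))) (hh G (tg (base a) ph)) (rho a ph) - eta H ph"
proof -
 let ?s = "sr (base a) ph" and ?t = "tg (base a) ph"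
 let ?A = "tau Xi ?s" and ?B = "si ?s" and ?A' = "tau Xi ?t" and ?B' = "si ?t"
 have st: "?s : X0 (base a)" "?t : X0 (base a)" using ph by (simp_all add: X.F.A.gpd_simps)
 note A = X.ta_in[OF st(1)] X.ta_in[OF st(2)] T.ta_in[OF st(1)] T.ta_in[OF st(2)]
 note fi = X.F.f1_in[OF ph] X.G.f1_in[OF ph] T.G.f1_in[OF ph]
 have ends: "sr (base b) ?B = tg (base b) ?A" "sr (base b) ?B' = tg (base b) ?A'" "sr (base b) ?A' = tg (base b) (f_ar F ph)"
  "sr (base b) (f_ar G ph) = tg (base b) ?A" "sr (base b) ?B' = tg (base b) (f_ar G ph)" "sr (base b) (f_ar H ph) = tg (base b) ?B"
  using ph st by (simp_all add: X.ta_simps T.ta_simps X.F.f_simps X.G.f_simps T.G.f_simps)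
 \<comment> \<open>The three chains run along two naturality squares stacked on each other;
   naturality identifies the composites that occur in two of them.\<close>
 note P1 = X.F.B.gam_coc[OF A(4,2) fi(1) ends(2,3), unfolded X.ta_nat[OF ph]]
 note P2 = X.F.B.gam_coc[OF A(4) fi(2) A(1) ends(5,4), unfolded T.ta_nat[OF ph]]
 note P3 = X.F.B.gam_coc[OF fi(3) A(3,1) ends(6,1)]
 note sq = X.F.square[OF ph] X.G.square[OF ph] T.G.square[OF ph] X.hh_eq[OF st(1), symmetric] X.hh_eq[OF st(2), symmetric]
  T.hh_eq[OF st(1), symmetric] T.hh_eq[OF st(2), symmetric]
 note acts = sq sq[THEN add_act] add.assoc X.F.B.rho_mu[OF A(3,1) ends(1)] X.F.B.rho_mu[OF A(4,2) ends(2)]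
 show ?thesis
  unfolding o[OF st(1)] o[OF st(2)]
  by (rule X.F.A.vcomp_algebra[where s=0 and t="rho a ph" and fs="hh F ?s" and ft="hh F ?t + rho a ph"
     and gs="hh G ?s" and gt="hh G ?t + rho a ph" and hs="hh H ?s" and ht="hh H ?t + rho a ph",
     OF P1 P2 P3 X.cond[OF ph]])
   (simp_all add: acts eq_diff_eq)
qed

end

section \<open>Vertical composition\<close>

locale cell_vpair = X: bun_cell al a b F G Xi + T: bun_cell al a b G H Th
 for al :: "'g::group_add => 'g => 'g => 'a::ab_group_add" and a b :: "('p, 'g, 'a) obj" and F G H :: "('p, 'g, 'a) mor"
  and Xi Th :: "('p, 'g, 'a) cell"
begin

lemma tau_vcomp: "x : X0 (base a) ==> tau (vcmp al Th Xi) x = mu (base b) (tau Th x) (tau Xi x)"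
 and omega_vcomp: "x : X0 (base a) ==> omega (vcmp al Th Xi) x = omega Th x + omega Xi x
  + al (rho b (tau Th x)) (rho b (tau Xi x)) (hh F x) + gam b (tau Th x, tau Xi x)"
 by (simp_all add: Bun_vcomp_def Let_def X.smor X.F.sob X.F.tob)

sublocale V: tr_vpair al a b F G H Xi "tau Th"
 by unfold_locales (rule T.hh_eq)

lemma vcomp_cell: "bun_cell al a b F H (vcmp al Th Xi)"
proof (rule bun_cell_intro)
 let ?V = "vcmp al Th Xi"
 show "bun_mor al a b F" "bun_mor al a b H" by unfold_locales
 show "smor ?V = F" "tmor ?V = H" by (simp_all add: Bun_vcomp_def Let_def X.smor T.tmor)
 note id = sm_ident[OF X.F.A.mfd_Ob]
 have m: "sr (base b) (tau Th x) = tg (base b) (tau Xi x)" if "x : X0 (base a)" for x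
  using that by (simp add: X.ta_simps T.ta_simps)
 show "smooth (Ob (base a)) (Ar (base b)) (tau ?V)"
  by (rule sm_cong[OF X.F.A.mfd_Ob X.F.B.mfd_Ar X.F.B.smooth_mu'[OF X.F.A.mfd_Ob T.smooth_ta X.smooth_ta m]])
   (simp_all add: tau_vcomp)
 show "tau ?V : extensional (X0 (base a))" "omega ?V : extensional (X0 (base a))"
  by (simp_all add: Bun_vcomp_def Let_def X.smor X.F.sob)
 have "locally_constant (mtop (Ob (base a))) (%x. omega Th x + omega Xi x
  + al (rho b (tau Th x)) (rho b (tau Xi x)) (hh F x) + gam b (tau Th x, tau Xi x))"
  by (intro lc_intros X.F.A.lc_al X.lc_omega T.lc_omega X.F.lc_hh X.F.B.lc_rho X.F.B.lc_gam X.smooth_ta T.smooth_ta id m)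
 then show "locally_constant (mtop (Ob (base a))) (omega ?V)"
  by (rule continuous_map_eq) (simp add: omega_vcomp)
 show "sr (base b) (tau ?V x) = f_ob F x" "tg (base b) (tau ?V x) = f_ob H x" "hh H x = rho b (tau ?V x) + hh F x"
  if x: "x : X0 (base a)" for x
  using x X.F.B.rho_mu[OF T.ta_in[OF x] X.ta_in[OF x] m[OF x]]
  by (simp_all add: tau_vcomp X.F.B.gpd_simps X.ta_simps T.ta_simps X.hh_eq T.hh_eq add.assoc)
 fix ph assume ph: "ph : X1 (base a)"
 let ?s = "sr (base a) ph" and ?t = "tg (base a) ph"
 have st: "?s : X0 (base a)" "?t : X0 (base a)" using ph by (simp_all add: X.F.A.gpd_simps)
 note bs = X.F.f_simps X.G.f_simps T.G.f_simps X.ta_simps T.ta_simps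
 have "mu (base b) (mu (base b) (tau Th ?t) (tau Xi ?t)) (f_ar F ph) = mu (base b) (tau Th ?t) (mu (base b) (tau Xi ?t) (f_ar F ph))"
  by (rule X.F.B.mu_assoc) (use ph st in \<open>simp_all add: bs\<close>)
 also have "\<dots> = mu (base b) (mu (base b) (tau Th ?t) (f_ar G ph)) (tau Xi ?s)"
  unfolding X.ta_nat[OF ph] by (rule X.F.B.mu_assoc[symmetric]) (use ph st in \<open>simp_all add: bs\<close>)
 also have "\<dots> = mu (base b) (f_ar H ph) (mu (base b) (tau Th ?s) (tau Xi ?s))"
  unfolding T.ta_nat[OF ph] by (rule X.F.B.mu_assoc) (use ph st in \<open>simp_all add: bs\<close>)
 finally show "mu (base b) (tau ?V ?t) (f_ar F ph) = mu (base b) (f_ar H ph) (tau ?V ?s)"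
  unfolding tau_vcomp[OF st(1)] tau_vcomp[OF st(2)] .
 show "omega ?V ?s - omega ?V ?t =
  gam b (tau ?V ?t, f_ar F ph) - gam b (f_ar H ph, tau ?V ?s) + eta F ph
  + al (rho b (tau ?V ?t)) (rho b (f_ar F ph)) (hh F ?s)
  - al (rho b (f_ar H ph)) (rho b (tau ?V ?s)) (hh F ?s)
  - al (rho b (tau ?V ?t)) (hh F ?t) (rho a ph) - eta H ph"
  unfolding tau_vcomp[OF st(1)] tau_vcomp[OF st(2)]
  by (rule V.vcomp_cond_iff[THEN iffD2, OF ph omega_vcomp T.cond[OF ph]])
qed

end

locale tr_hpair = X: bun_tr al a b F1 F2 xi + T: bun_cell al b c F3 F4 Th
 for al :: "'g::group_add => 'g => 'g => 'a::ab_group_add" and a b c :: "('p, 'g, 'a) obj" and F1 F2 F3 F4 :: "('p, 'g, 'a) mor"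
  and xi :: "'p => 'p" and Th :: "('p, 'g, 'a) cell"
begin

sublocale P13: mor_pair al a b c F1 F3 ..
sublocale P24: mor_pair al a b c F2 F4 ..

lemma hcomp_facts:
 assumes x: "x : X0 (base a)"
 shows "f_ob F1 x : X0 (base b)" "f_ob F2 x : X0 (base b)" "xi x : X1 (base b)" "tau Th (f_ob F1 x) : X1 (base c)" "f_ar F4 (xi x) : X1 (base c)"
  "sr (base c) (f_ar F4 (xi x)) = tg (base c) (tau Th (f_ob F1 x))"
  "sr (base b) (xi x) = f_ob F1 x" "tg (base b) (xi x) = f_ob F2 x"
  "sr (base c) (tau Th (f_ob F1 x)) = f_ob F3 (f_ob F1 x)" "tg (base c) (f_ar F4 (xi x)) = f_ob F4 (f_ob F2 x)"
  "rho c (f_ar F4 (xi x)) + hh F4 (f_ob F1 x) = hh F4 (f_ob F2 x) + rho b (xi x)"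
 using x T.G.square[OF X.ta_in[OF x]] by (simp_all add: X.ta_simps T.ta_simps X.F.f_simps X.G.f_simps T.G.f_simps)

text \<open>As in the vertical case, \<open>xi\<close> comes with a mere candidate
  \<open>o'\<close>, while the outer \<open>Th\<close> is a genuine 2-cell. The variables
  \<open>t\<close> and \<open>ov\<close> may be any maps that obey the composition formulas, so a
  given 2-cell can be recognized as a composite.\<close>

lemma hcomp_cond_iff:
 fixes o' ov t
 assumes ph: "ph : X1 (base a)"
  and tv: "\<And>x. x : X0 (base a) ==> t x = mu (base c) (f_ar F4 (xi x)) (tau Th (f_ob F1 x))"
  and ov: "\<And>x. x : X0 (base a) ==> ov x = omega Th (f_ob F1 x) + o' x + eta F4 (xi x)
  + gam c (f_ar F4 (xi x), tau Th (f_ob F1 x))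
  + al (rho c (f_ar F4 (xi x))) (rho c (tau Th (f_ob F1 x))) (hh F3 (f_ob F1 x) + hh F1 x)
  + al (hh F4 (f_ob F2 x)) (rho b (xi x)) (hh F1 x)
  - al (rho c (tau Th (f_ob F1 x))) (hh F3 (f_ob F1 x)) (hh F1 x)
  - al (rho c (f_ar F4 (xi x))) (hh F4 (f_ob F1 x)) (hh F1 x)"
 shows "ov (sr (base a) ph) - ov (tg (base a) ph) =
  gam c (t (tg (base a) ph), f_ar (cmp al F3 F1) ph) - gam c (f_ar (cmp al F4 F2) ph, t (sr (base a) ph))
  + eta (cmp al F3 F1) ph
  + al (rho c (t (tg (base a) ph))) (rho c (f_ar (cmp al F3 F1) ph)) (hh (cmp al F3 F1) (sr (base a) ph))
  - al (rho c (f_ar (cmp al F4 F2) ph)) (rho c (t (sr (base a) ph))) (hh (cmp al F3 F1) (sr (base a) ph))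
  - al (rho c (t (tg (base a) ph))) (hh (cmp al F3 F1) (tg (base a) ph)) (rho a ph) - eta (cmp al F4 F2) ph
  \<longleftrightarrow> o' (sr (base a) ph) - o' (tg (base a) ph) =
  gam b (xi (tg (base a) ph), f_ar F1 ph) - gam b (f_ar F2 ph, xi (sr (base a) ph)) + eta F1 ph
  + al (rho b (xi (tg (base a) ph))) (rho b (f_ar F1 ph)) (hh F1 (sr (base a) ph))
  - al (rho b (f_ar F2 ph)) (rho b (xi (sr (base a) ph))) (hh F1 (sr (base a) ph))
  - al (rho b (xi (tg (base a) ph))) (hh F1 (tg (base a) ph)) (rho a ph) - eta F2 ph"
proof -
 let ?s = "sr (base a) ph" and ?t = "tg (base a) ph"
 have st: "?s : X0 (base a)" "?t : X0 (base a)" using ph by (simp_all add: X.F.A.gpd_simps)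
 note hs = hcomp_facts[OF st(1)] and ht = hcomp_facts[OF st(2)]
 have f: "f_ar F1 ph : X1 (base b)" "f_ar F2 ph : X1 (base b)" "sr (base b) (f_ar F1 ph) = f_ob F1 ?s" "tg (base b) (f_ar F1 ph) = f_ob F1 ?t"
  "sr (base b) (f_ar F2 ph) = f_ob F2 ?s" "tg (base b) (f_ar F2 ph) = f_ob F2 ?t"
  "f_ar F3 (f_ar F1 ph) : X1 (base c)" "f_ar F4 (f_ar F1 ph) : X1 (base c)" "f_ar F4 (f_ar F2 ph) : X1 (base c)"
  using ph by (simp_all add: X.F.f_simps X.G.f_simps T.F.f_simps T.G.f_simps)
 have e: "sr (base b) (xi ?t) = tg (base b) (f_ar F1 ph)" "sr (base b) (f_ar F2 ph) = tg (base b) (xi ?s)"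
  "sr (base c) (tau Th (f_ob F1 ?t)) = tg (base c) (f_ar F3 (f_ar F1 ph))" "sr (base c) (f_ar F4 (f_ar F1 ph)) = tg (base c) (tau Th (f_ob F1 ?s))"
  "sr (base c) (f_ar F4 (xi ?t)) = tg (base c) (f_ar F4 (f_ar F1 ph))" "sr (base c) (f_ar F4 (f_ar F2 ph)) = tg (base c) (f_ar F4 (xi ?s))"
  using ph f hs ht by (simp_all add: T.ta_simps T.F.f_simps T.G.f_simps)
 have nT: "mu (base c) (tau Th (f_ob F1 ?t)) (f_ar F3 (f_ar F1 ph)) = mu (base c) (f_ar F4 (f_ar F1 ph)) (tau Th (f_ob F1 ?s))"
  using T.ta_nat[OF f(1)] f(3,4) by simp
 have N: "mu (base c) (f_ar F4 (xi ?t)) (f_ar F4 (f_ar F1 ph)) = mu (base c) (f_ar F4 (f_ar F2 ph)) (f_ar F4 (xi ?s))"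
  using T.G.f_mu[OF ht(3) f(1) e(1)] T.G.f_mu[OF f(2) hs(3) e(2)] X.ta_nat[OF ph] by simp
 note P1 = T.G.eta_coc[OF ht(3) f(1) e(1), unfolded X.ta_nat[OF ph] f(3,4) ht(8)]
 note P2 = T.G.eta_coc[OF f(2) hs(3) e(2), unfolded f(6) hs(7,8)]
 note P3 = T.F.B.gam_coc[OF ht(5,4) f(7) ht(6) e(3), unfolded nT]
 note P4 = T.F.B.gam_coc[OF ht(5) f(8) hs(4) e(5,4), unfolded N]
 note P5 = T.F.B.gam_coc[OF f(9) hs(5,4) e(6) hs(6)]
 note P7 = T.cond[OF f(1), unfolded f(3,4)]
 note sq = X.F.square[OF ph] X.G.square[OF ph] T.F.square[OF f(1), unfolded f(3,4)] T.G.square[OF f(1), unfolded f(3,4)]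
  T.G.square[OF f(2), unfolded f(5,6)] hs(11) ht(11)
  X.hh_eq[OF st(1), symmetric] X.hh_eq[OF st(2), symmetric] T.hh_eq[OF hs(1), symmetric] T.hh_eq[OF ht(1), symmetric]
 note acts = sq sq[THEN add_act] add.assoc T.F.B.rho_mu[OF hs(5,4,6)] T.F.B.rho_mu[OF ht(5,4,6)]
 show ?thesis
  unfolding tv[OF st(1)] tv[OF st(2)] ov[OF st(1)] ov[OF st(2)]
   P13.f_comp(2)[OF ph] P24.f_comp(2)[OF ph] P13.eta_comp[OF ph] P24.eta_comp[OF ph] P13.hh_comp[OF st(1)] P13.hh_comp[OF st(2)]
  by (rule X.F.A.hcomp_algebra[where s=0 and t="rho a ph" and f1s="hh F1 ?s" and f1t="hh F1 ?t + rho a ph"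
     and f2s="hh F2 ?s" and f2t="hh F2 ?t + rho a ph" and f3f1s="hh F3 (f_ob F1 ?s) + hh F1 ?s"
     and f3f1t="hh F3 (f_ob F1 ?t) + (hh F1 ?t + rho a ph)" and f4f1s="hh F4 (f_ob F1 ?s) + hh F1 ?s"
     and f4f1t="hh F4 (f_ob F1 ?t) + (hh F1 ?t + rho a ph)" and f4f2s="hh F4 (f_ob F2 ?s) + hh F2 ?s"
     and f4f2t="hh F4 (f_ob F2 ?t) + (hh F2 ?t + rho a ph)",
     OF P1 P2 P3 P4 P5 P7])
   (simp_all add: acts eq_diff_eq)
qed

end

section \<open>Horizontal composition\<close>

locale cell_hpair = X: bun_cell al a b F1 F2 Xi + T: bun_cell al b c F3 F4 Th
 for al :: "'g::group_add => 'g => 'g => 'a::ab_group_add" and a b c :: "('p, 'g, 'a) obj" and F1 F2 F3 F4 :: "('p, 'g, 'a) mor"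
  and Xi Th :: "('p, 'g, 'a) cell"
begin

sublocale tr_hpair al a b c F1 F2 F3 F4 "tau Xi" Th
 by unfold_locales (rule X.hh_eq)

lemma tau_hcomp: "x : X0 (base a) ==> tau (hcmp al Th Xi) x = mu (base c) (f_ar F4 (tau Xi x)) (tau Th (f_ob F1 x))"
 and omega_hcomp: "x : X0 (base a) ==> omega (hcmp al Th Xi) x = omega Th (f_ob F1 x) + omega Xi x + eta F4 (tau Xi x)
  + gam c (f_ar F4 (tau Xi x), tau Th (f_ob F1 x))
  + al (rho c (f_ar F4 (tau Xi x))) (rho c (tau Th (f_ob F1 x))) (hh F3 (f_ob F1 x) + hh F1 x)
  + al (hh F4 (f_ob F2 x)) (rho b (tau Xi x)) (hh F1 x)
  - al (rho c (tau Th (f_ob F1 x))) (hh F3 (f_ob F1 x)) (hh F1 x)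
  - al (rho c (f_ar F4 (tau Xi x))) (hh F4 (f_ob F1 x)) (hh F1 x)"
 by (simp_all add: Bun_hcomp_def Let_def X.smor X.tmor X.F.sob X.F.tob T.smor T.tmor T.F.sob T.F.tob)

lemma hcomp_cell: "bun_cell al a c (cmp al F3 F1) (cmp al F4 F2) (hcmp al Th Xi)"
proof (rule bun_cell_intro[OF P13.comp_mor P24.comp_mor])
 let ?h = "hcmp al Th Xi"
 show "smor ?h = cmp al F3 F1" "tmor ?h = cmp al F4 F2" by (simp_all add: Bun_hcomp_def Let_def X.smor X.tmor T.smor T.tmor)
 note id = sm_ident[OF X.F.A.mfd_Ob]
 note s1 = T.G.sm1[OF X.F.A.mfd_Ob X.smooth_ta] and f0 = X.F.sm0[OF X.F.A.mfd_Ob id]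
  and f20 = X.G.sm0[OF X.F.A.mfd_Ob id]
 note s2 = T.smooth_ta_comp[OF X.F.A.mfd_Ob f0]
 show "smooth (Ob (base a)) (Ar (base c)) (tau ?h)"
  by (rule sm_cong[OF X.F.A.mfd_Ob T.F.B.mfd_Ar T.F.B.smooth_mu'[OF X.F.A.mfd_Ob s1 s2 hcomp_facts(6)]])
   (simp_all add: tau_hcomp)
 show "tau ?h : extensional (X0 (base a))" "omega ?h : extensional (X0 (base a))"
  by (simp_all add: Bun_hcomp_def Let_def X.smor X.F.sob)
 have "locally_constant (mtop (Ob (base a))) (%x. omega Th (f_ob F1 x) + omega Xi x + eta F4 (tau Xi x)
  + gam c (f_ar F4 (tau Xi x), tau Th (f_ob F1 x))
  + al (rho c (f_ar F4 (tau Xi x))) (rho c (tau Th (f_ob F1 x))) (hh F3 (f_ob F1 x) + hh F1 x)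
  + al (hh F4 (f_ob F2 x)) (rho b (tau Xi x)) (hh F1 x)
  - al (rho c (tau Th (f_ob F1 x))) (hh F3 (f_ob F1 x)) (hh F1 x)
  - al (rho c (f_ar F4 (tau Xi x))) (hh F4 (f_ob F1 x)) (hh F1 x))"
  by (intro lc_intros X.F.A.lc_al X.lc_omega T.lc_omega X.F.lc_hh T.F.lc_hh T.G.lc_hh T.G.lc_eta X.F.B.lc_rho T.F.B.lc_rho T.F.B.lc_gam
    s1 s2 f0 f20 X.smooth_ta id hcomp_facts(6))
 then show "locally_constant (mtop (Ob (base a))) (omega ?h)"
  by (rule continuous_map_eq) (simp add: omega_hcomp)
 show "sr (base c) (tau ?h x) = f_ob (cmp al F3 F1) x" "tg (base c) (tau ?h x) = f_ob (cmp al F4 F2) x"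
  if x: "x : X0 (base a)" for x
  using hcomp_facts[OF x] by (simp_all add: tau_hcomp[OF x] P13.f_comp(1)[OF x] P24.f_comp(1)[OF x] T.F.B.sr_mu T.F.B.tg_mu)
 show "hh (cmp al F4 F2) x = rho c (tau ?h x) + hh (cmp al F3 F1) x" if x: "x : X0 (base a)" for x
 proof -
  note hx = hcomp_facts[OF x]
  note sq = hx(11) X.hh_eq[OF x, symmetric] T.hh_eq[OF hx(1), symmetric]
  show ?thesis
   by (simp add: tau_hcomp[OF x] P13.hh_comp[OF x] P24.hh_comp[OF x] T.F.B.rho_mu[OF hx(5,4,6)] sq sq[THEN add_act] add.assoc)
 qed
 fix ph assume ph: "ph : X1 (base a)"
 let ?s = "sr (base a) ph" and ?t = "tg (base a) ph"
 have st: "?s : X0 (base a)" "?t : X0 (base a)" using ph by (simp_all add: X.F.A.gpd_simps)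
 note hs = hcomp_facts[OF st(1)] and ht = hcomp_facts[OF st(2)]
 have f: "f_ar F1 ph : X1 (base b)" "f_ar F2 ph : X1 (base b)" "sr (base b) (f_ar F1 ph) = f_ob F1 ?s" "tg (base b) (f_ar F1 ph) = f_ob F1 ?t"
  "sr (base b) (f_ar F2 ph) = f_ob F2 ?s" "tg (base b) (f_ar F2 ph) = f_ob F2 ?t"
  "f_ar F3 (f_ar F1 ph) : X1 (base c)" "f_ar F4 (f_ar F1 ph) : X1 (base c)" "f_ar F4 (f_ar F2 ph) : X1 (base c)"
  using ph by (simp_all add: X.F.f_simps X.G.f_simps T.F.f_simps T.G.f_simps)
 have e: "sr (base b) (tau Xi ?t) = tg (base b) (f_ar F1 ph)" "sr (base b) (f_ar F2 ph) = tg (base b) (tau Xi ?s)"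
  "sr (base c) (tau Th (f_ob F1 ?t)) = tg (base c) (f_ar F3 (f_ar F1 ph))" "sr (base c) (f_ar F4 (f_ar F1 ph)) = tg (base c) (tau Th (f_ob F1 ?s))"
  "sr (base c) (f_ar F4 (tau Xi ?t)) = tg (base c) (f_ar F4 (f_ar F1 ph))" "sr (base c) (f_ar F4 (f_ar F2 ph)) = tg (base c) (f_ar F4 (tau Xi ?s))"
  using ph f hs ht by (simp_all add: T.ta_simps T.F.f_simps T.G.f_simps)
 have nT: "mu (base c) (tau Th (f_ob F1 ?t)) (f_ar F3 (f_ar F1 ph)) = mu (base c) (f_ar F4 (f_ar F1 ph)) (tau Th (f_ob F1 ?s))"
  using T.ta_nat[OF f(1)] f(3,4) by simp
 have N: "mu (base c) (f_ar F4 (tau Xi ?t)) (f_ar F4 (f_ar F1 ph)) = mu (base c) (f_ar F4 (f_ar F2 ph)) (f_ar F4 (tau Xi ?s))"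
  using T.G.f_mu[OF ht(3) f(1) e(1)] T.G.f_mu[OF f(2) hs(3) e(2)] X.ta_nat[OF ph] by simp
 note assoc = T.F.B.mu_assoc
 show "mu (base c) (tau ?h ?t) (f_ar (cmp al F3 F1) ph) = mu (base c) (f_ar (cmp al F4 F2) ph) (tau ?h ?s)"
  unfolding tau_hcomp[OF st(1)] tau_hcomp[OF st(2)] P13.f_comp(2)[OF ph] P24.f_comp(2)[OF ph]
   assoc[OF ht(5,4) f(7) ht(6) e(3)] nT assoc[OF ht(5) f(8) hs(4) e(5,4), symmetric] N
   assoc[OF f(9) hs(5,4) e(6) hs(6)] ..
qed (rule hcomp_cond_iff[THEN iffD2, OF _ tau_hcomp omega_hcomp X.cond]; assumption)

end

section \<open>Associators\<close>

locale mor_triple = FG: mor_pair al a b c F G + GH: mor_pair al b c d G H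
 for al :: "'g::group_add => 'g => 'g => 'a::ab_group_add" and a b c d :: "('p, 'g, 'a) obj" and F G H :: "('p, 'g, 'a) mor"
begin

sublocale GF: bun_mor al a c "cmp al G F" by (rule FG.comp_mor)
sublocale HG: bun_mor al b d "cmp al H G" by (rule GH.comp_mor)
sublocale L: mor_pair al a b d F "cmp al H G" ..
sublocale R: mor_pair al a c d "cmp al G F" H ..
sublocale LC: bun_mor al a d "cmp al (cmp al H G) F" by (rule L.comp_mor)
sublocale RC: bun_mor al a d "cmp al H (cmp al G F)" by (rule R.comp_mor)

lemma tau_assoc: "x : X0 (base a) ==> tau (asc al H G F) x = un (base d) (f_ob H (f_ob G (f_ob F x)))"
 and omega_assoc: "x : X0 (base a) ==> omega (asc al H G F) x = al (hh H (f_ob G (f_ob F x))) (hh G (f_ob F x)) (hh F x)"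
 by (simp_all add: Bun_assoc_def Let_def FG.F.sob GH.G.tob L.f_comp GH.f_comp FG.F.f_simps)

lemma assoc_cell: "bun_cell al a d (cmp al (cmp al H G) F) (cmp al H (cmp al G F)) (asc al H G F)"
proof (rule bun_cell_intro[OF L.comp_mor R.comp_mor])
 let ?A = "asc al H G F"
 show "smor ?A = cmp al (cmp al H G) F" "tmor ?A = cmp al H (cmp al G F)"
  by (simp_all add: Bun_assoc_def Let_def)
 note M = FG.F.A.mfd_Ob
 note id = sm_ident[OF M]
 note f0 = FG.F.sm0[OF M id] note g0 = FG.G.sm0[OF M f0] note h0 = GH.G.sm0[OF M g0]
 show "smooth (Ob (base a)) (Ar (base d)) (tau ?A)"
  by (rule sm_cong[OF M GH.G.B.mfd_Ar sm_compose'[OF M GH.G.B.mfd_Ob GH.G.B.mfd_Ar h0 GH.G.B.smooth_un]])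
   (simp_all add: tau_assoc)
 show "tau ?A : extensional (X0 (base a))" "omega ?A : extensional (X0 (base a))"
  by (simp_all add: Bun_assoc_def Let_def FG.F.sob)
 have "locally_constant (mtop (Ob (base a))) (%x. al (hh H (f_ob G (f_ob F x))) (hh G (f_ob F x)) (hh F x))"
  by (intro FG.F.A.lc_al FG.F.lc_hh FG.G.lc_hh GH.G.lc_hh f0 g0 id)
 then show "locally_constant (mtop (Ob (base a))) (omega ?A)"
  by (rule continuous_map_eq) (simp add: omega_assoc)
 have f: "f_ob (cmp al (cmp al H G) F) x = f_ob H (f_ob G (f_ob F x))" "f_ob (cmp al H (cmp al G F)) x = f_ob H (f_ob G (f_ob F x))"
  "hh (cmp al (cmp al H G) F) x = hh H (f_ob G (f_ob F x)) + (hh G (f_ob F x) + hh F x)"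
  "hh (cmp al H (cmp al G F)) x = hh H (f_ob G (f_ob F x)) + (hh G (f_ob F x) + hh F x)"
  "f_ob F x : X0 (base b)" "f_ob G (f_ob F x) : X0 (base c)" "f_ob H (f_ob G (f_ob F x)) : X0 (base d)" if "x : X0 (base a)" for x
  using that FG.F.f0_in[OF that] FG.G.f0_in[OF FG.F.f0_in[OF that]] GH.G.f0_in[OF FG.G.f0_in[OF FG.F.f0_in[OF that]]]
  by (simp_all add: L.f_comp R.f_comp GH.f_comp FG.f_comp L.hh_comp R.hh_comp GH.hh_comp FG.hh_comp add.assoc)
 note un = GH.G.B.sr_un GH.G.B.tg_un GH.G.B.rho_un
 show "sr (base d) (tau ?A x) = f_ob (cmp al (cmp al H G) F) x" "tg (base d) (tau ?A x) = f_ob (cmp al H (cmp al G F)) x"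
  "hh (cmp al H (cmp al G F)) x = rho d (tau ?A x) + hh (cmp al (cmp al H G) F) x"
  if x: "x : X0 (base a)" for x
  using f[OF x] by (simp_all add: tau_assoc[OF x] un)
 fix ph assume ph: "ph : X1 (base a)"
 let ?s = "sr (base a) ph" and ?t = "tg (base a) ph"
 have st: "?s : X0 (base a)" "?t : X0 (base a)" using ph by (simp_all add: FG.F.A.gpd_simps)
 note fs = f[OF st(1)] and ft = f[OF st(2)]
 have fph: "f_ar F ph : X1 (base b)" "f_ar G (f_ar F ph) : X1 (base c)" "f_ar H (f_ar G (f_ar F ph)) : X1 (base d)"
  "sr (base b) (f_ar F ph) = f_ob F ?s" "tg (base b) (f_ar F ph) = f_ob F ?t"
  "sr (base c) (f_ar G (f_ar F ph)) = f_ob G (f_ob F ?s)" "tg (base c) (f_ar G (f_ar F ph)) = f_ob G (f_ob F ?t)"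
  "sr (base d) (f_ar H (f_ar G (f_ar F ph))) = f_ob H (f_ob G (f_ob F ?s))" "tg (base d) (f_ar H (f_ar G (f_ar F ph))) = f_ob H (f_ob G (f_ob F ?t))"
  using ph by (simp_all add: FG.F.f_simps FG.G.f_simps GH.G.f_simps)
 have ar: "f_ar (cmp al (cmp al H G) F) ph = f_ar H (f_ar G (f_ar F ph))" "f_ar (cmp al H (cmp al G F)) ph = f_ar H (f_ar G (f_ar F ph))"
  using ph fph by (simp_all add: L.f_comp R.f_comp GH.f_comp FG.f_comp)
 show "mu (base d) (tau ?A ?t) (f_ar (cmp al (cmp al H G) F) ph) = mu (base d) (f_ar (cmp al H (cmp al G F)) ph) (tau ?A ?s)"
  using fph by (simp add: ar tau_assoc st GH.G.B.unit_r' GH.G.B.unit_l')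
 note sq = FG.F.square[OF ph] FG.G.square[OF fph(1), unfolded fph(4,5)] GH.G.square[OF fph(2), unfolded fph(6,7)]
 note acts = sq sq[THEN add_act] add.assoc
 \<comment> \<open>The components are units, so by normalization the terms in \<open>gamma\<close>
   and \<open>al\<close> drop out of the 2-cell condition, and only the difference of the two
   \<open>eta\<close> is left.\<close>
 have "omega ?A ?s - omega ?A ?t = eta (cmp al (cmp al H G) F) ph - eta (cmp al H (cmp al G F)) ph"
  unfolding omega_assoc[OF st(1)] omega_assoc[OF st(2)] L.eta_comp[OF ph] R.eta_comp[OF ph] GH.eta_comp[OF fph(1)] FG.eta_comp[OF ph]
   fph(4,5) FG.f_comp(2)[OF ph] FG.f_comp(1)[OF st(1)] FG.f_comp(1)[OF st(2)] FG.hh_comp[OF st(1)] FG.hh_comp[OF st(2)]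
   GH.f_comp(2)[OF fph(1)] GH.hh_comp[OF fs(5)] GH.hh_comp[OF ft(5)]
  by (rule FG.F.A.assoc_algebra[where s=0 and t="rho a ph" and fs="hh F ?s" and ft="hh F ?t + rho a ph"
     and gfs="hh G (f_ob F ?s) + hh F ?s" and gft="hh G (f_ob F ?t) + (hh F ?t + rho a ph)"
     and hgfs="hh H (f_ob G (f_ob F ?s)) + (hh G (f_ob F ?s) + hh F ?s)" and hgft="hh H (f_ob G (f_ob F ?t)) + (hh G (f_ob F ?t) + (hh F ?t + rho a ph))"])
   (simp_all add: acts eq_diff_eq)
 then show "omega ?A ?s - omega ?A ?t =
  gam d (tau ?A ?t, f_ar (cmp al (cmp al H G) F) ph) - gam d (f_ar (cmp al H (cmp al G F)) ph, tau ?A ?s)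
  + eta (cmp al (cmp al H G) F) ph
  + al (rho d (tau ?A ?t)) (rho d (f_ar (cmp al (cmp al H G) F) ph)) (hh (cmp al (cmp al H G) F) ?s)
  - al (rho d (f_ar (cmp al H (cmp al G F)) ph)) (rho d (tau ?A ?s)) (hh (cmp al (cmp al H G) F) ?s)
  - al (rho d (tau ?A ?t)) (hh (cmp al (cmp al H G) F) ?t) (rho a ph) - eta (cmp al H (cmp al G F)) ph"
  using fph fs ft by (simp add: ar tau_assoc st un GH.G.B.gam_un)
qed

end

section \<open>Inverses and units\<close>

context bun_cell
begin

text \<open>The value of \<open>omega\<close> is forced: the formula for vertical composition has to
  give 0 for the composite with \<open>Th\<close>.\<close>

definition inv2 :: "('p, 'g, 'a) cell" where
 "inv2 = \<lparr>smor = G, tmor = F, tau = (\<lambda>x\<in>X0 (base a). iv (base b) (tau Th x)),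
   omega = (\<lambda>x\<in>X0 (base a). - omega Th x - al (rho b (iv (base b) (tau Th x))) (rho b (tau Th x)) (hh F x)
    - gam b (iv (base b) (tau Th x), tau Th x))\<rparr>"

lemma tau_inv: "x : X0 (base a) ==> tau inv2 x = iv (base b) (tau Th x)"
 and omega_inv: "x : X0 (base a) ==> omega inv2 x = - omega Th x - al (rho b (iv (base b) (tau Th x))) (rho b (tau Th x)) (hh F x)
    - gam b (iv (base b) (tau Th x), tau Th x)"
 by (simp_all add: inv2_def)

lemma inv_nat: "ph : X1 (base a) ==>
  mu (base b) (iv (base b) (tau Th (tg (base a) ph))) (f_ar G ph) = mu (base b) (f_ar F ph) (iv (base b) (tau Th (sr (base a) ph)))"
proof -
 assume ph: "ph : X1 (base a)"
 let ?s = "tau Th (sr (base a) ph)" and ?t = "tau Th (tg (base a) ph)"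
 have bs: "?s : X1 (base b)" "?t : X1 (base b)" "f_ar F ph : X1 (base b)" "f_ar G ph : X1 (base b)"
  "sr (base b) ?s = sr (base b) (f_ar F ph)" "tg (base b) ?s = sr (base b) (f_ar G ph)"
  "sr (base b) ?t = tg (base b) (f_ar F ph)" "tg (base b) ?t = tg (base b) (f_ar G ph)"
  using ph by (simp_all add: ta_simps F.f_simps G.f_simps F.A.gpd_simps)
 have "f_ar F ph = mu (base b) (iv (base b) ?t) (mu (base b) ?t (f_ar F ph))"
  by (rule F.B.cancel_iv1[symmetric]) (simp_all add: bs)
 also have "\<dots> = mu (base b) (mu (base b) (iv (base b) ?t) (f_ar G ph)) ?s"
  unfolding ta_nat[OF ph] by (rule F.B.mu_assoc[symmetric]) (simp_all add: bs F.B.gpd_simps)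
 finally have e: "f_ar F ph = mu (base b) (mu (base b) (iv (base b) ?t) (f_ar G ph)) ?s" .
 show ?thesis
  by (subst e, rule F.B.cancel_iv3[symmetric]) (simp_all add: bs F.B.gpd_simps)
qed

lemma inv_cell: "bun_cell al a b G F inv2"
proof (rule bun_cell_intro)
 show GF: "bun_mor al a b G" "bun_mor al a b F" by unfold_locales
 show "smor inv2 = G" "tmor inv2 = F" by (simp_all add: inv2_def)
 note id = sm_ident[OF F.A.mfd_Ob]
 note i = smooth_iv_ta_comp[OF F.A.mfd_Ob id]
 show sm: "smooth (Ob (base a)) (Ar (base b)) (tau inv2)"
  by (rule sm_cong[OF F.A.mfd_Ob F.B.mfd_Ar i]) (simp add: tau_inv)
 show ext: "tau inv2 : extensional (X0 (base a))" "omega inv2 : extensional (X0 (base a))"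
  by (simp_all add: inv2_def)
 have st: "sr (base b) (iv (base b) (tau Th x)) = tg (base b) (tau Th x)" if "x : X0 (base a)" for x
  using that by (simp add: ta_simps F.B.gpd_simps)
 \<comment> \<open>Negation is written as subtraction from 0 to match the rules in
   \<open>lc_intros\<close>.\<close>
 have "locally_constant (mtop (Ob (base a))) (%x. (0 - omega Th x) - al (rho b (iv (base b) (tau Th x))) (rho b (tau Th x)) (hh F x)
    - gam b (iv (base b) (tau Th x), tau Th x))"
  by (intro lc_intros F.A.lc_al lc_omega F.lc_hh F.B.lc_rho F.B.lc_gam smooth_ta i id st)
 then show "locally_constant (mtop (Ob (base a))) (omega inv2)"
  by (rule continuous_map_eq) (simp add: omega_inv)
 show ends: "sr (base b) (tau inv2 x) = f_ob G x" "tg (base b) (tau inv2 x) = f_ob F x" if "x : X0 (base a)" for x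
  using that by (simp_all add: tau_inv F.B.gpd_simps ta_simps)
 show hF: "hh F x = rho b (tau inv2 x) + hh G x" if "x : X0 (base a)" for x
  using that by (simp add: tau_inv F.B.rho_iv ta_in hh_eq minus_add_cancel)
 show n: "mu (base b) (tau inv2 (tg (base a) ph)) (f_ar G ph) = mu (base b) (f_ar F ph) (tau inv2 (sr (base a) ph))"
  if "ph : X1 (base a)" for ph
  using inv_nat[OF that] that by (simp add: tau_inv F.A.gpd_simps)
 have "smooth_nat_trans (base a) (base b) (fn G) (fn F) (tau inv2)"
  unfolding smooth_nat_trans_def by (intro conjI ballI sm ext ends n)
 then interpret V: tr_vpair al a b F G F Th "tau inv2"
  by unfold_locales (simp_all add: hF)
 fix ph assume ph: "ph : X1 (base a)"
 have X: "sr (base a) ph : X0 (base a)" "tg (base a) ph : X0 (base a)" using ph by (simp_all add: F.A.gpd_simps)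
 have il: "mu (base b) (tau inv2 x) (tau Th x) = un (base b) (f_ob F x)" if "x : X0 (base a)" for x
  using that by (simp add: tau_inv F.B.iv_l ta_simps)
 \<comment> \<open>For the composite with \<open>Th\<close>, whose components are units and whose
   \<open>omega\<close> is 0, the 2-cell condition is trivial; the equivalence then yields the
   condition on the inverse.\<close>
 have o: "0 = omega inv2 x + omega Th x + al (rho b (tau inv2 x)) (rho b (tau Th x)) (hh F x) + gam b (tau inv2 x, tau Th x)"
  if "x : X0 (base a)" for x
  using that by (simp add: tau_inv omega_inv)
 show "omega inv2 (sr (base a) ph) - omega inv2 (tg (base a) ph) =
  gam b (tau inv2 (tg (base a) ph), f_ar G ph) - gam b (f_ar F ph, tau inv2 (sr (base a) ph)) + eta G ph
  + al (rho b (tau inv2 (tg (base a) ph))) (rho b (f_ar G ph)) (hh G (sr (base a) ph))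
  - al (rho b (f_ar F ph)) (rho b (tau inv2 (sr (base a) ph))) (hh G (sr (base a) ph))
  - al (rho b (tau inv2 (tg (base a) ph))) (hh G (tg (base a) ph)) (rho a ph) - eta F ph"
  by (rule V.vcomp_cond_iff[where ov="%_. 0", THEN iffD1, OF ph o])
   (use ph X in \<open>simp_all add: il F.f_simps F.B.rho_un F.B.gam_un\<close>)
qed

lemma inv_left: "vcmp al inv2 Th = Bun_id2 F"
proof -
 interpret I: bun_cell al a b G F inv2 by (rule inv_cell)
 interpret V: cell_vpair al a b F G F Th inv2 ..
 show ?thesis
  by (rule cell_eqI[OF V.vcomp_cell F.id2_cell])
   (simp_all add: V.tau_vcomp V.omega_vcomp F.tau_id2 F.omega_id2 tau_inv omega_inv F.B.iv_l ta_simps)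
qed

lemma vcomp_id2: "vcmp al Th (Bun_id2 F) = Th"
proof -
 interpret I: bun_cell al a b F F "Bun_id2 F" by (rule F.id2_cell)
 interpret V: cell_vpair al a b F F G "Bun_id2 F" Th ..
 show ?thesis
  by (rule cell_eqI[OF V.vcomp_cell])
   (unfold_locales, simp_all add: V.tau_vcomp V.omega_vcomp F.tau_id2 F.omega_id2 ta_simps F.B.unit_r' F.B.gam_un F.B.rho_un F.f_simps)
qed

lemma id2_vcomp: "vcmp al (Bun_id2 G) Th = Th"
proof -
 interpret I: bun_cell al a b G G "Bun_id2 G" by (rule G.id2_cell)
 interpret V: cell_vpair al a b F G G Th "Bun_id2 G" ..
 show ?thesis
  by (rule cell_eqI[OF V.vcomp_cell])
   (unfold_locales, simp_all add: V.tau_vcomp V.omega_vcomp G.tau_id2 G.omega_id2 ta_simps F.B.unit_l' F.B.gam_un F.B.rho_un G.f_simps)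
qed

lemma id1_hcomp: "hcmp al (Bun_id2 (Bun_id1 b)) Th = Th"
proof -
 interpret I: bun_mor al b b "Bun_id1 b" by (rule F.B.id1_mor)
 interpret J: bun_cell al b b "Bun_id1 b" "Bun_id1 b" "Bun_id2 (Bun_id1 b)" by (rule I.id2_cell)
 interpret H: cell_hpair al a b b F G "Bun_id1 b" "Bun_id1 b" Th "Bun_id2 (Bun_id1 b)" ..
 have d: "f_ob (Bun_id1 b) y = y" "hh (Bun_id1 b) y = 0" if "y : X0 (base b)" for y using that by (simp_all add: Bun_id1_def)
 have e: "f_ar (Bun_id1 b) pp = pp" "eta (Bun_id1 b) pp = 0" if "pp : X1 (base b)" for pp using that by (simp_all add: Bun_id1_def)
 show ?thesis
  by (rule cell_eqI[OF H.hcomp_cell[unfolded F.id1_comp G.id1_comp]])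
   (unfold_locales, simp_all add: H.tau_hcomp H.omega_hcomp I.tau_id2 I.omega_id2 ta_simps F.f_simps G.f_simps d e F.B.unit_r' F.B.gam_un F.B.rho_un)
qed

lemma hcomp_id1: "hcmp al Th (Bun_id2 (Bun_id1 a)) = Th"
proof -
 interpret I: bun_mor al a a "Bun_id1 a" by (rule F.A.id1_mor)
 interpret J: bun_cell al a a "Bun_id1 a" "Bun_id1 a" "Bun_id2 (Bun_id1 a)" by (rule I.id2_cell)
 interpret H: cell_hpair al a a b "Bun_id1 a" "Bun_id1 a" F G "Bun_id2 (Bun_id1 a)" Th ..
 have d: "f_ob (Bun_id1 a) y = y" "hh (Bun_id1 a) y = 0" if "y : X0 (base a)" for y using that by (simp_all add: Bun_id1_def)
 show ?thesis
  by (rule cell_eqI[OF H.hcomp_cell[unfolded F.comp_id1 G.comp_id1]])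
   (unfold_locales, simp_all add: H.tau_hcomp H.omega_hcomp I.tau_id2 I.omega_id2 ta_simps G.f_un G.eta_un G.f_simps d F.A.gpd_simps
    F.B.unit_l' F.B.gam_un F.B.rho_un F.A.rho_un)
qed

end

lemma (in mor_pair) hcomp_id2: "hcmp al (Bun_id2 G) (Bun_id2 F) = Bun_id2 (cmp al G F)"
proof -
 interpret I: bun_cell al a b F F "Bun_id2 F" by (rule F.id2_cell)
 interpret J: bun_cell al b c G G "Bun_id2 G" by (rule G.id2_cell)
 interpret H: cell_hpair al a b c F F G G "Bun_id2 F" "Bun_id2 G" ..
 interpret C: bun_mor al a c "cmp al G F" by (rule comp_mor)
 show ?thesis
  by (rule cell_eqI[OF H.hcomp_cell C.id2_cell])
   (simp_all add: H.tau_hcomp H.omega_hcomp F.tau_id2 F.omega_id2 G.tau_id2 G.omega_id2 C.tau_id2 C.omega_id2 f_comp F.f_simps G.f_un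
    G.f_simps G.eta_un F.B.gpd_simps G.B.gpd_simps F.B.rho_un G.B.rho_un G.B.gam_un G.B.unit_l')
qed

text \<open>The \<open>gamma\<close> terms of the two bracketings differ by the value of
  \<open>al\<close> at the three components; the cocycle condition of \<open>al\<close>, with
  \<open>hh F x\<close> as last argument, balances this against the remaining terms.\<close>

lemma vcomp_assoc_cells:
 assumes "bun_cell al a b F G Xi" "bun_cell al a b G H Th" "bun_cell al a b H K Om"
 shows "vcmp al (vcmp al Om Th) Xi = vcmp al Om (vcmp al Th Xi)"
proof -
 interpret X: bun_cell al a b F G Xi by (rule assms)
 interpret T: bun_cell al a b G H Th by (rule assms)
 interpret O: bun_cell al a b H K Om by (rule assms)
 interpret P1: cell_vpair al a b F G H Xi Th ..
 interpret P2: cell_vpair al a b G H K Th Om ..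
 interpret C1: bun_cell al a b F H "vcmp al Th Xi" by (rule P1.vcomp_cell)
 interpret C2: bun_cell al a b G K "vcmp al Om Th" by (rule P2.vcomp_cell)
 interpret Q1: cell_vpair al a b F H K "vcmp al Th Xi" Om ..
 interpret Q2: cell_vpair al a b F G K Xi "vcmp al Om Th" ..
 show ?thesis
 proof (rule cell_eqI[OF Q2.vcomp_cell Q1.vcomp_cell])
  fix x assume x: "x : X0 (base a)"
  let ?A = "tau Xi x" and ?B = "tau Th x" and ?C = "tau Om x"
  note m = X.ta_in[OF x] T.ta_in[OF x] O.ta_in[OF x]
  have e: "sr (base b) ?B = tg (base b) ?A" "sr (base b) ?C = tg (base b) ?B" using x by (simp_all add: X.ta_simps T.ta_simps O.ta_simps)
  show "tau (vcmp al (vcmp al Om Th) Xi) x = tau (vcmp al Om (vcmp al Th Xi)) x"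
   unfolding Q1.tau_vcomp[OF x] Q2.tau_vcomp[OF x] P1.tau_vcomp[OF x] P2.tau_vcomp[OF x] by (rule X.F.B.mu_assoc[OF m(3,2,1) e(2,1)])
  have c: "al (rho b ?C) (rho b ?B) (rho b ?A + hh F x) = al (rho b ?B) (rho b ?A) (hh F x) + al (rho b ?C) (rho b ?B + rho b ?A) (hh F x)
    + al (rho b ?C) (rho b ?B) (rho b ?A) - al (rho b ?C + rho b ?B) (rho b ?A) (hh F x)"
   unfolding X.F.A.cocycle by simp
  show "omega (vcmp al (vcmp al Om Th) Xi) x = omega (vcmp al Om (vcmp al Th Xi)) x"
   unfolding Q1.tau_vcomp[OF x] Q2.tau_vcomp[OF x] P1.tau_vcomp[OF x] P2.tau_vcomp[OF x]
    Q1.omega_vcomp[OF x] Q2.omega_vcomp[OF x] P1.omega_vcomp[OF x] P2.omega_vcomp[OF x]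
    X.F.B.rho_mu[OF m(2,1) e(1)] X.F.B.rho_mu[OF m(3,2) e(2)] X.hh_eq[OF x] c X.F.B.gam_coc[OF m(3,2,1) e(2,1), symmetric]
   by (simp add: algebra_simps)
 qed
qed

section \<open>The bicategory of bundles\<close>

lemma interchange_cells:
 assumes "bun_cell al a b F1 F2 Xi" "bun_cell al a b F2 F3 Xi'" "bun_cell al b c G1 G2 Th" "bun_cell al b c G2 G3 Th'"
 shows "hcmp al (vcmp al Th' Th) (vcmp al Xi' Xi) = vcmp al (hcmp al Th' Xi') (hcmp al Th Xi)"
proof -
 interpret X: bun_cell al a b F1 F2 Xi by (rule assms)
 interpret X': bun_cell al a b F2 F3 Xi' by (rule assms)
 interpret T: bun_cell al b c G1 G2 Th by (rule assms)
 interpret T': bun_cell al b c G2 G3 Th' by (rule assms)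
 interpret VX: cell_vpair al a b F1 F2 F3 Xi Xi' ..
 interpret VT: cell_vpair al b c G1 G2 G3 Th Th' ..
 interpret CX: bun_cell al a b F1 F3 "vcmp al Xi' Xi" by (rule VX.vcomp_cell)
 interpret CT: bun_cell al b c G1 G3 "vcmp al Th' Th" by (rule VT.vcomp_cell)
 interpret L: cell_hpair al a b c F1 F3 G1 G3 "vcmp al Xi' Xi" "vcmp al Th' Th" ..
 interpret H: cell_hpair al a b c F1 F2 G1 G2 Xi Th ..
 interpret H': cell_hpair al a b c F2 F3 G2 G3 Xi' Th' ..
 interpret CH: bun_cell al a c "cmp al G1 F1" "cmp al G2 F2" "hcmp al Th Xi" by (rule H.hcomp_cell)
 interpret CH': bun_cell al a c "cmp al G2 F2" "cmp al G3 F3" "hcmp al Th' Xi'" by (rule H'.hcomp_cell)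
 interpret R: cell_vpair al a c "cmp al G1 F1" "cmp al G2 F2" "cmp al G3 F3" "hcmp al Th Xi" "hcmp al Th' Xi'" ..
 show ?thesis
 proof (rule cell_eqI[OF L.hcomp_cell R.vcomp_cell])
  fix x assume x: "x : X0 (base a)"
  let ?y1 = "f_ob F1 x" and ?y2 = "f_ob F2 x"
  let ?A = "tau Xi x" and ?B = "tau Xi' x"
  note h = H.hcomp_facts[OF x] and h' = H'.hcomp_facts[OF x]
  note CX.ta_in[OF x]
  have g: "tau Th' ?y1 : X1 (base c)" "f_ar G3 ?A : X1 (base c)"
   "sr (base c) (tau Th' ?y1) = tg (base c) (tau Th ?y1)" "sr (base c) (f_ar G3 ?A) = tg (base c) (tau Th' ?y1)"
   "sr (base c) (f_ar G3 ?B) = tg (base c) (f_ar G3 ?A)" "sr (base c) (tau Th' ?y2) = tg (base c) (f_ar G2 ?A)"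
   "sr (base b) ?B = tg (base b) ?A"
   using h h' by (simp_all add: T.ta_simps T'.ta_simps T.G.f_simps T'.G.f_simps)
  let ?hA = "mu (base c) (f_ar G2 ?A) (tau Th ?y1)" and ?vT = "mu (base c) (tau Th' ?y1) (tau Th ?y1)"
  have m: "?hA : X1 (base c)" "?vT : X1 (base c)" "tg (base c) ?hA = tg (base c) (f_ar G2 ?A)" "tg (base c) ?vT = tg (base c) (tau Th' ?y1)"
   using h g by (simp_all add: T.F.B.gpd_simps)
  have G3m: "f_ar G3 (mu (base b) ?B ?A) = mu (base c) (f_ar G3 ?B) (f_ar G3 ?A)"
   by (rule T'.G.f_mu[OF h'(3) h(3) g(7)])
  have nT: "mu (base c) (tau Th' ?y2) (f_ar G2 ?A) = mu (base c) (f_ar G3 ?A) (tau Th' ?y1)"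
   using T'.ta_nat[OF h(3)] h(7,8) by simp
  \<comment> \<open>The two composites of components go around the naturality square of
    \<open>Th'\<close> at \<open>tau Xi x\<close> on different sides.\<close>
  have M: "mu (base c) (tau Th' ?y2) ?hA = mu (base c) (f_ar G3 ?A) ?vT"
   using T.F.B.mu_assoc[OF h'(4) h(5,4) g(6) h(6)] T.F.B.mu_assoc[OF g(2,1) h(4) g(4,3)] nT by simp
  have e: "sr (base c) (f_ar G3 ?B) = tg (base c) (tau Th' ?y2)" "sr (base c) (tau Th' ?y2) = tg (base c) ?hA" "sr (base c) (f_ar G3 ?A) = tg (base c) ?vT"
   using h h' g m by simp_all
  have GB: "mu (base c) (f_ar G3 ?B) (f_ar G3 ?A) : X1 (base c)" "sr (base c) (mu (base c) (f_ar G3 ?B) (f_ar G3 ?A)) = tg (base c) (tau Th' ?y1)"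
   using g h' by (simp_all add: T.F.B.gpd_simps)
  note assoc = T.F.B.mu_assoc
  show "tau (hcmp al (vcmp al Th' Th) (vcmp al Xi' Xi)) x = tau (vcmp al (hcmp al Th' Xi') (hcmp al Th Xi)) x"
   unfolding L.tau_hcomp[OF x] R.tau_vcomp[OF x] H.tau_hcomp[OF x] H'.tau_hcomp[OF x] VX.tau_vcomp[OF x] VT.tau_vcomp[OF h(1)] G3m
    assoc[OF h'(5) g(2) m(2) g(5) e(3)] assoc[OF h'(5,4) m(1) e(1,2)] M ..
  note P1 = T'.G.eta_coc[OF h'(3) h(3) g(7), unfolded h(7,8) h'(8) h'(7)]
  note P2 = T.F.B.gam_coc[OF h'(4) h(5,4) g(6) h(6), unfolded nT]
  note P3 = T.F.B.gam_coc[OF g(2,1) h(4) g(4,3)]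
  note P4 = T.F.B.gam_coc[OF h'(5,4) m(1) e(1,2), unfolded M]
  note P5 = T.F.B.gam_coc[OF h'(5) g(2) m(2) g(5) e(3)]
  note P6 = T'.cond[OF h(3), unfolded h(7,8)]
  note sq = X.hh_eq[OF x, symmetric] X'.hh_eq[OF x, symmetric] T.hh_eq[OF h(1), symmetric] T.hh_eq[OF h(2), symmetric]
   T'.hh_eq[OF h(1), symmetric] T'.hh_eq[OF h(2), symmetric] h(11) h'(11) T'.G.square[OF h(3), unfolded h(7,8)]
  note acts = sq sq[THEN add_act] add.assoc T.F.B.rho_mu[OF h(5,4,6)] T.F.B.rho_mu[OF h'(5,4,6)] T.F.B.rho_mu[OF g(1) h(4) g(3)]
   T.F.B.rho_mu[OF h'(5) g(2) g(5)] X.F.B.rho_mu[OF h'(3) h(3) g(7)]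
  show "omega (hcmp al (vcmp al Th' Th) (vcmp al Xi' Xi)) x = omega (vcmp al (hcmp al Th' Xi') (hcmp al Th Xi)) x"
   unfolding L.omega_hcomp[OF x] R.omega_vcomp[OF x] H.omega_hcomp[OF x] H'.omega_hcomp[OF x] VX.omega_vcomp[OF x] VT.omega_vcomp[OF h(1)]
    H.tau_hcomp[OF x] H'.tau_hcomp[OF x] VX.tau_vcomp[OF x] VT.tau_vcomp[OF h(1)] G3m L.P13.hh_comp[OF x]
   by (rule X.F.A.interchange_algebra[where x=0 and f1x="hh F1 x" and f2x="hh F2 x" and f3x="hh F3 x"
      and g1f1x="hh G1 ?y1 + hh F1 x" and g2f1x="hh G2 ?y1 + hh F1 x" and g3f1x="hh G3 ?y1 + hh F1 x"
      and g2f2x="hh G2 ?y2 + hh F2 x" and g3f2x="hh G3 ?y2 + hh F2 x" and g3f3x="hh G3 (f_ob F3 x) + hh F3 x",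
      OF P1 P2 P3 P4 P5 P6])
    (simp_all add: acts eq_diff_eq)
 qed
qed

lemma assoc_natural_cells:
 assumes "bun_cell al a b F P Xi" "bun_cell al b c G Q Th" "bun_cell al c d H R Om"
 shows "vcmp al (asc al R Q P) (hcmp al (hcmp al Om Th) Xi) = vcmp al (hcmp al Om (hcmp al Th Xi)) (asc al H G F)"
proof -
 interpret X: bun_cell al a b F P Xi by (rule assms)
 interpret T: bun_cell al b c G Q Th by (rule assms)
 interpret O: bun_cell al c d H R Om by (rule assms)
 interpret A: mor_triple al a b c d F G H ..
 interpret A': mor_triple al a b c d P Q R ..
 interpret TX: cell_hpair al a b c F P G Q Xi Th ..
 interpret OT: cell_hpair al b c d G Q H R Th Om ..
 interpret TXc: bun_cell al a c "cmp al G F" "cmp al Q P" "hcmp al Th Xi" by (rule TX.hcomp_cell)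
 interpret OTc: bun_cell al b d "cmp al H G" "cmp al R Q" "hcmp al Om Th" by (rule OT.hcomp_cell)
 interpret L: cell_hpair al a b d F P "cmp al H G" "cmp al R Q" Xi "hcmp al Om Th" ..
 interpret R: cell_hpair al a c d "cmp al G F" "cmp al Q P" H R "hcmp al Th Xi" Om ..
 interpret Lc: bun_cell al a d "cmp al (cmp al H G) F" "cmp al (cmp al R Q) P" "hcmp al (hcmp al Om Th) Xi"
  by (rule L.hcomp_cell)
 interpret Rc: bun_cell al a d "cmp al H (cmp al G F)" "cmp al R (cmp al Q P)" "hcmp al Om (hcmp al Th Xi)"
  by (rule R.hcomp_cell)
 interpret Ac: bun_cell al a d "cmp al (cmp al H G) F" "cmp al H (cmp al G F)" "asc al H G F" by (rule A.assoc_cell)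
 interpret Ac': bun_cell al a d "cmp al (cmp al R Q) P" "cmp al R (cmp al Q P)" "asc al R Q P" by (rule A'.assoc_cell)
 interpret VL: cell_vpair al a d "cmp al (cmp al H G) F" "cmp al (cmp al R Q) P" "cmp al R (cmp al Q P)"
  "hcmp al (hcmp al Om Th) Xi" "asc al R Q P" ..
 interpret VR: cell_vpair al a d "cmp al (cmp al H G) F" "cmp al H (cmp al G F)" "cmp al R (cmp al Q P)"
  "asc al H G F" "hcmp al Om (hcmp al Th Xi)" ..
 show ?thesis
 proof (rule cell_eqI[OF VL.vcomp_cell VR.vcomp_cell])
  fix x assume x: "x : X0 (base a)"
  let ?f = "f_ob F x" and ?p = "f_ob P x"
  note h = TX.hcomp_facts[OF x]
  note h2 = OT.hcomp_facts[OF h(1)]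
  let ?A = "tau Xi x" and ?B = "tau Th ?f" and ?C = "tau Om (f_ob G ?f)"
  have f: "f_ar R (f_ar Q ?A) : X1 (base d)" "sr (base d) (f_ar R (f_ar Q ?A)) = tg (base d) (f_ar R ?B)"
   "f_ar R (mu (base c) (f_ar Q ?A) ?B) = mu (base d) (f_ar R (f_ar Q ?A)) (f_ar R ?B)"
   "sr (base c) ?B = f_ob G ?f" "tg (base c) ?B = f_ob Q ?f" "tg (base c) (f_ar Q ?A) = f_ob Q ?p" "sr (base c) (f_ar Q ?A) = f_ob Q ?f"
   "f_ob Q ?p : X0 (base c)" "f_ob R (f_ob Q ?p) : X0 (base d)"
   using h T.ta_tg[OF h(1)] T.G.f_sr[OF h(3)] T.G.f0_in[OF h(2)]
   by (simp_all add: O.G.f_simps O.G.f_mu)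
  note e = T.F.B.mu_in[OF h(5,4,6)]
  let ?RB = "mu (base d) (f_ar R ?B) ?C"
  have m: "?RB : X1 (base d)" "mu (base d) (f_ar R (f_ar Q ?A)) ?RB = mu (base d) (mu (base d) (f_ar R (f_ar Q ?A)) (f_ar R ?B)) ?C"
   using h2 f O.F.B.mu_assoc[OF f(1) h2(5,4) f(2) h2(6)] by (simp_all add: O.F.B.mu_in)
  have big: "mu (base d) (f_ar R (f_ar Q ?A)) ?RB : X1 (base d)" "tg (base d) (mu (base d) (f_ar R (f_ar Q ?A)) ?RB) = f_ob R (f_ob Q ?p)"
   "sr (base d) (mu (base d) (f_ar R (f_ar Q ?A)) ?RB) = f_ob H (f_ob G ?f)"
   using f m(1) h2 h(5) by (simp_all add: O.F.B.gpd_simps O.G.f_simps O.ta_simps)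
  \<comment> \<open>Both horizontal composites have the same arrow as component, up to bracketing,
    and the associators add units; the content lies in the equation for
    \<open>omega\<close>.\<close>
  have tl: "tau (hcmp al (hcmp al Om Th) Xi) x = mu (base d) (f_ar R (f_ar Q ?A)) ?RB"
   unfolding L.tau_hcomp[OF x] OT.tau_hcomp[OF h(1)] A'.GH.f_comp(2)[OF h(3)] ..
  have tr: "tau (hcmp al Om (hcmp al Th Xi)) x = mu (base d) (f_ar R (f_ar Q ?A)) ?RB"
   unfolding R.tau_hcomp[OF x] TX.tau_hcomp[OF x] f(3) A.FG.f_comp(1)[OF x] m(2) ..
  note un = O.F.B.unit_l'[OF big(1)] O.F.B.unit_r'[OF big(1)] O.F.B.gam_un(1)[OF big(1)] O.F.B.gam_un(2)[OF big(1)] O.F.B.rho_un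
  show "tau (vcmp al (asc al R Q P) (hcmp al (hcmp al Om Th) Xi)) x =
    tau (vcmp al (hcmp al Om (hcmp al Th Xi)) (asc al H G F)) x"
   using big by (simp add: VL.tau_vcomp[OF x] VR.tau_vcomp[OF x] tl tr A.tau_assoc[OF x] A'.tau_assoc[OF x] un)
  have vl: "omega (vcmp al (asc al R Q P) (hcmp al (hcmp al Om Th) Xi)) x =
    omega (asc al R Q P) x + omega (hcmp al (hcmp al Om Th) Xi) x"
   using big f by (simp add: VL.omega_vcomp[OF x] tl A'.tau_assoc[OF x] un)
  have hg: "f_ob H (f_ob G ?f) : X0 (base d)" by (rule O.F.f0_in[OF T.F.f0_in[OF h(1)]])
  have vr: "omega (vcmp al (hcmp al Om (hcmp al Th Xi)) (asc al H G F)) x =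
    omega (hcmp al Om (hcmp al Th Xi)) x + omega (asc al H G F) x"
   using big f hg by (simp add: VR.omega_vcomp[OF x] tr A.tau_assoc[OF x] un)
  note P1 = O.G.eta_coc[OF h(5,4,6), unfolded f(4-6)]
  note P2 = O.F.B.gam_coc[OF f(1) h2(5,4) f(2) h2(6)]
  note sq = X.hh_eq[OF x, symmetric] T.hh_eq[OF h(1), symmetric] h(11) h2(11) O.hh_eq[OF h2(1), symmetric]
   O.G.square[OF h(5), unfolded f(6,7)]
  note acts = sq sq[THEN add_act] add.assoc O.F.B.rho_mu[OF h2(5,4,6)] T.F.B.rho_mu[OF h(5,4,6)] O.F.B.rho_mu[OF f(1) h2(5) f(2)]
  show "omega (vcmp al (asc al R Q P) (hcmp al (hcmp al Om Th) Xi)) x =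
    omega (vcmp al (hcmp al Om (hcmp al Th Xi)) (asc al H G F)) x"
   unfolding vl vr L.omega_hcomp[OF x] R.omega_hcomp[OF x] TX.omega_hcomp[OF x] OT.omega_hcomp[OF h(1)] TX.tau_hcomp[OF x] OT.tau_hcomp[OF h(1)]
    A.omega_assoc[OF x] A'.omega_assoc[OF x] A'.GH.f_comp(2)[OF h(3)] A'.GH.eta_comp[OF h(3)] h(7,8) A'.GH.hh_comp[OF h(1)] A'.GH.hh_comp[OF h(2)]
    A.GH.hh_comp[OF h(1)] A.FG.f_comp(1)[OF x] A.FG.hh_comp[OF x] A'.FG.f_comp(1)[OF x] f(3)
    add.assoc[of "hh H (f_ob G ?f)" "hh G ?f" "hh F x"]
   by (rule X.F.A.assoc_natural_algebra[where x=0 and fx="hh F x" and px="hh P x" and gfx="hh G ?f + hh F x" and qfx="hh Q ?f + hh F x"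
      and qpx="hh Q ?p + hh P x" and hgfx="hh H (f_ob G ?f) + (hh G ?f + hh F x)" and rgfx="hh R (f_ob G ?f) + (hh G ?f + hh F x)"
      and rqfx="hh R (f_ob Q ?f) + (hh Q ?f + hh F x)" and rqpx="hh R (f_ob Q ?p) + (hh Q ?p + hh P x)", OF P1 P2])
    (simp_all add: acts eq_diff_eq)
 qed
qed

text \<open>With an identity in the middle, the argument 0 makes \<open>al\<close> vanish, so the
  associator is an identity 2-cell.\<close>

lemma (in mor_pair) triangle_cells:
 "vcmp al (hcmp al (Bun_id2 G) (Bun_id2 F)) (asc al G (Bun_id1 b) F) = hcmp al (Bun_id2 G) (Bun_id2 F)"
proof -
 interpret I: bun_mor al b b "Bun_id1 b" by (rule F.B.id1_mor)
 interpret T: mor_triple al a b b c F "Bun_id1 b" G ..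
 interpret C: bun_mor al a c "cmp al G F" by (rule comp_mor)
 have eq: "asc al G (Bun_id1 b) F = Bun_id2 (cmp al G F)"
 proof (rule cell_eqI[OF T.assoc_cell[unfolded F.id1_comp G.comp_id1] C.id2_cell])
  fix x assume x: "x : X0 (base a)"
  have "f_ob (Bun_id1 b) (f_ob F x) = f_ob F x" "hh (Bun_id1 b) (f_ob F x) = 0"
   using F.f0_in[OF x] by (simp_all add: Bun_id1_def)
  then show "tau (asc al G (Bun_id1 b) F) x = tau (Bun_id2 (cmp al G F)) x"
   "omega (asc al G (Bun_id1 b) F) x = omega (Bun_id2 (cmp al G F)) x"
   using x by (simp_all add: T.tau_assoc T.omega_assoc C.tau_id2 C.omega_id2 f_comp)
 qed
 interpret D: bun_cell al a c "cmp al G F" "cmp al G F" "Bun_id2 (cmp al G F)" by (rule C.id2_cell)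
 show ?thesis by (simp add: eq hcomp_id2 D.vcomp_id2)
qed

text \<open>All components are units, so the equation reduces to that for \<open>omega\<close>,
  which is the cocycle identity for \<open>al\<close> at the values of the four maps
  \<open>hh\<close>.\<close>

lemma pentagon_cells:
 assumes "bun_mor al a b F" "bun_mor al b c G" "bun_mor al c d H" "bun_mor al d e K"
 shows "vcmp al (asc al K H (cmp al G F)) (asc al (cmp al K H) G F) =
  vcmp al (hcmp al (Bun_id2 K) (asc al H G F))
   (vcmp al (asc al K (cmp al H G) F) (hcmp al (asc al K H G) (Bun_id2 F)))"
proof -
 interpret F: bun_mor al a b F by (rule assms)
 interpret G: bun_mor al b c G by (rule assms)
 interpret H: bun_mor al c d H by (rule assms)
 interpret K: bun_mor al d e K by (rule assms)
 interpret FGH: mor_triple al a b c d F G H ..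
 interpret GHK: mor_triple al b c d e G H K ..
 let ?GF = "cmp al G F" and ?HG = "cmp al H G" and ?KH = "cmp al K H"
 interpret T1: mor_triple al a c d e ?GF H K ..
 interpret T2: mor_triple al a b c e F G ?KH ..
 interpret T3: mor_triple al a b d e F ?HG K ..
 interpret A1: bun_cell al a e "cmp al ?KH ?GF" "cmp al K (cmp al H ?GF)" "asc al K H ?GF" by (rule T1.assoc_cell)
 interpret A2: bun_cell al a e "cmp al (cmp al ?KH G) F" "cmp al ?KH ?GF" "asc al ?KH G F" by (rule T2.assoc_cell)
 interpret A3: bun_cell al a e "cmp al (cmp al K ?HG) F" "cmp al K (cmp al ?HG F)" "asc al K ?HG F" by (rule T3.assoc_cell)
 interpret A4: bun_cell al a d "cmp al ?HG F" "cmp al H ?GF" "asc al H G F" by (rule FGH.assoc_cell)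
 interpret A5: bun_cell al b e "cmp al ?KH G" "cmp al K ?HG" "asc al K H G" by (rule GHK.assoc_cell)
 interpret IF: bun_cell al a b F F "Bun_id2 F" by (rule F.id2_cell)
 interpret IK: bun_cell al d e K K "Bun_id2 K" by (rule K.id2_cell)
 interpret H1: cell_hpair al a d e "cmp al ?HG F" "cmp al H ?GF" K K "asc al H G F" "Bun_id2 K" ..
 interpret H2: cell_hpair al a b e F F "cmp al ?KH G" "cmp al K ?HG" "Bun_id2 F" "asc al K H G" ..
 interpret H1c: bun_cell al a e "cmp al K (cmp al ?HG F)" "cmp al K (cmp al H ?GF)" "hcmp al (Bun_id2 K) (asc al H G F)"
  by (rule H1.hcomp_cell)
 interpret H2c: bun_cell al a e "cmp al (cmp al ?KH G) F" "cmp al (cmp al K ?HG) F" "hcmp al (asc al K H G) (Bun_id2 F)"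
  by (rule H2.hcomp_cell)
 interpret V1: cell_vpair al a e "cmp al (cmp al ?KH G) F" "cmp al ?KH ?GF" "cmp al K (cmp al H ?GF)"
  "asc al ?KH G F" "asc al K H ?GF" ..
 interpret V2: cell_vpair al a e "cmp al (cmp al ?KH G) F" "cmp al (cmp al K ?HG) F" "cmp al K (cmp al ?HG F)"
  "hcmp al (asc al K H G) (Bun_id2 F)" "asc al K ?HG F" ..
 interpret V2c: bun_cell al a e "cmp al (cmp al ?KH G) F" "cmp al K (cmp al ?HG F)"
  "vcmp al (asc al K ?HG F) (hcmp al (asc al K H G) (Bun_id2 F))" by (rule V2.vcomp_cell)
 interpret V3: cell_vpair al a e "cmp al (cmp al ?KH G) F" "cmp al K (cmp al ?HG F)" "cmp al K (cmp al H ?GF)"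
  "vcmp al (asc al K ?HG F) (hcmp al (asc al K H G) (Bun_id2 F))" "hcmp al (Bun_id2 K) (asc al H G F)" ..
 show ?thesis
 proof (rule cell_eqI[OF V1.vcomp_cell V3.vcomp_cell])
  fix x assume x: "x : X0 (base a)"
  have y: "f_ob F x : X0 (base b)" "f_ob G (f_ob F x) : X0 (base c)" "f_ob H (f_ob G (f_ob F x)) : X0 (base d)"
   "f_ob K (f_ob H (f_ob G (f_ob F x))) : X0 (base e)"
   using F.f0_in[OF x] G.f0_in[OF F.f0_in[OF x]] H.f0_in[OF G.f0_in[OF F.f0_in[OF x]]] K.f0_in[OF H.f0_in[OF G.f0_in[OF F.f0_in[OF x]]]]
   by simp_all
  note fc = FGH.FG.f_comp(1)[OF x] FGH.FG.hh_comp[OF x] FGH.GH.f_comp(1)[OF y(1)] FGH.GH.hh_comp[OF y(1)] GHK.GH.f_comp(1)[OF y(2)] GHK.GH.hh_comp[OF y(2)]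
  have K1: "f_ar (cmp al K ?HG) (un (base b) (f_ob F x)) = un (base e) (f_ob K (f_ob H (f_ob G (f_ob F x))))"
   "f_ob (cmp al K ?HG) (f_ob F x) = f_ob K (f_ob H (f_ob G (f_ob F x)))"
   "f_ob (cmp al ?HG F) x = f_ob H (f_ob G (f_ob F x))"
   using GHK.R.f_comp(1)[OF y(1)] FGH.L.f_comp(1)[OF x] fc GHK.RC.f_un[OF y(1)] by simp_all
  note units = K.B.sr_un K.B.tg_un K.B.un_in K.B.unit_l' K.B.rho_un K.B.gam_un K.f_un K.eta_un GHK.RC.eta_un F.B.rho_un H.B.rho_un
  note taus = T1.tau_assoc[OF x] T2.tau_assoc[OF x] T3.tau_assoc[OF x] FGH.tau_assoc[OF x] GHK.tau_assoc[OF y(1)] F.tau_id2[OF x] K.tau_id2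
  note omegas = T1.omega_assoc[OF x] T2.omega_assoc[OF x] T3.omega_assoc[OF x] FGH.omega_assoc[OF x] GHK.omega_assoc[OF y(1)]
   F.omega_id2[OF x] K.omega_id2
  show "tau (vcmp al (asc al K H ?GF) (asc al ?KH G F)) x =
   tau (vcmp al (hcmp al (Bun_id2 K) (asc al H G F)) (vcmp al (asc al K ?HG F) (hcmp al (asc al K H G) (Bun_id2 F)))) x"
   by (simp add: V1.tau_vcomp[OF x] V2.tau_vcomp[OF x] V3.tau_vcomp[OF x] H1.tau_hcomp[OF x] H2.tau_hcomp[OF x] taus fc K1 y units)
  show "omega (vcmp al (asc al K H ?GF) (asc al ?KH G F)) x =
   omega (vcmp al (hcmp al (Bun_id2 K) (asc al H G F)) (vcmp al (asc al K ?HG F) (hcmp al (asc al K H G) (Bun_id2 F)))) x"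
   using F.A.cocycle[of "hh H (f_ob G (f_ob F x))" "hh G (f_ob F x)" "hh F x" "hh K (f_ob H (f_ob G (f_ob F x)))"]
   by (simp add: V1.tau_vcomp[OF x] V2.tau_vcomp[OF x] V3.tau_vcomp[OF x] H1.tau_hcomp[OF x] H2.tau_hcomp[OF x]
     V1.omega_vcomp[OF x] V2.omega_vcomp[OF x] V3.omega_vcomp[OF x] H1.omega_hcomp[OF x] H2.omega_hcomp[OF x]
     taus omegas fc K1 y units) (simp add: add_ac)
 qed
qed

context
 fixes al :: "'g::group_add => 'g => 'g => 'a::ab_group_add"
 assumes n: "normalized_3cocycle al"
begin

abbreviation Bun :: "(('p, 'g, 'a) obj, ('p, 'g, 'a) mor, ('p, 'g, 'a) cell) bicat" where
 "Bun \<equiv> Bun_pre al"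

lemma Bun_sel [simp]: "cells0 Bun = Bun_cells0 al" "cells1 Bun = Bun_cells1 al" "cells2 Bun = Bun_cells2 al"
 "dom1 Bun = sob" "cod1 Bun = tob" "dom2 Bun = smor" "cod2 Bun = tmor" "id1 Bun = Bun_id1" "id2 Bun = Bun_id2"
 "comp1 Bun = cmp al" "vcomp Bun = vcmp al" "hcomp Bun = hcmp al" "assoc Bun = asc al"
 "lunit Bun = Bun_id2" "runit Bun = Bun_id2"
 by (simp_all add: Bun_pre_def)

lemma is_1cell_iff: "is_1cell Bun F a b \<longleftrightarrow> bun_mor al a b F"
 using bun_morI[OF n] bun_mor.mor bun_mor.sob bun_mor.tob unfolding is_1cell_def Bun_sel by metis

lemma is_2cellD: "is_2cell Bun Th F G ==> bun_cell al (sob F) (tob F) F G Th"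
 using bun_cellI[OF n] unfolding is_2cell_def Bun_sel by metis

lemma is_2cellI: "bun_cell al a b F G Th ==> is_2cell Bun Th F G"
 by (simp add: is_2cell_def bun_cell.cell bun_cell.smor bun_cell.tmor)

text \<open>Only left inverses have been computed. As the left inverse has a left inverse in turn,
  it is two-sided, by the argument familiar from groups.\<close>

lemma inverse_2cells_inv2: "bun_cell al a b F G Th ==> inverse_2cells Bun Th (bun_cell.inv2 al a b F G Th)"
proof -
 assume "bun_cell al a b F G Th"
 then interpret T: bun_cell al a b F G Th .
 interpret I: bun_cell al a b G F T.inv2 by (rule T.inv_cell)
 have "I.inv2 = vcmp al (vcmp al I.inv2 T.inv2) Th"
  unfolding vcomp_assoc_cells[OF T.bun_cell_axioms T.inv_cell I.inv_cell] T.inv_left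
  by (rule bun_cell.vcomp_id2[OF I.inv_cell, symmetric])
 then have "I.inv2 = Th" unfolding I.inv_left T.id2_vcomp .
 then have "vcmp al Th T.inv2 = Bun_id2 G" using I.inv_left by simp
 then show ?thesis
  unfolding inverse_2cells_def using T.inv_left is_2cellI[OF T.inv_cell] by (simp add: T.smor T.tmor)
qed

lemma iso_2cellI: "bun_cell al a b F G Th ==> iso_2cell Bun Th F G"
 unfolding iso_2cell_def using is_2cellI inverse_2cells_inv2 by blast

lemma inverse_2cells_unique:
 assumes c: "bun_cell al a b F G Th" and i: "inverse_2cells Bun Th Xi" and j: "inverse_2cells Bun Th Xi'"
 shows "Xi = Xi'"
proof -
 interpret T: bun_cell al a b F G Th by (rule c)
 have X: "bun_cell al a b G F Xi" "bun_cell al a b G F Xi'"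
  using i j is_2cellD[of _ G F] T.G.sob T.G.tob by (simp_all add: inverse_2cells_def T.smor T.tmor)
 have "Xi = vcmp al Xi (Bun_id2 G)" using bun_cell.vcomp_id2[OF X(1)] by simp
 also have "\<dots> = vcmp al Xi (vcmp al Th Xi')" using j by (simp add: inverse_2cells_def T.tmor)
 also have "\<dots> = vcmp al (vcmp al Xi Th) Xi'" by (rule vcomp_assoc_cells[OF X(2) c X(1), symmetric])
 also have "\<dots> = vcmp al (Bun_id2 F) Xi'" using i by (simp add: inverse_2cells_def T.smor)
 also have "\<dots> = Xi'" using bun_cell.id2_vcomp[OF X(2)] .
 finally show ?thesis .
qed

lemma inv_2cell_eq: "bun_cell al a b F G Th ==> inverse_2cells Bun Th (inv_2cell Bun Th)"
 unfolding inv_2cell_def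
 by (rule theI[where a="bun_cell.inv2 al a b F G Th"])
  (rule inverse_2cells_inv2, assumption, rule inverse_2cells_unique, assumption, assumption, rule inverse_2cells_inv2, assumption)

lemma bicategory_Bun: "bicategory Bun"
proof
 show "dom1 Bun F : cells0 Bun & cod1 Bun F : cells0 Bun" if "F : cells1 Bun" for F
  using that by (simp add: Bun_cells1_def)
 show "F : cells1 Bun & G : cells1 Bun & dom1 Bun F = dom1 Bun G & cod1 Bun F = cod1 Bun G" if "is_2cell Bun Th F G" for Th F G
  using that by (auto simp: is_2cell_def Bun_cells2_def Let_def)
 show "is_1cell Bun (id1 Bun a) a a" if "a : cells0 Bun" for a
  using bun_gpd.id1_mor[OF bun_gpdI[OF n]] that by (simp add: is_1cell_iff)
 show "is_1cell Bun (comp1 Bun G F) a c" if "is_1cell Bun F a b" "is_1cell Bun G b c" for F G a b c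
  using that mor_pair.comp_mor[of al a b c F G] by (simp add: is_1cell_iff mor_pair_def)
 show "is_2cell Bun (id2 Bun F) F F" if "F : cells1 Bun" for F
  using is_2cellI[OF bun_mor.id2_cell[OF bun_morI[OF n _ refl refl]]] that by simp
 show "is_2cell Bun (vcomp Bun Th Xi) F H" if X: "is_2cell Bun Xi F G" and T: "is_2cell Bun Th G H" for Xi Th F G H
 proof -
  interpret X: bun_cell al "sob F" "tob F" F G Xi by (rule is_2cellD[OF X])
  interpret T: bun_cell al "sob F" "tob F" G H Th using is_2cellD[OF T] X.G.sob X.G.tob by simp
  interpret V: cell_vpair al "sob F" "tob F" F G H Xi Th ..
  show ?thesis using is_2cellI[OF V.vcomp_cell] by simp
 qed
 show "vcomp Bun Th (id2 Bun F) = Th & vcomp Bun (id2 Bun G) Th = Th" if "is_2cell Bun Th F G" for Th F G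
  using bun_cell.vcomp_id2[OF is_2cellD[OF that]] bun_cell.id2_vcomp[OF is_2cellD[OF that]] by simp
 show "vcomp Bun (vcomp Bun Om Th) Xi = vcomp Bun Om (vcomp Bun Th Xi)"
  if X: "is_2cell Bun Xi F G" and T: "is_2cell Bun Th G H" and O: "is_2cell Bun Om H K" for Xi Th Om F G H K
 proof -
  interpret X: bun_cell al "sob F" "tob F" F G Xi by (rule is_2cellD[OF X])
  interpret T: bun_cell al "sob F" "tob F" G H Th using is_2cellD[OF T] X.G.sob X.G.tob by simp
  interpret O: bun_cell al "sob F" "tob F" H K Om using is_2cellD[OF O] T.G.sob T.G.tob by simp
  show ?thesis using vcomp_assoc_cells[OF X.bun_cell_axioms T.bun_cell_axioms O.bun_cell_axioms] by simp
 qed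
 show "is_2cell Bun (hcomp Bun Th Xi) (comp1 Bun G F) (comp1 Bun G' F')"
  if X: "is_2cell Bun Xi F F'" and T: "is_2cell Bun Th G G'" and m: "cod1 Bun F = dom1 Bun G" for Xi Th F F' G G'
 proof -
  interpret X: bun_cell al "sob F" "tob F" F F' Xi by (rule is_2cellD[OF X])
  interpret T: bun_cell al "tob F" "tob G" G G' Th using is_2cellD[OF T] m by simp
  interpret H: cell_hpair al "sob F" "tob F" "tob G" F F' G G' Xi Th ..
  show ?thesis using is_2cellI[OF H.hcomp_cell] by simp
 qed
 show "hcomp Bun (id2 Bun G) (id2 Bun F) = id2 Bun (comp1 Bun G F)" if "is_1cell Bun F a b" "is_1cell Bun G b c" for F G a b c
  using that mor_pair.hcomp_id2[of al a b c F G] by (simp add: is_1cell_iff mor_pair_def)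
 show "hcomp Bun (vcomp Bun Th' Th) (vcomp Bun Xi' Xi) = vcomp Bun (hcomp Bun Th' Xi') (hcomp Bun Th Xi)"
  if X: "is_2cell Bun Xi F F'" and X': "is_2cell Bun Xi' F' F''" and T: "is_2cell Bun Th G G'" and T': "is_2cell Bun Th' G' G''"
   and m: "cod1 Bun F = dom1 Bun G" for Xi Xi' Th Th' F F' F'' G G' G''
 proof -
  interpret X: bun_cell al "sob F" "tob F" F F' Xi by (rule is_2cellD[OF X])
  interpret X': bun_cell al "sob F" "tob F" F' F'' Xi' using is_2cellD[OF X'] X.G.sob X.G.tob by simp
  interpret T: bun_cell al "tob F" "tob G" G G' Th using is_2cellD[OF T] m by simp
  interpret T': bun_cell al "tob F" "tob G" G' G'' Th' using is_2cellD[OF T'] T.G.sob T.G.tob m by simp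
  show ?thesis
   using interchange_cells[OF X.bun_cell_axioms X'.bun_cell_axioms T.bun_cell_axioms T'.bun_cell_axioms] by simp
 qed
 show "iso_2cell Bun (assoc Bun H G F) (comp1 Bun (comp1 Bun H G) F) (comp1 Bun H (comp1 Bun G F))"
  if "is_1cell Bun F a b" "is_1cell Bun G b c" "is_1cell Bun H c d" for F G H a b c d
  using that iso_2cellI[OF mor_triple.assoc_cell[of al a b c d F G H]] by (simp add: is_1cell_iff mor_triple_def mor_pair_def)
 show "vcomp Bun (assoc Bun H' G' F') (hcomp Bun (hcomp Bun Om Th) Xi) = vcomp Bun (hcomp Bun Om (hcomp Bun Th Xi)) (assoc Bun H G F)"
  if X: "is_2cell Bun Xi F F'" and T: "is_2cell Bun Th G G'" and O: "is_2cell Bun Om H H'"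
   and m: "cod1 Bun F = dom1 Bun G" "cod1 Bun G = dom1 Bun H" for Xi Th Om F F' G G' H H'
 proof -
  interpret X: bun_cell al "sob F" "tob F" F F' Xi by (rule is_2cellD[OF X])
  interpret T: bun_cell al "tob F" "tob G" G G' Th using is_2cellD[OF T] m by simp
  interpret O: bun_cell al "tob G" "tob H" H H' Om using is_2cellD[OF O] m by simp
  show ?thesis using assoc_natural_cells[OF X.bun_cell_axioms T.bun_cell_axioms O.bun_cell_axioms] by simp
 qed
 show "iso_2cell Bun (lunit Bun F) (comp1 Bun (id1 Bun b) F) F" "iso_2cell Bun (runit Bun F) (comp1 Bun F (id1 Bun a)) F"
  if "is_1cell Bun F a b" for F a b
 proof -
  interpret bun_mor al a b F using that by (simp add: is_1cell_iff)
  show "iso_2cell Bun (lunit Bun F) (comp1 Bun (id1 Bun b) F) F" "iso_2cell Bun (runit Bun F) (comp1 Bun F (id1 Bun a)) F"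
   using iso_2cellI[OF id2_cell] by (simp_all add: id1_comp comp_id1)
 qed
 show "vcomp Bun (lunit Bun G) (hcomp Bun (id2 Bun (id1 Bun b)) Th) = vcomp Bun Th (lunit Bun F)"
  if T: "is_2cell Bun Th F G" and b: "cod1 Bun F = b" for Th F G b
 proof -
  interpret T: bun_cell al "sob F" "tob F" F G Th by (rule is_2cellD[OF T])
  show ?thesis using b by (simp add: T.id1_hcomp[unfolded b] T.vcomp_id2 T.id2_vcomp flip: b)
 qed
 show "vcomp Bun (runit Bun G) (hcomp Bun Th (id2 Bun (id1 Bun a))) = vcomp Bun Th (runit Bun F)"
  if T: "is_2cell Bun Th F G" and a: "dom1 Bun F = a" for Th F G a
 proof -
  interpret T: bun_cell al "sob F" "tob F" F G Th by (rule is_2cellD[OF T])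
  show ?thesis using a by (simp add: T.hcomp_id1 T.vcomp_id2 T.id2_vcomp flip: a)
 qed
 show "vcomp Bun (hcomp Bun (id2 Bun G) (lunit Bun F)) (assoc Bun G (id1 Bun b) F) = hcomp Bun (runit Bun G) (id2 Bun F)"
  if "is_1cell Bun F a b" "is_1cell Bun G b c" for F G a b c
  using that mor_pair.triangle_cells[of al a b c F G] by (simp add: is_1cell_iff mor_pair_def)
 show "vcomp Bun (assoc Bun K H (comp1 Bun G F)) (assoc Bun (comp1 Bun K H) G F) =
   vcomp Bun (hcomp Bun (id2 Bun K) (assoc Bun H G F)) (vcomp Bun (assoc Bun K (comp1 Bun H G) F) (hcomp Bun (assoc Bun K H G) (id2 Bun F)))"
  if "is_1cell Bun F a b" "is_1cell Bun G b c" "is_1cell Bun H c d" "is_1cell Bun K d e" for F G H K a b c d e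
  using that pentagon_cells[of al a b F c G d H e K] by (simp add: is_1cell_iff)
qed

end

section \<open>Right fractions\<close>

text \<open>The condition on \<open>eta\<close> at one pair of arrows, with all data as arbitrary
  functions. It applies to maps that are not yet known to form a 1-morphism and to pulled back
  bundles that have not been made into objects.\<close>

definition mor_coc :: "('g::group_add => 'g => 'g => 'a::ab_group_add) => 'p groupoid_data => 'p => 'p =>
  ('p => 'g) => 'a => ('p => 'g) => 'a => ('p => 'g) => ('p => 'a) => bool" where
 "mor_coc al X ph pp r1 g1 r2 g2 h e \<longleftrightarrow> e ph + e pp - e (mu X ph pp) =
   g1 - g2 + al (r2 ph) (h (tg X pp)) (r1 pp) - al (r2 ph) (r2 pp) (h (sr X pp)) - al (h (tg X ph)) (r1 ph) (r1 pp)"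

text \<open>\<open>comp1_algebra\<close> in this language. From left to right it divides a composite
  by its left factor.\<close>

lemma (in cocycle3) mor_coc_comp_iff:
 fixes r1 r2 r3 h1 h2 h :: "'p => 'g" and e1 e2 e :: "'p => 'a"
 assumes st: "sr X ph = tg X pp" and mu: "sr X (mu X ph pp) = sr X pp" "tg X (mu X ph pp) = tg X ph"
  and mult: "r1 (mu X ph pp) = r1 ph + r1 pp" "r2 (mu X ph pp) = r2 ph + r2 pp" "r3 (mu X ph pp) = r3 ph + r3 pp"
  and sq1: "\<And>th. th : {ph, pp} ==> r2 th + h1 (sr X th) = h1 (tg X th) + r1 th"
  and sq2: "\<And>th. th : {ph, pp} ==> r3 th + h2 (sr X th) = h2 (tg X th) + r2 th"
  and c2: "mor_coc al X ph pp r2 g2 r3 g3 h2 e2"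
  and h: "\<And>x. x : {sr X pp, tg X pp, tg X ph} ==> h x = h2 x + h1 x"
  and e: "\<And>th. th : {ph, pp, mu X ph pp} ==> e th = e2 th + e1 th + al (h2 (tg X th)) (r2 th) (h1 (sr X th))
   - al (r3 th) (h2 (sr X th)) (h1 (sr X th)) - al (h2 (tg X th)) (h1 (tg X th)) (r1 th)"
 shows "mor_coc al X ph pp r1 g1 r3 g3 h e \<longleftrightarrow> mor_coc al X ph pp r1 g1 r2 g2 h1 e1"
proof -
 let ?s = "sr X pp" and ?t = "tg X pp" and ?u = "tg X ph"
 note sq = sq1[of ph, simplified, unfolded st] sq1[of pp, simplified] sq2[of ph, simplified, unfolded st] sq2[of pp, simplified]
 note acts = sq sq[THEN add_act] add.assoc mult
 note E = e[of ph, simplified, unfolded st] e[of pp, simplified] e[of "mu X ph pp", simplified, unfolded mu]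
 note H = h[of ?s, simplified] h[of ?t, simplified] h[of ?u, simplified]
 show ?thesis
  unfolding mor_coc_def E H
  by (rule comp1_algebra[where s=0 and t="r1 pp" and u="r1 ph + r1 pp"
     and fs="h1 ?s" and ft="h1 ?t + r1 pp" and fu="h1 ?u + (r1 ph + r1 pp)"
     and gfs="h2 ?s + h1 ?s" and gft="h2 ?t + (h1 ?t + r1 pp)" and gfu="h2 ?u + (h1 ?u + (r1 ph + r1 pp))",
     OF c2[unfolded mor_coc_def]])
   (simp_all add: acts eq_diff_eq)
qed

text \<open>Take the cocycle condition of \<open>gamma\<close> at the three chains in which the
  component of \<open>ta\<close> comes first, second and third among the images of the two arrows.
  Naturality identifies the mixed terms, and the rest is the asserted condition.\<close>

lemma (in bun_gpd) tau_tilde_coc: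
 assumes N: "nat_trans U X f g ta" and ph: "ph : X1 U" and pp: "pp : X1 U" and st: "sr U ph = tg U pp"
 shows "mor_coc al U ph pp (%th. rho a (snd f th)) (gam a (snd f ph, snd f pp)) (%th. rho a (snd g th)) (gam a (snd g ph, snd g pp))
  (%x. rho a (ta x)) (%th. gam a (ta (tg U th), snd f th) - gam a (snd g th, ta (sr U th)))"
proof -
 interpret N: nat_trans U X f g ta by (rule N)
 have x: "sr U pp : X0 U" "tg U pp : X0 U" "tg U ph : X0 U" using ph pp by (simp_all add: N.F.dom.gpd_simps)
 note t = N.ta_in[OF x(1)] N.ta_in[OF x(2)] N.ta_in[OF x(3)]
 note f = N.F.f1_in[OF ph] N.F.f1_in[OF pp] and g = N.G.f1_in[OF ph] N.G.f1_in[OF pp]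
 have e: "sr X (ta (tg U ph)) = tg X (snd f ph)" "sr X (snd f ph) = tg X (snd f pp)" "sr X (snd g ph) = tg X (ta (tg U pp))"
  "sr X (ta (tg U pp)) = tg X (snd f pp)" "sr X (snd g ph) = tg X (snd g pp)" "sr X (snd g pp) = tg X (ta (sr U pp))"
  using ph pp st x by (simp_all add: N.ta_simps N.F.f_simps N.G.f_simps)
 note nat = N.ta_nat[OF ph, unfolded st] N.ta_nat[OF pp]
 note P = gam_coc[OF t(3) f e(1,2), unfolded nat(1)] gam_coc[OF g(1) t(2) f(2) e(3,4), unfolded nat(2)] gam_coc[OF g t(1) e(5,6)]
 show ?thesis
  unfolding mor_coc_def N.F.dom.sr_mu[OF ph pp st] N.F.dom.tg_mu[OF ph pp st] N.F.f_mu[OF ph pp st] N.G.f_mu[OF ph pp st] st P[symmetric]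
  by (simp add: algebra_simps)
qed

text \<open>A 1-morphism can be transported along a natural transformation, and then be divided by a
  1-morphism through which its functor factors.\<close>

lemma transport_mor:
 fixes al :: "'g::group_add => 'g => 'g => 'a::ab_group_add" and w F :: "('p, 'g, 'a) mor"
 assumes w: "bun_mor al a c w" and F: "bun_mor al u c F" and g: "smooth_functor (base u) (base a) g"
  and t: "smooth_nat_trans (base u) (base c) (comp_functor (base u) (fn w) g) (fn F) ta"
 obtains G Th where "bun_mor al u a G" "bun_cell al u c (cmp al w G) F Th"
proof -
 interpret w: bun_mor al a c w by (rule w)
 interpret F: bun_mor al u c F by (rule F)
 interpret g: smooth_fctr "base u" "base a" g by (rule smooth_fctrI'[OF F.A.lie_gpd_axioms w.A.lie_gpd_axioms g])
 let ?U = "base u" and ?X = "base a" and ?Z = "base c"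
 have wg: "smooth_fctr ?U ?Z (comp_functor ?U (fn w) g)"
  by (rule smooth_fctrI'[OF F.A.lie_gpd_axioms w.B.lie_gpd_axioms smooth_functor_comp[OF g.smooth_fctr_axioms w.smooth_fctr_axioms]])
 interpret N: nat_trans ?U ?Z "comp_functor ?U (fn w) g" "fn F" ta by (rule nat_transI[OF wg F.smooth_fctr_axioms t])
 \<comment> \<open>\<open>(k, E)\<close> is the solution of the equation that its composite with the
   1-morphism of \<open>ta\<close> is \<open>F\<close>, and \<open>(h, et)\<close> of the equation
   that its composite with \<open>w\<close> is \<open>(k, E)\<close>. The formulas solve that of
   \<open>bun_comp\<close> for the right factor.\<close>
 define h where "h x = - hh w (fst g x) + (- rho c (ta x) + hh F x)" for x
 define k where "k x = - rho c (ta x) + hh F x" for x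
 define E where "E ph = eta F ph - (gam c (ta (tg ?U ph), f_ar w (snd g ph)) - gam c (f_ar F ph, ta (sr ?U ph)))
  - al (rho c (ta (tg ?U ph))) (rho c (f_ar w (snd g ph))) (k (sr ?U ph))
  + al (rho c (f_ar F ph)) (rho c (ta (sr ?U ph))) (k (sr ?U ph)) + al (rho c (ta (tg ?U ph))) (k (tg ?U ph)) (rho u ph)" for ph
 define et where "et ph = E ph - eta w (snd g ph) - al (hh w (fst g (tg ?U ph))) (rho a (snd g ph)) (h (sr ?U ph))
  + al (rho c (f_ar w (snd g ph))) (hh w (fst g (sr ?U ph))) (h (sr ?U ph)) + al (hh w (fst g (tg ?U ph))) (h (tg ?U ph)) (rho u ph)" for ph
 define G where "G = \<lparr>sob = u, tob = a, fn = g, bmor = (\<lambda>x\<in>X0 ?U. h x, \<lambda>ph\<in>X1 ?U. et ph)\<rparr>"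
 have G [simp]: "sob G = u" "tob G = a" "fn G = g" "x : X0 ?U ==> hh G x = h x" "ph : X1 ?U ==> eta G ph = et ph" for x ph
  by (simp_all add: G_def)
 have hk: "k x = hh w (fst g x) + h x" and hF: "hh F x = rho c (ta x) + k x" for x
  by (simp_all add: h_def k_def)
 have ar: "snd (comp_functor ?U (fn w) g) ph = f_ar w (snd g ph)" if "ph : X1 ?U" for ph using that by simp
 have ts: "sr ?Z (ta x) = f_ob w (fst g x)" "tg ?Z (ta x) = f_ob F x" "ta x : X1 ?Z" if "x : X0 ?U" for x
  using that N.ta_simps[OF that] by simp_all
 \<comment> \<open>The square laws for the quotients follow from those of \<open>F\<close> and
   \<open>w\<close> and from naturality of \<open>ta\<close>, by cancelling a label on the
   left.\<close>
 have sqE: "rho c (f_ar w (snd g ph)) + k (sr ?U ph) = k (tg ?U ph) + rho u ph"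
  and sqT: "rho c (f_ar F ph) + rho c (ta (sr ?U ph)) = rho c (ta (tg ?U ph)) + rho c (f_ar w (snd g ph))" if ph: "ph : X1 ?U" for ph
 proof -
  have x: "sr ?U ph : X0 ?U" "tg ?U ph : X0 ?U" using ph by (simp_all add: F.A.gpd_simps)
  have m: "f_ar w (snd g ph) : X1 ?Z" "sr ?Z (ta (tg ?U ph)) = tg ?Z (f_ar w (snd g ph))" "sr ?Z (f_ar F ph) = tg ?Z (ta (sr ?U ph))"
   using ph x by (simp_all add: ts w.f_simps g.f_simps F.f_simps)
  have "mu ?Z (ta (tg ?U ph)) (f_ar w (snd g ph)) = mu ?Z (f_ar F ph) (ta (sr ?U ph))" using N.ta_nat[OF ph] ar[OF ph] by simp
  then show T: "rho c (f_ar F ph) + rho c (ta (sr ?U ph)) = rho c (ta (tg ?U ph)) + rho c (f_ar w (snd g ph))"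
   using w.B.rho_mu[OF ts(3)[OF x(2)] m(1,2)] w.B.rho_mu[OF F.f1_in[OF ph] ts(3)[OF x(1)] m(3)] by simp
  have "rho c (ta (tg ?U ph)) + (rho c (f_ar w (snd g ph)) + k (sr ?U ph)) = rho c (ta (tg ?U ph)) + (k (tg ?U ph) + rho u ph)"
   unfolding add.assoc[symmetric, where a="rho c (ta (tg ?U ph))"] T[symmetric]
   unfolding add.assoc[where a="rho c (f_ar F ph)"] hF[symmetric] by (rule F.square[OF ph])
  then show "rho c (f_ar w (snd g ph)) + k (sr ?U ph) = k (tg ?U ph) + rho u ph" by (simp only: add_left_cancel)
 qed
 have sqw: "rho c (f_ar w (snd g ph)) + hh w (fst g (sr ?U ph)) = hh w (fst g (tg ?U ph)) + rho a (snd g ph)" if "ph : X1 ?U" for ph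
  using w.square[OF g.f1_in[OF that]] that by (simp add: g.f_simps)
 have sqG: "rho a (snd g ph) + h (sr ?U ph) = h (tg ?U ph) + rho u ph" if ph: "ph : X1 ?U" for ph
 proof -
  have "hh w (fst g (tg ?U ph)) + (rho a (snd g ph) + h (sr ?U ph)) = hh w (fst g (tg ?U ph)) + (h (tg ?U ph) + rho u ph)"
   unfolding add.assoc[symmetric, where a="hh w (fst g (tg ?U ph))"] sqw[OF ph, symmetric]
   unfolding add.assoc[where a="rho c (f_ar w (snd g ph))"] hk[symmetric] by (rule sqE[OF ph])
  then show ?thesis by (simp only: add_left_cancel)
 qed
 note idU = sm_ident[OF F.A.mfd_Ob] sm_ident[OF F.A.mfd_Ar]
 note s1 = F.A.smooth_sr F.A.smooth_tg
 have g0: "smooth T (Ob ?X) (%t. fst g (p t))" if "manifold T" "smooth T (Ob ?U) p" for T :: "'p mfd" and p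
  by (rule sm_compose'[OF that(1) F.A.mfd_Ob w.A.mfd_Ob that(2) g.smooth0])
 note g1 = g.smooth1
 note sT = sm_compose'[OF _ F.A.mfd_Ob w.B.mfd_Ar _ N.smooth_ta]
 note lc = lc_intros F.A.lc_al w.lc_hh F.lc_hh w.lc_eta F.lc_eta F.A.lc_rho w.A.lc_rho w.B.lc_rho
 have lh: "locally_constant (mtop T) (%x. h (p x))" and lk: "locally_constant (mtop T) (%x. k (p x))"
  if T: "manifold T" and p: "smooth T (Ob ?U) p" for T :: "'p mfd" and p
 proof -
  have k': "locally_constant (mtop T) (%x. (0 - rho c (ta (p x))) + hh F (p x))"
   by (intro lc sT[OF T p] p)
  then show "locally_constant (mtop T) (%x. k (p x))" unfolding k_def by simp
  have "locally_constant (mtop T) (%x. (0 - hh w (fst g (p x))) + ((0 - rho c (ta (p x))) + hh F (p x)))"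
   by (intro lc sT[OF T p] g0[OF T p] p)
  then show "locally_constant (mtop T) (%x. h (p x))" unfolding h_def by simp
 qed
 have Gm: "bun_mor al u a G"
 proof (rule bun_mor_intro)
  show "bun_gpd al u" "bun_gpd al a" by unfold_locales
  show "smooth_functor ?U ?X (fn G)" using g by simp
  show "locally_constant (mtop (Ob ?U)) (hh G)"
   by (rule continuous_map_eq[OF lh[OF F.A.mfd_Ob idU(1)]]) simp
  note M = F.A.mfd_Ar
  have wg1: "smooth (Ar ?U) (Ar ?Z) (%ph. f_ar w (snd g ph))" by (rule w.sm1[OF M g1])
  have F1: "smooth (Ar ?U) (Ar ?Z) (%ph. f_ar F ph)" by (rule F.sm1[OF M idU(2)])
  note ss = sT[OF M s1(1)] sT[OF M s1(2)]
  have l1: "locally_constant (mtop (Ar ?U)) (%ph. gam c (ta (tg ?U ph), f_ar w (snd g ph)))"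
   by (rule w.B.lc_gam[OF ss(2) wg1]) (simp add: ts w.f_simps g.f_simps F.A.gpd_simps)
  have l2: "locally_constant (mtop (Ar ?U)) (%ph. gam c (f_ar F ph, ta (sr ?U ph)))"
   by (rule w.B.lc_gam[OF F1 ss(1)]) (simp add: ts F.f_simps F.A.gpd_simps)
  have lE: "locally_constant (mtop (Ar ?U)) (%ph. E ph)"
   unfolding E_def by (intro lc l1 l2 lk M s1 ss F1 wg1 idU)
  have "locally_constant (mtop (Ar ?U)) (%ph. et ph)"
   unfolding et_def by (intro lc lE lh M s1 g0[OF M s1(1)] g0[OF M s1(2)] wg1 g1 idU)
  then show "locally_constant (mtop (Ar ?U)) (eta G)" by (rule continuous_map_eq) simp
  show "rho a (f_ar G ph) + hh G (sr ?U ph) = hh G (tg ?U ph) + rho u ph" if "ph : X1 ?U" for ph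
   using sqG[OF that] that by (simp add: F.A.gpd_simps)
  fix ph pp assume ph: "ph : X1 ?U" and pp: "pp : X1 ?U" and st: "sr ?U ph = tg ?U pp"
  let ?m = "mu ?U ph pp"
  have m: "?m : X1 ?U" and mst: "sr ?U ?m = sr ?U pp" "tg ?U ?m = tg ?U ph" using ph pp st by (simp_all add: F.A.gpd_simps)
  have ends: "sr ?X (snd g ph) = tg ?X (snd g pp)" "sr ?Z (f_ar F ph) = tg ?Z (f_ar F pp)" "sr ?Z (f_ar w (snd g ph)) = tg ?Z (f_ar w (snd g pp))"
   using ph pp st by (simp_all add: g.f_simps F.f_simps w.f_simps)
  have mult: "rho u ?m = rho u ph + rho u pp" "rho a (snd g ?m) = rho a (snd g ph) + rho a (snd g pp)"
   "rho c (f_ar w (snd g ?m)) = rho c (f_ar w (snd g ph)) + rho c (f_ar w (snd g pp))" "rho c (f_ar F ?m) = rho c (f_ar F ph) + rho c (f_ar F pp)"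
   using F.A.rho_mu[OF ph pp st] w.A.rho_mu[OF g.f1_in[OF ph] g.f1_in[OF pp] ends(1)] w.B.rho_mu[OF F.f1_in[OF ph] F.f1_in[OF pp] ends(2)]
    w.B.rho_mu[OF w.f1_in[OF g.f1_in[OF ph]] w.f1_in[OF g.f1_in[OF pp]] ends(3)]
   by (simp_all add: g.f_mu[OF ph pp st] F.f_mu[OF ph pp st] w.f_mu[OF g.f1_in[OF ph] g.f1_in[OF pp] ends(1)])
  have mem: "th : X1 ?U" if "th : {ph, pp, ?m}" for th using that ph pp m by blast
  have cF: "mor_coc al ?U ph pp (rho u) (gam u (ph, pp)) (%th. rho c (f_ar F th)) (gam c (f_ar F ph, f_ar F pp)) (hh F) (eta F)"
   using F.eta_coc[OF ph pp st] unfolding mor_coc_def .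
  have cT: "mor_coc al ?U ph pp (%th. rho c (f_ar w (snd g th))) (gam c (f_ar w (snd g ph), f_ar w (snd g pp))) (%th. rho c (f_ar F th)) (gam c (f_ar F ph, f_ar F pp))
   (%x. rho c (ta x)) (%th. gam c (ta (tg ?U th), f_ar w (snd g th)) - gam c (f_ar F th, ta (sr ?U th)))"
   using w.B.tau_tilde_coc[OF N.nat_trans_axioms ph pp st] unfolding mor_coc_def ar[OF ph] ar[OF pp] ar[OF m] .
  \<comment> \<open>Division by the 1-morphism of \<open>ta\<close>; the division by
    \<open>w\<close> follows in the same way.\<close>
  have cE: "mor_coc al ?U ph pp (rho u) (gam u (ph, pp)) (%th. rho c (f_ar w (snd g th))) (gam c (f_ar w (snd g ph), f_ar w (snd g pp))) k E"
   by (rule w.A.mor_coc_comp_iff[THEN iffD1, OF st mst mult(1,3,4) _ _ cT _ _ cF])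
    (use ph pp m in \<open>auto simp: sqE sqT hF E_def\<close>)
  have cw: "mor_coc al ?U ph pp (%th. rho a (snd g th)) (gam a (snd g ph, snd g pp)) (%th. rho c (f_ar w (snd g th))) (gam c (f_ar w (snd g ph), f_ar w (snd g pp)))
   (%x. hh w (fst g x)) (%th. eta w (snd g th))"
   using w.eta_coc[OF g.f1_in[OF ph] g.f1_in[OF pp] ends(1)] ph pp
   unfolding mor_coc_def by (simp add: g.f_mu[OF ph pp st] g.f_simps)
  have "mor_coc al ?U ph pp (rho u) (gam u (ph, pp)) (%th. rho a (snd g th)) (gam a (snd g ph, snd g pp)) h et"
   by (rule w.A.mor_coc_comp_iff[THEN iffD1, OF st mst mult(1-3) _ _ cw _ _ cE])
    (use ph pp m in \<open>auto simp: sqG sqw hk et_def\<close>)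
  then show "eta G ph + eta G pp - eta G ?m = gam u (ph, pp) - gam a (f_ar G ph, f_ar G pp) + al (rho a (f_ar G ph)) (hh G (tg ?U pp)) (rho u pp)
    - al (rho a (f_ar G ph)) (rho a (f_ar G pp)) (hh G (sr ?U pp)) - al (hh G (tg ?U ph)) (rho u ph) (rho u pp)"
   using ph pp m unfolding mor_coc_def by (simp add: F.A.gpd_simps)
 qed (simp_all add: G_def)
 interpret G: bun_mor al u a G by (rule Gm)
 interpret wG: mor_pair al u a c G w ..
 define Th where "Th = \<lparr>smor = cmp al w G, tmor = F, tau = ta, omega = (\<lambda>x\<in>X0 ?U. 0 :: 'a)\<rparr>"
 have "bun_cell al u c (cmp al w G) F Th"
 proof (rule bun_cell_intro[OF wG.comp_mor F])
  show "smooth (Ob ?U) (Ar ?Z) (tau Th)" "tau Th : extensional (X0 ?U)" using N.smooth_ta N.ext_ta by (simp_all add: Th_def)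
  show "locally_constant (mtop (Ob ?U)) (omega Th)"
   using locally_constant_restrict[OF locally_constant_const, of "mtop (Ob ?U)" 0] by (simp add: Th_def)
  show "hh F x = rho c (tau Th x) + hh (cmp al w G) x" if "x : X0 ?U" for x
   using hF[of x] hk[of x] that by (simp add: Th_def wG.hh_comp)
  fix ph assume ph: "ph : X1 ?U"
  have x: "sr ?U ph : X0 ?U" "tg ?U ph : X0 ?U" using ph by (simp_all add: F.A.gpd_simps)
  have kk: "hh (cmp al w G) x = k x" if "x : X0 ?U" for x using that by (simp add: wG.hh_comp hk)
  have EE: "eta (cmp al w G) ph = E ph"
   using ph x by (simp add: wG.eta_comp et_def)
  show "mu ?Z (tau Th (tg ?U ph)) (f_ar (cmp al w G) ph) = mu ?Z (f_ar F ph) (tau Th (sr ?U ph))"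
   using N.ta_nat[OF ph] ph by (simp add: Th_def wG.f_comp)
  show "omega Th (sr ?U ph) - omega Th (tg ?U ph) =
   gam c (tau Th (tg ?U ph), f_ar (cmp al w G) ph) - gam c (f_ar F ph, tau Th (sr ?U ph)) + eta (cmp al w G) ph
   + al (rho c (tau Th (tg ?U ph))) (rho c (f_ar (cmp al w G) ph)) (hh (cmp al w G) (sr ?U ph))
   - al (rho c (f_ar F ph)) (rho c (tau Th (sr ?U ph))) (hh (cmp al w G) (sr ?U ph))
   - al (rho c (tau Th (tg ?U ph))) (hh (cmp al w G) (tg ?U ph)) (rho u ph) - eta F ph"
   unfolding EE kk[OF x(1)] kk[OF x(2)] using ph x by (simp add: Th_def wG.f_comp E_def)
 qed (simp_all add: Th_def ts wG.f_comp)
 with Gm show thesis by (rule that)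
qed

text \<open>Pulling the bundle back along \<open>v\<close> makes zero \<open>h\<close> and
  \<open>eta\<close> a 1-morphism over \<open>v\<close>, so every smooth functor into the base of
  \<open>b\<close> underlies a 1-morphism to \<open>b\<close>.\<close>

lemma pull_mor_exists:
 fixes al :: "'g::group_add => 'g => 'g => 'a::ab_group_add" and b :: "('p, 'g, 'a) obj"
 assumes b: "bun_gpd al b" and v: "smooth_fctr U (base b) v"
 obtains u V where "base u = U" "bun_mor al u b V" "fn V = v"
proof -
 interpret b: bun_gpd al b by (rule b)
 interpret v: smooth_fctr U "base b" v by (rule v)
 define u where "u = \<lparr>base = U, bun_of = pull_ob U v (bun_of b)\<rparr>"
 have [simp]: "base u = U" by (simp add: u_def)
 have r: "ph : X1 U ==> rho u ph = rho b (snd v ph)" "ph : X1 U ==> pp : X1 U ==> sr U ph = tg U pp ==> gam u (ph, pp) = gam b (snd v ph, snd v pp)" for ph pp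
  by (simp_all add: u_def pull_ob_def split_beta X2_def)
 have "bun_ob al U (bun_of u)"
  unfolding bun_ob_def split_beta
 proof (intro conjI)
  show "rho u : extensional (X1 U)" "gam u : extensional (X2 U)" by (simp_all add: u_def pull_ob_def split_beta)
  show "locally_constant (mtop (Ar U)) (rho u)" by (rule continuous_map_eq[OF b.lc_rho[OF v.smooth1]]) (simp add: r)
  have lcb: "locally_constant (X2_top (base b)) (gam b)" using b.ob unfolding Bun_cells0_def bun_ob_def split_beta by blast
  have top: "topspace (X2_top U) = X2 U" by (auto simp: X2_top_def X2_def)
  have c1: "continuous_map (X2_top U) (mtop (Ar (base b))) (%p. snd v (fst p))" "continuous_map (X2_top U) (mtop (Ar (base b))) (%p. snd v (snd p))"
   using continuous_map_compose[OF continuous_map_from_subtopology[OF continuous_map_fst] sm_continuous[OF v.smooth1]]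
    continuous_map_compose[OF continuous_map_from_subtopology[OF continuous_map_snd] sm_continuous[OF v.smooth1]]
   by (simp_all add: X2_top_def o_def)
  have "continuous_map (X2_top U) (X2_top (base b)) (%p. (snd v (fst p), snd v (snd p)))"
   unfolding X2_top_def[of "base b"] continuous_map_in_subtopology
  proof
   show "continuous_map (X2_top U) (prod_topology (mtop (Ar (base b))) (mtop (Ar (base b)))) (%p. (snd v (fst p), snd v (snd p)))"
    using c1 by (simp add: continuous_map_pairwise o_def)
   show "(%p. (snd v (fst p), snd v (snd p))) : topspace (X2_top U) \<rightarrow> X2 (base b)"
    unfolding top by (auto simp: X2_def v.f_simps)
  qed
  from continuous_map_compose[OF this lcb] show "locally_constant (X2_top U) (gam u)"
   by (rule continuous_map_eq) (auto simp: top X2_def r)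
  show "\<forall>p\<in>X2 U. rho u (mu U (fst p) (snd p)) = rho u (fst p) + rho u (snd p)"
   by (auto simp: X2_def r v.f_mu b.rho_mu v.f_simps v.dom.gpd_simps)
  show "\<forall>ph pp xi. (ph, pp) : X2 U & (pp, xi) : X2 U \<longrightarrow>
    gam u (pp, xi) + gam u (ph, mu U pp xi) - gam u (mu U ph pp, xi) - gam u (ph, pp) = al (rho u ph) (rho u pp) (rho u xi)"
  proof (intro allI impI)
   fix ph pp xi assume "(ph, pp) : X2 U & (pp, xi) : X2 U"
   then have m: "ph : X1 U" "pp : X1 U" "xi : X1 U" "sr U ph = tg U pp" "sr U pp = tg U xi" by (simp_all add: X2_def)
   then show "gam u (pp, xi) + gam u (ph, mu U pp xi) - gam u (mu U ph pp, xi) - gam u (ph, pp) = al (rho u ph) (rho u pp) (rho u xi)"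
    using b.gam_coc[OF v.f1_in[OF m(1)] v.f1_in[OF m(2)] v.f1_in[OF m(3)]] by (simp add: r v.f_mu v.f_simps v.dom.gpd_simps)
  qed
  show "\<forall>ph\<in>X1 U. gam u (un U (tg U ph), ph) = 0 & gam u (ph, un U (sr U ph)) = 0"
   by (simp add: r v.f_un b.gam_un v.f_simps v.dom.gpd_simps)
 qed
 then have u: "bun_gpd al u" using v.dom.lie by (intro bun_gpdI b.normalized) (simp add: Bun_cells0_def)
 define V :: "('p, 'g, 'a) mor" where "V = \<lparr>sob = u, tob = b, fn = v, bmor = (\<lambda>x\<in>X0 U. 0, \<lambda>ph\<in>X1 U. 0)\<rparr>"
 have "bun_mor al u b V"
 proof (rule bun_mor_intro[OF u b])
  show "locally_constant (mtop (Ob (base u))) (hh V)" "locally_constant (mtop (Ar (base u))) (eta V)"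
   using locally_constant_restrict[OF locally_constant_const, of _ 0] by (simp_all add: V_def)
 qed (simp_all add: V_def v.fctr r v.dom.gpd_simps)
 then show thesis by (intro that[of u V]) (simp_all add: V_def)
qed

text \<open>A type into which the reals inject is infinite, hence as large as its square; applying
  an injection of the square twice codes triples.\<close>

lemma infinite_triple_inj:
 assumes "\<exists>e :: real => 'p. inj e" obtains i :: "'p \<times> 'p \<times> 'p => 'p" where "inj i"
proof -
 obtain e :: "real => 'p" where e: "inj e" using assms by blast
 have inf: "infinite (UNIV :: 'p set)"
  using infinite_UNIV_char_0[where 'a=real] finite_subset[OF subset_UNIV] finite_imageD[OF _ e] by blast
 have "(card_of (UNIV \<times> UNIV :: ('p \<times> 'p) set), card_of (UNIV :: 'p set)) : ordLeq"
  by (rule ordIso_imp_ordLeq[OF card_of_Times_same_infinite[OF inf]])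
 from this[folded card_of_ordLeq] obtain j :: "'p \<times> 'p => 'p" where jj: "inj_on j (UNIV \<times> UNIV)" by blast
 have j: "x = y" if "j x = j y" for x y by (rule inj_onD[OF jj that]) simp_all
 have "inj (%p. j (fst p, j (snd p)))"
 proof (rule injI)
  fix p q assume "j (fst p, j (snd p)) = j (fst q, j (snd q))"
  from j[OF this] j[of "snd p" "snd q"] show "p = q" by (simp add: prod_eq_iff)
 qed
 then show thesis by (rule that)
qed

section \<open>Pasting of 2-cells and the conditions on fractions\<close>

context
 fixes al :: "'g::group_add => 'g => 'g => 'a::ab_group_add"
 assumes n: "normalized_3cocycle al"
begin

abbreviation B :: "(('p, 'g, 'a) obj, ('p, 'g, 'a) mor, ('p, 'g, 'a) cell) bicat" where "B \<equiv> Bun_pre al"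
abbreviation comp_1cells (infixl "oc" 75) where "comp_1cells \<equiv> cmp al"
abbreviation vertical (infixr "vc" 65) where "vertical \<equiv> vcmp al"
abbreviation horizontal (infixl "hc" 70) where "horizontal \<equiv> hcmp al"
abbreviation as where "as \<equiv> asc al"
abbreviation C1 :: "('p, 'g, 'a) mor set" where "C1 \<equiv> Bun_cells1 al"
abbreviation C2 :: "('p, 'g, 'a) cell set" where "C2 \<equiv> Bun_cells2 al"

interpretation B: bicategory B by (rule bicategory_Bun[OF n])

lemmas sel = Bun_sel[OF n]

text \<open>Boundaries are read off the records, also for cells that do not compose. Together with
  the closure rules in \<open>ty\<close>, this leaves the typing conditions of pasting arguments to
  the simplifier.\<close>

lemma ends [simp]: "sob (G oc F) = sob F" "tob (G oc F) = tob G" "smor (Th vc Xi) = smor Xi" "tmor (Th vc Xi) = tmor Th"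
 "smor (Th hc Xi) = smor Th oc smor Xi" "tmor (Th hc Xi) = tmor Th oc tmor Xi" "smor (Bun_id2 F) = F" "tmor (Bun_id2 F) = F"
 "smor (as H G F) = H oc G oc F" "tmor (as H G F) = H oc (G oc F)"
 by (simp_all add: Bun_comp1_def Bun_vcomp_def Bun_hcomp_def Bun_id2_def Bun_assoc_def Let_def)

lemma two: "Th : C2 ==> is_2cell B Th (smor Th) (tmor Th)"
 by (simp add: is_2cell_def sel)

lemma one: "F : C1 ==> sob F = a ==> tob F = b ==> is_1cell B F a b"
 by (simp add: is_1cell_def sel)

lemma C2_ends: "Th : C2 ==> sob (tmor Th) = sob (smor Th)" "Th : C2 ==> tob (tmor Th) = tob (smor Th)"
 by (simp_all add: Bun_cells2_def)

lemma V_in: "Th : C2 ==> Xi : C2 ==> smor Th = tmor Xi ==> Th vc Xi : C2"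
proof -
 assume "Th : C2" "Xi : C2" and m: "smor Th = tmor Xi"
 from B.vcomp_cell[OF two[OF this(2)] two[OF this(1), unfolded m]] show ?thesis unfolding is_2cell_def sel by blast
qed

lemma H_in: "Th : C2 ==> Xi : C2 ==> tob (smor Xi) = sob (smor Th) ==> Th hc Xi : C2"
proof -
 assume "Th : C2" "Xi : C2" and m: "tob (smor Xi) = sob (smor Th)"
 from B.hcomp_cell[OF two[OF this(2)] two[OF this(1)], unfolded sel, OF m] show ?thesis unfolding is_2cell_def sel by blast
qed

lemma I_in: "F : C1 ==> Bun_id2 F : C2"
 using B.id2_cell[unfolded sel, of F] unfolding is_2cell_def sel by blast

lemma O_in: "F : C1 ==> G : C1 ==> tob F = sob G ==> G oc F : C1"
proof -
 assume "F : C1" "G : C1" and m: "tob F = sob G"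
 from B.comp1_cell[OF one[OF this(1) refl m] one[OF this(2) refl refl]] show ?thesis unfolding is_1cell_def sel by blast
qed

lemma A_in: "F : C1 ==> G : C1 ==> H : C1 ==> tob F = sob G ==> tob G = sob H ==> as H G F : C2"
proof -
 assume "F : C1" "G : C1" "H : C1" and m: "tob F = sob G" "tob G = sob H"
 from B.assoc_cell[OF one[OF this(1) refl m(1)] one[OF this(2) refl m(2)] one[OF this(3) refl refl]] show ?thesis
  unfolding iso_2cell_def is_2cell_def sel by blast
qed

lemmas ty = V_in H_in I_in O_in A_in C2_ends

lemma vassoc: "Om : C2 ==> Th : C2 ==> Xi : C2 ==> smor Om = tmor Th ==> smor Th = tmor Xi ==> (Om vc Th) vc Xi = Om vc Th vc Xi"
proof -
 assume "Om : C2" "Th : C2" "Xi : C2" and m: "smor Om = tmor Th" "smor Th = tmor Xi"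
 from B.vcomp_assoc[OF two[OF this(3)] two[OF this(2), unfolded m] two[OF this(1), unfolded m]] show ?thesis unfolding sel .
qed

lemma idl: "Th : C2 ==> tmor Th = G ==> Bun_id2 G vc Th = Th" and idr: "Th : C2 ==> smor Th = F ==> Th vc Bun_id2 F = Th"
 using B.vcomp_id[OF two[of Th], unfolded sel] by blast+

lemma inter: "Th' : C2 ==> Th : C2 ==> Xi' : C2 ==> Xi : C2 ==> smor Th' = tmor Th ==> smor Xi' = tmor Xi ==> tob (smor Xi) = sob (smor Th) ==>
  (Th' vc Th) hc (Xi' vc Xi) = (Th' hc Xi') vc (Th hc Xi)"
proof -
 assume "Th' : C2" "Th : C2" "Xi' : C2" "Xi : C2" and m: "smor Th' = tmor Th" "smor Xi' = tmor Xi" and o: "tob (smor Xi) = sob (smor Th)"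
 from B.interchange[OF two[OF this(4)] two[OF this(3), unfolded m] two[OF this(2)] two[OF this(1), unfolded m], unfolded sel, OF o]
 show ?thesis .
qed

lemma whisker_l: "F : C1 ==> Xi' : C2 ==> Xi : C2 ==> smor Xi' = tmor Xi ==> tob (smor Xi) = sob F ==>
  Bun_id2 F hc (Xi' vc Xi) = (Bun_id2 F hc Xi') vc (Bun_id2 F hc Xi)"
 using inter[of "Bun_id2 F" "Bun_id2 F" Xi' Xi] by (simp add: idl ty)

lemma whisker_r: "F : C1 ==> Xi' : C2 ==> Xi : C2 ==> smor Xi' = tmor Xi ==> tob F = sob (smor Xi) ==>
  (Xi' vc Xi) hc Bun_id2 F = (Xi' hc Bun_id2 F) vc (Xi hc Bun_id2 F)"
 using inter[of Xi' Xi "Bun_id2 F" "Bun_id2 F"] by (simp add: idl ty)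

lemma hid: "F : C1 ==> G : C1 ==> tob F = sob G ==> Bun_id2 G hc Bun_id2 F = Bun_id2 (G oc F)"
proof -
 assume "F : C1" "G : C1" and m: "tob F = sob G"
 from B.hcomp_id[OF one[OF this(1) refl m] one[OF this(2) refl refl]] show ?thesis unfolding sel .
qed

lemma anat: "Xi : C2 ==> Th : C2 ==> Om : C2 ==> tob (smor Xi) = sob (smor Th) ==> tob (smor Th) = sob (smor Om) ==>
  as (tmor Om) (tmor Th) (tmor Xi) vc (Om hc Th hc Xi) = (Om hc (Th hc Xi)) vc as (smor Om) (smor Th) (smor Xi)"
 using B.assoc_natural[OF two two two, unfolded sel] .

lemma pent: "F : C1 ==> G : C1 ==> H : C1 ==> K : C1 ==> tob F = sob G ==> tob G = sob H ==> tob H = sob K ==>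
  as K H (G oc F) vc as (K oc H) G F = (Bun_id2 K hc as H G F) vc as K (H oc G) F vc (as K H G hc Bun_id2 F)"
proof -
 assume "F : C1" "G : C1" "H : C1" "K : C1" and m: "tob F = sob G" "tob G = sob H" "tob H = sob K"
 from B.pentagon[OF one[OF this(1) refl m(1)] one[OF this(2) refl m(2)] one[OF this(3) refl m(3)] one[OF this(4) refl refl]]
 show ?thesis unfolding sel .
qed

lemma inverse_ex: "Th : C2 ==> \<exists>Xi\<in>C2. smor Xi = tmor Th & tmor Xi = smor Th & Xi vc Th = Bun_id2 (smor Th) & Th vc Xi = Bun_id2 (tmor Th)"
 using inverse_2cells_inv2[OF n bun_cellI[OF n, of Th]] unfolding inverse_2cells_def is_2cell_def sel by blast

lemma lcancel:
 assumes "Th : C2" "x : C2" "y : C2" "smor Th = tmor x" "smor Th = tmor y" and eq: "Th vc x = Th vc y"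
 shows "x = y"
proof -
 obtain Xi where X: "Xi : C2" "smor Xi = tmor Th" "Xi vc Th = Bun_id2 (smor Th)" using inverse_ex[OF assms(1)] by blast
 have "z = Xi vc Th vc z" if "z : C2" "smor Th = tmor z" for z
  using vassoc[of Xi Th z] that assms(1) X by (simp add: idl)
 then show ?thesis using assms by metis
qed

lemma rcancel:
 assumes "Th : C2" "x : C2" "y : C2" "smor x = tmor Th" "smor y = tmor Th" and eq: "x vc Th = y vc Th"
 shows "x = y"
proof -
 obtain Xi where X: "Xi : C2" "tmor Xi = smor Th" "Th vc Xi = Bun_id2 (tmor Th)" using inverse_ex[OF assms(1)] by blast
 have "z = (z vc Th) vc Xi" if "z : C2" "smor z = tmor Th" for z
  using vassoc[of z Th Xi] that assms(1) X by (simp add: idr)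
 then show ?thesis using assms by metis
qed

text \<open>The lifting equation passes from \<open>v\<close> to \<open>v oc p\<close>: it is
  whiskered with \<open>p\<close>, naturality of the associator moves \<open>be\<close> and
  \<open>Th\<close> to the other side, and the pentagon collects the associators.\<close>

lemma whiskered_lift:
 assumes c: "w : C1" "f : C1" "g : C1" "v : C1" "p : C1" and t: "Th : C2" "smor Th = w oc f" "tmor Th = w oc g"
  and b: "be : C2" "smor be = f oc v" "tmor be = g oc v" and o: "sob w = tob f" "tob g = tob f" "sob g = sob f" "tob v = sob f" "tob p = sob v"
  and lift: "as w g v vc (Th hc Bun_id2 v) = (Bun_id2 w hc be) vc as w f v"
 shows "(Bun_id2 w hc (as g v p vc (be hc Bun_id2 p))) vc as w (f oc v) p vc (as w f v hc Bun_id2 p)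
  = as w g (v oc p) vc (Th hc Bun_id2 (v oc p)) vc as (w oc f) v p"
proof -
 note T = c t b o ty
 have 1: "(Bun_id2 w hc (be hc Bun_id2 p)) vc as w (f oc v) p = as w (g oc v) p vc (Bun_id2 w hc be hc Bun_id2 p)"
  using anat[of "Bun_id2 p" be "Bun_id2 w"] by (simp add: T)
 have 2: "(Bun_id2 w hc be hc Bun_id2 p) vc (as w f v hc Bun_id2 p) = (as w g v hc Bun_id2 p) vc (Th hc Bun_id2 v hc Bun_id2 p)"
  using whisker_r[of p "Bun_id2 w hc be" "as w f v"] whisker_r[of p "as w g v" "Th hc Bun_id2 v"] lift by (simp add: T)
 have 3: "as (w oc g) v p vc (Th hc Bun_id2 v hc Bun_id2 p) = (Th hc Bun_id2 (v oc p)) vc as (w oc f) v p"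
  using anat[of "Bun_id2 p" "Bun_id2 v" Th] by (simp add: T hid)
 have 4: "as w g (v oc p) vc as (w oc g) v p = (Bun_id2 w hc as g v p) vc as w (g oc v) p vc (as w g v hc Bun_id2 p)"
  by (rule pent) (simp_all add: T)
 have "(Bun_id2 w hc (as g v p vc (be hc Bun_id2 p))) vc as w (f oc v) p vc (as w f v hc Bun_id2 p)
   = (Bun_id2 w hc as g v p) vc ((Bun_id2 w hc (be hc Bun_id2 p)) vc as w (f oc v) p) vc (as w f v hc Bun_id2 p)"
  by (simp add: T whisker_l vassoc)
 also have "\<dots> = (Bun_id2 w hc as g v p) vc as w (g oc v) p vc ((Bun_id2 w hc be hc Bun_id2 p) vc (as w f v hc Bun_id2 p))"
  unfolding 1 by (simp add: T vassoc)
 also have "\<dots> = ((Bun_id2 w hc as g v p) vc as w (g oc v) p vc (as w g v hc Bun_id2 p)) vc (Th hc Bun_id2 v hc Bun_id2 p)"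
  unfolding 2 by (simp add: T vassoc)
 also have "\<dots> = as w g (v oc p) vc (as (w oc g) v p vc (Th hc Bun_id2 v hc Bun_id2 p))"
  unfolding 4[symmetric] by (rule vassoc) (simp_all add: T)
 finally show ?thesis unfolding 3 .
qed

text \<open>Precomposed with the associators \<open>?A\<close>, both sides become
  \<open>Th hc ep\<close> between associators: for \<open>x\<close> by whiskering the first lift and
  then applying \<open>ep\<close>, for \<open>y\<close> by applying \<open>ep\<close> and then
  whiskering the second. As \<open>?A\<close> is invertible, it cancels.\<close>

lemma lift_comparison:
 assumes c: "w : C1" "f : C1" "g : C1" "v : C1" "p : C1" "v' : C1" "p' : C1"
  and t: "Th : C2" "smor Th = w oc f" "tmor Th = w oc g"
  and b: "be : C2" "smor be = f oc v" "tmor be = g oc v" and b': "be' : C2" "smor be' = f oc v'" "tmor be' = g oc v'"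
  and o: "sob w = tob f" "tob g = tob f" "sob g = sob f" "tob v = sob f" "tob p = sob v" "tob v' = sob f" "tob p' = sob v'" "sob p' = sob p"
  and lift: "as w g v vc (Th hc Bun_id2 v) = (Bun_id2 w hc be) vc as w f v"
  and lift': "as w g v' vc (Th hc Bun_id2 v') = (Bun_id2 w hc be') vc as w f v'"
  and e: "ep : C2" "smor ep = v oc p" "tmor ep = v' oc p'"
  and J: "J : C2" "smor J = f oc (v' oc p')" "tmor J = f oc v' oc p'" "as f v' p' vc J = Bun_id2 (f oc (v' oc p'))"
 defines "x \<equiv> (Bun_id2 g hc ep) vc as g v p vc (be hc Bun_id2 p)"
  and "y \<equiv> as g v' p' vc (be' hc Bun_id2 p') vc J vc (Bun_id2 f hc ep) vc as f v p"
 shows "Bun_id2 w hc x = Bun_id2 w hc y"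
proof -
 note T = c t b b' o e J ty
 let ?A = "as w (f oc v) p vc (as w f v hc Bun_id2 p)" and ?A' = "as w (f oc v') p' vc (as w f v' hc Bun_id2 p')"
 let ?q = "v' oc p'"
 note L = whiskered_lift[OF c(1-5) t b o(1-5) lift]
  and L' = whiskered_lift[OF c(1-3,6,7) t b' o(1-3,6,7) lift']
 have gep: "(Bun_id2 w hc (Bun_id2 g hc ep)) vc as w g (v oc p) = as w g ?q vc (Bun_id2 (w oc g) hc ep)"
  using anat[of ep "Bun_id2 g" "Bun_id2 w"] by (simp add: T hid)
 have fep: "(Bun_id2 w hc (Bun_id2 f hc ep)) vc as w f (v oc p) = as w f ?q vc (Bun_id2 (w oc f) hc ep)"
  using anat[of ep "Bun_id2 f" "Bun_id2 w"] by (simp add: T hid)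
 have i1: "(Bun_id2 (w oc g) hc ep) vc (Th hc Bun_id2 (v oc p)) = Th hc ep"
  using inter[of "Bun_id2 (w oc g)" Th ep "Bun_id2 (v oc p)"] by (simp add: T idl idr)
 have i2: "(Th hc Bun_id2 ?q) vc (Bun_id2 (w oc f) hc ep) = Th hc ep"
  using inter[of Th "Bun_id2 (w oc f)" "Bun_id2 ?q" ep] by (simp add: T idl idr)
 have P: "as w f (v oc p) vc as (w oc f) v p = (Bun_id2 w hc as f v p) vc ?A" by (rule pent) (simp_all add: T)
 have P': "as w f ?q vc as (w oc f) v' p' = (Bun_id2 w hc as f v' p') vc ?A'" by (rule pent) (simp_all add: T)
 have xA: "(Bun_id2 w hc x) vc ?A = as w g ?q vc (Th hc ep) vc as (w oc f) v p"
 proof -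
  have "(Bun_id2 w hc x) vc ?A = (Bun_id2 w hc (Bun_id2 g hc ep)) vc ((Bun_id2 w hc (as g v p vc (be hc Bun_id2 p))) vc ?A)"
   unfolding x_def by (subst whisker_l) (simp_all add: T vassoc)
  also have "\<dots> = ((Bun_id2 w hc (Bun_id2 g hc ep)) vc as w g (v oc p)) vc (Th hc Bun_id2 (v oc p)) vc as (w oc f) v p"
   unfolding L by (rule vassoc[symmetric]) (simp_all add: T)
  also have "\<dots> = as w g ?q vc ((Bun_id2 (w oc g) hc ep) vc (Th hc Bun_id2 (v oc p))) vc as (w oc f) v p"
   unfolding gep by (simp add: T vassoc)
  finally show ?thesis unfolding i1 .
 qed
 obtain D where D: "D : C2" "smor D = (w oc f) oc ?q" "tmor D = w oc f oc v' oc p'" "as (w oc f) v' p' vc D = Bun_id2 ((w oc f) oc ?q)"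
  using inverse_ex[of "as (w oc f) v' p'"] by (simp add: T) blast
 \<comment> \<open>\<open>s\<close> and \<open>r\<close> are \<open>ep\<close> whiskered with
   \<open>w oc f\<close> and with \<open>f\<close>, rebracketed at both ends; \<open>D\<close> and
   \<open>J\<close> are the inverse associators that this takes.\<close>
 define s where "s = D vc (Bun_id2 (w oc f) hc ep) vc as (w oc f) v p"
 define r where "r = J vc (Bun_id2 f hc ep) vc as f v p"
 have s: "s : C2" "smor s = w oc f oc v oc p" "tmor s = w oc f oc v' oc p'" unfolding s_def by (simp_all add: T D)
 have r: "r : C2" "smor r = f oc v oc p" "tmor r = f oc v' oc p'" unfolding r_def by (simp_all add: T)
 have as: "as (w oc f) v' p' vc s = (Bun_id2 (w oc f) hc ep) vc as (w oc f) v p"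
  unfolding s_def using vassoc[of "as (w oc f) v' p'" D "(Bun_id2 (w oc f) hc ep) vc as (w oc f) v p"] by (simp add: T D idl)
 have Kr: "as f v' p' vc r = (Bun_id2 f hc ep) vc as f v p"
  unfolding r_def using vassoc[of "as f v' p'" J "(Bun_id2 f hc ep) vc as f v p"] by (simp add: T idl)
 \<comment> \<open>Composing with an invertible associator from the left removes \<open>J\<close>
   and \<open>D\<close> from both sides and leaves the pentagons and naturality in
   \<open>ep\<close>.\<close>
 have rA: "(Bun_id2 w hc r) vc ?A = ?A' vc s"
 proof (rule lcancel[of "Bun_id2 w hc as f v' p'"])
  have "(Bun_id2 w hc as f v' p') vc ((Bun_id2 w hc r) vc ?A) = (Bun_id2 w hc (as f v' p' vc r)) vc ?A"
   by (simp add: whisker_l vassoc T r)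
  also have "\<dots> = (Bun_id2 w hc (Bun_id2 f hc ep)) vc ((Bun_id2 w hc as f v p) vc ?A)"
   unfolding Kr by (simp add: whisker_l vassoc T)
  also have "\<dots> = ((Bun_id2 w hc (Bun_id2 f hc ep)) vc as w f (v oc p)) vc as (w oc f) v p"
   unfolding P[symmetric] by (rule vassoc[symmetric]) (simp_all add: T)
  also have "\<dots> = as w f ?q vc (as (w oc f) v' p' vc s)"
   unfolding fep as by (rule vassoc) (simp_all add: T)
  also have "\<dots> = (as w f ?q vc as (w oc f) v' p') vc s"
   by (rule vassoc[symmetric]) (simp_all add: T s)
  also have "\<dots> = (Bun_id2 w hc as f v' p') vc (?A' vc s)"
   unfolding P' by (rule vassoc) (simp_all add: T s)
  finally show "(Bun_id2 w hc as f v' p') vc ((Bun_id2 w hc r) vc ?A) = (Bun_id2 w hc as f v' p') vc (?A' vc s)" .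
 qed (simp_all add: T r s)
 have yA: "(Bun_id2 w hc y) vc ?A = as w g ?q vc (Th hc ep) vc as (w oc f) v p"
 proof -
  let ?Y = "as g v' p' vc (be' hc Bun_id2 p')"
  have y: "y = ?Y vc r" unfolding y_def r_def by (simp add: vassoc T)
  have "(Bun_id2 w hc y) vc ?A = (Bun_id2 w hc ?Y) vc ((Bun_id2 w hc r) vc ?A)"
   unfolding y by (subst whisker_l) (simp_all add: vassoc T r)
  also have "\<dots> = ((Bun_id2 w hc ?Y) vc ?A') vc s"
   unfolding rA by (rule vassoc[symmetric]) (simp_all add: T s)
  also have "\<dots> = as w g ?q vc (Th hc Bun_id2 ?q) vc (as (w oc f) v' p' vc s)"
   unfolding L' by (simp add: vassoc T s)
  also have "\<dots> = as w g ?q vc ((Th hc Bun_id2 ?q) vc (Bun_id2 (w oc f) hc ep)) vc as (w oc f) v p"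
   unfolding as by (simp add: vassoc T)
  finally show ?thesis unfolding i2 .
 qed
 have xy: "x : C2" "smor x = f oc v oc p" "y : C2" "smor y = f oc v oc p" unfolding x_def y_def by (simp_all add: T)
 show ?thesis
  by (rule rcancel[of ?A, rotated -1]) (simp_all add: T xA yA xy)
qed

section \<open>Whiskering with an essential equivalence\<close>

lemma W_D: "F : ess_equiv_class al ==> bun_mor al (sob F) (tob F) F"
 "F : ess_equiv_class al ==> essential_equivalence (base (sob F)) (base (tob F)) (fn F)" "F : ess_equiv_class al ==> F : C1"
 using bun_morI[OF n, of F] by (auto simp: ess_equiv_class_def)

lemma W_I: "bun_mor al a b F ==> essential_equivalence (base a) (base b) (fn F) ==> F : ess_equiv_class al"
 unfolding ess_equiv_class_def using bun_mor.mor bun_mor.sob bun_mor.tob by blast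

text \<open>The component of a whiskered 2-cell is the image under \<open>w\<close> of the original
  component times a unit, so the components agree by faithfulness of the functor. Then all terms in
  the formula for \<open>omega\<close> agree except those of \<open>x\<close> and \<open>y\<close>,
  which are therefore equal too.\<close>

lemma whisker_faithful:
 assumes w: "w : ess_equiv_class al" and x: "x : C2" and y: "y : C2" and p: "smor y = smor x" "tmor y = tmor x" "tob (smor x) = sob w"
  and eq: "Bun_id2 w hc x = Bun_id2 w hc y"
 shows "x = y"
proof -
 interpret w: bun_mor al "sob w" "tob w" w by (rule W_D(1)[OF w])
 interpret I: bun_cell al "sob w" "tob w" w w "Bun_id2 w" by (rule w.id2_cell)
 interpret x: bun_cell al "sob (smor x)" "sob w" "smor x" "tmor x" x using bun_cellI[OF n x] p by simp
 interpret y: bun_cell al "sob (smor x)" "sob w" "smor x" "tmor x" y using bun_cellI[OF n y] p by simp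
 interpret X: cell_hpair al "sob (smor x)" "sob w" "tob w" "smor x" "tmor x" w w x "Bun_id2 w" ..
 interpret Y: cell_hpair al "sob (smor x)" "sob w" "tob w" "smor x" "tmor x" w w y "Bun_id2 w" ..
 have fa: "faithful (base (sob w)) (fn w)" using w.ess_equiv_imp[OF W_D(2)[OF w]] by blast
 have t: "tau x z = tau y z" if z: "z : X0 (base (sob (smor x)))" for z
 proof (rule faithfulD[OF fa x.ta_in[OF z] y.ta_in[OF z]])
  have "mu (base (tob w)) (f_ar w (tau x z)) (un (base (tob w)) (f_ob w (f_ob (smor x) z))) = mu (base (tob w)) (f_ar w (tau y z)) (un (base (tob w)) (f_ob w (f_ob (smor x) z)))"
   using arg_cong[OF eq, of "%c. tau c z"] x.F.f0_in[OF z] by (simp add: X.tau_hcomp[OF z] Y.tau_hcomp[OF z] w.tau_id2)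
  then show "f_ar w (tau x z) = f_ar w (tau y z)"
   using z by (simp add: w.B.unit_r' w.f_simps x.ta_simps y.ta_simps)
 qed (use z in \<open>simp_all add: x.ta_simps y.ta_simps\<close>)
 show ?thesis
 proof (rule cell_eqI[OF x.bun_cell_axioms y.bun_cell_axioms t])
  show "omega x z = omega y z" if z: "z : X0 (base (sob (smor x)))" for z
   using arg_cong[OF eq, of "%c. omega c z"] by (simp add: X.omega_hcomp[OF z] Y.omega_hcomp[OF z] t[OF z])
 qed
qed

text \<open>The components of \<open>Th\<close> form a smooth family of arrows between images, which
  lifts by fullness; naturality of the lift is checked after \<open>w\<close>, by faithfulness. The
  value of \<open>omega\<close> is solved from the composition formula, and
  \<open>hcomp_cond_iff\<close> read backwards gives its condition.\<close>

lemma lift_2cell: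
 assumes w: "w : ess_equiv_class al" and f: "bun_mor al a (sob w) f" and g: "bun_mor al a (sob w) g" and T: "bun_cell al a (tob w) (w oc f) (w oc g) Th"
 obtains be where "bun_cell al a (sob w) f g be" "Bun_id2 w hc be = Th"
proof -
 let ?b = "sob w" and ?c = "tob w"
 let ?X = "base a" and ?Y = "base (sob w)" and ?Z = "base (tob w)"
 interpret w: bun_mor al ?b ?c w by (rule W_D(1)[OF w])
 interpret f: bun_mor al a ?b f by (rule f)
 interpret g: bun_mor al a ?b g by (rule g)
 interpret wf: mor_pair al a ?b ?c f w ..
 interpret wg: mor_pair al a ?b ?c g w ..
 interpret T: bun_cell al a ?c "w oc f" "w oc g" Th by (rule T)
 interpret I: bun_cell al ?b ?c w w "Bun_id2 w" by (rule w.id2_cell)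
 have fu: "smoothly_full ?Y ?Z (fn w)" and fa: "faithful ?Y (fn w)" using w.ess_equiv_imp[OF W_D(2)[OF w]] by blast+
 obtain u where u: "smooth (Ob ?X) (Ar ?Y) u" "\<forall>t\<in>X0 ?X. f_ar w (u t) = tau Th t & sr ?Y (u t) = f_ob f t & tg ?Y (u t) = f_ob g t"
  by (rule smoothly_fullE[OF fu f.A.mfd_Ob T.smooth_ta f.smooth0 g.smooth0]) (simp add: T.ta_simps wf.f_comp wg.f_comp)
 define t where "t = restrict u (X0 ?X)"
 have t: "t x : X1 ?Y" "f_ar w (t x) = tau Th x" "sr ?Y (t x) = f_ob f x" "tg ?Y (t x) = f_ob g x" if "x : X0 ?X" for x
  using u(2) that sm_point[OF u(1) that] by (simp_all add: t_def)
 have st: "smooth (Ob ?X) (Ar ?Y) t" by (rule sm_cong[OF f.A.mfd_Ob w.A.mfd_Ar u(1)]) (simp add: t_def)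
 have nat: "smooth_nat_trans ?X ?Y (fn f) (fn g) t"
  unfolding smooth_nat_trans_def
 proof (intro conjI ballI st)
  show "t : extensional (X0 ?X)" by (simp add: t_def)
  show "sr ?Y (t x) = f_ob f x" "tg ?Y (t x) = f_ob g x" if "x : X0 ?X" for x using t[OF that] by simp_all
  fix ph assume ph: "ph : X1 ?X"
  have x: "sr ?X ph : X0 ?X" "tg ?X ph : X0 ?X" using ph by (simp_all add: f.A.gpd_simps)
  note m = t(1)[OF x(1)] t(1)[OF x(2)] f.f1_in[OF ph] g.f1_in[OF ph]
  have e: "sr ?Y (t (tg ?X ph)) = tg ?Y (f_ar f ph)" "sr ?Y (f_ar g ph) = tg ?Y (t (sr ?X ph))"
   using ph x by (simp_all add: t f.f_simps g.f_simps)
  show "mu ?Y (t (tg ?X ph)) (f_ar f ph) = mu ?Y (f_ar g ph) (t (sr ?X ph))"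
  proof (rule faithfulD[OF fa])
   show "f_ar w (mu ?Y (t (tg ?X ph)) (f_ar f ph)) = f_ar w (mu ?Y (f_ar g ph) (t (sr ?X ph)))"
    unfolding w.f_mu[OF m(2,3) e(1)] w.f_mu[OF m(4,1) e(2)] t(2)[OF x(1)] t(2)[OF x(2)]
    using T.ta_nat[OF ph] unfolding wf.f_comp(2)[OF ph] wg.f_comp(2)[OF ph] .
  qed (use m e ph x in \<open>simp_all add: w.A.gpd_simps t f.f_simps g.f_simps\<close>)
 qed
 \<comment> \<open>Cancelling the label of \<open>w\<close> on the left: the square law of
   \<open>w\<close> at the lifted arrow turns the equation for \<open>Th\<close> into one for the
   lift.\<close>
 have hg: "hh g x = rho ?b (t x) + hh f x" if x: "x : X0 ?X" for x
 proof -
  have "hh w (f_ob g x) + hh g x = rho ?c (f_ar w (t x)) + (hh w (f_ob f x) + hh f x)"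
   using T.hh_eq[OF x] t(2)[OF x] wf.hh_comp[OF x] wg.hh_comp[OF x] by simp
  also have "\<dots> = hh w (f_ob g x) + (rho ?b (t x) + hh f x)"
   using w.square[OF t(1)[OF x]] unfolding t(3)[OF x] t(4)[OF x] by (simp add: add.assoc[symmetric])
  finally show ?thesis by (simp only: add_left_cancel)
 qed
 interpret tr: bun_tr al a ?b f g t by unfold_locales (rule nat, rule hg)
 interpret H: tr_hpair al a ?b ?c f g w w t "Bun_id2 w" ..
 \<comment> \<open>The formula of \<open>Bun_hcomp\<close> for whiskering with the identity 2-cell
   of \<open>w\<close>, solved for the inner \<open>omega\<close>; the terms missing here vanish at
   units.\<close>
 define o' where "o' x = omega Th x - eta w (t x) - al (hh w (f_ob g x)) (rho ?b (t x)) (hh f x) + al (rho ?c (f_ar w (t x))) (hh w (f_ob f x)) (hh f x)" for x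
 define be where "be = \<lparr>smor = f, tmor = g, tau = t, omega = restrict o' (X0 ?X)\<rparr>"
 have be[simp]: "smor be = f" "tmor be = g" "tau be = t" "x : X0 ?X ==> omega be x = o' x" for x by (simp_all add: be_def)
 note idw = w.tau_id2 w.omega_id2
 have tv: "tau Th x = mu ?Z (f_ar w (t x)) (tau (Bun_id2 w) (f_ob f x))" if x: "x : X0 ?X" for x
  using t[OF x] f.f0_in[OF x] by (simp add: idw w.B.unit_r' w.f_simps T.ta_simps[OF x] wf.f_comp x)
 have ov: "omega Th x = omega (Bun_id2 w) (f_ob f x) + o' x + eta w (t x)
  + gam ?c (f_ar w (t x), tau (Bun_id2 w) (f_ob f x))
  + al (rho ?c (f_ar w (t x))) (rho ?c (tau (Bun_id2 w) (f_ob f x))) (hh w (f_ob f x) + hh f x)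
  + al (hh w (f_ob g x)) (rho ?b (t x)) (hh f x)
  - al (rho ?c (tau (Bun_id2 w) (f_ob f x))) (hh w (f_ob f x)) (hh f x)
  - al (rho ?c (f_ar w (t x))) (hh w (f_ob f x)) (hh f x)" if x: "x : X0 ?X" for x
 proof -
  have "gam ?c (f_ar w (t x), un ?Z (f_ob w (f_ob f x))) = 0"
   by (rule w.B.gam_un(2)) (use t(1,3)[OF x] in \<open>simp_all add: w.f_simps\<close>)
  then show ?thesis using f.f0_in[OF x] by (simp add: idw w.B.rho_un w.f_simps o'_def)
 qed
 have "bun_cell al a ?b f g be"
 proof (rule bun_cell_intro[OF f g])
  note id = sm_ident[OF f.A.mfd_Ob]
  have "locally_constant (mtop (Ob ?X)) o'"
   unfolding o'_def
   by (intro lc_intros f.A.lc_al T.lc_omega w.lc_eta w.lc_hh f.lc_hh w.A.lc_rho w.B.lc_rho id st w.sm1[OF f.A.mfd_Ob st]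
     f.sm0[OF f.A.mfd_Ob id] g.sm0[OF f.A.mfd_Ob id])
  then show "locally_constant (mtop (Ob ?X)) (omega be)" by (rule continuous_map_eq) simp
  fix ph assume ph: "ph : X1 ?X"
  have x: "sr ?X ph : X0 ?X" "tg ?X ph : X0 ?X" using ph by (simp_all add: f.A.gpd_simps)
  show "omega be (sr ?X ph) - omega be (tg ?X ph) =
   gam ?b (tau be (tg ?X ph), f_ar f ph) - gam ?b (f_ar g ph, tau be (sr ?X ph)) + eta f ph
   + al (rho ?b (tau be (tg ?X ph))) (rho ?b (f_ar f ph)) (hh f (sr ?X ph))
   - al (rho ?b (f_ar g ph)) (rho ?b (tau be (sr ?X ph))) (hh f (sr ?X ph))
   - al (rho ?b (tau be (tg ?X ph))) (hh f (tg ?X ph)) (rho a ph) - eta g ph"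
   unfolding be(3) be(4)[OF x(1)] be(4)[OF x(2)]
   by (rule H.hcomp_cond_iff[THEN iffD1, OF ph tv ov T.cond[OF ph]])
 qed (use tr.ta_nat in \<open>simp_all add: st t hg\<close>, simp_all add: be_def t_def)
 then interpret b: bun_cell al a ?b f g be .
 interpret K: cell_hpair al a ?b ?c f g w w be "Bun_id2 w" ..
 have "Bun_id2 w hc be = Th"
 proof (rule cell_eqI[OF K.hcomp_cell T])
  show "tau (Bun_id2 w hc be) x = tau Th x" if "x : X0 ?X" for x
   unfolding K.tau_hcomp[OF that] be(3) by (rule tv[OF that, symmetric])
  show "omega (Bun_id2 w hc be) x = omega Th x" if "x : X0 ?X" for x
   unfolding K.omega_hcomp[OF that] be(3) be(4)[OF that] by (rule ov[OF that, symmetric])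
 qed
 with b.bun_cell_axioms show thesis by (rule that)
qed

text \<open>An object of the new groupoid is an arrow from some \<open>w x\<close> to some
  \<open>f y\<close>. Its arrows are taken from \<open>Y\<close> alone: with the tautological arrows
  at both ends, such an arrow determines one between the images of \<open>w\<close>, which full
  faithfulness of \<open>w\<close> lifts to \<open>X\<close>.\<close>

lemma weak_fibre_product:
 fixes w f :: "('p, 'g, 'a) mor"
 assumes i: "\<exists>e :: real => 'p. inj e" and w: "w : ess_equiv_class al" and f: "bun_mor al b (tob w) f"
 obtains u v g Th where "v : ess_equiv_class al" "bun_mor al u b v" "bun_mor al u (sob w) g" "bun_cell al u (tob w) (w oc g) (f oc v) Th"
proof -
 let ?a = "sob w" and ?c = "tob w"
 let ?X = "base (sob w)" and ?Y = "base b" and ?Z = "base (tob w)"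
 interpret w: bun_mor al ?a ?c w by (rule W_D(1)[OF w])
 interpret f: bun_mor al b ?c f by (rule f)
 have wl: "lifts_locally ?X ?Z (fn w)" and we: "ess_surjective ?X ?Z (fn w)" and wf: "smoothly_full ?X ?Z (fn w)" and wa: "faithful ?X (fn w)"
  using w.ess_equiv_imp[OF W_D(2)[OF w]] by blast+
 obtain c :: "'p \<times> 'p \<times> 'p => 'p" where c: "inj c" by (rule infinite_triple_inj[OF i])
 let ?P = "w.arrows_from_image"
 note fibP = w.arrows_from_image_rules
 note mP = manifold_fibre[OF fibP] and pP = points_fibre[OF fibP] and prP = smooth_fibre_proj[OF fibP]
 note sP = w.arrows_from_image_submersion[OF wl]
 \<comment> \<open>The manifold of objects must have its points in \<open>'p\<close>, so
   \<open>((ph, x), y)\<close> is stored as \<open>c (ph, x, y)\<close> and read back by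
   \<open>q\<close>.\<close>
 define q where "q p = ((fst (inv c p), fst (snd (inv c p))), snd (snd (inv c p)))" for p
 have q: "q (c (ph, x, y)) = ((ph, x), y)" for ph x y by (simp add: q_def inv_f_f[OF c])
 define S where "S = (%((ph, x), y). c (ph, x, y)) ` {(p, y). p : points ?P & y : X0 ?Y & tg ?Z (fst p) = f_ob f y}"
 have qS: "inj_on q S" "q ` S = {(p, y). p : points ?P & y : X0 ?Y & tg ?Z (fst p) = f_ob f y}"
 proof -
  have "q ((%((ph, x), y). c (ph, x, y)) z) = z" for z by (cases z) (simp add: q split_beta)
  then show "inj_on q S" "q ` S = {(p, y). p : points ?P & y : X0 ?Y & tg ?Z (fst p) = f_ob f y}"
   unfolding S_def image_image by (auto intro!: inj_onI)
 qed
 note fibU = mP w.B.mfd_Ob f.A.mfd_Ob sP f.smooth0 qS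
 define M where "M = fibre_mfd S q ?P (Ob ?Z) (Ob ?Y)"
 note mM = manifold_fibre[OF fibU, folded M_def] and pM = points_fibre[OF fibU, folded M_def]
  and prM = smooth_fibre_proj[OF fibU, folded M_def] and sM = fibre_snd_submersion[OF fibU, folded M_def]
 let ?v = "%p. snd (q p)" and ?g = "%p. snd (fst (q p))" and ?t = "%p. fst (fst (q p))"
 have M: "?v p : X0 ?Y" "?g p : X0 ?X" "?t p : X1 ?Z" "sr ?Z (?t p) = f_ob w (?g p)" "tg ?Z (?t p) = f_ob f (?v p)" if "p : points M" for p
 proof -
  have "q p : q ` S" using that unfolding pM by blast
  then show "?v p : X0 ?Y" "?g p : X0 ?X" "?t p : X1 ?Z" "sr ?Z (?t p) = f_ob w (?g p)" "tg ?Z (?t p) = f_ob f (?v p)"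
   unfolding qS(2) pP by auto
 qed
 \<comment> \<open>Over \<open>y\<close> there is a point because \<open>w\<close> is essentially
   surjective at \<open>f_ob f y\<close>.\<close>
 have onto: "?v ` points M = X0 ?Y"
 proof
  show "?v ` points M <= X0 ?Y" using M(1) by blast
  show "X0 ?Y <= ?v ` points M"
  proof
   fix y assume y: "y : X0 ?Y"
   obtain ph x where ph: "ph : X1 ?Z" "x : X0 ?X" "sr ?Z ph = f_ob w x" "tg ?Z ph = f_ob f y"
    using we f.f0_in[OF y] unfolding ess_surjective_def by blast
   then have "((ph, x), y) : q ` S" using y unfolding qS(2) pP by simp
   then obtain s where s: "s : S" "q s = ((ph, x), y)" by (metis imageE)
   then have "?v s = y" by simp
   then show "y : ?v ` points M" unfolding pM using s(1) by blast
  qed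
 qed
 have sg: "smooth M (Ob ?X) ?g" by (rule sm_compose'[OF mM mP w.A.mfd_Ob prM(1) prP(2)])
 have stt: "smooth M (Ar ?Z) ?t" by (rule sm_compose'[OF mM mP w.B.mfd_Ar prM(1) prP(1)])
 interpret BC: base_change ?Y M ?v c by unfold_locales (rule mM, rule sM, rule onto, rule c)
 let ?U = "BC.U"
 interpret v: smooth_fctr ?U ?Y BC.proj by (rule smooth_fctrI[OF BC.lie_U f.A.lie BC.smooth_functor_proj])
 obtain u V where u: "base u = ?U" and V: "bun_mor al u b V" and fV: "fn V = BC.proj"
  by (rule pull_mor_exists[OF f.A.bun_gpd_axioms v.smooth_fctr_axioms])
 have VW: "V : ess_equiv_class al" by (rule W_I[OF V]) (unfold u fV, rule BC.ess_equiv_proj)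
 interpret V: bun_mor al u b V by (rule V)
 interpret fV: mor_pair al u b ?c V f ..
 interpret F: bun_mor al u ?c "f oc V" by (rule fV.comp_mor)
 have ObU: "Ob ?U = M" and pU: "X0 ?U = points M" by simp_all
 have v0: "x : X0 ?U ==> fst BC.proj x = ?v x" for x by simp
 have ends: "ph : X1 ?U ==> sr ?U ph : points M" "ph : X1 ?U ==> tg ?U ph : points M" for ph
  using v.dom.sr_in[of ph] v.dom.tg_in[of ph] by simp_all
 \<comment> \<open>The image under \<open>w\<close> that the arrow \<open>g\<close> assigns to
   \<open>ph\<close> must have, if the tautological arrows \<open>?t\<close> are to be
   natural.\<close>
 define k where "k ph = mu ?Z (iv ?Z (?t (tg ?U ph))) (mu ?Z (f_ar f (snd BC.proj ph)) (?t (sr ?U ph)))" for ph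
 have fp: "f_ar f (snd BC.proj ph) : X1 ?Z" "sr ?Z (f_ar f (snd BC.proj ph)) = f_ob f (?v (sr ?U ph))" "tg ?Z (f_ar f (snd BC.proj ph)) = f_ob f (?v (tg ?U ph))"
  if "ph : X1 ?U" for ph
  using f.f1_in[OF v.f1_in[OF that]] f.f_sr[OF v.f1_in[OF that]] f.f_tg[OF v.f1_in[OF that]] v.f_sr[OF that] v.f_tg[OF that]
   BC.proj_simps(1)[OF ends(1)[OF that]] BC.proj_simps(1)[OF ends(2)[OF that]] by simp_all
 have kt: "mu ?Z (?t (tg ?U ph)) (k ph) = mu ?Z (f_ar f (snd BC.proj ph)) (?t (sr ?U ph))" "k ph : X1 ?Z"
  "sr ?Z (k ph) = f_ob w (?g (sr ?U ph))" "tg ?Z (k ph) = f_ob w (?g (tg ?U ph))" if ph: "ph : X1 ?U" for ph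
 proof -
  note m = M[OF ends(1)[OF ph]] M[OF ends(2)[OF ph]] fp[OF ph]
  have 1: "mu ?Z (f_ar f (snd BC.proj ph)) (?t (sr ?U ph)) : X1 ?Z" "tg ?Z (mu ?Z (f_ar f (snd BC.proj ph)) (?t (sr ?U ph))) = f_ob f (?v (tg ?U ph))"
   "sr ?Z (mu ?Z (f_ar f (snd BC.proj ph)) (?t (sr ?U ph))) = f_ob w (?g (sr ?U ph))"
   using m by (simp_all only: w.B.gpd_simps)
  show "mu ?Z (?t (tg ?U ph)) (k ph) = mu ?Z (f_ar f (snd BC.proj ph)) (?t (sr ?U ph))"
   unfolding k_def by (rule w.B.cancel_iv2[OF m(8) 1(1)]) (simp only: m 1)
  have 2: "sr ?Z (iv ?Z (?t (tg ?U ph))) = tg ?Z (mu ?Z (f_ar f (snd BC.proj ph)) (?t (sr ?U ph)))"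
   using w.B.sr_iv[OF m(8)] m(10) 1(2) by (simp only:)
  show "k ph : X1 ?Z" unfolding k_def by (rule w.B.mu_in[OF w.B.iv_in[OF m(8)] 1(1) 2])
  show "sr ?Z (k ph) = f_ob w (?g (sr ?U ph))" unfolding k_def w.B.sr_mu[OF w.B.iv_in[OF m(8)] 1(1) 2] by (rule 1(3))
  show "tg ?Z (k ph) = f_ob w (?g (tg ?U ph))" unfolding k_def w.B.tg_mu[OF w.B.iv_in[OF m(8)] 1(1) 2] w.B.tg_iv[OF m(8)] by (rule m(9))
 qed
 have mU: "manifold (Ar ?U)" by (rule v.dom.mfd_Ar)
 have ss: "smooth (Ar ?U) M (sr ?U)" "smooth (Ar ?U) M (tg ?U)" using v.dom.smooth_sr v.dom.smooth_tg by simp_all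
 have sf: "smooth (Ar ?U) (Ar ?Z) (%ph. f_ar f (snd BC.proj ph))" by (rule f.sm1[OF mU v.smooth1])
 have s1: "smooth (Ar ?U) (Ar ?Z) (%ph. mu ?Z (f_ar f (snd BC.proj ph)) (?t (sr ?U ph)))"
  by (rule w.B.smooth_mu'[OF mU sf sm_compose'[OF mU mM w.B.mfd_Ar ss(1) stt]]) (simp only: fp M ends)
 have s2: "smooth (Ar ?U) (Ar ?Z) (%ph. iv ?Z (?t (tg ?U ph)))"
  by (rule sm_compose'[OF mU w.B.mfd_Ar w.B.mfd_Ar sm_compose'[OF mU mM w.B.mfd_Ar ss(2) stt] w.B.smooth_iv])
 have sk: "smooth (Ar ?U) (Ar ?Z) k"
  unfolding k_def by (rule w.B.smooth_mu'[OF mU s2 s1]) (simp only: fp M ends w.B.gpd_simps)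
 obtain g1 where g1: "smooth (Ar ?U) (Ar ?X) g1" "\<forall>ph\<in>X1 ?U. f_ar w (g1 ph) = k ph & sr ?X (g1 ph) = ?g (sr ?U ph) & tg ?X (g1 ph) = ?g (tg ?U ph)"
  by (rule smoothly_fullE[OF wf mU sk sm_compose'[OF mU mM w.A.mfd_Ob ss(1) sg] sm_compose'[OF mU mM w.A.mfd_Ob ss(2) sg]])
   (simp only: kt)
 have g1': "f_ar w (g1 ph) = k ph" "sr ?X (g1 ph) = ?g (sr ?U ph)" "tg ?X (g1 ph) = ?g (tg ?U ph)" "g1 ph : X1 ?X" if "ph : X1 ?U" for ph
  using g1(2) that sm_point[OF g1(1) that] by blast+
 define g where "g = (\<lambda>x\<in>points M. ?g x, \<lambda>ph\<in>X1 ?U. g1 ph)"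
 have g: "x : points M ==> fst g x = ?g x" "ph : X1 ?U ==> snd g ph = g1 ph" for x ph by (simp_all add: g_def)
 have gf: "smooth_functor ?U ?X g"
 proof (rule smooth_functorI)
  show "fst g : extensional (X0 ?U)" "snd g : extensional (X1 ?U)" by (simp_all add: g_def)
  show "smooth (Ob ?U) (Ob ?X) (fst g)" unfolding ObU by (rule sm_cong[OF mM w.A.mfd_Ob sg]) (rule g[symmetric])
  show "smooth (Ar ?U) (Ar ?X) (snd g)" by (rule sm_cong[OF mU w.A.mfd_Ar g1(1)]) (rule g[symmetric])
  show "sr ?X (snd g ph) = fst g (sr ?U ph)" "tg ?X (snd g ph) = fst g (tg ?U ph)" if "ph : X1 ?U" for ph
   unfolding g(2)[OF that] g(1)[OF ends(1)[OF that]] g(1)[OF ends(2)[OF that]] by (rule g1'[OF that])+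
  \<comment> \<open>Functoriality of \<open>g\<close> is tested after applying \<open>w\<close>, by
    faithfulness, and after composing with a tautological arrow, which cancels. The same holds for
    products below.\<close>
  show "snd g (un ?U x) = un ?X (fst g x)" if x: "x : X0 ?U" for x
  proof -
   have xM: "x : points M" using x by simp
   note m = M[OF xM] and un = v.dom.un_in[OF x] v.dom.sr_un[OF x] v.dom.tg_un[OF x]
   have "snd BC.proj (un ?U x) = un ?Y (?v x)" using v.f_un[OF x] v0[OF x] by (simp only:)
   then have kk: "mu ?Z (?t x) (k (un ?U x)) = mu ?Z (?t x) (un ?Z (f_ob w (?g x)))"
    using kt(1)[OF un(1)] m f.f_un[OF m(1)] un(2,3) w.B.unit_l'[OF m(3), of "f_ob f (?v x)"] w.B.unit_r'[OF m(3), of "f_ob w (?g x)"]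
    by (simp only:)
   have "k (un ?U x) = un ?Z (f_ob w (?g x))"
    by (rule w.B.cancel_l[OF m(3) kt(2)[OF un(1)] _ _ _ kk])
     (use m un kt(4)[OF un(1)] w.f0_in[OF m(2)] in \<open>simp_all only: w.B.gpd_simps\<close>)
   then have "f_ar w (g1 (un ?U x)) = f_ar w (un ?X (?g x))" unfolding g1'(1)[OF un(1)] w.f_un[OF m(2)] .
   then have "g1 (un ?U x) = un ?X (?g x)"
    by (rule faithfulD[OF wa g1'(4)[OF un(1)] w.A.un_in[OF m(2)], rotated -1])
     (simp_all only: g1'(2,3)[OF un(1)] un(2,3) w.A.sr_un[OF m(2)] w.A.tg_un[OF m(2)])
   then show ?thesis unfolding g(2)[OF un(1)] g(1)[OF xM] .
  qed
  fix ph pp assume ph: "ph : X1 ?U" and pp: "pp : X1 ?U" and st: "sr ?U ph = tg ?U pp"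
  let ?m = "mu ?U ph pp"
  have m: "?m : X1 ?U" "sr ?U ?m = sr ?U pp" "tg ?U ?m = tg ?U ph"
   by (rule v.dom.mu_in[OF ph pp st] v.dom.sr_mu[OF ph pp st] v.dom.tg_mu[OF ph pp st])+
  note M1 = M[OF ends(1)[OF pp]] and M2 = M[OF ends(2)[OF pp]] and M3 = M[OF ends(2)[OF ph]]
  note kph = kt[OF ph, unfolded st] and kpp = kt[OF pp] and km = kt[OF m(1), unfolded m]
  note fph = fp[OF ph, unfolded st] and fpp = fp[OF pp]
  let ?fa = "f_ar f (snd BC.proj ph)" and ?fb = "f_ar f (snd BC.proj pp)"
  have e: "sr ?Y (snd BC.proj ph) = tg ?Y (snd BC.proj pp)" using v.f_sr[OF ph] v.f_tg[OF pp] st by (simp only:)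
  have fm: "f_ar f (snd BC.proj ?m) = mu ?Z ?fa ?fb"
   unfolding v.f_mu[OF ph pp st] by (rule f.f_mu[OF v.f1_in[OF ph] v.f1_in[OF pp] e])
  have "mu ?Z (?t (tg ?U ph)) (mu ?Z (k ph) (k pp)) = mu ?Z (mu ?Z (?t (tg ?U ph)) (k ph)) (k pp)"
   by (rule w.B.mu_assoc[symmetric]) (simp_all only: M3 kph kpp)
  also have "\<dots> = mu ?Z ?fa (mu ?Z (?t (tg ?U pp)) (k pp))"
   unfolding kph(1) by (rule w.B.mu_assoc) (simp_all only: M2 fph kpp)
  also have "\<dots> = mu ?Z (mu ?Z ?fa ?fb) (?t (sr ?U pp))"
   unfolding kpp(1) by (rule w.B.mu_assoc[symmetric]) (simp_all only: M1 fph fpp)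
  also have "\<dots> = mu ?Z (?t (tg ?U ph)) (k ?m)" unfolding km(1) fm ..
  finally have kk: "mu ?Z (?t (tg ?U ph)) (k ?m) = mu ?Z (?t (tg ?U ph)) (mu ?Z (k ph) (k pp))" ..
  have ck: "sr ?Z (k ph) = tg ?Z (k pp)" by (simp only: kph kpp)
  have km': "k ?m = mu ?Z (k ph) (k pp)"
   by (rule w.B.cancel_l[OF M3(3) km(2) w.B.mu_in[OF kph(2) kpp(2) ck] _ _ kk])
    (simp_all only: M3 km w.B.tg_mu[OF kph(2) kpp(2) ck] kph)
  have gs: "sr ?X (g1 ph) = tg ?X (g1 pp)" using g1'(2)[OF ph] g1'(3)[OF pp] st by (simp only:)
  have "f_ar w (g1 ?m) = f_ar w (mu ?X (g1 ph) (g1 pp))"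
   unfolding w.f_mu[OF g1'(4)[OF ph] g1'(4)[OF pp] gs] g1'(1)[OF ph] g1'(1)[OF pp] g1'(1)[OF m(1)] by (rule km')
  then have "g1 ?m = mu ?X (g1 ph) (g1 pp)"
   by (rule faithfulD[OF wa g1'(4)[OF m(1)] w.A.mu_in[OF g1'(4)[OF ph] g1'(4)[OF pp] gs], rotated -1])
    (simp_all only: w.A.sr_mu[OF g1'(4)[OF ph] g1'(4)[OF pp] gs] w.A.tg_mu[OF g1'(4)[OF ph] g1'(4)[OF pp] gs] g1'(2,3)[OF ph] g1'(2,3)[OF pp] g1'(2,3)[OF m(1)] m)
  then show "snd g ?m = mu ?X (snd g ph) (snd g pp)" unfolding g(2)[OF ph] g(2)[OF pp] g(2)[OF m(1)] .
 qed
 have nat: "smooth_nat_trans ?U ?Z (comp_functor ?U (fn w) g) (fn (f oc V)) (restrict ?t (points M))"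
  unfolding smooth_nat_trans_def
 proof (intro conjI ballI)
  show "restrict ?t (points M) : extensional (X0 ?U)" by simp
  show "smooth (Ob ?U) (Ar ?Z) (restrict ?t (points M))" unfolding ObU by (rule sm_cong[OF mM w.B.mfd_Ar stt]) simp
  show "sr ?Z (restrict ?t (points M) x) = fst (comp_functor ?U (fn w) g) x" "tg ?Z (restrict ?t (points M) x) = f_ob (f oc V) x" if "x : X0 ?U" for x
   using M[of x] that fV.f_comp(1)[of x] v0[OF that] u fV by (simp_all add: g)
  fix ph assume ph: "ph : X1 ?U"
  have "f_ar (f oc V) ph = f_ar f (snd BC.proj ph)" using fV.f_comp(2)[of ph] ph unfolding u fV by blast
  then show "mu ?Z (restrict ?t (points M) (tg ?U ph)) (snd (comp_functor ?U (fn w) g) ph) = mu ?Z (f_ar (f oc V) ph) (restrict ?t (points M) (sr ?U ph))"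
   unfolding comp_functor_simps(2)[OF ph] g(2)[OF ph] g1'(1)[OF ph] restrict_apply'[OF ends(1)[OF ph]] restrict_apply'[OF ends(2)[OF ph]]
   using kt(1)[OF ph] by (simp only:)
 qed
 obtain G Th where "bun_mor al u ?a G" "bun_cell al u ?c (w oc G) (f oc V) Th"
  by (rule transport_mor[OF W_D(1)[OF w] fV.comp_mor, unfolded u, OF gf nat])
 then show thesis by (rule that[OF VW V])
qed

text \<open>The transformations in the two invertible 2-cells relate the composites of the
  underlying functors to the identities, so these functors are quasi-inverse to each other.\<close>

lemma equivalence_ess_equiv: "equivalence_1cell B F ==> F : ess_equiv_class al"
proof -
 assume "equivalence_1cell B F"
 then obtain G Th Xi where F: "F : C1" and G: "is_1cell B G (tob F) (sob F)" and T: "is_2cell B Th (G oc F) (Bun_id1 (sob F))"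
  and X: "is_2cell B Xi (F oc G) (Bun_id1 (tob F))"
  unfolding equivalence_1cell_def isomorphic_1cells_def iso_2cell_def sel by blast
 interpret F: bun_mor al "sob F" "tob F" F by (rule bun_morI[OF n F refl refl])
 interpret G: bun_mor al "tob F" "sob F" G using G is_1cell_iff[OF n] by blast
 interpret GF: mor_pair al "sob F" "tob F" "sob F" F G ..
 interpret FG: mor_pair al "tob F" "sob F" "tob F" G F ..
 interpret T: bun_cell al "sob F" "sob F" "G oc F" "Bun_id1 (sob F)" Th using is_2cellD[OF n T] by (simp add: G.tob)
 interpret X: bun_cell al "tob F" "tob F" "F oc G" "Bun_id1 (tob F)" Xi using is_2cellD[OF n X] by (simp add: G.sob)
 have id: "fn (Bun_id1 a) = id_functor (base a)" for a :: "('p, 'g, 'a) obj" by (simp add: Bun_id1_def)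
 show ?thesis
  by (rule W_I[OF F.bun_mor_axioms quasi_inverse_ess_equiv[OF F.smooth_fctr_axioms G.smooth_fctr_axioms
     T.nat[unfolded GF.fn_comp id] X.nat[unfolded FG.fn_comp id]]])
qed

end

theorem theorem4p7:
  fixes \<alpha> :: "'g::group_add \<Rightarrow> 'g \<Rightarrow> 'g \<Rightarrow> 'a::ab_group_add"
  assumes "normalized_3cocycle \<alpha>"
    and "\<exists>e :: real \<Rightarrow> 'p. inj e"
  shows "right_fractions
    (Bun_pre \<alpha> :: (('p, 'g, 'a) obj, ('p, 'g, 'a) mor, ('p, 'g, 'a) cell) bicat)
    (ess_equiv_class \<alpha>)"
proof -
 note n = assms(1)
 let ?B = "Bun_pre \<alpha> :: (('p, 'g, 'a) obj, ('p, 'g, 'a) mor, ('p, 'g, 'a) cell) bicat"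
 let ?W = "ess_equiv_class \<alpha> :: ('p, 'g, 'a) mor set"
 note sel = Bun_sel[OF n] and cell_in = bun_cell.cell bun_cell.smor bun_cell.tmor
 have BF2: "cmp \<alpha> G F : ?W" if F: "F : ?W" and G: "G : ?W" and m: "tob F = sob G" for F G
 proof -
  interpret F: bun_mor \<alpha> "sob F" "sob G" F using W_D(1)[OF n F] m by simp
  interpret G: bun_mor \<alpha> "sob G" "tob G" G by (rule W_D(1)[OF n G])
  interpret P: mor_pair \<alpha> "sob F" "sob G" "tob G" F G ..
  show ?thesis
   by (rule W_I[OF n P.comp_mor], unfold P.fn_comp, rule ess_equiv_comp[OF F.smooth_fctr_axioms G.smooth_fctr_axioms])
    (use W_D(2)[OF n F] W_D(2)[OF n G] m in simp_all)
 qed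
 have BF5: "F : ?W" if G: "G : ?W" and c: "bun_cell \<alpha> a b F G \<Theta>" for F G a b \<Theta>
 proof -
  interpret bun_cell \<alpha> a b F G \<Theta> by (rule c)
  show ?thesis using W_I[OF n F.bun_mor_axioms ess_equiv_iso] W_D(2)[OF n G] G.sob G.tob by simp
 qed
 show ?thesis
 proof (intro right_fractions.intro right_fractions_axioms.intro bicategory_Bun[OF n], unfold sel)
  show "?W <= Bun_cells1 \<alpha>" using W_D(3)[OF n] by blast
  show "F : ?W" if "equivalence_1cell ?B F" for F by (rule equivalence_ess_equiv[OF n that])
  show "cmp \<alpha> G F : ?W" if "F : ?W" "G : ?W" "tob F = sob G" for F G by (rule BF2[OF that])
  show "F : ?W" if "G : ?W" "isomorphic_1cells ?B F G" for F G
   using BF5[OF that(1) is_2cellD[OF n]] that(2) unfolding isomorphic_1cells_def iso_2cell_def by blast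
  show "\<exists>u v g. v : ?W & is_1cell ?B v u y & is_1cell ?B g u x & isomorphic_1cells ?B (cmp \<alpha> w g) (cmp \<alpha> f v)"
   if w: "w : ?W" and wx: "is_1cell ?B w x z" and f: "is_1cell ?B f y z" for w x z f y
  proof -
   have xz: "x = sob w" "z = tob w" using wx by (simp_all add: is_1cell_def sel)
   obtain u v g \<Theta> where "v : ?W" "bun_mor \<alpha> u y v" "bun_mor \<alpha> u (sob w) g" "bun_cell \<alpha> u (tob w) (cmp \<alpha> w g) (cmp \<alpha> f v) \<Theta>"
    by (rule weak_fibre_product[OF n assms(2) w f[unfolded xz is_1cell_iff[OF n]]]) (rule that; assumption)
   then show ?thesis unfolding is_1cell_iff[OF n] isomorphic_1cells_def xz using iso_2cellI[OF n] by blast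
  qed
  show "\<exists>v \<beta>. BF4_lift ?B ?W w f g \<Theta> v \<beta>"
   if w: "w : ?W" and wy: "is_1cell ?B w y z" and f: "is_1cell ?B f x y" and g: "is_1cell ?B g x y"
    and T: "is_2cell ?B \<Theta> (cmp \<alpha> w f) (cmp \<alpha> w g)" for w y z f x g \<Theta>
  proof -
   have yz: "y = sob w" "z = tob w" using wy by (simp_all add: is_1cell_def sel)
   interpret w: bun_mor \<alpha> "sob w" "tob w" w by (rule W_D(1)[OF n w])
   interpret f: bun_mor \<alpha> x "sob w" f using f yz is_1cell_iff[OF n] by blast
   interpret g: bun_mor \<alpha> x "sob w" g using g yz is_1cell_iff[OF n] by blast
   interpret wf: mor_pair \<alpha> x "sob w" "tob w" f w ..
   interpret wg: mor_pair \<alpha> x "sob w" "tob w" g w ..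
   interpret T: bun_cell \<alpha> x "tob w" "cmp \<alpha> w f" "cmp \<alpha> w g" \<Theta> using is_2cellD[OF n T] wf.sob_comp wf.tob_comp by simp
   obtain \<beta> where b: "bun_cell \<alpha> x (sob w) f g \<beta>" "hcmp \<alpha> (Bun_id2 w) \<beta> = \<Theta>"
    by (rule lift_2cell[OF n w f.bun_mor_axioms g.bun_mor_axioms T.bun_cell_axioms])
   \<comment> \<open>With an identity as the innermost factor \<open>al\<close> vanishes, so the
     associators in the equation of (BF4) are identity 2-cells, and it reduces to the equation for
     the lift \<open>\<beta>\<close>.\<close>
   have id: "asc \<alpha> w h (Bun_id1 x) = Bun_id2 (cmp \<alpha> w h)" if h: "bun_mor \<alpha> x (sob w) h" for h
   proof -
    interpret h: bun_mor \<alpha> x "sob w" h by (rule h)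
    interpret I: bun_mor \<alpha> x x "Bun_id1 x" by (rule f.A.id1_mor)
    interpret A: mor_triple \<alpha> x x "sob w" "tob w" "Bun_id1 x" h w ..
    note C = A.GH.comp_mor
    show ?thesis
     by (rule cell_eqI[OF A.assoc_cell[unfolded bun_mor.comp_id1[OF C] h.comp_id1] bun_mor.id2_cell[OF C]])
      (simp_all add: A.tau_assoc A.omega_assoc bun_mor.tau_id2[OF C] bun_mor.omega_id2[OF C] A.GH.f_comp, simp_all add: Bun_id1_def)
   qed
   have idW: "Bun_id1 x : ?W"
   proof (rule equivalence_ess_equiv[OF n])
    interpret I: bun_mor \<alpha> x x "Bun_id1 x" by (rule f.A.id1_mor)
    have "isomorphic_1cells ?B (cmp \<alpha> (Bun_id1 x) (Bun_id1 x)) (Bun_id1 x)"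
     unfolding I.id1_comp isomorphic_1cells_def using iso_2cellI[OF n I.id2_cell] by blast
    then show "equivalence_1cell ?B (Bun_id1 x)"
     unfolding equivalence_1cell_def is_1cell_iff[OF n] sel I.sob I.tob using I.mor I.bun_mor_axioms by blast
   qed
   interpret I: bun_mor \<alpha> x x "Bun_id1 x" by (rule f.A.id1_mor)
   have iso: "iso_2cell ?B \<beta> f g" by (rule iso_2cellI[OF n b(1)])
   have "BF4_lift ?B ?W w f g \<Theta> (Bun_id1 x) \<beta>"
    unfolding BF4_lift_def sel f.comp_id1 g.comp_id1 I.sob f.sob id[OF f.bun_mor_axioms] id[OF g.bun_mor_axioms] T.hcomp_id1 b(2)
     T.vcomp_id2 T.id2_vcomp is_1cell_iff[OF n]
    using idW I.bun_mor_axioms is_2cellI[OF n b(1)] iso by blast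
   then show ?thesis by blast
  qed
  show "BF4_comparison ?B ?W f g v \<beta> v' \<beta>'"
   if w: "w : ?W" and wy: "is_1cell ?B w y z" and f: "is_1cell ?B f x y" and g: "is_1cell ?B g x y"
    and T: "is_2cell ?B \<Theta> (cmp \<alpha> w f) (cmp \<alpha> w g)"
    and l: "BF4_lift ?B ?W w f g \<Theta> v \<beta>" and l': "BF4_lift ?B ?W w f g \<Theta> v' \<beta>'" for w y z f x g \<Theta> v \<beta> v' \<beta>'
  proof -
   note d = is_1cell_def is_2cell_def sel
   have fg: "f : Bun_cells1 \<alpha>" "g : Bun_cells1 \<alpha>" "w : Bun_cells1 \<alpha>" "sob f = x" "tob f = y" "sob g = x" "tob g = y" "sob w = y" "tob w = z"
    using wy f g by (simp_all add: d)
   have t: "\<Theta> : Bun_cells2 \<alpha>" "smor \<Theta> = cmp \<alpha> w f" "tmor \<Theta> = cmp \<alpha> w g" using T by (simp_all add: d)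
   have v: "v : ?W" "tob v = x" "\<beta> : Bun_cells2 \<alpha>" "smor \<beta> = cmp \<alpha> f v" "tmor \<beta> = cmp \<alpha> g v"
    "vcmp \<alpha> (asc \<alpha> w g v) (hcmp \<alpha> \<Theta> (Bun_id2 v)) = vcmp \<alpha> (hcmp \<alpha> (Bun_id2 w) \<beta>) (asc \<alpha> w f v)"
    using l fg unfolding BF4_lift_def d by simp_all
   have v': "v' : ?W" "tob v' = x" "\<beta>' : Bun_cells2 \<alpha>" "smor \<beta>' = cmp \<alpha> f v'" "tmor \<beta>' = cmp \<alpha> g v'"
    "vcmp \<alpha> (asc \<alpha> w g v') (hcmp \<alpha> \<Theta> (Bun_id2 v')) = vcmp \<alpha> (hcmp \<alpha> (Bun_id2 w) \<beta>') (asc \<alpha> w f v')"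
    using l' fg unfolding BF4_lift_def d by simp_all
   have vm: "bun_mor \<alpha> (sob v') (tob v) v'" using W_D(1)[OF n v'(1)] v(2) v'(2) by simp
   \<comment> \<open>(BF3) for \<open>v\<close> and \<open>v'\<close>. It puts \<open>p'\<close>
     into the class, so (BF2) does the same for the composite of \<open>v'\<close> and
     \<open>p'\<close>; the composite of \<open>v\<close> and \<open>p\<close> follows by (BF5)
     along \<open>E\<close>.\<close>
   obtain s p p' E where p: "p' : ?W" "bun_mor \<alpha> s (sob v') p'" "bun_mor \<alpha> s (sob v) p" and E: "bun_cell \<alpha> s (tob v) (cmp \<alpha> v p) (cmp \<alpha> v' p') E"
    by (rule weak_fibre_product[OF n assms(2) v(1) vm])
   note pm = bun_mor.mor[OF p(3)] bun_mor.sob[OF p(3)] bun_mor.tob[OF p(3)] and pm' = bun_mor.mor[OF p(2)] bun_mor.sob[OF p(2)] bun_mor.tob[OF p(2)]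
   have c1: "v : Bun_cells1 \<alpha>" "v' : Bun_cells1 \<alpha>" using W_D(3)[OF n] v(1) v'(1) by blast+
   have v'p': "cmp \<alpha> v' p' : ?W" by (rule BF2[OF p(1) v'(1) pm'(3)])
   have vp: "cmp \<alpha> v p : ?W" by (rule BF5[OF v'p' E])
   let ?A = "asc \<alpha> f v' p'"
   have A: "?A : Bun_cells2 \<alpha>" by (rule A_in[OF n pm'(1) c1(2) fg(1) pm'(3)]) (simp add: v' fg)
   \<comment> \<open>The inverse in the definition of the comparison is a definite description. What
     is used of it is its boundary and that it inverts the associator from the right.\<close>
   have J: "inverse_2cells ?B ?A (inv_2cell ?B ?A)" by (rule inv_2cell_eq[OF n bun_cellI[OF n A]])
   let ?J = "inv_2cell ?B ?A"
   have J': "?J : Bun_cells2 \<alpha>" "smor ?J = cmp \<alpha> f (cmp \<alpha> v' p')" "tmor ?J = cmp \<alpha> (cmp \<alpha> f v') p'"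
    "vcmp \<alpha> ?A ?J = Bun_id2 (cmp \<alpha> f (cmp \<alpha> v' p'))"
    using J unfolding inverse_2cells_def d by (simp_all add: ends[OF n])
   let ?x = "vcmp \<alpha> (hcmp \<alpha> (Bun_id2 g) E) (vcmp \<alpha> (asc \<alpha> g v p) (hcmp \<alpha> \<beta> (Bun_id2 p)))"
   let ?y = "vcmp \<alpha> (asc \<alpha> g v' p') (vcmp \<alpha> (hcmp \<alpha> \<beta>' (Bun_id2 p'))
    (vcmp \<alpha> ?J (vcmp \<alpha> (hcmp \<alpha> (Bun_id2 f) E) (asc \<alpha> f v p))))"
   have w': "hcmp \<alpha> (Bun_id2 w) ?x = hcmp \<alpha> (Bun_id2 w) ?y"
    by (rule lift_comparison[OF n fg(3,1,2) c1(1) pm(1) c1(2) pm'(1) t v(3-5) v'(3-5) _ _ _ _ _ _ _ _ v(6) v'(6) cell_in[OF E] J'])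
     (simp_all add: fg v v' pm pm')
   note T = cell_in[OF E] J' A fg t v v' pm pm' c1 ends[OF n] ty[OF n]
   have "?x = ?y"
    by (rule whisker_faithful[OF n w _ _ _ _ _ w']) (simp_all add: T)
   then show ?thesis
    unfolding BF4_comparison_def sel is_1cell_iff[OF n]
    using p(2,3) vp v'p' iso_2cellI[OF n E] by blast
  qed
 qed
qed

end
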